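(* Let $\mathcal{C}$ be a symmetric monoidal category such that: (0) $\mathcal{C}$ has all equalizers and coequalizers; (1) the monoidal structure of $\mathcal{C}$ is bistable; (2) the category $\mathsf{Hopf}^{\mathsf{bc}}(\mathcal{C})$ of bicommutative Hopf monoids in $\mathcal{C}$ is abelian. Then: (1) For a bicommutative Hopf monoid $A$, the identity $id_A$ is Fredholm and $Ind(id_A)=id_{\mathds{1}}\in M^{-1}_{\mathcal{C}}$. (2) For Fredholm homomorphisms $\xi:A\to B$ and $\xi':B\to C$ between bicommutative Hopf monoids, the composition $\xi'\circ\xi$ is Fredholm and $Ind(\xi'\circ\xi)=Ind(\xi')\circ Ind(\xi)\in M^{-1}_{\mathcal{C}}$. (3) For a Fredholm homomorphism $\xi:A\to B$ and a finite homomorphism $\epsilon:A\to B$ between bicommutative Hopf monoids, the convolution $\xi\ast\epsilon=\nabla_B\circ(\xi\otimes\epsilon)\circ\Delta_A$ is Fredholm and $Ind(\xi\ast\epsilon)=Ind(\xi)\in M^{-1}_{\mathcal{C}}$.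
   Context: Coherence isomorphisms are suppressed; $\mathds{1}$ is the unit object. A bimonoid $A$ has structure maps $\nabla_A,\eta_A,\Delta_A,\epsilon_A$; bicommutative means commutative and cocommutative; morphisms of $\mathsf{Hopf}^{\mathsf{bc}}(\mathcal{C})$ are bimonoid homomorphisms, and kernels, cokernels, images are taken in $\mathsf{Hopf}^{\mathsf{bc}}(\mathcal{C})$. Inverse volume. A morphism $\varphi:\mathds{1}\to A$ is an integral of $A$ if $\nabla_A\circ(\varphi\otimes id_A)=\varphi\otimes\epsilon_A$ and $\nabla_A\circ(id_A\otimes\varphi)=\epsilon_A\otimes\varphi$, normalized if $\epsilon_A\circ\varphi=id_{\mathds{1}}$; a morphism $\varphi:A\to\mathds{1}$ is a cointegral if $(\varphi\otimes id_A)\circ\Delta_A=\eta_A\circ\varphi=(id_A\otimes\varphi)\circ\Delta_A$, normalized if $\varphi\circ\eta_A=id_{\mathds{1}}$. Normalized (co)integrals are unique if they exist and are denoted $\sigma_A$, $\sigma^A$; a bismall bimonoid has both. Put $vol^{-1}(A)=\sigma^A\circ\sigma_A\in End_{\mathcal{C}}(\mathds{1})$. $M_{\mathcal{C}}$ is the smallest submonoid of the abelian monoid $End_{\mathcal{C}}(\mathds{1})$ containing all $f$ such that, for some bismall bicommutative Hopf monoid $A$, either $f=vol^{-1}(A)$ or $f\circ vol^{-1}(A)=id_{\mathds{1}}=vol^{-1}(A)\circ f$; $M^{-1}_{\mathcal{C}}=M_{\mathcal{C}}\cap Aut_{\mathcal{C}}(\mathds{1})$. Fredholm, index, finite. A homomorphism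 $\xi$ between bicommutative Hopf monoids is Fredholm if $Ker(\xi)$ and $Cok(\xi)$ are bismall and $vol^{-1}(Ker(\xi))$, $vol^{-1}(Cok(\xi))$ are invertible; then $Ind(\xi)=vol^{-1}(Cok(\xi))\circ vol^{-1}(Ker(\xi))^{-1}$. A homomorphism is finite if its image $Im(\xi)$ in $\mathsf{Hopf}^{\mathsf{bc}}(\mathcal{C})$ is bismall and $vol^{-1}(Im(\xi))$ is invertible. Actions. A left action $(A,\alpha,X)$ is a bimonoid $A$, an object $X$ and $\alpha:A\otimes X\to X$ associative and unital; the trivial action is $\epsilon_A\otimes id_X$. Its stabilized object $\alpha\backslash X$ is a coequalizer of $\alpha$ and $\epsilon_A\otimes id_X$. Its invariant object is a morphism $i:\alpha\backslash\backslash X\to X$ with $\alpha\circ(id_A\otimes i)=\epsilon_A\otimes i$, universal with this property. Let ${}_\alpha\gamma:\alpha\backslash\backslash X\to X\to\alpha\backslash X$ be the canonical composite. Right actions are treated in the same way. Dually, for a left coaction $\beta:Y\to A\otimes Y$ of a bimonoid $A$ (coassociative, counital), the stabilized object $\beta/Y\to Y$ is an equalizer of $\beta$ and the trivial coaction $\eta_A\otimes id_Y$, the invariant object is a universal morphism $q:Y\to\beta//Y$ with $(id_A\otimes q)\circ\beta=\eta_A\otimes q$, and ${}^\beta\gamma:\beta/Y\to Y\to\beta//Y$; similarly for right coactions. Bismall. A bimonoid $A$ is small if for every left action and every right action of $A$ the invariant and stabilized objects exist and the canonical morphism from the invariant to the stabilized object is an isomorphism. It is cosmall if for every left and every right coaction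 of $A$ the invariant and stabilized objects exist and the canonical morphism from the stabilized to the invariant object is an isomorphism. Bismall means small and cosmall. Bistability. The tensor product of left actions $(A,\alpha,X)$ and $(A',\alpha',X')$ is $(A\otimes A',\alpha\tilde\otimes\alpha',X\otimes X')$, where $\alpha\tilde\otimes\alpha'=(\alpha\otimes\alpha')\circ(id_A\otimes\mathbf{s}_{A',X}\otimes id_{X'})$ and $\mathbf{s}$ is the symmetry. The projections induce canonical morphisms $(\alpha\tilde\otimes\alpha')\backslash(X\otimes X')\to(\alpha\backslash X)\otimes(\alpha'\backslash X')$, making $(A,\alpha,X)\mapsto\alpha\backslash X$ a symmetric comonoidal functor; similarly for right actions. The monoidal structure of $\mathcal{C}$ is stable if these functors, for left and right actions, are strong symmetric monoidal, i.e. these canonical morphisms are isomorphisms. Dually, it is costable if the symmetric monoidal functors sending a left (resp. right) coaction to its stabilized object are strong. Bistable means stable and costable. *)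

theory Defs
  imports "HOL-Algebra.Group"
begin

section \<open>Categories\<close>

text \<open>
  Objects and arrows are elements of arbitrary types; \<open>Hom C a b\<close> is the set of arrows from \<open>a\<close>
  to \<open>b\<close>, and \<open>g \<cdot> f\<close> means "first \<open>f\<close>, then \<open>g\<close>".  Distinct hom-sets are not required to be
  disjoint.  This covers the usual categories with disjoint hom-sets, and it lets a bimonoid
  homomorphism be represented by its underlying arrow.  Outside of the intended domains the operations
  take arbitrary values.
\<close>

record ('o, 'm) cat =
  Ob :: "'o set"
  Hom :: "'o \<Rightarrow> 'o \<Rightarrow> 'm set"
  Id :: "'o \<Rightarrow> 'm"
  Comp :: "'m \<Rightarrow> 'm \<Rightarrow> 'm"  (infixr \<open>\<cdot>\<index>\<close> 55)

locale category =
  fixes C :: "('o, 'm, 'x) cat_scheme" (structure)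
  assumes Hom_Ob: "f \<in> Hom C a b \<Longrightarrow> a \<in> Ob C \<and> b \<in> Ob C"
    and Id_Hom: "a \<in> Ob C \<Longrightarrow> Id C a \<in> Hom C a a"
    and Comp_Hom: "\<lbrakk>f \<in> Hom C a b; g \<in> Hom C b c\<rbrakk> \<Longrightarrow> g \<cdot> f \<in> Hom C a c"
    and Comp_Id: "f \<in> Hom C a b \<Longrightarrow> f \<cdot> Id C a = f"
    and Id_Comp: "f \<in> Hom C a b \<Longrightarrow> Id C b \<cdot> f = f"
    and Comp_assoc: "\<lbrakk>f \<in> Hom C a b; g \<in> Hom C b c; h \<in> Hom C c d\<rbrakk>
          \<Longrightarrow> (h \<cdot> g) \<cdot> f = h \<cdot> (g \<cdot> f)"

context
  fixes C :: "('o, 'm, 'x) cat_scheme" (structure)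
begin

definition inverse_arrs :: "'o \<Rightarrow> 'o \<Rightarrow> 'm \<Rightarrow> 'm \<Rightarrow> bool" where
  "inverse_arrs a b f g \<longleftrightarrow>
     f \<in> Hom C a b \<and> g \<in> Hom C b a \<and> g \<cdot> f = Id C a \<and> f \<cdot> g = Id C b"

definition iso_arr :: "'o \<Rightarrow> 'o \<Rightarrow> 'm \<Rightarrow> bool" where
  "iso_arr a b f \<longleftrightarrow> (\<exists>g. inverse_arrs a b f g)"

definition inv_arr :: "'o \<Rightarrow> 'o \<Rightarrow> 'm \<Rightarrow> 'm" where
  "inv_arr a b f = (THE g. inverse_arrs a b f g)"

definition mono_arr :: "'o \<Rightarrow> 'o \<Rightarrow> 'm \<Rightarrow> bool" where
  "mono_arr a b f \<longleftrightarrow> f \<in> Hom C a b \<and>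
     (\<forall>x. \<forall>g \<in> Hom C x a. \<forall>h \<in> Hom C x a. f \<cdot> g = f \<cdot> h \<longrightarrow> g = h)"

definition epi_arr :: "'o \<Rightarrow> 'o \<Rightarrow> 'm \<Rightarrow> bool" where
  "epi_arr a b f \<longleftrightarrow> f \<in> Hom C a b \<and>
     (\<forall>x. \<forall>g \<in> Hom C b x. \<forall>h \<in> Hom C b x. g \<cdot> f = h \<cdot> f \<longrightarrow> g = h)"

definition is_equalizer :: "'o \<Rightarrow> 'o \<Rightarrow> 'm \<Rightarrow> 'm \<Rightarrow> 'o \<Rightarrow> 'm \<Rightarrow> bool" where
  "is_equalizer a b f g e i \<longleftrightarrow> i \<in> Hom C e a \<and> f \<cdot> i = g \<cdot> i \<and>
     (\<forall>x. \<forall>j \<in> Hom C x a. f \<cdot> j = g \<cdot> j \<longrightarrow> (\<exists>!u. u \<in> Hom C x e \<and> i \<cdot> u = j))"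

definition is_coequalizer :: "'o \<Rightarrow> 'o \<Rightarrow> 'm \<Rightarrow> 'm \<Rightarrow> 'o \<Rightarrow> 'm \<Rightarrow> bool" where
  "is_coequalizer a b f g q p \<longleftrightarrow> p \<in> Hom C b q \<and> p \<cdot> f = p \<cdot> g \<and>
     (\<forall>x. \<forall>j \<in> Hom C b x. j \<cdot> f = j \<cdot> g \<longrightarrow> (\<exists>!u. u \<in> Hom C q x \<and> u \<cdot> p = j))"

definition has_equalizers :: bool where
  "has_equalizers \<longleftrightarrow>
     (\<forall>a b. \<forall>f \<in> Hom C a b. \<forall>g \<in> Hom C a b. \<exists>e i. is_equalizer a b f g e i)"

definition has_coequalizers :: bool where
  "has_coequalizers \<longleftrightarrow>
     (\<forall>a b. \<forall>f \<in> Hom C a b. \<forall>g \<in> Hom C a b. \<exists>q p. is_coequalizer a b f g q p)"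

definition zero_ob :: "'o \<Rightarrow> bool" where
  "zero_ob z \<longleftrightarrow> z \<in> Ob C \<and>
     (\<forall>a \<in> Ob C. (\<exists>!f. f \<in> Hom C a z) \<and> (\<exists>!f. f \<in> Hom C z a))"

definition zero_arr :: "'o \<Rightarrow> 'o \<Rightarrow> 'm \<Rightarrow> bool" where
  "zero_arr a b f \<longleftrightarrow>
     (\<exists>z g h. zero_ob z \<and> g \<in> Hom C a z \<and> h \<in> Hom C z b \<and> f = h \<cdot> g)"

definition is_kernel :: "'o \<Rightarrow> 'o \<Rightarrow> 'm \<Rightarrow> 'o \<Rightarrow> 'm \<Rightarrow> bool" where
  "is_kernel a b f k i \<longleftrightarrow> f \<in> Hom C a b \<and> i \<in> Hom C k a \<and> zero_arr k b (f \<cdot> i) \<and>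
     (\<forall>x. \<forall>j \<in> Hom C x a. zero_arr x b (f \<cdot> j) \<longrightarrow> (\<exists>!u. u \<in> Hom C x k \<and> i \<cdot> u = j))"

definition is_cokernel :: "'o \<Rightarrow> 'o \<Rightarrow> 'm \<Rightarrow> 'o \<Rightarrow> 'm \<Rightarrow> bool" where
  "is_cokernel a b f c p \<longleftrightarrow> f \<in> Hom C a b \<and> p \<in> Hom C b c \<and> zero_arr a c (p \<cdot> f) \<and>
     (\<forall>x. \<forall>j \<in> Hom C b x. zero_arr a x (j \<cdot> f) \<longrightarrow> (\<exists>!u. u \<in> Hom C c x \<and> u \<cdot> p = j))"

text \<open>
  Meant for abelian categories.  \<open>Ker\<close>, \<open>Cok\<close> and \<open>Im\<close> choose a representing object; the notions
  built on them below do not depend on this choice, being invariant under isomorphism.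
\<close>

definition is_image :: "'o \<Rightarrow> 'o \<Rightarrow> 'm \<Rightarrow> 'o \<Rightarrow> 'm \<Rightarrow> bool" where
  "is_image a b f m i \<longleftrightarrow> (\<exists>c p. is_cokernel a b f c p \<and> is_kernel b c p m i)"

definition Ker :: "'o \<Rightarrow> 'o \<Rightarrow> 'm \<Rightarrow> 'o" where
  "Ker a b f = (SOME k. \<exists>i. is_kernel a b f k i)"

definition Cok :: "'o \<Rightarrow> 'o \<Rightarrow> 'm \<Rightarrow> 'o" where
  "Cok a b f = (SOME c. \<exists>p. is_cokernel a b f c p)"

definition Im :: "'o \<Rightarrow> 'o \<Rightarrow> 'm \<Rightarrow> 'o" where
  "Im a b f = (SOME m. \<exists>i. is_image a b f m i)"

definition is_product :: "'o \<Rightarrow> 'o \<Rightarrow> 'o \<Rightarrow> 'm \<Rightarrow> 'm \<Rightarrow> bool" where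
  "is_product a b c p q \<longleftrightarrow> p \<in> Hom C c a \<and> q \<in> Hom C c b \<and>
     (\<forall>x. \<forall>f \<in> Hom C x a. \<forall>g \<in> Hom C x b. \<exists>!u. u \<in> Hom C x c \<and> p \<cdot> u = f \<and> q \<cdot> u = g)"

definition preadditive :: bool where
  "preadditive \<longleftrightarrow> (\<exists>plus zero.
     (\<forall>a \<in> Ob C. \<forall>b \<in> Ob C.
        comm_group \<lparr>carrier = Hom C a b, mult = plus a b, one = zero a b\<rparr>) \<and>
     (\<forall>a b c. \<forall>f \<in> Hom C a b. \<forall>f' \<in> Hom C a b. \<forall>g \<in> Hom C b c. \<forall>g' \<in> Hom C b c.
        g \<cdot> plus a b f f' = plus a c (g \<cdot> f) (g \<cdot> f') \<and>
        plus b c g g' \<cdot> f = plus a c (g \<cdot> f) (g' \<cdot> f)))"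

end

text \<open>In a preadditive category binary products are automatically biproducts.\<close>

locale abelian_category = category +
  assumes preadditive: "preadditive C"
    and zero_ob: "\<exists>z. zero_ob C z"
    and products: "\<lbrakk>a \<in> Ob C; b \<in> Ob C\<rbrakk> \<Longrightarrow> \<exists>c p q. is_product C a b c p q"
    and kernels: "f \<in> Hom C a b \<Longrightarrow> \<exists>k i. is_kernel C a b f k i"
    and cokernels: "f \<in> Hom C a b \<Longrightarrow> \<exists>c p. is_cokernel C a b f c p"
    and mono_kernel: "mono_arr C a b f \<Longrightarrow> \<exists>c g. is_kernel C b c g a f"
    and epi_cokernel: "epi_arr C a b f \<Longrightarrow> \<exists>c g. is_cokernel C c a g b f"


section \<open>Symmetric monoidal categories\<close>

text \<open>Associators and unitors are kept explicit; the category need not be strict.\<close>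

record ('o, 'm) smcat = "('o, 'm) cat" +
  Unit :: "'o"  (\<open>\<I>\<index>\<close>)
  tensor_ob :: "'o \<Rightarrow> 'o \<Rightarrow> 'o"  (infixr \<open>\<odot>\<index>\<close> 65)
  tensor :: "'m \<Rightarrow> 'm \<Rightarrow> 'm"  (infixr \<open>\<boxtimes>\<index>\<close> 60)
  assoc :: "'o \<Rightarrow> 'o \<Rightarrow> 'o \<Rightarrow> 'm"
  lunit :: "'o \<Rightarrow> 'm"
  runit :: "'o \<Rightarrow> 'm"
  symm :: "'o \<Rightarrow> 'o \<Rightarrow> 'm"

locale symmetric_monoidal_category = category C
  for C :: "('o, 'm, 'x) smcat_scheme" (structure) +
  assumes Unit_Ob: "\<I> \<in> Ob C"
    and tensor_Ob: "\<lbrakk>a \<in> Ob C; b \<in> Ob C\<rbrakk> \<Longrightarrow> a \<odot> b \<in> Ob C"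
    and tensor_Hom: "\<lbrakk>f \<in> Hom C a b; g \<in> Hom C c d\<rbrakk> \<Longrightarrow> f \<boxtimes> g \<in> Hom C (a \<odot> c) (b \<odot> d)"
    and tensor_Id: "\<lbrakk>a \<in> Ob C; b \<in> Ob C\<rbrakk> \<Longrightarrow> Id C a \<boxtimes> Id C b = Id C (a \<odot> b)"
    and tensor_Comp: "\<lbrakk>f \<in> Hom C a b; f' \<in> Hom C b c; g \<in> Hom C a' b'; g' \<in> Hom C b' c'\<rbrakk>
          \<Longrightarrow> (f' \<cdot> f) \<boxtimes> (g' \<cdot> g) = (f' \<boxtimes> g') \<cdot> (f \<boxtimes> g)"
    and assoc_iso: "\<lbrakk>a \<in> Ob C; b \<in> Ob C; c \<in> Ob C\<rbrakk>
          \<Longrightarrow> iso_arr C ((a \<odot> b) \<odot> c) (a \<odot> (b \<odot> c)) (assoc C a b c)"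
    and lunit_iso: "a \<in> Ob C \<Longrightarrow> iso_arr C (\<I> \<odot> a) a (lunit C a)"
    and runit_iso: "a \<in> Ob C \<Longrightarrow> iso_arr C (a \<odot> \<I>) a (runit C a)"
    and symm_Hom: "\<lbrakk>a \<in> Ob C; b \<in> Ob C\<rbrakk> \<Longrightarrow> symm C a b \<in> Hom C (a \<odot> b) (b \<odot> a)"
    and symm_symm: "\<lbrakk>a \<in> Ob C; b \<in> Ob C\<rbrakk> \<Longrightarrow> symm C b a \<cdot> symm C a b = Id C (a \<odot> b)"
    and assoc_nat: "\<lbrakk>f \<in> Hom C a a'; g \<in> Hom C b b'; h \<in> Hom C c c'\<rbrakk>
          \<Longrightarrow> assoc C a' b' c' \<cdot> ((f \<boxtimes> g) \<boxtimes> h) = (f \<boxtimes> (g \<boxtimes> h)) \<cdot> assoc C a b c"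
    and lunit_nat: "f \<in> Hom C a b \<Longrightarrow> lunit C b \<cdot> (Id C \<I> \<boxtimes> f) = f \<cdot> lunit C a"
    and runit_nat: "f \<in> Hom C a b \<Longrightarrow> runit C b \<cdot> (f \<boxtimes> Id C \<I>) = f \<cdot> runit C a"
    and symm_nat: "\<lbrakk>f \<in> Hom C a a'; g \<in> Hom C b b'\<rbrakk>
          \<Longrightarrow> symm C a' b' \<cdot> (f \<boxtimes> g) = (g \<boxtimes> f) \<cdot> symm C a b"
    and pentagon: "\<lbrakk>a \<in> Ob C; b \<in> Ob C; c \<in> Ob C; d \<in> Ob C\<rbrakk>
          \<Longrightarrow> (Id C a \<boxtimes> assoc C b c d) \<cdot> assoc C a (b \<odot> c) d \<cdot> (assoc C a b c \<boxtimes> Id C d)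
            = assoc C a b (c \<odot> d) \<cdot> assoc C (a \<odot> b) c d"
    and triangle: "\<lbrakk>a \<in> Ob C; b \<in> Ob C\<rbrakk>
          \<Longrightarrow> (Id C a \<boxtimes> lunit C b) \<cdot> assoc C a \<I> b = runit C a \<boxtimes> Id C b"
    and hexagon: "\<lbrakk>a \<in> Ob C; b \<in> Ob C; c \<in> Ob C\<rbrakk>
          \<Longrightarrow> assoc C b c a \<cdot> symm C a (b \<odot> c) \<cdot> assoc C a b c
            = (Id C b \<boxtimes> symm C a c) \<cdot> assoc C b a c \<cdot> (symm C a b \<boxtimes> Id C c)"


section \<open>Bimonoids and bicommutative Hopf monoids\<close>

record ('o, 'm) bimon =
  und :: "'o"
  nabla :: "'m"
  eta :: "'m"
  delta :: "'m"
  eps :: "'m"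

context
  fixes C :: "('o, 'm, 'x) smcat_scheme" (structure)
begin

abbreviation assoc_inv :: "'o \<Rightarrow> 'o \<Rightarrow> 'o \<Rightarrow> 'm" where
  "assoc_inv a b c \<equiv> inv_arr C ((a \<odot> b) \<odot> c) (a \<odot> (b \<odot> c)) (assoc C a b c)"

abbreviation lunit_inv :: "'o \<Rightarrow> 'm" where
  "lunit_inv a \<equiv> inv_arr C (\<I> \<odot> a) a (lunit C a)"

abbreviation runit_inv :: "'o \<Rightarrow> 'm" where
  "runit_inv a \<equiv> inv_arr C (a \<odot> \<I>) a (runit C a)"

text \<open>The arrow \<open>id\<^sub>a \<otimes> s\<^sub>b\<^sub>,\<^sub>c \<otimes> id\<^sub>d\<close>, from \<open>(a \<odot> b) \<odot> (c \<odot> d)\<close> to \<open>(a \<odot> c) \<odot> (b \<odot> d)\<close>.\<close>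

definition swap_mid :: "'o \<Rightarrow> 'o \<Rightarrow> 'o \<Rightarrow> 'o \<Rightarrow> 'm" where
  "swap_mid a b c d =
     assoc_inv a c (b \<odot> d)
     \<cdot> (Id C a \<boxtimes> (assoc C c b d \<cdot> (symm C b c \<boxtimes> Id C d) \<cdot> assoc_inv b c d))
     \<cdot> assoc C a b (c \<odot> d)"

definition is_monoid :: "'o \<Rightarrow> 'm \<Rightarrow> 'm \<Rightarrow> bool" where
  "is_monoid a m e \<longleftrightarrow> a \<in> Ob C \<and> m \<in> Hom C (a \<odot> a) a \<and> e \<in> Hom C \<I> a \<and>
     m \<cdot> (m \<boxtimes> Id C a) = m \<cdot> (Id C a \<boxtimes> m) \<cdot> assoc C a a a \<and>
     m \<cdot> (e \<boxtimes> Id C a) = lunit C a \<and> m \<cdot> (Id C a \<boxtimes> e) = runit C a"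

definition is_comonoid :: "'o \<Rightarrow> 'm \<Rightarrow> 'm \<Rightarrow> bool" where
  "is_comonoid a d e \<longleftrightarrow> a \<in> Ob C \<and> d \<in> Hom C a (a \<odot> a) \<and> e \<in> Hom C a \<I> \<and>
     assoc C a a a \<cdot> (d \<boxtimes> Id C a) \<cdot> d = (Id C a \<boxtimes> d) \<cdot> d \<and>
     lunit C a \<cdot> (e \<boxtimes> Id C a) \<cdot> d = Id C a \<and> runit C a \<cdot> (Id C a \<boxtimes> e) \<cdot> d = Id C a"

definition bimonoid :: "('o, 'm) bimon \<Rightarrow> bool" where
  "bimonoid A \<longleftrightarrow>
     is_monoid (und A) (nabla A) (eta A) \<and> is_comonoid (und A) (delta A) (eps A) \<and>
     delta A \<cdot> nabla A
       = (nabla A \<boxtimes> nabla A) \<cdot> swap_mid (und A) (und A) (und A) (und A) \<cdot> (delta A \<boxtimes> delta A) \<and>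
     delta A \<cdot> eta A = (eta A \<boxtimes> eta A) \<cdot> lunit_inv \<I> \<and>
     eps A \<cdot> nabla A = lunit C \<I> \<cdot> (eps A \<boxtimes> eps A) \<and>
     eps A \<cdot> eta A = Id C \<I>"

definition bimonoid_hom :: "('o, 'm) bimon \<Rightarrow> ('o, 'm) bimon \<Rightarrow> 'm \<Rightarrow> bool" where
  "bimonoid_hom A B f \<longleftrightarrow> f \<in> Hom C (und A) (und B) \<and>
     f \<cdot> nabla A = nabla B \<cdot> (f \<boxtimes> f) \<and> f \<cdot> eta A = eta B \<and>
     delta B \<cdot> f = (f \<boxtimes> f) \<cdot> delta A \<and> eps B \<cdot> f = eps A"

definition bicommutative :: "('o, 'm) bimon \<Rightarrow> bool" where
  "bicommutative A \<longleftrightarrow>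
     nabla A \<cdot> symm C (und A) (und A) = nabla A \<and> symm C (und A) (und A) \<cdot> delta A = delta A"

text \<open>Antipodes are unique, so the antipode is a property and not a further structure map.\<close>

definition hopf_monoid :: "('o, 'm) bimon \<Rightarrow> bool" where
  "hopf_monoid A \<longleftrightarrow> bimonoid A \<and>
     (\<exists>S \<in> Hom C (und A) (und A).
        nabla A \<cdot> (S \<boxtimes> Id C (und A)) \<cdot> delta A = eta A \<cdot> eps A \<and>
        nabla A \<cdot> (Id C (und A) \<boxtimes> S) \<cdot> delta A = eta A \<cdot> eps A)"

definition Hopf_bc :: "(('o, 'm) bimon, 'm) cat" where
  "Hopf_bc =
     \<lparr>Ob = {A. hopf_monoid A \<and> bicommutative A},
      Hom = (\<lambda>A B. {f. hopf_monoid A \<and> bicommutative A \<and> hopf_monoid B \<and> bicommutative B \<and>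
                       bimonoid_hom A B f}),
      Id = (\<lambda>A. Id C (und A)),
      Comp = Comp C\<rparr>"

definition tensor_bimon :: "('o, 'm) bimon \<Rightarrow> ('o, 'm) bimon \<Rightarrow> ('o, 'm) bimon" where
  "tensor_bimon A B =
     \<lparr>und = und A \<odot> und B,
      nabla = (nabla A \<boxtimes> nabla B) \<cdot> swap_mid (und A) (und B) (und A) (und B),
      eta = (eta A \<boxtimes> eta B) \<cdot> lunit_inv \<I>,
      delta = swap_mid (und A) (und A) (und B) (und B) \<cdot> (delta A \<boxtimes> delta B),
      eps = lunit C \<I> \<cdot> (eps A \<boxtimes> eps B)\<rparr>"

definition convolution :: "('o, 'm) bimon \<Rightarrow> ('o, 'm) bimon \<Rightarrow> 'm \<Rightarrow> 'm \<Rightarrow> 'm" where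
  "convolution A B f g = nabla B \<cdot> (f \<boxtimes> g) \<cdot> delta A"


section \<open>Actions and coactions, stabilized and invariant objects\<close>

definition left_action :: "('o, 'm) bimon \<Rightarrow> 'm \<Rightarrow> 'o \<Rightarrow> bool" where
  "left_action A \<alpha> X \<longleftrightarrow> bimonoid A \<and> X \<in> Ob C \<and> \<alpha> \<in> Hom C (und A \<odot> X) X \<and>
     \<alpha> \<cdot> (nabla A \<boxtimes> Id C X) = \<alpha> \<cdot> (Id C (und A) \<boxtimes> \<alpha>) \<cdot> assoc C (und A) (und A) X \<and>
     \<alpha> \<cdot> (eta A \<boxtimes> Id C X) = lunit C X"

definition right_action :: "('o, 'm) bimon \<Rightarrow> 'm \<Rightarrow> 'o \<Rightarrow> bool" where
  "right_action A \<alpha> X \<longleftrightarrow> bimonoid A \<and> X \<in> Ob C \<and> \<alpha> \<in> Hom C (X \<odot> und A) X \<and>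
     \<alpha> \<cdot> (\<alpha> \<boxtimes> Id C (und A)) = \<alpha> \<cdot> (Id C X \<boxtimes> nabla A) \<cdot> assoc C X (und A) (und A) \<and>
     \<alpha> \<cdot> (Id C X \<boxtimes> eta A) = runit C X"

definition left_coaction :: "('o, 'm) bimon \<Rightarrow> 'm \<Rightarrow> 'o \<Rightarrow> bool" where
  "left_coaction A \<beta> Y \<longleftrightarrow> bimonoid A \<and> Y \<in> Ob C \<and> \<beta> \<in> Hom C Y (und A \<odot> Y) \<and>
     assoc C (und A) (und A) Y \<cdot> (delta A \<boxtimes> Id C Y) \<cdot> \<beta> = (Id C (und A) \<boxtimes> \<beta>) \<cdot> \<beta> \<and>
     lunit C Y \<cdot> (eps A \<boxtimes> Id C Y) \<cdot> \<beta> = Id C Y"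

definition right_coaction :: "('o, 'm) bimon \<Rightarrow> 'm \<Rightarrow> 'o \<Rightarrow> bool" where
  "right_coaction A \<beta> Y \<longleftrightarrow> bimonoid A \<and> Y \<in> Ob C \<and> \<beta> \<in> Hom C Y (Y \<odot> und A) \<and>
     assoc C Y (und A) (und A) \<cdot> (\<beta> \<boxtimes> Id C (und A)) \<cdot> \<beta> = (Id C Y \<boxtimes> delta A) \<cdot> \<beta> \<and>
     runit C Y \<cdot> (Id C Y \<boxtimes> eps A) \<cdot> \<beta> = Id C Y"

text \<open>
  \<open>left_stab A \<alpha> X P p\<close> says that \<open>p\<close> exhibits \<open>P\<close> as the stabilized object, and
  \<open>left_invariant A \<alpha> X I i\<close> that \<open>i\<close> exhibits \<open>I\<close> as the invariant object.  For a
  coaction, \<open>left_costab\<close> describes the stabilized object \<open>\<beta>/Y\<close> (an equalizer) and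
  \<open>left_coinvariant\<close> the invariant object \<open>\<beta>//Y\<close>.
\<close>

definition left_stab :: "('o, 'm) bimon \<Rightarrow> 'm \<Rightarrow> 'o \<Rightarrow> 'o \<Rightarrow> 'm \<Rightarrow> bool" where
  "left_stab A \<alpha> X P p \<longleftrightarrow>
     is_coequalizer C (und A \<odot> X) X \<alpha> (lunit C X \<cdot> (eps A \<boxtimes> Id C X)) P p"

definition right_stab :: "('o, 'm) bimon \<Rightarrow> 'm \<Rightarrow> 'o \<Rightarrow> 'o \<Rightarrow> 'm \<Rightarrow> bool" where
  "right_stab A \<alpha> X P p \<longleftrightarrow>
     is_coequalizer C (X \<odot> und A) X \<alpha> (runit C X \<cdot> (Id C X \<boxtimes> eps A)) P p"

definition left_costab :: "('o, 'm) bimon \<Rightarrow> 'm \<Rightarrow> 'o \<Rightarrow> 'o \<Rightarrow> 'm \<Rightarrow> bool" where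
  "left_costab A \<beta> Y E e \<longleftrightarrow>
     is_equalizer C Y (und A \<odot> Y) \<beta> ((eta A \<boxtimes> Id C Y) \<cdot> lunit_inv Y) E e"

definition right_costab :: "('o, 'm) bimon \<Rightarrow> 'm \<Rightarrow> 'o \<Rightarrow> 'o \<Rightarrow> 'm \<Rightarrow> bool" where
  "right_costab A \<beta> Y E e \<longleftrightarrow>
     is_equalizer C Y (Y \<odot> und A) \<beta> ((Id C Y \<boxtimes> eta A) \<cdot> runit_inv Y) E e"

definition left_inv_arr :: "('o, 'm) bimon \<Rightarrow> 'm \<Rightarrow> 'o \<Rightarrow> 'o \<Rightarrow> 'm \<Rightarrow> bool" where
  "left_inv_arr A \<alpha> X I i \<longleftrightarrow> i \<in> Hom C I X \<and>
     \<alpha> \<cdot> (Id C (und A) \<boxtimes> i) = lunit C X \<cdot> (eps A \<boxtimes> i)"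

definition left_invariant :: "('o, 'm) bimon \<Rightarrow> 'm \<Rightarrow> 'o \<Rightarrow> 'o \<Rightarrow> 'm \<Rightarrow> bool" where
  "left_invariant A \<alpha> X I i \<longleftrightarrow> left_inv_arr A \<alpha> X I i \<and>
     (\<forall>J j. left_inv_arr A \<alpha> X J j \<longrightarrow> (\<exists>!u. u \<in> Hom C J I \<and> i \<cdot> u = j))"

definition right_inv_arr :: "('o, 'm) bimon \<Rightarrow> 'm \<Rightarrow> 'o \<Rightarrow> 'o \<Rightarrow> 'm \<Rightarrow> bool" where
  "right_inv_arr A \<alpha> X I i \<longleftrightarrow> i \<in> Hom C I X \<and>
     \<alpha> \<cdot> (i \<boxtimes> Id C (und A)) = runit C X \<cdot> (i \<boxtimes> eps A)"

definition right_invariant :: "('o, 'm) bimon \<Rightarrow> 'm \<Rightarrow> 'o \<Rightarrow> 'o \<Rightarrow> 'm \<Rightarrow> bool" where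
  "right_invariant A \<alpha> X I i \<longleftrightarrow> right_inv_arr A \<alpha> X I i \<and>
     (\<forall>J j. right_inv_arr A \<alpha> X J j \<longrightarrow> (\<exists>!u. u \<in> Hom C J I \<and> i \<cdot> u = j))"

definition left_coinv_arr :: "('o, 'm) bimon \<Rightarrow> 'm \<Rightarrow> 'o \<Rightarrow> 'o \<Rightarrow> 'm \<Rightarrow> bool" where
  "left_coinv_arr A \<beta> Y Q q \<longleftrightarrow> q \<in> Hom C Y Q \<and>
     (Id C (und A) \<boxtimes> q) \<cdot> \<beta> = (eta A \<boxtimes> q) \<cdot> lunit_inv Y"

definition left_coinvariant :: "('o, 'm) bimon \<Rightarrow> 'm \<Rightarrow> 'o \<Rightarrow> 'o \<Rightarrow> 'm \<Rightarrow> bool" where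
  "left_coinvariant A \<beta> Y Q q \<longleftrightarrow> left_coinv_arr A \<beta> Y Q q \<and>
     (\<forall>R r. left_coinv_arr A \<beta> Y R r \<longrightarrow> (\<exists>!u. u \<in> Hom C Q R \<and> u \<cdot> q = r))"

definition right_coinv_arr :: "('o, 'm) bimon \<Rightarrow> 'm \<Rightarrow> 'o \<Rightarrow> 'o \<Rightarrow> 'm \<Rightarrow> bool" where
  "right_coinv_arr A \<beta> Y Q q \<longleftrightarrow> q \<in> Hom C Y Q \<and>
     (q \<boxtimes> Id C (und A)) \<cdot> \<beta> = (q \<boxtimes> eta A) \<cdot> runit_inv Y"

definition right_coinvariant :: "('o, 'm) bimon \<Rightarrow> 'm \<Rightarrow> 'o \<Rightarrow> 'o \<Rightarrow> 'm \<Rightarrow> bool" where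
  "right_coinvariant A \<beta> Y Q q \<longleftrightarrow> right_coinv_arr A \<beta> Y Q q \<and>
     (\<forall>R r. right_coinv_arr A \<beta> Y R r \<longrightarrow> (\<exists>!u. u \<in> Hom C Q R \<and> u \<cdot> q = r))"


section \<open>Bismall bimonoids\<close>

text \<open>
  Invariant and stabilized objects are unique up to canonical isomorphism, so demanding that the
  canonical composite be invertible for all choices is the same as demanding it for one choice.
\<close>

definition small :: "('o, 'm) bimon \<Rightarrow> bool" where
  "small A \<longleftrightarrow> bimonoid A \<and>
     (\<forall>\<alpha> X. left_action A \<alpha> X \<longrightarrow>
        (\<exists>I i. left_invariant A \<alpha> X I i) \<and> (\<exists>P p. left_stab A \<alpha> X P p) \<and>
        (\<forall>I i P p. left_invariant A \<alpha> X I i \<and> left_stab A \<alpha> X P p \<longrightarrow> iso_arr C I P (p \<cdot> i))) \<and>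
     (\<forall>\<alpha> X. right_action A \<alpha> X \<longrightarrow>
        (\<exists>I i. right_invariant A \<alpha> X I i) \<and> (\<exists>P p. right_stab A \<alpha> X P p) \<and>
        (\<forall>I i P p. right_invariant A \<alpha> X I i \<and> right_stab A \<alpha> X P p \<longrightarrow> iso_arr C I P (p \<cdot> i)))"

definition cosmall :: "('o, 'm) bimon \<Rightarrow> bool" where
  "cosmall A \<longleftrightarrow> bimonoid A \<and>
     (\<forall>\<beta> Y. left_coaction A \<beta> Y \<longrightarrow>
        (\<exists>Q q. left_coinvariant A \<beta> Y Q q) \<and> (\<exists>E e. left_costab A \<beta> Y E e) \<and>
        (\<forall>Q q E e. left_coinvariant A \<beta> Y Q q \<and> left_costab A \<beta> Y E e \<longrightarrow> iso_arr C E Q (q \<cdot> e))) \<and>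
     (\<forall>\<beta> Y. right_coaction A \<beta> Y \<longrightarrow>
        (\<exists>Q q. right_coinvariant A \<beta> Y Q q) \<and> (\<exists>E e. right_costab A \<beta> Y E e) \<and>
        (\<forall>Q q E e. right_coinvariant A \<beta> Y Q q \<and> right_costab A \<beta> Y E e \<longrightarrow> iso_arr C E Q (q \<cdot> e)))"

definition bismall :: "('o, 'm) bimon \<Rightarrow> bool" where
  "bismall A \<longleftrightarrow> small A \<and> cosmall A"


section \<open>Bistability\<close>

text \<open>
  The arrow \<open>u\<close> below is the canonical comparison arrow: it is determined by the stated equation,
  because \<open>r\<close> is a coequalizer (equalizer in the dual case).  The comparison arrow between the
  units is always invertible.
\<close>

definition left_stable :: bool where
  "left_stable \<longleftrightarrow>
     (\<forall>A \<alpha> X A' \<alpha>' X' P p P' p' R r.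
        left_action A \<alpha> X \<and> left_action A' \<alpha>' X' \<and>
        left_stab A \<alpha> X P p \<and> left_stab A' \<alpha>' X' P' p' \<and>
        left_stab (tensor_bimon A A') ((\<alpha> \<boxtimes> \<alpha>') \<cdot> swap_mid (und A) (und A') X X') (X \<odot> X') R r
        \<longrightarrow> (\<exists>u. iso_arr C R (P \<odot> P') u \<and> u \<cdot> r = p \<boxtimes> p'))"

definition right_stable :: bool where
  "right_stable \<longleftrightarrow>
     (\<forall>A \<alpha> X A' \<alpha>' X' P p P' p' R r.
        right_action A \<alpha> X \<and> right_action A' \<alpha>' X' \<and>
        right_stab A \<alpha> X P p \<and> right_stab A' \<alpha>' X' P' p' \<and>
        right_stab (tensor_bimon A A') ((\<alpha> \<boxtimes> \<alpha>') \<cdot> swap_mid X X' (und A) (und A')) (X \<odot> X') R r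
        \<longrightarrow> (\<exists>u. iso_arr C R (P \<odot> P') u \<and> u \<cdot> r = p \<boxtimes> p'))"

definition left_costable :: bool where
  "left_costable \<longleftrightarrow>
     (\<forall>A \<beta> Y A' \<beta>' Y' E e E' e' R r.
        left_coaction A \<beta> Y \<and> left_coaction A' \<beta>' Y' \<and>
        left_costab A \<beta> Y E e \<and> left_costab A' \<beta>' Y' E' e' \<and>
        left_costab (tensor_bimon A A') (swap_mid (und A) Y (und A') Y' \<cdot> (\<beta> \<boxtimes> \<beta>')) (Y \<odot> Y') R r
        \<longrightarrow> (\<exists>u. iso_arr C (E \<odot> E') R u \<and> r \<cdot> u = e \<boxtimes> e'))"

definition right_costable :: bool where
  "right_costable \<longleftrightarrow>
     (\<forall>A \<beta> Y A' \<beta>' Y' E e E' e' R r.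
        right_coaction A \<beta> Y \<and> right_coaction A' \<beta>' Y' \<and>
        right_costab A \<beta> Y E e \<and> right_costab A' \<beta>' Y' E' e' \<and>
        right_costab (tensor_bimon A A') (swap_mid Y (und A) Y' (und A') \<cdot> (\<beta> \<boxtimes> \<beta>')) (Y \<odot> Y') R r
        \<longrightarrow> (\<exists>u. iso_arr C (E \<odot> E') R u \<and> r \<cdot> u = e \<boxtimes> e'))"

definition stable :: bool where
  "stable \<longleftrightarrow> left_stable \<and> right_stable"

definition costable :: bool where
  "costable \<longleftrightarrow> left_costable \<and> right_costable"

definition bistable :: bool where
  "bistable \<longleftrightarrow> stable \<and> costable"


section \<open>Inverse volume, Fredholm homomorphisms and the index\<close>

definition integral :: "('o, 'm) bimon \<Rightarrow> 'm \<Rightarrow> bool" where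
  "integral A \<phi> \<longleftrightarrow> \<phi> \<in> Hom C \<I> (und A) \<and>
     nabla A \<cdot> (\<phi> \<boxtimes> Id C (und A)) = runit C (und A) \<cdot> (\<phi> \<boxtimes> eps A) \<and>
     nabla A \<cdot> (Id C (und A) \<boxtimes> \<phi>) = lunit C (und A) \<cdot> (eps A \<boxtimes> \<phi>)"

definition cointegral :: "('o, 'm) bimon \<Rightarrow> 'm \<Rightarrow> bool" where
  "cointegral A \<phi> \<longleftrightarrow> \<phi> \<in> Hom C (und A) \<I> \<and>
     lunit C (und A) \<cdot> (\<phi> \<boxtimes> Id C (und A)) \<cdot> delta A = eta A \<cdot> \<phi> \<and>
     runit C (und A) \<cdot> (Id C (und A) \<boxtimes> \<phi>) \<cdot> delta A = eta A \<cdot> \<phi>"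

text \<open>
  Normalized integrals and cointegrals are unique if they exist, and they exist for bismall \<open>A\<close>;
  for other \<open>A\<close> the values below carry no meaning.
\<close>

definition normalized_integral :: "('o, 'm) bimon \<Rightarrow> 'm" where
  "normalized_integral A = (THE \<phi>. integral A \<phi> \<and> eps A \<cdot> \<phi> = Id C \<I>)"

definition normalized_cointegral :: "('o, 'm) bimon \<Rightarrow> 'm" where
  "normalized_cointegral A = (THE \<phi>. cointegral A \<phi> \<and> \<phi> \<cdot> eta A = Id C \<I>)"

definition vol_inv :: "('o, 'm) bimon \<Rightarrow> 'm" where
  "vol_inv A = normalized_cointegral A \<cdot> normalized_integral A"

definition End_Unit :: "'m monoid" where
  "End_Unit = \<lparr>carrier = Hom C \<I> \<I>, mult = Comp C, one = Id C \<I>\<rparr>"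

definition vol_generators :: "'m set" where
  "vol_generators = {f \<in> Hom C \<I> \<I>. \<exists>A. bismall A \<and> hopf_monoid A \<and> bicommutative A \<and>
     (f = vol_inv A \<or> (f \<cdot> vol_inv A = Id C \<I> \<and> vol_inv A \<cdot> f = Id C \<I>))}"

definition M :: "'m set" where
  "M = \<Inter>{H. submonoid H End_Unit \<and> vol_generators \<subseteq> H}"

definition M_inv :: "'m set" where
  "M_inv = M \<inter> Units End_Unit"

definition fredholm :: "('o, 'm) bimon \<Rightarrow> ('o, 'm) bimon \<Rightarrow> 'm \<Rightarrow> bool" where
  "fredholm A B \<xi> \<longleftrightarrow> \<xi> \<in> Hom Hopf_bc A B \<and>
     bismall (Ker Hopf_bc A B \<xi>) \<and> vol_inv (Ker Hopf_bc A B \<xi>) \<in> Units End_Unit \<and>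
     bismall (Cok Hopf_bc A B \<xi>) \<and> vol_inv (Cok Hopf_bc A B \<xi>) \<in> Units End_Unit"

definition Ind :: "('o, 'm) bimon \<Rightarrow> ('o, 'm) bimon \<Rightarrow> 'm \<Rightarrow> 'm" where
  "Ind A B \<xi> = vol_inv (Cok Hopf_bc A B \<xi>) \<cdot> inv\<^bsub>End_Unit\<^esub> (vol_inv (Ker Hopf_bc A B \<xi>))"

definition finite_hom :: "('o, 'm) bimon \<Rightarrow> ('o, 'm) bimon \<Rightarrow> 'm \<Rightarrow> bool" where
  "finite_hom A B \<xi> \<longleftrightarrow> \<xi> \<in> Hom Hopf_bc A B \<and>
     bismall (Im Hopf_bc A B \<xi>) \<and> vol_inv (Im Hopf_bc A B \<xi>) \<in> Units End_Unit"

end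

end

theory Submission
  imports Defs
begin

text \<open>
 The index is multiplicative because the inverse volume is multiplicative on short exact sequences
 and because kernels and cokernels of a composite are linked by four short exact sequences
 \<open>Ker f \<rightarrow> Ker gf \<rightarrow> X\<close>, \<open>X \<rightarrow> Ker g \<rightarrow> I\<close>, \<open>I \<rightarrow> Cok f \<rightarrow> Y\<close>, \<open>Y \<rightarrow> Cok gf \<rightarrow> Cok g\<close>, the pieces of
 the usual six-term exact sequence (\<open>kernel_cokernel_sequence\<close>). Call a bicommutative Hopf monoid
 good if it has a normalized integral \<open>\<sigma>\<close> and a normalized cointegral \<open>\<lambda>\<close> and \<open>\<lambda>\<sigma>\<close> is
 invertible. Averaging over \<open>\<sigma>\<close> splits invariants off every action, so a bismall Hopf monoid with
 invertible inverse volume is the same as a good one (\<open>bismall_iff\<close>). Three facts about a short exact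
 sequence \<open>A \<rightarrow> B \<rightarrow> C\<close> remain.

 \<^item> If \<open>A\<close> and \<open>C\<close> are good, so is \<open>B\<close>, and \<open>vol B = vol A vol C\<close> (\<open>extension\<close>): multiplication by
 the integral of \<open>A\<close> descends to a section \<open>C \<rightarrow> B\<close>, which carries the integral of \<open>C\<close> to one of \<open>B\<close>.
 \<^item> If \<open>B\<close> is good and \<open>C\<close> has a normalized cointegral, then \<open>A\<close> and \<open>C\<close> are good
 (\<open>kernel_good\<close>). Restricting the integral of \<open>B\<close> to \<open>A\<close> gives an integral \<open>t\<close>, and the point is
 that the scalar \<open>\<epsilon>t\<close> is invertible. For this the pairing and the copairing given by \<open>t\<close> and the
 cointegral of \<open>A\<close> turn the object of \<open>A\<close> into a bimonoid that plays the role of the dual of \<open>A\<close>. It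
 coacts on \<open>B\<close>, costability yields an object of invariants, and pairing the invariants with \<open>C\<close>
 produces an inverse of \<open>\<epsilon>t\<close>.
 \<^item> The dual statement, obtained by reversing all arrows.

 The image of an arrow between good objects has a normalized integral as a quotient and a normalized
 cointegral as a subobject, so kernel, image and cokernel of such an arrow are good. Applied to
 \<open>Ker g \<rightarrow> Cok f\<close> this makes \<open>X\<close>, \<open>I\<close>, \<open>Y\<close> good, and the index of a composite is the product of the
 indices. The same argument shows that \<open>g\<close> is Fredholm if \<open>f\<close> and \<open>gf\<close> are. For a
 finite perturbation \<open>\<xi> * \<epsilon>\<close> let \<open>k\<close> be the kernel of \<open>\<epsilon>\<close>. It is Fredholm, its cokernel being the image of
 \<open>\<epsilon>\<close>, and \<open>(\<xi> * \<epsilon>) k = \<xi> k\<close>; hence \<open>\<xi> * \<epsilon>\<close> is Fredholm, and the index of \<open>k\<close> cancels.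

 The computations with Hopf monoids are carried out in a strict symmetric monoidal category whose
 objects are lists (\<open>strictification\<close>). There \<open>g ** f\<close> is composition and \<open>f || g\<close> is the tensor
 product, reversing the arrows is a mere change of notation, and every dual statement is an instance
 of the original one. Identities are checked on generalized elements: arrows out of a cocommutative
 comonoid into a bicommutative Hopf monoid form an abelian group under convolution, and the universal
 such arrows suffice to test an equation.
\<close>

section \<open>Coherence in a symmetric monoidal category\<close>

locale smc = symmetric_monoidal_category C
 for C :: "('o, 'm) smcat" (structure)
begin

text \<open>Short infix forms of composition and tensor product.\<close>

abbreviation cmp :: "'m => 'm => 'm"  (infixr \<open>oo\<close> 55) where "g oo f == Comp C g f"
abbreviation tsr :: "'m => 'm => 'm"  (infixr \<open>##\<close> 60) where "f ## g == tensor C f g"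

lemma inverse_arrs_unique:
 assumes "inverse_arrs C a b f g" "inverse_arrs C a b f g'" shows "g = g'"
proof -
 have t: "f \<in> Hom C a b" "g \<in> Hom C b a" "g' \<in> Hom C b a"
  and e: "g oo f = Id C a" "f oo g' = Id C b"
  using assms by (auto simp: inverse_arrs_def)
 have "g = g oo (f oo g')" using e(2) Comp_Id[OF t(2)] by simp
 also have "\<dots> = (g oo f) oo g'" by (rule Comp_assoc[symmetric, OF t(3) t(1) t(2)])
 finally show ?thesis using e(1) Id_Comp[OF t(3)] by simp
qed

lemma inv_arr_inverse:
 assumes "iso_arr C a b f" shows "inverse_arrs C a b f (inv_arr C a b f)"
proof -
 obtain g where "inverse_arrs C a b f g" using assms by (auto simp: iso_arr_def)
 thus ?thesis unfolding inv_arr_def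
  by (rule theI) (erule inverse_arrs_unique, fact)
qed

lemma assoc_Hom: "[|a \<in> Ob C; b \<in> Ob C; c \<in> Ob C|] ==> assoc C a b c \<in> Hom C ((a \<odot> b) \<odot> c) (a \<odot> (b \<odot> c))"
 and assoc_inv_Hom: "[|a \<in> Ob C; b \<in> Ob C; c \<in> Ob C|] ==> assoc_inv C a b c \<in> Hom C (a \<odot> (b \<odot> c)) ((a \<odot> b) \<odot> c)"
 and assoc_inv_assoc: "[|a \<in> Ob C; b \<in> Ob C; c \<in> Ob C|] ==> assoc_inv C a b c oo assoc C a b c = Id C ((a \<odot> b) \<odot> c)"
 and assoc_assoc_inv: "[|a \<in> Ob C; b \<in> Ob C; c \<in> Ob C|] ==> assoc C a b c oo assoc_inv C a b c = Id C (a \<odot> (b \<odot> c))"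
 using inv_arr_inverse[OF assoc_iso] by (auto simp: inverse_arrs_def)

lemma lunit_Hom: "a \<in> Ob C ==> lunit C a \<in> Hom C (\<I> \<odot> a) a"
 and lunit_inv_Hom: "a \<in> Ob C ==> lunit_inv C a \<in> Hom C a (\<I> \<odot> a)"
 and lunit_inv_lunit: "a \<in> Ob C ==> lunit_inv C a oo lunit C a = Id C (\<I> \<odot> a)"
 and lunit_lunit_inv: "a \<in> Ob C ==> lunit C a oo lunit_inv C a = Id C a"
 using inv_arr_inverse[OF lunit_iso] by (auto simp: inverse_arrs_def)

lemma runit_Hom: "a \<in> Ob C ==> runit C a \<in> Hom C (a \<odot> \<I>) a"
 and runit_inv_Hom: "a \<in> Ob C ==> runit_inv C a \<in> Hom C a (a \<odot> \<I>)"
 and runit_inv_runit: "a \<in> Ob C ==> runit_inv C a oo runit C a = Id C (a \<odot> \<I>)"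
 and runit_runit_inv: "a \<in> Ob C ==> runit C a oo runit_inv C a = Id C a"
 using inv_arr_inverse[OF runit_iso] by (auto simp: inverse_arrs_def)

lemmas ty = Comp_Hom tensor_Hom Id_Hom assoc_Hom assoc_inv_Hom lunit_Hom lunit_inv_Hom
 runit_Hom runit_inv_Hom symm_Hom tensor_Ob Unit_Ob

lemma lwhisk: "[|a \<in> Ob C; f \<in> Hom C x y; g \<in> Hom C y z|]
  ==> Id C a ## (g oo f) = (Id C a ## g) oo (Id C a ## f)"
 using tensor_Comp[of "Id C a" a a "Id C a" a f x y g z] Id_Hom[of a] Comp_Id[of "Id C a" a a] by simp

lemma rwhisk: "[|a \<in> Ob C; f \<in> Hom C x y; g \<in> Hom C y z|]
  ==> (g oo f) ## Id C a = (g ## Id C a) oo (f ## Id C a)"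
 using tensor_Comp[of f x y g z "Id C a" a a "Id C a" a] Id_Hom[of a] Comp_Id[of "Id C a" a a] by simp

text \<open>
 Tensoring with the unit is faithful by naturality of the unitors. The unit coherences below become consequences of the triangle once a factor \<open>\<I>\<close> has been added.
\<close>

lemma lunit_faithful:
 assumes "f \<in> Hom C a b" "g \<in> Hom C a b" "Id C \<I> ## f = Id C \<I> ## g" shows "f = g"
proof -
 have ob: "a \<in> Ob C" "b \<in> Ob C" using Hom_Ob assms(1) by auto
 have "f oo lunit C a = g oo lunit C a" using lunit_nat assms by metis
 hence "(f oo lunit C a) oo lunit_inv C a = (g oo lunit C a) oo lunit_inv C a" by simp
 thus ?thesis using assms ob
  by (simp add: Comp_assoc[OF lunit_inv_Hom lunit_Hom] lunit_lunit_inv Comp_Id)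
qed

lemma runit_faithful:
 assumes "f \<in> Hom C a b" "g \<in> Hom C a b" "f ## Id C \<I> = g ## Id C \<I>" shows "f = g"
proof -
 have ob: "a \<in> Ob C" "b \<in> Ob C" using Hom_Ob assms(1) by auto
 have "f oo runit C a = g oo runit C a" using runit_nat assms by metis
 hence "(f oo runit C a) oo runit_inv C a = (g oo runit C a) oo runit_inv C a" by simp
 thus ?thesis using assms ob
  by (simp add: Comp_assoc[OF runit_inv_Hom runit_Hom] runit_runit_inv Comp_Id)
qed

lemma iso_cancel_right:
 assumes "h \<in> Hom C a b" "h' \<in> Hom C b a" "h oo h' = Id C b" "f \<in> Hom C b c" "g \<in> Hom C b c"
  and "f oo h = g oo h"
 shows "f = g"
proof -
 have "(f oo h) oo h' = (g oo h) oo h'" using assms by simp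
 thus ?thesis
  by (simp add: Comp_assoc[OF assms(2,1,4)] Comp_assoc[OF assms(2,1,5)] assms(3)
    Comp_Id[OF assms(4)] Comp_Id[OF assms(5)])
qed

lemma iso_cancel_left:
 assumes "h \<in> Hom C a b" "h' \<in> Hom C b a" "h' oo h = Id C a" "f \<in> Hom C c a" "g \<in> Hom C c a"
  and "h oo f = h oo g"
 shows "f = g"
proof -
 have "h' oo (h oo f) = h' oo (h oo g)" using assms by simp
 thus ?thesis
  by (simp add: Comp_assoc[OF assms(4,1,2), symmetric] Comp_assoc[OF assms(5,1,2), symmetric]
    assms(3) Id_Comp[OF assms(4)] Id_Comp[OF assms(5)])
qed

lemma assoc_cancel:
 assumes "a \<in> Ob C" "b \<in> Ob C" "c \<in> Ob C"
  and "f \<in> Hom C (a \<odot> (b \<odot> c)) d" "g \<in> Hom C (a \<odot> (b \<odot> c)) d"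
  and "f oo assoc C a b c = g oo assoc C a b c"
 shows "f = g"
 using iso_cancel_right[OF assoc_Hom assoc_inv_Hom assoc_assoc_inv] assms by blast

text \<open>
 The two remaining unit coherences follow from the triangle after tensoring with \<open>\<I>\<close>, which is
 a faithful operation; the pentagon moves the unit into the position needed by the triangle.
\<close>

lemma lunit_tensor:
 assumes [simp]: "a \<in> Ob C" "b \<in> Ob C"
 shows "lunit C (a \<odot> b) oo assoc C \<I> a b = lunit C a ## Id C b"
proof -
 let ?I = "Id C \<I>" and ?b = "Id C b"
 let ?L = "?I ## lunit C (a \<odot> b)" and ?A3 = "?I ## assoc C \<I> a b"
 let ?A2 = "assoc C \<I> (\<I> \<odot> a) b" and ?A1 = "assoc C \<I> \<I> a ## ?b"
 let ?M = "?I ## (lunit C a ## ?b)"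
 have ob: "a \<in> Ob C" "b \<in> Ob C" "\<I> \<in> Ob C" using Unit_Ob by auto
 have L: "?L \<in> Hom C (\<I> \<odot> (\<I> \<odot> (a \<odot> b))) (\<I> \<odot> (a \<odot> b))"
  and A3: "?A3 \<in> Hom C (\<I> \<odot> ((\<I> \<odot> a) \<odot> b)) (\<I> \<odot> (\<I> \<odot> (a \<odot> b)))"
  and A2: "?A2 \<in> Hom C ((\<I> \<odot> (\<I> \<odot> a)) \<odot> b) (\<I> \<odot> ((\<I> \<odot> a) \<odot> b))"
  and A1: "?A1 \<in> Hom C (((\<I> \<odot> \<I>) \<odot> a) \<odot> b) ((\<I> \<odot> (\<I> \<odot> a)) \<odot> b)"
  and M: "?M \<in> Hom C (\<I> \<odot> ((\<I> \<odot> a) \<odot> b)) (\<I> \<odot> (a \<odot> b))"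
  and B1: "assoc C \<I> \<I> (a \<odot> b) \<in> Hom C ((\<I> \<odot> \<I>) \<odot> (a \<odot> b)) (\<I> \<odot> (\<I> \<odot> (a \<odot> b)))"
  and B2: "assoc C (\<I> \<odot> \<I>) a b \<in> Hom C (((\<I> \<odot> \<I>) \<odot> a) \<odot> b) ((\<I> \<odot> \<I>) \<odot> (a \<odot> b))"
  and B3: "assoc C \<I> a b \<in> Hom C ((\<I> \<odot> a) \<odot> b) (\<I> \<odot> (a \<odot> b))"
  and M2: "(?I ## lunit C a) ## ?b \<in> Hom C ((\<I> \<odot> (\<I> \<odot> a)) \<odot> b) ((\<I> \<odot> a) \<odot> b)"
  by (rule ty ob)+
 have "(?L oo ?A3) oo (?A2 oo ?A1) = ?L oo (?A3 oo (?A2 oo ?A1))"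
  by (rule Comp_assoc[OF Comp_Hom[OF A1 A2] A3 L])
 also have "\<dots> = ?L oo (assoc C \<I> \<I> (a \<odot> b) oo assoc C (\<I> \<odot> \<I>) a b)"
  by (simp only: pentagon[OF ob(3) ob(3) ob(1) ob(2)])
 also have "\<dots> = (?L oo assoc C \<I> \<I> (a \<odot> b)) oo assoc C (\<I> \<odot> \<I>) a b"
  by (rule Comp_assoc[symmetric, OF B2 B1 L])
 also have "\<dots> = (runit C \<I> ## (Id C a ## ?b)) oo assoc C (\<I> \<odot> \<I>) a b"
  by (simp only: triangle[OF ob(3) tensor_Ob[OF ob(1,2)]] tensor_Id[OF ob(1,2)])
 also have "\<dots> = assoc C \<I> a b oo ((runit C \<I> ## Id C a) ## ?b)"
  by (rule assoc_nat[symmetric]) (rule ty ob)+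
 also have "\<dots> = assoc C \<I> a b oo (((?I ## lunit C a) oo assoc C \<I> \<I> a) ## ?b)"
  by (simp only: triangle[OF ob(3,1)])
 also have "\<dots> = assoc C \<I> a b oo (((?I ## lunit C a) ## ?b) oo ?A1)"
  by (subst rwhisk) (rule refl ty ob)+
 also have "\<dots> = (assoc C \<I> a b oo ((?I ## lunit C a) ## ?b)) oo ?A1"
  by (rule Comp_assoc[symmetric, OF A1 M2 B3])
 also have "\<dots> = (?M oo ?A2) oo ?A1"
  by (subst assoc_nat) (rule refl ty ob)+
 also have "\<dots> = ?M oo (?A2 oo ?A1)"
  by (rule Comp_assoc[OF A1 A2 M])
 finally have c1: "((?L oo ?A3) oo ?A2) oo ?A1 = (?M oo ?A2) oo ?A1"
  by (simp only: Comp_assoc[OF A1 A2 M] Comp_assoc[OF A1 A2 Comp_Hom[OF A3 L]])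
 have c2: "?A1 oo (assoc_inv C \<I> \<I> a ## ?b) = Id C ((\<I> \<odot> (\<I> \<odot> a)) \<odot> b)"
  by (subst rwhisk[symmetric], (rule ty ob)+,
    simp only: assoc_assoc_inv[OF ob(3,3,1)], rule tensor_Id) (rule ty ob)+
 have "(?L oo ?A3) oo ?A2 = ?M oo ?A2"
  by (rule iso_cancel_right[OF A1 _ c2 _ _ c1]) (rule ty ob)+
 hence "?L oo ?A3 = ?M"
  by (rule assoc_cancel[rotated -1]) (rule ty ob)+
 hence "?I ## (lunit C (a \<odot> b) oo assoc C \<I> a b) = ?I ## (lunit C a ## ?b)"
  by (subst lwhisk) (rule ty ob | assumption)+
 thus ?thesis by (rule lunit_faithful[rotated -1]) (rule ty ob)+
qed

lemma runit_tensor: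
 assumes ob1: "a \<in> Ob C" "b \<in> Ob C"
 shows "(Id C a ## runit C b) oo assoc C a b \<I> = runit C (a \<odot> b)"
proof -
 let ?I = "Id C \<I>" and ?a = "Id C a" and ?b = "Id C b"
 let ?L = "?a ## (?b ## lunit C \<I>)" and ?A3 = "?a ## assoc C b \<I> \<I>"
 let ?A2 = "assoc C a (b \<odot> \<I>) \<I>" and ?A1 = "assoc C a b \<I> ## ?I"
 let ?M = "?a ## (runit C b ## ?I)" and ?A = "assoc C a b \<I>"
 let ?R = "?a ## runit C b"
 have ob: "a \<in> Ob C" "b \<in> Ob C" "\<I> \<in> Ob C" using ob1 Unit_Ob by auto
 note t = ty ob
 have "?A oo ((?R oo ?A) ## ?I) = ?A oo ((?R ## ?I) oo ?A1)"
  by (subst rwhisk) (rule refl t)+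
 also have "\<dots> = (?A oo (?R ## ?I)) oo ?A1"
  by (rule Comp_assoc[symmetric]) (rule t)+
 also have "\<dots> = (?M oo ?A2) oo ?A1"
  by (subst assoc_nat) (rule refl t)+
 also have "\<dots> = ?M oo (?A2 oo ?A1)"
  by (rule Comp_assoc) (rule t)+
 also have "?M = ?L oo ?A3"
  by (subst lwhisk[symmetric], (rule t)+, simp only: triangle[OF ob(2,3)])
 also have "(?L oo ?A3) oo (?A2 oo ?A1) = ?L oo (?A3 oo (?A2 oo ?A1))"
  by (rule Comp_assoc) (rule t)+
 also have "\<dots> = ?L oo (assoc C a b (\<I> \<odot> \<I>) oo assoc C (a \<odot> b) \<I> \<I>)"
  by (simp only: pentagon[OF ob(1,2,3,3)])
 also have "\<dots> = (?L oo assoc C a b (\<I> \<odot> \<I>)) oo assoc C (a \<odot> b) \<I> \<I>"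
  by (rule Comp_assoc[symmetric]) (rule t)+
 also have "\<dots> = (?A oo ((?a ## ?b) ## lunit C \<I>)) oo assoc C (a \<odot> b) \<I> \<I>"
  by (subst assoc_nat) (rule refl t)+
 also have "\<dots> = ?A oo (((?a ## ?b) ## lunit C \<I>) oo assoc C (a \<odot> b) \<I> \<I>)"
  by (rule Comp_assoc) (rule t)+
 also have "((?a ## ?b) ## lunit C \<I>) oo assoc C (a \<odot> b) \<I> \<I> = runit C (a \<odot> b) ## ?I"
  by (simp only: tensor_Id[OF ob(1,2)] triangle[OF tensor_Ob[OF ob(1,2)] ob(3)])
 finally have e: "?A oo ((?R oo ?A) ## ?I) = ?A oo (runit C (a \<odot> b) ## ?I)" .
 have "(?R oo ?A) ## ?I = runit C (a \<odot> b) ## ?I"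
  by (rule iso_cancel_left[OF _ _ assoc_inv_assoc _ _ e]) (rule t)+
 thus ?thesis by (rule runit_faithful[rotated -1]) (rule t)+
qed

lemma lunit_eq_runit: "lunit C \<I> = runit C \<I>"
proof -
 note t = ty Unit_Ob
 let ?I = "Id C \<I>"
 have "lunit C \<I> oo (?I ## lunit C \<I>) = lunit C \<I> oo lunit C (\<I> \<odot> \<I>)"
  by (rule lunit_nat) (rule t)+
 hence "?I ## lunit C \<I> = lunit C (\<I> \<odot> \<I>)"
  by (rule iso_cancel_left[OF _ _ lunit_inv_lunit, rotated -1]) (rule t)+
 hence "lunit C \<I> ## ?I = runit C \<I> ## ?I"
  using lunit_tensor[OF Unit_Ob Unit_Ob] triangle[OF Unit_Ob Unit_Ob] by simp
 thus ?thesis by (rule runit_faithful[rotated -1]) (rule t)+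
qed

end

context smc begin

section \<open>Strictification\<close>

lemma comp_rw:
 "[|f oo g = h oo k; x \<in> Hom C u v; g \<in> Hom C v w; f \<in> Hom C w y; k \<in> Hom C v w'; h \<in> Hom C w' y|]
  ==> f oo (g oo x) = h oo (k oo x)"
 by (simp only: Comp_assoc[symmetric])

lemma comp_rw1:
 "[|f oo g = h; x \<in> Hom C u v; g \<in> Hom C v w; f \<in> Hom C w y|] ==> f oo (g oo x) = h oo x"
 by (simp only: Comp_assoc[symmetric])

fun Jo :: "'o list => 'o" where
 "Jo [] = \<I>"
| "Jo [a] = a"
| "Jo (a # b # xs) = a \<odot> Jo (b # xs)"

text \<open>
 The canonical isomorphism from \<open>Jo xs \<odot> Jo ys\<close> to \<open>Jo (xs @ ys)\<close>. Joining is right-nested without a trailing unit, so that a one-element list denotes its element itself and the arrows below are defined by recursion on the first list only.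
\<close>

fun mu :: "'o list => 'o list => 'm" where
 "mu [] ys = lunit C (Jo ys)"
| "mu [a] [] = runit C a"
| "mu [a] (y # ys) = Id C (a \<odot> Jo (y # ys))"
| "mu (a # b # xs) ys = (Id C a ## mu (b # xs) ys) oo assoc C a (Jo (b # xs)) (Jo ys)"

fun mu_inv :: "'o list => 'o list => 'm" where
 "mu_inv [] ys = lunit_inv C (Jo ys)"
| "mu_inv [a] [] = runit_inv C a"
| "mu_inv [a] (y # ys) = Id C (a \<odot> Jo (y # ys))"
| "mu_inv (a # b # xs) ys = assoc_inv C a (Jo (b # xs)) (Jo ys) oo (Id C a ## mu_inv (b # xs) ys)"

abbreviation obs :: "'o list => bool" where "obs xs \<equiv> set xs \<subseteq> Ob C"

lemma Jo_Ob: "obs xs ==> Jo xs \<in> Ob C"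
 by (induction xs rule: Jo.induct) (auto simp: Unit_Ob tensor_Ob)

lemma mu_Hom: "[|obs xs; obs ys|] ==> mu xs ys \<in> Hom C (Jo xs \<odot> Jo ys) (Jo (xs @ ys))"
proof (induction xs ys rule: mu.induct)
 case (1 ys) thus ?case using lunit_Hom Jo_Ob by simp
next
 case (2 a) thus ?case using runit_Hom by simp
next
 case (3 a y ys)
 thus ?case using Id_Hom[OF tensor_Ob, of a "Jo (y # ys)"] Jo_Ob[of "y # ys"] by simp
next
 case (4 a b xs ys)
 have ob: "a \<in> Ob C" "Jo (b # xs) \<in> Ob C" "Jo ys \<in> Ob C" using 4 Jo_Ob by auto
 have "mu (b # xs) ys \<in> Hom C (Jo (b # xs) \<odot> Jo ys) (Jo (b # xs @ ys))" using 4 by simp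
 hence "(Id C a ## mu (b # xs) ys) oo assoc C a (Jo (b # xs)) (Jo ys)
  \<in> Hom C ((a \<odot> Jo (b # xs)) \<odot> Jo ys) (a \<odot> Jo (b # xs @ ys))"
  by - (rule ty ob | assumption)+
 thus ?case by simp
qed

lemma mu_inv_inverse: "[|obs xs; obs ys|] ==> inverse_arrs C (Jo xs \<odot> Jo ys) (Jo (xs @ ys)) (mu xs ys) (mu_inv xs ys)"
proof (induction xs ys rule: mu.induct)
 case (1 ys) thus ?case using inv_arr_inverse lunit_iso Jo_Ob by simp
next
 case (2 a) thus ?case using inv_arr_inverse runit_iso by simp
next
 case (3 a y ys)
 thus ?case using Id_Hom[OF tensor_Ob, of a "Jo (y # ys)"] Jo_Ob[of "y # ys"] Comp_Id
  by (auto simp: inverse_arrs_def)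
next
 case (4 a b xs ys)
 have ob: "a \<in> Ob C" "Jo (b # xs) \<in> Ob C" "Jo ys \<in> Ob C" "Jo (b # xs @ ys) \<in> Ob C"
  using 4 Jo_Ob[of "b # xs"] Jo_Ob[of ys] Jo_Ob[of "b # xs @ ys"] by auto
 have m: "mu (b # xs) ys \<in> Hom C (Jo (b # xs) \<odot> Jo ys) (Jo (b # xs @ ys))"
  and n: "mu_inv (b # xs) ys \<in> Hom C (Jo (b # xs @ ys)) (Jo (b # xs) \<odot> Jo ys)"
  and mn: "mu (b # xs) ys oo mu_inv (b # xs) ys = Id C (Jo (b # xs @ ys))"
  and nm: "mu_inv (b # xs) ys oo mu (b # xs) ys = Id C (Jo (b # xs) \<odot> Jo ys)"
  using 4 by (auto simp: inverse_arrs_def)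
 let ?a = "Id C a" and ?m = "mu (b # xs) ys" and ?n = "mu_inv (b # xs) ys"
 let ?A = "assoc C a (Jo (b # xs)) (Jo ys)" and ?B = "assoc_inv C a (Jo (b # xs)) (Jo ys)"
 note t = ty ob m n
 have "((?a ## ?m) oo ?A) oo (?B oo (?a ## ?n)) = (?a ## ?m) oo (?A oo (?B oo (?a ## ?n)))"
  by (rule Comp_assoc) (rule t)+
 also have "?A oo (?B oo (?a ## ?n)) = Id C (a \<odot> (Jo (b # xs) \<odot> Jo ys)) oo (?a ## ?n)"
  by (rule comp_rw1[OF assoc_assoc_inv]) (rule t)+
 also have "\<dots> = ?a ## ?n" by (rule Id_Comp) (rule t)+
 also have "(?a ## ?m) oo (?a ## ?n) = ?a ## (?m oo ?n)" by (rule lwhisk[symmetric]) (rule t)+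
 also have "\<dots> = Id C (a \<odot> Jo (b # xs @ ys))" unfolding mn by (rule tensor_Id) (rule t)+
 finally have 1: "((?a ## ?m) oo ?A) oo (?B oo (?a ## ?n)) = Id C (a \<odot> Jo (b # xs @ ys))" .
 have "(?B oo (?a ## ?n)) oo ((?a ## ?m) oo ?A) = ?B oo ((?a ## ?n) oo ((?a ## ?m) oo ?A))"
  by (rule Comp_assoc) (rule t)+
 also have "(?a ## ?n) oo ((?a ## ?m) oo ?A) = (?a ## (?n oo ?m)) oo ?A"
  by (rule comp_rw1[OF lwhisk[symmetric]]) (rule t)+
 also have "?a ## (?n oo ?m) = Id C (a \<odot> (Jo (b # xs) \<odot> Jo ys))" unfolding nm by (rule tensor_Id) (rule t)+
 also have "Id C (a \<odot> (Jo (b # xs) \<odot> Jo ys)) oo ?A = ?A" by (rule Id_Comp) (rule t)+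
 also have "?B oo ?A = Id C ((a \<odot> Jo (b # xs)) \<odot> Jo ys)" by (rule assoc_inv_assoc) (rule t)+
 finally have 2: "(?B oo (?a ## ?n)) oo ((?a ## ?m) oo ?A) = Id C ((a \<odot> Jo (b # xs)) \<odot> Jo ys)" .
 have "(?a ## ?m) oo ?A \<in> Hom C ((a \<odot> Jo (b # xs)) \<odot> Jo ys) (a \<odot> Jo (b # xs @ ys))"
  "?B oo (?a ## ?n) \<in> Hom C (a \<odot> Jo (b # xs @ ys)) ((a \<odot> Jo (b # xs)) \<odot> Jo ys)"
  by (rule t)+
 thus ?case using 1 2 by (simp add: inverse_arrs_def)
qed

lemma mu_inv_Hom: "[|obs xs; obs ys|] ==> mu_inv xs ys \<in> Hom C (Jo (xs @ ys)) (Jo xs \<odot> Jo ys)"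
 and mu_mu_inv: "[|obs xs; obs ys|] ==> mu xs ys oo mu_inv xs ys = Id C (Jo (xs @ ys))"
 and mu_inv_mu: "[|obs xs; obs ys|] ==> mu_inv xs ys oo mu xs ys = Id C (Jo xs \<odot> Jo ys)"
 using mu_inv_inverse by (auto simp: inverse_arrs_def)

lemma mu_Nil_right: "obs xs ==> mu xs [] = runit C (Jo xs)"
proof (induction xs rule: Jo.induct)
 case 1 thus ?case by (simp add: lunit_eq_runit)
next
 case (2 a) thus ?case by simp
next
 case (3 a b xs)
 thus ?case using runit_tensor[of a "Jo (b # xs)"] Jo_Ob[of "b # xs"] by simp
qed

text \<open>
 Coherence of the joins. This identity makes the tensor product of the strict category associative on the nose; the induction moves one head element across, which costs one pentagon.
\<close>

lemma mu_assoc: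
 assumes "obs xs" and ys: "obs ys" and zs: "obs zs"
 shows "mu (xs @ ys) zs oo (mu xs ys ## Id C (Jo zs))
   = mu xs (ys @ zs) oo ((Id C (Jo xs) ## mu ys zs) oo assoc C (Jo xs) (Jo ys) (Jo zs))"
 using assms(1)
proof (induction xs rule: Jo.induct)
 case 1
 have yz: "obs (ys @ zs)" using ys zs by simp
 note t = ty Jo_Ob mu_Hom ys zs yz
 let ?y = "Jo ys" and ?z = "Jo zs"
 have "lunit C (Jo (ys @ zs)) oo ((Id C \<I> ## mu ys zs) oo assoc C \<I> ?y ?z)
   = mu ys zs oo (lunit C (?y \<odot> ?z) oo assoc C \<I> ?y ?z)"
  by (rule comp_rw[OF lunit_nat]) (rule t)+
 also have "lunit C (?y \<odot> ?z) oo assoc C \<I> ?y ?z = lunit C ?y ## Id C ?z"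
  by (rule lunit_tensor) (rule t)+
 finally show ?case by simp
next
 case (2 a)
 hence a: "a \<in> Ob C" by simp
 have yz: "obs (ys @ zs)" using ys zs by simp
 note t = ty Jo_Ob mu_Hom a ys zs yz
 show ?case
 proof (cases ys)
  case Nil
  have "mu [a] zs oo ((Id C a ## lunit C (Jo zs)) oo assoc C a \<I> (Jo zs))
    = mu [a] zs oo (runit C a ## Id C (Jo zs))"
   by (subst triangle) (rule refl t)+
  thus ?thesis using Nil by simp
 next
  case (Cons y ys')
  have yz: "Jo (ys @ zs) \<in> Ob C" "Jo ys \<in> Ob C" using ys zs Jo_Ob[of "ys @ zs"] Jo_Ob by auto
  have "Id C (a \<odot> Jo ys) ## Id C (Jo zs) = Id C ((a \<odot> Jo ys) \<odot> Jo zs)"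
   by (rule tensor_Id) (rule t)+
  moreover have "((Id C a ## mu ys zs) oo assoc C a (Jo ys) (Jo zs)) oo Id C ((a \<odot> Jo ys) \<odot> Jo zs)
    = (Id C a ## mu ys zs) oo assoc C a (Jo ys) (Jo zs)"
   by (rule Comp_Id) (rule t)+
  moreover have "Id C (a \<odot> Jo (ys @ zs)) oo ((Id C a ## mu ys zs) oo assoc C a (Jo ys) (Jo zs))
    = (Id C a ## mu ys zs) oo assoc C a (Jo ys) (Jo zs)"
   by (rule Id_Comp) (rule t)+
  ultimately show ?thesis using Cons by simp
 qed
next
 case (3 a b xs)
 define w x y z where "w = b # xs" and "x = Jo w" and "y = Jo ys" and "z = Jo zs"
 have ob: "a \<in> Ob C" "obs w" "x \<in> Ob C" "y \<in> Ob C" "z \<in> Ob C" "obs (ys @ zs)" "obs (w @ ys)"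
   "Jo (ys @ zs) \<in> Ob C"
  using 3(2) ys zs Jo_Ob[of w] Jo_Ob[of ys] Jo_Ob[of zs] Jo_Ob[of "ys @ zs"]
  by (auto simp: w_def x_def y_def z_def)
 have m: "mu w ys \<in> Hom C (x \<odot> y) (Jo (w @ ys))" "mu ys zs \<in> Hom C (y \<odot> z) (Jo (ys @ zs))"
  "mu (w @ ys) zs \<in> Hom C (Jo (w @ ys) \<odot> z) (Jo (w @ (ys @ zs)))"
  "mu w (ys @ zs) \<in> Hom C (x \<odot> Jo (ys @ zs)) (Jo (w @ (ys @ zs)))"
  using mu_Hom[of w ys] mu_Hom[of ys zs] mu_Hom[of "w @ ys" zs] mu_Hom[of w "ys @ zs"] ob ys zs
  by (simp_all add: x_def y_def z_def)
 have wy: "Jo (w @ ys) \<in> Ob C" using ob Jo_Ob by blast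
 have IH: "mu (w @ ys) zs oo (mu w ys ## Id C z)
   = mu w (ys @ zs) oo ((Id C x ## mu ys zs) oo assoc C x y z)"
  using 3 by (simp add: w_def x_def y_def z_def)
 let ?a = "Id C a"
 note t = ty m wy ob
 have rw: "((?a ## mu w ys) oo assoc C a x y) ## Id C z
   = ((?a ## mu w ys) ## Id C z) oo (assoc C a x y ## Id C z)"
  by (rule rwhisk) (rule t)+
 have "((?a ## mu (w @ ys) zs) oo assoc C a (Jo (w @ ys)) z) oo (((?a ## mu w ys) ## Id C z) oo (assoc C a x y ## Id C z))
  = (?a ## mu (w @ ys) zs) oo (assoc C a (Jo (w @ ys)) z oo (((?a ## mu w ys) ## Id C z) oo (assoc C a x y ## Id C z)))"
  by (rule Comp_assoc) (rule t)+
 also have "assoc C a (Jo (w @ ys)) z oo (((?a ## mu w ys) ## Id C z) oo (assoc C a x y ## Id C z))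
   = (?a ## (mu w ys ## Id C z)) oo (assoc C a (x \<odot> y) z oo (assoc C a x y ## Id C z))"
  by (rule comp_rw[OF assoc_nat]) (rule t)+
 also have "(?a ## mu (w @ ys) zs) oo \<dots>
   = (?a ## (mu (w @ ys) zs oo (mu w ys ## Id C z))) oo (assoc C a (x \<odot> y) z oo (assoc C a x y ## Id C z))"
  by (rule comp_rw1[OF lwhisk[symmetric]]) (rule t)+
 also have "?a ## (mu (w @ ys) zs oo (mu w ys ## Id C z))
   = (?a ## mu w (ys @ zs)) oo (?a ## ((Id C x ## mu ys zs) oo assoc C x y z))"
  unfolding IH by (rule lwhisk) (rule t)+
 also have "?a ## ((Id C x ## mu ys zs) oo assoc C x y z)
   = (?a ## (Id C x ## mu ys zs)) oo (?a ## assoc C x y z)"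
  by (rule lwhisk) (rule t)+
 also have "((?a ## mu w (ys @ zs)) oo ((?a ## (Id C x ## mu ys zs)) oo (?a ## assoc C x y z)))
    oo (assoc C a (x \<odot> y) z oo (assoc C a x y ## Id C z))
  = (?a ## mu w (ys @ zs)) oo (((?a ## (Id C x ## mu ys zs)) oo (?a ## assoc C x y z))
    oo (assoc C a (x \<odot> y) z oo (assoc C a x y ## Id C z)))"
  by (rule Comp_assoc) (rule t)+
 also have "((?a ## (Id C x ## mu ys zs)) oo (?a ## assoc C x y z))
    oo (assoc C a (x \<odot> y) z oo (assoc C a x y ## Id C z))
   = (?a ## (Id C x ## mu ys zs)) oo ((?a ## assoc C x y z)
    oo (assoc C a (x \<odot> y) z oo (assoc C a x y ## Id C z)))"
  by (rule Comp_assoc) (rule t)+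
 also have "(?a ## assoc C x y z) oo (assoc C a (x \<odot> y) z oo (assoc C a x y ## Id C z))
   = assoc C a x (y \<odot> z) oo assoc C (a \<odot> x) y z"
  by (rule pentagon) (rule t)+
 also have "(?a ## (Id C x ## mu ys zs)) oo (assoc C a x (y \<odot> z) oo assoc C (a \<odot> x) y z)
   = assoc C a x (Jo (ys @ zs)) oo (((?a ## Id C x) ## mu ys zs) oo assoc C (a \<odot> x) y z)"
  by (rule comp_rw[OF assoc_nat[symmetric]]) (rule t)+
 also have "(?a ## mu w (ys @ zs)) oo (assoc C a x (Jo (ys @ zs)) oo (((?a ## Id C x) ## mu ys zs) oo assoc C (a \<odot> x) y z))
   = ((?a ## mu w (ys @ zs)) oo assoc C a x (Jo (ys @ zs))) oo (((?a ## Id C x) ## mu ys zs) oo assoc C (a \<odot> x) y z)"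
  by (rule Comp_assoc[symmetric]) (rule t)+
 also have "?a ## Id C x = Id C (a \<odot> x)" by (rule tensor_Id) (rule t)+
 finally show ?case unfolding rw[symmetric] by (simp add: w_def x_def y_def z_def)
qed

end

text \<open>
 A strict symmetric monoidal category with a single sort of arrows. Objects are lists of atoms and the tensor product of objects is concatenation. Source and target are functions of the arrow, and an undefined composite is an arrow that fails \<open>ar\<close>; composition and tensor product are then associative without side conditions, which lets the simplifier normalize diagrams.
\<close>

locale ssmc =
 fixes At :: "'o set"
  and ar :: "'a => bool" and src trg :: "'a => 'o list"
  and cp :: "'a => 'a => 'a"  (infixr \<open>**\<close> 55)
  and ts :: "'a => 'a => 'a"  (infixr \<open>||\<close> 60)
  and ide :: "'o list => 'a"
  and sw :: "'o list => 'o list => 'a"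
 assumes src_obs: "ar f ==> set (src f) \<subseteq> At" and trg_obs: "ar f ==> set (trg f) \<subseteq> At"
  and ar_cp: "ar (g ** f) \<longleftrightarrow> ar g \<and> ar f \<and> trg f = src g"
  and src_cp: "ar (g ** f) ==> src (g ** f) = src f" and trg_cp: "ar (g ** f) ==> trg (g ** f) = trg g"
  and cp_assoc: "(h ** g) ** f = h ** g ** f"
  and ar_ide: "ar (ide xs) \<longleftrightarrow> set xs \<subseteq> At"
  and src_ide: "src (ide xs) = xs" and trg_ide: "trg (ide xs) = xs"
  and cp_ide: "ar f ==> src f = xs ==> f ** ide xs = f"
  and ide_cp: "ar f ==> trg f = xs ==> ide xs ** f = f"
  and ar_ts: "ar (f || g) \<longleftrightarrow> ar f \<and> ar g"
  and src_ts: "ar f ==> ar g ==> src (f || g) = src f @ src g"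
  and trg_ts: "ar f ==> ar g ==> trg (f || g) = trg f @ trg g"
  and ts_assoc: "(f || g) || h = f || g || h"
  and ide_ts: "ar f ==> ide [] || f = f" and ts_ide: "ar f ==> f || ide [] = f"
  and ide_ide: "set xs \<subseteq> At ==> set ys \<subseteq> At ==> ide xs || ide ys = ide (xs @ ys)"
  and interchange: "ar (g ** f) ==> ar (g' ** f') ==> (g ** f) || (g' ** f') = (g || g') ** (f || f')"
  and ar_sw: "ar (sw xs ys) \<longleftrightarrow> set xs \<subseteq> At \<and> set ys \<subseteq> At"
  and src_sw: "src (sw xs ys) = xs @ ys" and trg_sw: "trg (sw xs ys) = ys @ xs"
  and sw_sw: "set xs \<subseteq> At ==> set ys \<subseteq> At ==> sw ys xs ** sw xs ys = ide (xs @ ys)"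
  and sw_nat: "ar f ==> ar g ==> sw (trg f) (trg g) ** (f || g) = (g || f) ** sw (src f) (src g)"
  and sw_hex: "set xs \<subseteq> At ==> set ys \<subseteq> At ==> set zs \<subseteq> At
   ==> sw xs (ys @ zs) = (ide ys || sw xs zs) ** (sw xs ys || ide zs)"

context smc begin

fun sm :: "('o list \<times> 'm \<times> 'o list) option => 'm" where
 "sm (Some (xs, f, ys)) = f" | "sm None = undefined"
fun ssrc :: "('o list \<times> 'm \<times> 'o list) option => 'o list" where
 "ssrc (Some (xs, f, ys)) = xs" | "ssrc None = []"
fun strg :: "('o list \<times> 'm \<times> 'o list) option => 'o list" where
 "strg (Some (xs, f, ys)) = ys" | "strg None = []"
text \<open>
 An arrow \<open>xs \<rightarrow> ys\<close> of the strict category is an arrow between the joins. It is tagged with both lists because hom-sets need not be disjoint; \<open>None\<close> is the undefined composite.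
\<close>

fun sar :: "('o list \<times> 'm \<times> 'o list) option => bool" where
 "sar (Some (xs, f, ys)) \<longleftrightarrow> obs xs \<and> obs ys \<and> f \<in> Hom C (Jo xs) (Jo ys)" | "sar None \<longleftrightarrow> False"

definition scp where
 "scp g f = (if sar g \<and> sar f \<and> strg f = ssrc g then Some (ssrc f, sm g oo sm f, strg g) else None)"
definition sts where
 "sts f g = (if sar f \<and> sar g
   then Some (ssrc f @ ssrc g,
    mu (strg f) (strg g) oo ((sm f ## sm g) oo mu_inv (ssrc f) (ssrc g)), strg f @ strg g)
   else None)"
definition side :: "'o list => ('o list \<times> 'm \<times> 'o list) option" where
 "side xs = Some (xs, Id C (Jo xs), xs)"
definition ssw :: "'o list => 'o list => ('o list \<times> 'm \<times> 'o list) option" where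
 "ssw xs ys = Some (xs @ ys, mu ys xs oo (symm C (Jo xs) (Jo ys) oo mu_inv xs ys), ys @ xs)"

lemma sarD: "sar f ==> obs (ssrc f)" "sar f ==> obs (strg f)"
 "sar f ==> sm f \<in> Hom C (Jo (ssrc f)) (Jo (strg f))"
 by (cases f; force)+

lemma s_eqI: "[|sar f; sar g; ssrc f = ssrc g; strg f = strg g; sm f = sm g|] ==> f = g"
 by (cases f; cases g) auto

lemma mu_cancel:
 assumes "obs xs" "obs ys" "f \<in> Hom C (Jo (xs @ ys)) c" "g \<in> Hom C (Jo (xs @ ys)) c"
  and "f oo mu xs ys = g oo mu xs ys"
 shows "f = g"
 using iso_cancel_right[OF mu_Hom mu_inv_Hom mu_mu_inv] assms by blast

lemma sar_scp: "sar (scp g f) \<longleftrightarrow> sar g \<and> sar f \<and> strg f = ssrc g"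
 using sarD[of f] sarD[of g] Comp_Hom[of "sm f" "Jo (ssrc f)" "Jo (strg f)" "sm g" "Jo (strg g)"]
 by (auto simp: scp_def)

lemma sar_sts: "sar (sts f g) \<longleftrightarrow> sar f \<and> sar g"
proof -
 have "mu (strg f) (strg g) oo ((sm f ## sm g) oo mu_inv (ssrc f) (ssrc g))
   \<in> Hom C (Jo (ssrc f @ ssrc g)) (Jo (strg f @ strg g))" if "sar f" "sar g"
  by (rule ty mu_Hom mu_inv_Hom sarD that)+
 thus ?thesis using sarD by (auto simp: sts_def)
qed

lemma sm_sts:
 assumes f: "sar f" and g: "sar g"
 shows "sm (sts f g) oo mu (ssrc f) (ssrc g) = mu (strg f) (strg g) oo (sm f ## sm g)"
proof -
 let ?m = "mu (ssrc f) (ssrc g)" and ?n = "mu_inv (ssrc f) (ssrc g)" and ?k = "mu (strg f) (strg g)"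
 note t = ty mu_Hom mu_inv_Hom sarD f g Jo_Ob
 have "(?k oo ((sm f ## sm g) oo ?n)) oo ?m = ?k oo (((sm f ## sm g) oo ?n) oo ?m)"
  by (rule Comp_assoc) (rule t)+
 also have "((sm f ## sm g) oo ?n) oo ?m = (sm f ## sm g) oo (?n oo ?m)"
  by (rule Comp_assoc) (rule t)+
 also have "?n oo ?m = Id C (Jo (ssrc f) \<odot> Jo (ssrc g))" by (rule mu_inv_mu) (rule t)+
 also have "(sm f ## sm g) oo \<dots> = sm f ## sm g" by (rule Comp_Id) (rule t)+
 finally show ?thesis using f g by (simp add: sts_def)
qed

lemma ssw_Hom: "obs xs ==> obs ys ==> sm (ssw xs ys) \<in> Hom C (Jo (xs @ ys)) (Jo (ys @ xs))"
 unfolding ssw_def sm.simps by (rule ty mu_Hom mu_inv_Hom Jo_Ob | assumption)+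

lemma sar_ssw: "sar (ssw xs ys) \<longleftrightarrow> obs xs \<and> obs ys"
 using ssw_Hom[of xs ys] by (auto simp: ssw_def)

lemma sm_ssw:
 assumes "obs xs" "obs ys"
 shows "sm (ssw xs ys) oo mu xs ys = mu ys xs oo symm C (Jo xs) (Jo ys)"
proof -
 let ?s = "symm C (Jo xs) (Jo ys)"
 note t = ty mu_Hom mu_inv_Hom Jo_Ob assms
 have "(mu ys xs oo (?s oo mu_inv xs ys)) oo mu xs ys = mu ys xs oo ((?s oo mu_inv xs ys) oo mu xs ys)"
  by (rule Comp_assoc) (rule t)+
 also have "(?s oo mu_inv xs ys) oo mu xs ys = ?s oo (mu_inv xs ys oo mu xs ys)"
  by (rule Comp_assoc) (rule t)+
 also have "\<dots> = ?s" by (subst mu_inv_mu, (rule t)+, rule Comp_Id) (rule t)+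
 finally show ?thesis by (simp add: ssw_def)
qed

lemma s_src [simp]: "ssrc (side xs) = xs" "strg (side xs) = xs" "sm (side xs) = Id C (Jo xs)"
 "ssrc (ssw xs ys) = xs @ ys" "strg (ssw xs ys) = ys @ xs"
 "sar (side xs) \<longleftrightarrow> obs xs"
 "sar (scp g f) \<longleftrightarrow> sar g \<and> sar f \<and> strg f = ssrc g"
 "sar (sts f g) \<longleftrightarrow> sar f \<and> sar g" "sar (ssw xs ys) \<longleftrightarrow> obs xs \<and> obs ys"
 by (auto simp: side_def sar_scp sar_sts sar_ssw intro: Id_Hom Jo_Ob) (simp_all add: ssw_def)

lemma s_cp [simp]: "[|sar g; sar f; strg f = ssrc g|] ==> ssrc (scp g f) = ssrc f"
 "[|sar g; sar f; strg f = ssrc g|] ==> strg (scp g f) = strg g"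
 "[|sar g; sar f; strg f = ssrc g|] ==> sm (scp g f) = sm g oo sm f"
 by (auto simp: scp_def)

lemma s_ts [simp]: "[|sar f; sar g|] ==> ssrc (sts f g) = ssrc f @ ssrc g"
 "[|sar f; sar g|] ==> strg (sts f g) = strg f @ strg g"
 by (auto simp: sts_def)

lemma sm_Hom: "[|sar f; ssrc f = xs; strg f = ys|] ==> sm f \<in> Hom C (Jo xs) (Jo ys)"
 using sarD by blast

lemma scp_None: "\<not> (sar g \<and> sar f \<and> strg f = ssrc g) ==> scp g f = None"
 by (auto simp: scp_def)

lemma sts_None: "\<not> (sar g \<and> sar f) ==> sts g f = None"
 by (auto simp: sts_def)

lemma scp_assoc: "scp (scp h g) f = scp h (scp g f)"
proof (cases "sar h \<and> sar g \<and> sar f \<and> strg g = ssrc h \<and> strg f = ssrc g")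
 case True
 hence "(sm h oo sm g) oo sm f = sm h oo (sm g oo sm f)"
  by (intro Comp_assoc[OF sarD(3)[of f] sm_Hom[of g "strg f" "strg g"] sm_Hom[of h]]) auto
 with True show ?thesis by (intro s_eqI) auto
next
 case False
 have "scp (scp h g) f = None" by (rule scp_None) (use False in auto)
 moreover have "scp h (scp g f) = None" by (rule scp_None) (use False in auto)
 ultimately show ?thesis by simp
qed

lemma sts_assoc: "sts (sts f g) h = sts f (sts g h)"
proof (cases "sar f \<and> sar g \<and> sar h")
 case True
 hence F: "sar f" and G: "sar g" and H: "sar h" by auto
 let ?f = "sm f" and ?g = "sm g" and ?h = "sm h"
 define a a' b b' c c' where "a = ssrc f" and "a' = strg f" and "b = ssrc g" and "b' = strg g"
  and "c = ssrc h" and "c' = strg h"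
 note D = a_def a'_def b_def b'_def c_def c'_def
 have o1: "obs a" "obs a'" "obs b" "obs b'" "obs c" "obs c'" using F G H sarD by (auto simp: D)
 hence o2: "obs (a @ b)" "obs (a' @ b')" "obs (b @ c)" "obs (b' @ c')" by auto
 have fh: "?f \<in> Hom C (Jo a) (Jo a')" "?g \<in> Hom C (Jo b) (Jo b')" "?h \<in> Hom C (Jo c) (Jo c')"
  using F G H sarD by (auto simp: D)
 have fg: "sm (sts f g) \<in> Hom C (Jo (a @ b)) (Jo (a' @ b'))"
  "sm (sts g h) \<in> Hom C (Jo (b @ c)) (Jo (b' @ c'))"
  by (rule sm_Hom; use F G H in \<open>simp add: D\<close>)+
 have l: "sm (sts (sts f g) h) \<in> Hom C (Jo ((a @ b) @ c)) (Jo ((a' @ b') @ c'))"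
  "sm (sts f (sts g h)) \<in> Hom C (Jo ((a @ b) @ c)) (Jo ((a' @ b') @ c'))"
  by (rule sm_Hom; use F G H in \<open>simp add: D\<close>)+
 have e: "sm (sts (sts f g) h) oo mu (a @ b) c = mu (a' @ b') c' oo (sm (sts f g) ## ?h)"
  "sm (sts f (sts g h)) oo mu a (b @ c) = mu a' (b' @ c') oo (?f ## sm (sts g h))"
  "sm (sts f g) oo mu a b = mu a' b' oo (?f ## ?g)"
  "sm (sts g h) oo mu b c = mu b' c' oo (?g ## ?h)"
  using sm_sts[of "sts f g" h] sm_sts[of f "sts g h"] sm_sts[of f g] sm_sts[of g h] F G H
  by (auto simp: D)
 note t = ty mu_Hom o1 o2 fh fg Jo_Ob l l[unfolded append_assoc] mu_Hom[of "a @ b" c, unfolded append_assoc]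
  mu_Hom[of "a' @ b'" c', unfolded append_assoc]
 let ?A = "assoc C (Jo a) (Jo b) (Jo c)" and ?A' = "assoc C (Jo a') (Jo b') (Jo c')"
 let ?M = "mu (a @ b) c oo (mu a b ## Id C (Jo c))"
 let ?N = "mu a' (b' @ c') oo ((Id C (Jo a') ## mu b' c') oo (?A' oo ((?f ## ?g) ## ?h)))"
 have "sm (sts (sts f g) h) oo ?M = mu (a' @ b') c' oo ((sm (sts f g) ## ?h) oo (mu a b ## Id C (Jo c)))"
  by (rule comp_rw[OF e(1)]) (rule t)+
 also have "(sm (sts f g) ## ?h) oo (mu a b ## Id C (Jo c)) = (sm (sts f g) oo mu a b) ## (?h oo Id C (Jo c))"
  by (rule tensor_Comp[symmetric]) (rule t)+
 also have "\<dots> = (mu a' b' oo (?f ## ?g)) ## (Id C (Jo c') oo ?h)"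
  by (simp only: e Comp_Id[OF fh(3)] Id_Comp[OF fh(3)])
 also have "\<dots> = (mu a' b' ## Id C (Jo c')) oo ((?f ## ?g) ## ?h)"
  by (rule tensor_Comp) (rule t)+
 also have "mu (a' @ b') c' oo \<dots> = (mu (a' @ b') c' oo (mu a' b' ## Id C (Jo c'))) oo ((?f ## ?g) ## ?h)"
  by (rule Comp_assoc[symmetric]) (rule t)+
 also have "\<dots> = (mu a' (b' @ c') oo ((Id C (Jo a') ## mu b' c') oo ?A')) oo ((?f ## ?g) ## ?h)"
  by (simp only: mu_assoc[OF o1(2,4,6)])
 also have "\<dots> = mu a' (b' @ c') oo (((Id C (Jo a') ## mu b' c') oo ?A') oo ((?f ## ?g) ## ?h))"
  by (rule Comp_assoc) (rule t)+
 also have "((Id C (Jo a') ## mu b' c') oo ?A') oo ((?f ## ?g) ## ?h)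
   = (Id C (Jo a') ## mu b' c') oo (?A' oo ((?f ## ?g) ## ?h))"
  by (rule Comp_assoc) (rule t)+
 finally have 1: "sm (sts (sts f g) h) oo ?M = ?N" .
 have "sm (sts f (sts g h)) oo ?M
   = sm (sts f (sts g h)) oo (mu a (b @ c) oo ((Id C (Jo a) ## mu b c) oo ?A))"
  by (simp only: mu_assoc[OF o1(1,3,5)])
 also have "\<dots> = mu a' (b' @ c') oo ((?f ## sm (sts g h)) oo ((Id C (Jo a) ## mu b c) oo ?A))"
  by (rule comp_rw[OF e(2)]) (rule t)+
 also have "(?f ## sm (sts g h)) oo ((Id C (Jo a) ## mu b c) oo ?A)
   = ((?f oo Id C (Jo a)) ## (sm (sts g h) oo mu b c)) oo ?A"
  by (rule comp_rw1[OF tensor_Comp[symmetric]]) (rule t)+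
 also have "(?f oo Id C (Jo a)) ## (sm (sts g h) oo mu b c) = (Id C (Jo a') oo ?f) ## (mu b' c' oo (?g ## ?h))"
  by (simp only: e Comp_Id[OF fh(1)] Id_Comp[OF fh(1)])
 also have "\<dots> = (Id C (Jo a') ## mu b' c') oo (?f ## (?g ## ?h))"
  by (rule tensor_Comp) (rule t)+
 also have "\<dots> oo ?A = (Id C (Jo a') ## mu b' c') oo ((?f ## (?g ## ?h)) oo ?A)"
  by (rule Comp_assoc) (rule t)+
 also have "(?f ## (?g ## ?h)) oo ?A = ?A' oo ((?f ## ?g) ## ?h)"
  by (rule assoc_nat[symmetric]) (rule t)+
 finally have 2: "sm (sts f (sts g h)) oo ?M = ?N" .
 have c: "mu a b ## Id C (Jo c) \<in> Hom C ((Jo a \<odot> Jo b) \<odot> Jo c) (Jo (a @ b) \<odot> Jo c)"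
  "mu_inv a b ## Id C (Jo c) \<in> Hom C (Jo (a @ b) \<odot> Jo c) ((Jo a \<odot> Jo b) \<odot> Jo c)"
  by (rule t mu_inv_Hom)+
 have ci: "(mu a b ## Id C (Jo c)) oo (mu_inv a b ## Id C (Jo c)) = Id C (Jo (a @ b) \<odot> Jo c)"
  by (subst rwhisk[symmetric], (rule t mu_inv_Hom)+, subst mu_mu_inv, (rule t)+, rule tensor_Id) (rule t)+
 have k: "sm (sts (sts f g) h) oo mu (a @ b) c \<in> Hom C (Jo (a @ b) \<odot> Jo c) (Jo ((a' @ b') @ c'))"
  "sm (sts f (sts g h)) oo mu (a @ b) c \<in> Hom C (Jo (a @ b) \<odot> Jo c) (Jo ((a' @ b') @ c'))"
  by (rule Comp_Hom[OF mu_Hom[OF o2(1) o1(5)] l(1)] Comp_Hom[OF mu_Hom[OF o2(1) o1(5)] l(2)])+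
 have "sm (sts (sts f g) h) oo mu (a @ b) c = sm (sts f (sts g h)) oo mu (a @ b) c"
  by (rule iso_cancel_right[OF c ci k])
    (simp only: Comp_assoc[OF c(1) mu_Hom[OF o2(1) o1(5)] l(1)]
     Comp_assoc[OF c(1) mu_Hom[OF o2(1) o1(5)] l(2)] 1 2)
 hence "sm (sts (sts f g) h) = sm (sts f (sts g h))"
  by (rule mu_cancel[OF o2(1) o1(5) l])
 thus ?thesis using F G H by (intro s_eqI) auto
next
 case False
 have "sts (sts f g) h = None" by (rule sts_None) (use False in auto)
 moreover have "sts f (sts g h) = None" by (rule sts_None) (use False in auto)
 ultimately show ?thesis by simp
qed

lemma sw_sw_strict: 
 assumes "obs xs" "obs ys" shows "scp (ssw ys xs) (ssw xs ys) = side (xs @ ys)"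
proof -
 let ?s = "symm C (Jo xs) (Jo ys)" and ?s' = "symm C (Jo ys) (Jo xs)"
 note t = ty mu_Hom ssw_Hom Jo_Ob assms
 have o: "obs (xs @ ys)" using assms by simp
 have "(sm (ssw ys xs) oo sm (ssw xs ys)) oo mu xs ys = sm (ssw ys xs) oo (sm (ssw xs ys) oo mu xs ys)"
  by (rule Comp_assoc) (rule t)+
 also have "\<dots> = sm (ssw ys xs) oo (mu ys xs oo ?s)" by (simp only: sm_ssw[OF assms])
 also have "\<dots> = mu xs ys oo (?s' oo ?s)"
  by (rule comp_rw[OF sm_ssw]) (rule t)+
 also have "?s' oo ?s = Id C (Jo xs \<odot> Jo ys)" by (rule symm_symm) (rule t)+
 also have "mu xs ys oo \<dots> = mu xs ys" by (rule Comp_Id) (rule t)+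
 also have "\<dots> = Id C (Jo (xs @ ys)) oo mu xs ys" by (rule Id_Comp[symmetric]) (rule t)+
 finally have "sm (ssw ys xs) oo sm (ssw xs ys) = Id C (Jo (xs @ ys))"
  by (rule mu_cancel[rotated -1]) (rule t o)+
 thus ?thesis using assms by (intro s_eqI) auto
qed

lemma sw_nat_strict:
 assumes f: "sar f" and g: "sar g"
 shows "scp (ssw (strg f) (strg g)) (sts f g) = scp (sts g f) (ssw (ssrc f) (ssrc g))"
proof -
 define a a' b b' where "a = ssrc f" and "a' = strg f" and "b = ssrc g" and "b' = strg g"
 note D = a_def a'_def b_def b'_def
 have o: "obs a" "obs a'" "obs b" "obs b'" "obs (a @ b)" "obs (b' @ a')" using f g sarD by (auto simp: D)
 have fh: "sm f \<in> Hom C (Jo a) (Jo a')" "sm g \<in> Hom C (Jo b) (Jo b')" using f g sarD by (auto simp: D)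
 have fg: "sm (sts f g) \<in> Hom C (Jo (a @ b)) (Jo (a' @ b'))"
  "sm (sts g f) \<in> Hom C (Jo (b @ a)) (Jo (b' @ a'))"
  by (rule sm_Hom; use f g in \<open>simp add: D\<close>)+
 have e: "sm (sts f g) oo mu a b = mu a' b' oo (sm f ## sm g)"
  "sm (sts g f) oo mu b a = mu b' a' oo (sm g ## sm f)"
  using sm_sts[of f g] sm_sts[of g f] f g by (auto simp: D)
 note t = ty mu_Hom o fh fg Jo_Ob ssw_Hom
 have "(sm (ssw a' b') oo sm (sts f g)) oo mu a b = sm (ssw a' b') oo (sm (sts f g) oo mu a b)"
  by (rule Comp_assoc) (rule t)+
 also have "\<dots> = sm (ssw a' b') oo (mu a' b' oo (sm f ## sm g))" by (simp only: e)
 also have "\<dots> = mu b' a' oo (symm C (Jo a') (Jo b') oo (sm f ## sm g))"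
  by (rule comp_rw[OF sm_ssw]) (rule t)+
 also have "symm C (Jo a') (Jo b') oo (sm f ## sm g) = (sm g ## sm f) oo symm C (Jo a) (Jo b)"
  by (rule symm_nat) (rule t)+
 finally have 1: "(sm (ssw a' b') oo sm (sts f g)) oo mu a b
   = mu b' a' oo ((sm g ## sm f) oo symm C (Jo a) (Jo b))" .
 have "(sm (sts g f) oo sm (ssw a b)) oo mu a b = sm (sts g f) oo (sm (ssw a b) oo mu a b)"
  by (rule Comp_assoc) (rule t)+
 also have "\<dots> = sm (sts g f) oo (mu b a oo symm C (Jo a) (Jo b))" by (simp only: sm_ssw[OF o(1,3)])
 also have "\<dots> = mu b' a' oo ((sm g ## sm f) oo symm C (Jo a) (Jo b))"
  by (rule comp_rw[OF e(2)]) (rule t)+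
 finally have "(sm (sts g f) oo sm (ssw a b)) oo mu a b
   = mu b' a' oo ((sm g ## sm f) oo symm C (Jo a) (Jo b))" .
 with 1 have "(sm (ssw a' b') oo sm (sts f g)) oo mu a b = (sm (sts g f) oo sm (ssw a b)) oo mu a b" by simp
 hence "sm (ssw a' b') oo sm (sts f g) = sm (sts g f) oo sm (ssw a b)"
  by (rule mu_cancel[rotated -1]) (rule t)+
 thus ?thesis using f g sarD by (intro s_eqI) (auto simp: D)
qed

lemma sw_hex_strict:
 assumes o1: "obs xs" "obs ys" "obs zs"
 shows "ssw xs (ys @ zs) = scp (sts (side ys) (ssw xs zs)) (sts (ssw xs ys) (side zs))"
proof -
 let ?x = "Jo xs" and ?y = "Jo ys" and ?z = "Jo zs"
 let ?S = "sm (sts (ssw xs ys) (side zs))" and ?T = "sm (sts (side ys) (ssw xs zs))"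
 have o2: "obs (xs @ ys)" "obs (ys @ xs)" "obs (ys @ zs)" "obs (zs @ xs)" "obs (xs @ zs)" using o1 by auto
 have ST: "?S \<in> Hom C (Jo ((xs @ ys) @ zs)) (Jo ((ys @ xs) @ zs))"
  "?T \<in> Hom C (Jo ((ys @ xs) @ zs)) (Jo ((ys @ zs) @ xs))"
  "sm (ssw xs (ys @ zs)) \<in> Hom C (Jo ((xs @ ys) @ zs)) (Jo ((ys @ zs) @ xs))"
  by (rule sm_Hom; use o1 in \<open>simp\<close>)+
 have e: "?S oo mu (xs @ ys) zs = mu (ys @ xs) zs oo (sm (ssw xs ys) ## Id C ?z)"
  "?T oo mu ys (xs @ zs) = mu ys (zs @ xs) oo (Id C ?y ## sm (ssw xs zs))"
  using sm_sts[of "ssw xs ys" "side zs"] sm_sts[of "side ys" "ssw xs zs"] o1 by auto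
 note mh = mu_Hom[OF o2(1) o1(3)] mu_Hom[OF o2(2) o1(3)] mu_Hom[OF o2(3) o1(1)]
   mu_Hom[OF o1(2) o2(4)] mu_Hom[OF o1(2) o2(5)]  mu_Hom[OF o1(1) o2(3)]
 note t = ty mh mh[unfolded append_assoc] mu_Hom[OF o1(1,2)] mu_Hom[OF o1(1,3)] mu_Hom[OF o1(2,1)]
   mu_Hom[OF o1(2,3)] mu_Hom[OF o1(3,1)] o1 o2 ST[unfolded append_assoc] ST Jo_Ob ssw_Hom[OF o1(1,2)] ssw_Hom[OF o1(1,3)]
   ssw_Hom[OF o1(1) o2(3)] ssw_Hom[OF o1(1) o2(3), unfolded append_assoc]
 let ?A = "assoc C ?x ?y ?z"
 let ?M = "mu (xs @ ys) zs oo (mu xs ys ## Id C ?z)"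
 let ?R = "mu (ys @ zs) xs oo ((mu ys zs ## Id C ?x) oo (symm C ?x (?y \<odot> ?z) oo ?A))"
 have "sm (ssw xs (ys @ zs)) oo ?M = sm (ssw xs (ys @ zs)) oo (mu xs (ys @ zs) oo ((Id C ?x ## mu ys zs) oo ?A))"
  by (simp only: mu_assoc[OF o1])
 also have "\<dots> = mu (ys @ zs) xs oo (symm C ?x (Jo (ys @ zs)) oo ((Id C ?x ## mu ys zs) oo ?A))"
  by (rule comp_rw[OF sm_ssw]) (rule t)+
 also have "symm C ?x (Jo (ys @ zs)) oo ((Id C ?x ## mu ys zs) oo ?A)
   = (mu ys zs ## Id C ?x) oo (symm C ?x (?y \<odot> ?z) oo ?A)"
  by (rule comp_rw[OF symm_nat]) (rule t)+
 finally have 1: "sm (ssw xs (ys @ zs)) oo ?M = ?R" .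
 have s2: "?S oo ?M = mu ys (xs @ zs) oo ((Id C ?y ## mu xs zs) oo (assoc C ?y ?x ?z oo (symm C ?x ?y ## Id C ?z)))"
 proof -
  have "?S oo ?M = mu (ys @ xs) zs oo ((sm (ssw xs ys) ## Id C ?z) oo (mu xs ys ## Id C ?z))"
   by (rule comp_rw[OF e(1)]) (rule t)+
  also have "(sm (ssw xs ys) ## Id C ?z) oo (mu xs ys ## Id C ?z) = (sm (ssw xs ys) oo mu xs ys) ## Id C ?z"
   by (rule rwhisk[symmetric]) (rule t)+
  also have "\<dots> = (mu ys xs oo symm C ?x ?y) ## Id C ?z" by (simp only: sm_ssw[OF o1(1,2)])
  also have "\<dots> = (mu ys xs ## Id C ?z) oo (symm C ?x ?y ## Id C ?z)" by (rule rwhisk) (rule t)+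
  also have "mu (ys @ xs) zs oo \<dots> = (mu (ys @ xs) zs oo (mu ys xs ## Id C ?z)) oo (symm C ?x ?y ## Id C ?z)"
   by (rule Comp_assoc[symmetric]) (rule t)+
  also have "\<dots> = (mu ys (xs @ zs) oo ((Id C ?y ## mu xs zs) oo assoc C ?y ?x ?z)) oo (symm C ?x ?y ## Id C ?z)"
   by (simp only: mu_assoc[OF o1(2,1,3)])
  also have "\<dots> = mu ys (xs @ zs) oo (((Id C ?y ## mu xs zs) oo assoc C ?y ?x ?z) oo (symm C ?x ?y ## Id C ?z))"
   by (rule Comp_assoc) (rule t)+
  also have "((Id C ?y ## mu xs zs) oo assoc C ?y ?x ?z) oo (symm C ?x ?y ## Id C ?z)
    = (Id C ?y ## mu xs zs) oo (assoc C ?y ?x ?z oo (symm C ?x ?y ## Id C ?z))"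
   by (rule Comp_assoc) (rule t)+
  finally show ?thesis .
 qed
 have "(?T oo ?S) oo ?M = ?T oo (?S oo ?M)"
  by (rule Comp_assoc) (rule t)+
 also have "\<dots> = ?T oo (mu ys (xs @ zs) oo ((Id C ?y ## mu xs zs) oo (assoc C ?y ?x ?z oo (symm C ?x ?y ## Id C ?z))))"
  by (simp only: s2)
 also have "\<dots> = mu ys (zs @ xs) oo ((Id C ?y ## sm (ssw xs zs)) oo ((Id C ?y ## mu xs zs) oo (assoc C ?y ?x ?z oo (symm C ?x ?y ## Id C ?z))))"
  by (rule comp_rw[OF e(2)]) (rule t)+
 also have "(Id C ?y ## sm (ssw xs zs)) oo ((Id C ?y ## mu xs zs) oo (assoc C ?y ?x ?z oo (symm C ?x ?y ## Id C ?z)))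
   = (Id C ?y ## (sm (ssw xs zs) oo mu xs zs)) oo (assoc C ?y ?x ?z oo (symm C ?x ?y ## Id C ?z))"
  by (rule comp_rw1[OF lwhisk[symmetric]]) (rule t)+
 also have "Id C ?y ## (sm (ssw xs zs) oo mu xs zs) = (Id C ?y ## mu zs xs) oo (Id C ?y ## symm C ?x ?z)"
  unfolding sm_ssw[OF o1(1,3)] by (rule lwhisk) (rule t)+
 also have "((Id C ?y ## mu zs xs) oo (Id C ?y ## symm C ?x ?z)) oo (assoc C ?y ?x ?z oo (symm C ?x ?y ## Id C ?z))
   = (Id C ?y ## mu zs xs) oo ((Id C ?y ## symm C ?x ?z) oo (assoc C ?y ?x ?z oo (symm C ?x ?y ## Id C ?z)))"
  by (rule Comp_assoc) (rule t)+
 also have "(Id C ?y ## symm C ?x ?z) oo (assoc C ?y ?x ?z oo (symm C ?x ?y ## Id C ?z))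
   = assoc C ?y ?z ?x oo (symm C ?x (?y \<odot> ?z) oo ?A)"
  by (rule hexagon[symmetric]) (rule t)+
 also have "mu ys (zs @ xs) oo ((Id C ?y ## mu zs xs) oo (assoc C ?y ?z ?x oo (symm C ?x (?y \<odot> ?z) oo ?A)))
   = mu ys (zs @ xs) oo (((Id C ?y ## mu zs xs) oo assoc C ?y ?z ?x) oo (symm C ?x (?y \<odot> ?z) oo ?A))"
  by (rule arg_cong[of _ _ "\<lambda>u. mu ys (zs @ xs) oo u"], rule Comp_assoc[symmetric]) (rule t)+
 also have "\<dots> = (mu ys (zs @ xs) oo ((Id C ?y ## mu zs xs) oo assoc C ?y ?z ?x)) oo (symm C ?x (?y \<odot> ?z) oo ?A)"
  by (rule Comp_assoc[symmetric]) (rule t)+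
 also have "\<dots> = (mu (ys @ zs) xs oo (mu ys zs ## Id C ?x)) oo (symm C ?x (?y \<odot> ?z) oo ?A)"
  by (simp only: mu_assoc[OF o1(2,3,1)])
 also have "\<dots> = ?R"
  by (rule Comp_assoc) (rule t)+
 finally have 2: "(?T oo ?S) oo ?M = ?R" .
 have c: "mu xs ys ## Id C ?z \<in> Hom C ((?x \<odot> ?y) \<odot> ?z) (Jo (xs @ ys) \<odot> ?z)"
  "mu_inv xs ys ## Id C ?z \<in> Hom C (Jo (xs @ ys) \<odot> ?z) ((?x \<odot> ?y) \<odot> ?z)"
  by (rule t mu_inv_Hom)+
 have ci: "(mu xs ys ## Id C ?z) oo (mu_inv xs ys ## Id C ?z) = Id C (Jo (xs @ ys) \<odot> ?z)"
  by (subst rwhisk[symmetric], (rule t mu_inv_Hom)+, subst mu_mu_inv, (rule t)+, rule tensor_Id) (rule t)+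
 note l = ST(3) Comp_Hom[OF ST(1,2)]
 note m = mu_Hom[OF o2(1) o1(3)]
 have "sm (ssw xs (ys @ zs)) oo mu (xs @ ys) zs = (?T oo ?S) oo mu (xs @ ys) zs"
  by (rule iso_cancel_right[OF c ci Comp_Hom[OF m l(1)] Comp_Hom[OF m l(2)]])
    (simp only: Comp_assoc[OF c(1) m l(1)] Comp_assoc[OF c(1) m l(2)] 1 2)
 hence "sm (ssw xs (ys @ zs)) = ?T oo ?S"
  by (rule mu_cancel[OF o2(1) o1(3) l])
 thus ?thesis using o1 by (intro s_eqI) auto
qed

lemma interchange_strict:
 assumes "sar (scp g f)" "sar (scp g' f')"
 shows "sts (scp g f) (scp g' f') = scp (sts g g') (sts f f')"
proof -
 have s: "sar g" "sar f" "strg f = ssrc g" "sar g'" "sar f'" "strg f' = ssrc g'" using assms by auto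
 define a b c a' b' c' where "a = ssrc f" "b = ssrc g" "c = strg g" "a' = ssrc f'" "b' = ssrc g'" "c' = strg g'"
 note D = this
 have o: "obs a" "obs b" "obs c" "obs a'" "obs b'" "obs c'" using s sarD by (auto simp: D)
 have h: "sm f \<in> Hom C (Jo a) (Jo b)" "sm g \<in> Hom C (Jo b) (Jo c)" "sm f' \<in> Hom C (Jo a') (Jo b')"
  "sm g' \<in> Hom C (Jo b') (Jo c')" using s sm_Hom by (auto simp: D)
 have k: "sm (sts f f') \<in> Hom C (Jo (a @ a')) (Jo (b @ b'))" "sm (sts g g') \<in> Hom C (Jo (b @ b')) (Jo (c @ c'))"
  "sm (sts (scp g f) (scp g' f')) \<in> Hom C (Jo (a @ a')) (Jo (c @ c'))"
  by (rule sm_Hom; use s in \<open>simp add: D\<close>)+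
 have e: "sm (sts f f') oo mu a a' = mu b b' oo (sm f ## sm f')"
  "sm (sts g g') oo mu b b' = mu c c' oo (sm g ## sm g')"
  "sm (sts (scp g f) (scp g' f')) oo mu a a' = mu c c' oo ((sm g oo sm f) ## (sm g' oo sm f'))"
  using sm_sts[of f f'] sm_sts[of g g'] sm_sts[of "scp g f" "scp g' f'"] s by (auto simp: D)
 note t = ty mu_Hom o h k Jo_Ob
 have "(sm (sts g g') oo sm (sts f f')) oo mu a a' = sm (sts g g') oo (sm (sts f f') oo mu a a')"
  by (rule Comp_assoc) (rule t)+
 also have "\<dots> = sm (sts g g') oo (mu b b' oo (sm f ## sm f'))" by (simp only: e)
 also have "\<dots> = mu c c' oo ((sm g ## sm g') oo (sm f ## sm f'))"
  by (rule comp_rw[OF e(2)]) (rule t)+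
 also have "(sm g ## sm g') oo (sm f ## sm f') = (sm g oo sm f) ## (sm g' oo sm f')"
  by (rule tensor_Comp[symmetric]) (rule t)+
 finally have "sm (sts (scp g f) (scp g' f')) oo mu a a' = (sm (sts g g') oo sm (sts f f')) oo mu a a'"
  using e(3) by simp
 hence "sm (sts (scp g f) (scp g' f')) = sm (sts g g') oo sm (sts f f')"
  by (rule mu_cancel[rotated -1]) (rule t)+
 thus ?thesis using s by (intro s_eqI) auto
qed

lemma unit_strict:
 assumes f: "sar f" shows "sts (side []) f = f" "sts f (side []) = f"
proof -
 have o: "obs (ssrc f)" "obs (strg f)" "obs []" using f sarD by auto
 have h: "sm f \<in> Hom C (Jo (ssrc f)) (Jo (strg f))" using f sarD by auto
 have "sm (sts (side []) f) oo mu [] (ssrc f) = mu [] (strg f) oo (Id C \<I> ## sm f)"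
  using sm_sts[of "side []" f] f by simp
 also have "\<dots> = sm f oo mu [] (ssrc f)" using lunit_nat[OF h] by simp
 finally have "sm (sts (side []) f) = sm f"
  by (rule mu_cancel[OF o(3,1), rotated -1]) (rule sm_Hom; use f in simp)+
 thus "sts (side []) f = f" using f by (intro s_eqI) auto
 have "sm (sts f (side [])) oo mu (ssrc f) [] = mu (strg f) [] oo (sm f ## Id C \<I>)"
  using sm_sts[of f "side []"] f by simp
 also have "\<dots> = sm f oo mu (ssrc f) []" using runit_nat[OF h] o by (simp add: mu_Nil_right)
 finally have "sm (sts f (side [])) = sm f"
  by (rule mu_cancel[OF o(1,3), rotated -1]) (rule sm_Hom; use f in simp)+
 thus "sts f (side []) = f" using f by (intro s_eqI) auto
qed

lemma ide_strict:
 assumes "obs xs" "obs ys" shows "sts (side xs) (side ys) = side (xs @ ys)"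
proof -
 note t = ty mu_Hom Jo_Ob assms
 have "sm (sts (side xs) (side ys)) oo mu xs ys = mu xs ys oo (Id C (Jo xs) ## Id C (Jo ys))"
  using sm_sts[of "side xs" "side ys"] assms by simp
 also have "Id C (Jo xs) ## Id C (Jo ys) = Id C (Jo xs \<odot> Jo ys)" by (rule tensor_Id) (rule t)+
 also have "mu xs ys oo \<dots> = mu xs ys" by (rule Comp_Id) (rule t)+
 also have "\<dots> = Id C (Jo (xs @ ys)) oo mu xs ys" by (rule Id_Comp[symmetric]) (rule t)+
 finally have e: "sm (sts (side xs) (side ys)) oo mu xs ys = Id C (Jo (xs @ ys)) oo mu xs ys" .
 have o: "obs (xs @ ys)" using assms by simp
 have "sm (sts (side xs) (side ys)) \<in> Hom C (Jo (xs @ ys)) (Jo (xs @ ys))"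
  by (rule sm_Hom) (use assms in simp_all)
 from mu_cancel[OF assms this Id_Hom[OF Jo_Ob[OF o]] e]
 have "sm (sts (side xs) (side ys)) = Id C (Jo (xs @ ys))" .
 thus ?thesis using assms by (intro s_eqI) auto
qed

text \<open>
 Every axiom reduces to an identity about the joining isomorphisms: associativity of the tensor product to \<open>mu_assoc\<close>, the hexagon to that of the given category.
\<close>

theorem strictification: "ssmc (Ob C) sar ssrc strg scp sts side ssw"
proof -
 have "scp f (side xs) = f" if "sar f" "ssrc f = xs" for f xs
  using Comp_Id[OF sarD(3)[of f]] sarD[of f] that by (intro s_eqI) auto
 moreover have "scp (side xs) f = f" if "sar f" "strg f = xs" for f xs
  using Id_Comp[OF sarD(3)[of f]] sarD[of f] that by (intro s_eqI) auto
 ultimately show ?thesis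
  by unfold_locales (auto simp: scp_assoc sts_assoc unit_strict ide_strict interchange_strict
    sw_sw_strict sw_nat_strict sw_hex_strict simp del: set_append dest: sarD)
qed

end

context ssmc begin

abbreviation obs :: "'o list => bool" where "obs xs \<equiv> set xs \<subseteq> At"
abbreviation hom :: "'a => 'o list => 'o list => bool" where
 "hom f xs ys \<equiv> ar f \<and> src f = xs \<and> trg f = ys"

declare ar_cp [simp] src_cp [simp] trg_cp [simp] cp_assoc [simp] ar_ide [simp] src_ide [simp]
 trg_ide [simp] cp_ide [simp] ide_cp [simp] ar_ts [simp] src_ts [simp] trg_ts [simp]
 ts_assoc [simp] ide_ts [simp] ts_ide [simp] ar_sw [simp] src_sw [simp] trg_sw [simp] sw_sw [simp]

lemma ide_app: "obs xs ==> obs ys ==> ide (xs @ ys) = ide xs || ide ys"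
 by (simp add: ide_ide)

lemma ic: "[|ar g; ar f; trg f = src g; ar g'; ar f'; trg f' = src g'|]
  ==> (g || g') ** (f || f') = (g ** f) || (g' ** f')"
 by (simp add: interchange)

lemma ic_r: "[|ar g; ar f; trg f = src g; ar g'; ar f'; trg f' = src g'|]
  ==> (g || g') ** (f || f') ** k = ((g ** f) || (g' ** f')) ** k"
 by (simp add: interchange)

lemma cp_ide2: "[|ar f; src f = xs @ ys; obs xs; obs ys|] ==> f ** (ide xs || ide ys) = f"
 and ide2_cp: "[|ar f; trg f = xs @ ys; obs xs; obs ys|] ==> (ide xs || ide ys) ** f = f"
 by (simp_all add: ide_ide)

lemma cp_ide3: "[|ar f; src f = xs @ ys @ zs; obs xs; obs ys; obs zs|] ==> f ** (ide xs || ide ys || ide zs) = f"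
 and ide3_cp: "[|ar f; trg f = xs @ ys @ zs; obs xs; obs ys; obs zs|] ==> (ide xs || ide ys || ide zs) ** f = f"
 by (simp_all add: ide_ide)

lemma sw_sw_r: "[|obs xs; obs ys; ar f; trg f = xs @ ys|] ==> sw ys xs ** sw xs ys ** f = f"
 by (subst cp_assoc[symmetric]) (simp del: cp_assoc)

lemma sw_Nil_right: assumes "obs xs" shows "sw xs [] = ide xs"
proof -
 have "(ide [] || sw xs []) ** (sw xs [] || ide []) = sw xs ([] @ [])"
  by (rule sw_hex[symmetric]) (use assms in simp_all)
 hence "sw xs [] ** sw xs [] = sw xs []" using assms by simp
 hence "sw [] xs ** sw xs [] ** sw xs [] = sw [] xs ** sw xs []" by simp
 thus ?thesis using assms by (simp add: sw_sw_r)
qed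

lemma sw_Nil_left: "obs xs ==> sw [] xs = ide xs"
 using sw_sw[of xs "[]"] by (simp add: sw_Nil_right)

lemma sw_hex2: assumes [simp]: "obs xs" "obs ys" "obs zs"
 shows "sw (xs @ ys) zs = (sw xs zs || ide ys) ** (ide xs || sw ys zs)"
proof -
 let ?r = "(sw xs zs || ide ys) ** (ide xs || sw ys zs)"
 have "sw zs (xs @ ys) ** ?r = (ide xs || sw zs ys) ** ((sw zs xs ** sw xs zs) || (ide ys ** ide ys)) ** (ide xs || sw ys zs)"
  by (subst interchange) (simp_all add: sw_hex)
 also have "\<dots> = (ide xs || sw zs ys) ** (ide xs || sw ys zs)"
  by (simp add: ide_ide)
 also have "\<dots> = ide (xs @ ys @ zs)" by (subst ic) (simp_all add: ide_ide)
 finally have "sw (xs @ ys) zs ** sw zs (xs @ ys) ** ?r = sw (xs @ ys) zs ** ide (xs @ ys @ zs)"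
  by simp
 thus ?thesis by (subst (asm) sw_sw_r) simp_all
qed

lemma sw_nat1: "[|ar f; src f = xs; trg f = ys; obs zs|] ==> sw ys zs ** (f || ide zs) = (ide zs || f) ** sw xs zs"
 by (drule sw_nat[of f "ide zs"]) simp_all

lemma sw_nat2: "[|ar f; src f = xs; trg f = ys; obs zs|] ==> sw zs ys ** (ide zs || f) = (f || ide zs) ** sw zs xs"
 by (frule sw_nat[of "ide zs" f, rotated]) simp_all

section \<open>Cocommutative comonoids and pairing\<close>

text \<open>
 A cocommutative comonoid. Its arrows into an object are regarded as generalized elements of that object; the record is the one of bimonoids, of which only the comonoid part is used.
\<close>

definition cc :: "('o list, 'a) bimon => bool" where
 "cc D \<longleftrightarrow> obs (und D) \<and> hom (delta D) (und D) (und D @ und D) \<and> hom (eps D) (und D) [] \<and>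
   (delta D || ide (und D)) ** delta D = (ide (und D) || delta D) ** delta D \<and>
   (eps D || ide (und D)) ** delta D = ide (und D) \<and> sw (und D) (und D) ** delta D = delta D"

text \<open>
 Evaluation of two generalized elements on the same parameter.
\<close>

definition pair :: "('o list, 'a) bimon => 'a => 'a => 'a" where
 "pair D u v = (u || v) ** delta D"

abbreviation chom :: "('o list, 'a) bimon => ('o list, 'a) bimon => 'a => bool" where
 "chom D E f \<equiv> hom f (und D) (und E) \<and> delta E ** f = pair D f f \<and> eps E ** f = eps D"

text \<open>
 The tensor product of two comonoids, which is their categorical product among cocommutative comonoids.
\<close>

definition tb :: "('o list, 'a) bimon => ('o list, 'a) bimon => ('o list, 'a) bimon" where
 "tb D E = \<lparr>und = und D @ und E,
   nabla = (nabla D || nabla E) ** (ide (und D) || sw (und E) (und D) || ide (und E)),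
   eta = eta D || eta E,
   delta = (ide (und D) || sw (und D) (und E) || ide (und E)) ** (delta D || delta E),
   eps = eps D || eps E\<rparr>"

lemma ccD [simp]: assumes "cc D"
 shows "obs (und D)" "ar (delta D)" "src (delta D) = und D" "trg (delta D) = und D @ und D"
  "ar (eps D)" "src (eps D) = und D" "trg (eps D) = []"
  "(eps D || ide (und D)) ** delta D = ide (und D)" "sw (und D) (und D) ** delta D = delta D"
 using assms unfolding cc_def by blast+

lemma cc_coassoc: "cc D ==> (delta D || ide (und D)) ** delta D = (ide (und D) || delta D) ** delta D"
 unfolding cc_def by blast

abbreviation frm :: "('o list, 'a) bimon => 'a => bool" where "frm D u \<equiv> ar u \<and> src u = und D"

context
 fixes D assumes D [simp]: "cc D"
begin

lemma pair_ar [simp]: "ar u ==> ar v ==> src u = und D ==> src v = und D ==> ar (pair D u v)"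
 and pair_src [simp]: "ar u ==> ar v ==> src u = und D ==> src v = und D ==> src (pair D u v) = und D"
 and pair_trg [simp]: "ar u ==> ar v ==> src u = und D ==> src v = und D ==> trg (pair D u v) = trg u @ trg v"
 by (simp_all add: pair_def)

lemma pair_ts [simp]: "[|ar u; ar v; src u = und D; src v = und D; ar f; ar g; src f = trg u; src g = trg v|]
  ==> (f || g) ** pair D u v = pair D (f ** u) (g ** v)"
 by (simp add: pair_def ic_r)

lemma pair_assoc [simp]: assumes "frm D u" "frm D v" "frm D w"
 shows "pair D (pair D u v) w = pair D u (pair D v w)"
proof -
 have "pair D (pair D u v) w = ((u || v) || w) ** (delta D || ide (und D)) ** delta D"
  using assms by (subst ic_r) (simp_all add: pair_def)
 also have "\<dots> = (u || v || w) ** (ide (und D) || delta D) ** delta D" by (simp add: cc_coassoc)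
 also have "\<dots> = pair D u (pair D v w)"
  using assms by (subst ic_r) (simp_all add: pair_def)
 finally show ?thesis .
qed

lemma pair_ts2 [simp]: "[|frm D u; frm D v; frm D w; ar f; ar g; src f = trg u @ trg v; src g = trg w|]
  ==> (f || g) ** pair D u (pair D v w) = pair D (f ** pair D u v) (g ** w)"
 by (subst pair_assoc[symmetric]) (simp_all del: pair_assoc)

lemma pair_ts3 [simp]: "[|frm D u; frm D v; frm D w; frm D x; ar f; ar g; src f = trg u @ trg v @ trg w; src g = trg x|]
  ==> (f || g) ** pair D u (pair D v (pair D w x)) = pair D (f ** pair D u (pair D v w)) (g ** x)"
 by (subst (2) pair_assoc[symmetric], simp_all del: pair_assoc pair_ts2)
  (subst pair_assoc[symmetric], simp_all del: pair_assoc pair_ts2)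

lemma pair_sw [simp]: "[|frm D u; frm D v; trg u = xs; trg v = ys|] ==> sw xs ys ** pair D u v = pair D v u"
proof -
 assume a: "frm D u" "frm D v" "trg u = xs" "trg v = ys"
 have "sw xs ys ** pair D u v = (sw (trg u) (trg v) ** (u || v)) ** delta D"
  using a by (simp add: pair_def)
 also have "\<dots> = (v || u) ** sw (und D) (und D) ** delta D" using a by (subst sw_nat) simp_all
 finally show ?thesis by (simp add: pair_def)
qed

lemma pair_eps_left [simp]: "frm D u ==> pair D (eps D) u = u"
proof -
 assume a: "frm D u"
 have "pair D (eps D) u = (ide [] || u) ** (eps D || ide (und D)) ** delta D"
  using a unfolding pair_def by (subst ic_r) simp_all
 thus ?thesis using a by simp
qed

lemma pair_swap: "frm D u ==> frm D v ==> trg u = [] ==> pair D v u = pair D u v"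
 using pair_sw[of u v "[]" "trg v"] trg_obs[of v] by (simp add: sw_Nil_left)

lemma pair_eps_right [simp]: "frm D u ==> pair D u (eps D) = u"
 using pair_swap[of "eps D" u] by simp

lemma pair_comp: "[|cc X; chom X D h; frm D u; frm D v|] ==> pair D u v ** h = pair X (u ** h) (v ** h)"
 by (simp add: pair_def[of D]) (simp add: pair_def ic_r)

lemma delta_as_pair: "delta D = pair D (ide (und D)) (ide (und D))"
 by (simp add: pair_def ide_ide)

lemma chom_ide: "chom D D (ide (und D))"
 by (simp add: delta_as_pair[symmetric])

lemma chom_comp: "[|cc X; cc Y; chom X Y f; chom Y D g|] ==> chom X D (g ** f)"
 by (simp add: cp_assoc[symmetric] del: cp_assoc) (simp add: pair_def ic_r)

end

subsection \<open>Tensor products of comonoids\<close>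

lemma tb_sel [simp]: "und (tb D E) = und D @ und E" "eps (tb D E) = eps D || eps E" "eta (tb D E) = eta D || eta E"
 "nabla (tb D E) = (nabla D || nabla E) ** (ide (und D) || sw (und E) (und D) || ide (und E))"
 by (simp_all add: tb_def)

context
 fixes D E assumes D [simp]: "cc D" and E [simp]: "cc E"
begin

lemma delta_tb: "delta (tb D E) = (ide (und D) || sw (und D) (und E) || ide (und E)) ** (delta D || delta E)"
 by (simp add: tb_def)

lemma tb_counit: "((eps D || eps E) || (ide (und D) || ide (und E))) ** delta (tb D E) = ide (und D @ und E)"
proof -
 let ?a = "ide (und D)" and ?b = "ide (und E)"
 have "((eps D || eps E) || (?a || ?b)) ** (?a || sw (und D) (und E) || ?b)
  = eps D || ((eps E || ?a) ** sw (und D) (und E)) || ?b"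
  using ic[of "eps D" ?a "(eps E || ?a) || ?b" "sw (und D) (und E) || ?b"]
   ic[of "eps E || ?a" "sw (und D) (und E)" ?b ?b] by simp
 also have "(eps E || ?a) ** sw (und D) (und E) = ?a || eps E"
  using sw_nat2[of "eps E" "und E" "[]" "und D"] by (simp add: sw_Nil_right)
 finally have "((eps D || eps E) || (?a || ?b)) ** (?a || sw (und D) (und E) || ?b)
  = (eps D || ?a) || (eps E || ?b)" by simp
 hence "((eps D || eps E) || (?a || ?b)) ** delta (tb D E) = ((eps D || ?a) || (eps E || ?b)) ** (delta D || delta E)"
  unfolding delta_tb by (metis cp_assoc)
 also have "\<dots> = ((eps D || ?a) ** delta D) || ((eps E || ?b) ** delta E)" by (rule ic) simp_all
 finally show ?thesis by (simp add: ide_ide)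
qed

lemma tb_cocomm: "sw (und D @ und E) (und D @ und E) ** delta (tb D E) = delta (tb D E)"
proof -
 let ?a = "und D" and ?b = "und E"
 have "sw (?a @ ?b) (?a @ ?b) = (ide ?a || sw (?a @ ?b) ?b) ** (sw (?a @ ?b) ?a || ide ?b)"
  by (rule sw_hex) simp_all
 also have "\<dots> = (ide ?a || ((sw ?a ?b || ide ?b) ** (ide ?a || sw ?b ?b)))
   ** (((sw ?a ?a || ide ?b) ** (ide ?a || sw ?b ?a)) || ide ?b)"
  by (simp add: sw_hex2)
 finally have h: "sw (?a @ ?b) (?a @ ?b) = \<dots>" .
 have "\<dots> = (ide ?a || sw ?a ?b || ide ?b) ** (ide ?a || ide ?a || sw ?b ?b)
   ** (sw ?a ?a || ide ?b || ide ?b) ** (ide ?a || sw ?b ?a || ide ?b)"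
  using interchange[of "ide ?a" "ide ?a" "sw ?a ?b || ide ?b" "ide ?a || sw ?b ?b"]
   interchange[of "sw ?a ?a || ide ?b" "ide ?a || sw ?b ?a" "ide ?b" "ide ?b"] by simp
 also have "(ide ?a || ide ?a || sw ?b ?b) ** (sw ?a ?a || ide ?b || ide ?b) ** (ide ?a || sw ?b ?a || ide ?b)
   = (sw ?a ?a || sw ?b ?b) ** (ide ?a || sw ?b ?a || ide ?b)"
  using ic_r[of "ide ?a || ide ?a" "sw ?a ?a" "sw ?b ?b" "ide ?b || ide ?b"] by (simp add: cp_ide2 ide2_cp)
 finally have h': "sw (?a @ ?b) (?a @ ?b) = (ide ?a || sw ?a ?b || ide ?b) ** (sw ?a ?a || sw ?b ?b) ** (ide ?a || sw ?b ?a || ide ?b)"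
  using h by simp
 have "(ide ?a || sw ?b ?a || ide ?b) ** delta (tb D E) = delta D || delta E"
 proof -
  have "(sw ?b ?a || ide ?b) ** (sw ?a ?b || ide ?b) = (ide ?a || ide ?b) || ide ?b"
   by (subst ic) (simp_all add: ide_ide)
  hence "(ide ?a || sw ?b ?a || ide ?b) ** (ide ?a || sw ?a ?b || ide ?b) ** (delta D || delta E)
    = ((ide ?a || ide ?a) || (ide ?b || ide ?b)) ** (delta D || delta E)"
   by (subst ic_r) simp_all
  also have "\<dots> = delta D || delta E" by (subst ic) (simp_all add: ide2_cp)
  finally show ?thesis by (simp add: delta_tb)
 qed
 thus ?thesis unfolding h' by (simp add: ic delta_tb)
qed

lemma tb_coassoc:
 "(delta (tb D E) || (ide (und D) || ide (und E))) ** delta (tb D E)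
  = ((ide (und D) || ide (und E)) || delta (tb D E)) ** delta (tb D E)"
proof -
 let ?a = "und D" and ?b = "und E" and ?s = "sw (und D) (und E)"
 let ?A = "ide (und D)" and ?B = "ide (und E)"
 let ?S = "?A || ?s || ?B"
 have l: "(delta D || delta E || ?A || ?B) ** ?S = (?A || ?A || sw ?a (?b @ ?b) || ?B) ** (delta D || ?A || delta E || ?B)"
 proof -
  have "(delta D || delta E || ?A || ?B) ** ?S = delta D || ((delta E || ?A) ** ?s) || ?B"
   using ic[of "delta D" ?A "(delta E || ?A) || ?B" "?s || ?B"] ic[of "delta E || ?A" ?s ?B ?B] by simp
  also have "(delta E || ?A) ** ?s = sw ?a (?b @ ?b) ** (?A || delta E)"
   by (rule sw_nat2[symmetric]) simp_all
  also have "delta D || (sw ?a (?b @ ?b) ** (?A || delta E)) || ?B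
    = (?A || ?A || sw ?a (?b @ ?b) || ?B) ** (delta D || ?A || delta E || ?B)"
   using ic[of "?A || ?A" "delta D" "sw ?a (?b @ ?b) || ?B" "(?A || delta E) || ?B"]
    ic[of "sw ?a (?b @ ?b)" "?A || delta E" ?B ?B] by (simp add: ide2_cp)
  finally show ?thesis .
 qed
 have r: "(?A || ?B || delta D || delta E) ** ?S = (?A || sw (?a @ ?a) ?b || ?B || ?B) ** (?A || delta D || ?B || delta E)"
 proof -
  have "(?A || ?B || delta D || delta E) ** ?S = ?A || ((?B || delta D) ** ?s) || delta E"
   using ic[of ?A ?A "(?B || delta D) || delta E" "?s || ?B"] ic[of "?B || delta D" ?s "delta E" ?B] by simp
  also have "(?B || delta D) ** ?s = sw (?a @ ?a) ?b ** (delta D || ?B)"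
   by (rule sw_nat1[symmetric]) simp_all
  also have "?A || (sw (?a @ ?a) ?b ** (delta D || ?B)) || delta E
    = (?A || sw (?a @ ?a) ?b || ?B || ?B) ** (?A || delta D || ?B || delta E)"
   using ic[of ?A ?A "sw (?a @ ?a) ?b || ?B || ?B" "(delta D || ?B) || delta E"]
    ic[of "sw (?a @ ?a) ?b" "delta D || ?B" "?B || ?B" "delta E"] by (simp add: ide2_cp)
  finally show ?thesis .
 qed
 let ?P = "(?S || ?A || ?B) ** (?A || ?A || sw ?a (?b @ ?b) || ?B)"
 let ?Q = "(?A || ?B || ?S) ** (?A || sw (?a @ ?a) ?b || ?B || ?B)"
 have p: "?P = ?Q"
 proof -
  have "?A || ?A || sw ?a (?b @ ?b) || ?B
    = (?A || ?A || ?B || ?s || ?B) ** (?A || ?A || ?s || ?B || ?B)"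
   using ic[of "?B || ?s" "?s || ?B" ?B ?B] by (simp add: sw_hex ic)
  hence "?P = (?A || ?s || ?B || ?A || ?B) ** (?A || ?A || ?B || ?s || ?B) ** (?A || ?A || ?s || ?B || ?B)"
   by simp
  also have "\<dots> = (?A || ?s || ?s || ?B) ** (?A || ?A || ?s || ?B || ?B)"
   using ic_r[of "?A || ?s" "?A || ?A || ?B" "?B || ?A || ?B" "?s || ?B" "?A || ?A || ?s || ?B || ?B"]
   by (simp add: ide2_cp cp_ide2 ide3_cp cp_ide3)
  finally have P: "?P = (?A || ?s || ?s || ?B) ** (?A || ?A || ?s || ?B || ?B)" .
  have "?A || sw (?a @ ?a) ?b || ?B || ?B
    = (?A || ?s || ?A || ?B || ?B) ** (?A || ?A || ?s || ?B || ?B)"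
   using ic[of "?s || ?A" "?A || ?s" "?B || ?B" "?B || ?B"] by (simp add: sw_hex2 ic ide2_cp)
  hence "?Q = (?A || ?B || ?A || ?s || ?B) ** (?A || ?s || ?A || ?B || ?B) ** (?A || ?A || ?s || ?B || ?B)"
   by simp
  also have "\<dots> = (?A || ?s || ?s || ?B) ** (?A || ?A || ?s || ?B || ?B)"
   using ic_r[of "?A || ?B || ?A" "?A || ?s" "?s || ?B" "?A || ?B || ?B" "?A || ?A || ?s || ?B || ?B"]
   by (simp add: ide2_cp cp_ide2 ide3_cp cp_ide3)
  finally show ?thesis using P by simp
 qed
 have L: "(delta (tb D E) || (?A || ?B)) ** delta (tb D E)
   = ?P ** (((delta D || ?A) ** delta D) || ((delta E || ?B) ** delta E))"
 proof -
  have "delta (tb D E) || (?A || ?B) = (?S || ?A || ?B) ** (delta D || delta E || ?A || ?B)"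
   unfolding delta_tb
   using ic[of ?S "delta D || delta E" "?A || ?B" "?A || ?B"] by (simp add: ide2_cp)
  hence "(delta (tb D E) || (?A || ?B)) ** delta (tb D E)
    = (?S || ?A || ?B) ** ((delta D || delta E || ?A || ?B) ** ?S) ** (delta D || delta E)"
   by (simp add: delta_tb)
  thus ?thesis unfolding l
   using ic[of "delta D || ?A" "delta D" "delta E || ?B" "delta E"] by simp
 qed
 have R: "((?A || ?B) || delta (tb D E)) ** delta (tb D E)
   = ?Q ** (((?A || delta D) ** delta D) || ((?B || delta E) ** delta E))"
 proof -
  have "(?A || ?B) || delta (tb D E) = (?A || ?B || ?S) ** (?A || ?B || delta D || delta E)"
   unfolding delta_tb
   using ic[of "?A || ?B" "?A || ?B" ?S "delta D || delta E"] by (simp add: ide2_cp)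
  hence "((?A || ?B) || delta (tb D E)) ** delta (tb D E)
    = (?A || ?B || ?S) ** ((?A || ?B || delta D || delta E) ** ?S) ** (delta D || delta E)"
   by (simp add: delta_tb)
  thus ?thesis unfolding r
   using ic[of "?A || delta D" "delta D" "?B || delta E" "delta E"] by simp
 qed
 show ?thesis unfolding L R p by (simp add: cc_coassoc)
qed

lemma cc_tb [simp]: "cc (tb D E)"
 unfolding cc_def using tb_counit tb_cocomm tb_coassoc
 by (simp add: ide_app) (simp add: delta_tb)

end

end

context ssmc begin

text \<open>
 Reversing the arrows. The axioms of a strict symmetric monoidal category are self-dual, and \<open>du\<close> exchanges the monoid and comonoid part of a bimonoid, so theorems instantiate to their duals.
\<close>

lemma ssmc_op: "ssmc At ar trg src (\<lambda>g f. f ** g) ts ide (\<lambda>x y. sw y x)"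
 by unfold_locales (auto simp: src_obs trg_obs ide_ide interchange sw_nat sw_hex2)

abbreviation p1 where "p1 D E \<equiv> ide (und D) || eps E"
abbreviation p2 where "p2 D E \<equiv> eps D || ide (und E)"

context
 fixes D E assumes D [simp]: "cc D" and E [simp]: "cc E"
begin

lemma pair_tb_ts:
 assumes u [simp]: "frm D u" "frm D u'" and v [simp]: "frm E v" "frm E v'"
 shows "pair (tb D E) (u || v) (u' || v')
  = (ide (trg u) || sw (trg u') (trg v) || ide (trg v')) ** (pair D u u' || pair E v v')"
proof -
 have ob [simp]: "obs (trg u)" "obs (trg u')" "obs (trg v)" "obs (trg v')" using trg_obs u v by auto
 have "((u || v) || (u' || v')) ** (ide (und D) || sw (und D) (und E) || ide (und E))
   = u || ((v || u') ** sw (und D) (und E)) || v'"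
  using ic[of u "ide (und D)" "(v || u') || v'" "sw (und D) (und E) || ide (und E)"]
   ic[of "v || u'" "sw (und D) (und E)" v' "ide (und E)"] by simp
 also have "(v || u') ** sw (und D) (und E) = sw (trg u') (trg v) ** (u' || v)"
  using sw_nat[of u' v] by simp
 also have "u || (sw (trg u') (trg v) ** (u' || v)) || v'
   = (ide (trg u) || sw (trg u') (trg v) || ide (trg v')) ** ((u || u') || (v || v'))"
  using ic[of "ide (trg u)" u "sw (trg u') (trg v) || ide (trg v')" "(u' || v) || v'"]
   ic[of "sw (trg u') (trg v)" "u' || v" "ide (trg v')" v'] by simp
 finally have e: "((u || v) || (u' || v')) ** (ide (und D) || sw (und D) (und E) || ide (und E))
   = (ide (trg u) || sw (trg u') (trg v) || ide (trg v')) ** ((u || u') || (v || v'))" .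
 have "pair (tb D E) (u || v) (u' || v')
   = (((u || v) || (u' || v')) ** (ide (und D) || sw (und D) (und E) || ide (und E))) ** (delta D || delta E)"
  unfolding pair_def delta_tb[OF D E] by (simp only: cp_assoc)
 also have "\<dots> = (ide (trg u) || sw (trg u') (trg v) || ide (trg v')) ** ((u || u') || (v || v')) ** (delta D || delta E)"
  unfolding e by (simp only: cp_assoc)
 also have "((u || u') || (v || v')) ** (delta D || delta E) = pair D u u' || pair E v v'"
  by (subst ic) (simp_all add: pair_def)
 finally show ?thesis .
qed

lemma pair_ide_ide: "pair D (ide (und D)) (ide (und D)) = delta D"
 by (simp add: pair_def ide2_cp)

lemma p1_chom: "chom (tb D E) D (p1 D E)"
proof -
 have "pair (tb D E) (p1 D E) (p1 D E) = pair D (ide (und D)) (ide (und D)) || eps E"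
  by (simp add: pair_tb_ts sw_Nil_right ide2_cp)
 also have "\<dots> = delta D ** p1 D E"
  using ic[of "delta D" "ide (und D)" "ide []" "eps E"] by (simp add: pair_ide_ide)
 finally show ?thesis using ic[of "eps D" "ide (und D)" "ide []" "eps E"] by simp
qed

lemma p2_chom: "chom (tb D E) E (p2 D E)"
proof -
 have "pair (tb D E) (p2 D E) (p2 D E) = eps D || pair E (ide (und E)) (ide (und E))"
  by (simp add: pair_tb_ts sw_Nil_left ide2_cp)
 also have "\<dots> = delta E ** p2 D E"
  using ic[of "ide []" "eps D" "delta E" "ide (und E)"] by (simp add: pair_def ide2_cp)
 finally show ?thesis using ic[of "ide []" "eps D" "eps E" "ide (und E)"] by simp
qed

lemma pair_p1_p2: "pair (tb D E) (p1 D E) (p2 D E) = ide (und D @ und E)"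
 by (simp add: pair_tb_ts sw_Nil_left ide2_cp ide_ide)

lemma ts_as_pair: "frm D u ==> frm E v ==> u || v = pair (tb D E) (u ** p1 D E) (v ** p2 D E)"
proof -
 assume a: "frm D u" "frm E v"
 have "u || v = (u || v) ** pair (tb D E) (p1 D E) (p2 D E)" using a by (simp add: pair_p1_p2)
 thus ?thesis using a by simp
qed

end

section \<open>Bimonoids and the convolution group\<close>

text \<open>
 The axioms of a bimonoid without associators.
\<close>

definition bim :: "('o list, 'a) bimon => bool" where
 "bim A \<longleftrightarrow> obs (und A) \<and>
   hom (nabla A) (und A @ und A) (und A) \<and> hom (eta A) [] (und A) \<and>
   hom (delta A) (und A) (und A @ und A) \<and> hom (eps A) (und A) [] \<and>
   nabla A ** (nabla A || ide (und A)) = nabla A ** (ide (und A) || nabla A) \<and>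
   nabla A ** (eta A || ide (und A)) = ide (und A) \<and> nabla A ** (ide (und A) || eta A) = ide (und A) \<and>
   (delta A || ide (und A)) ** delta A = (ide (und A) || delta A) ** delta A \<and>
   (eps A || ide (und A)) ** delta A = ide (und A) \<and> (ide (und A) || eps A) ** delta A = ide (und A) \<and>
   delta A ** nabla A = (nabla A || nabla A) ** (ide (und A) || sw (und A) (und A) || ide (und A)) ** (delta A || delta A) \<and>
   delta A ** eta A = eta A || eta A \<and> eps A ** nabla A = eps A || eps A \<and> eps A ** eta A = ide []"

definition antip :: "('o list, 'a) bimon => 'a => bool" where
 "antip A S \<longleftrightarrow> hom S (und A) (und A) \<and> nabla A ** (S || ide (und A)) ** delta A = eta A ** eps A"

definition hopf :: "('o list, 'a) bimon => bool" where
 "hopf A \<longleftrightarrow> bim A \<and> nabla A ** sw (und A) (und A) = nabla A \<and> sw (und A) (und A) ** delta A = delta A \<and>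
   (\<exists>S. antip A S)"

definition anti :: "('o list, 'a) bimon => 'a" where "anti A = (SOME S. antip A S)"

definition du :: "('o list, 'a) bimon => ('o list, 'a) bimon" where
 "du A = \<lparr>und = und A, nabla = delta A, eta = eps A, delta = nabla A, eps = eta A\<rparr>"

text \<open>
 Convolution; it is the group operation on generalized elements of a bicommutative Hopf monoid.
\<close>

definition cv :: "('o list, 'a) bimon => ('o list, 'a) bimon => 'a => 'a => 'a" where
 "cv A D u v = nabla A ** pair D u v"

abbreviation hhom :: "('o list, 'a) bimon => ('o list, 'a) bimon => 'a => bool" where
 "hhom A B f \<equiv> chom A B f \<and> f ** nabla A = nabla B ** (f || f) \<and> f ** eta A = eta B"

lemma du_sel [simp]: "und (du A) = und A" "nabla (du A) = delta A" "eta (du A) = eps A"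
 "delta (du A) = nabla A" "eps (du A) = eta A"
 by (simp_all add: du_def)

lemma du_du [simp]: "du (du A) = A" by (simp add: du_def)

lemma hopf_cc [simp]: "hopf A ==> cc A" unfolding hopf_def bim_def cc_def by blast

lemma hopfD [simp]: assumes "hopf A"
 shows "obs (und A)" "ar (nabla A)" "src (nabla A) = und A @ und A" "trg (nabla A) = und A"
  "ar (eta A)" "src (eta A) = []" "trg (eta A) = und A"
  "nabla A ** (eta A || ide (und A)) = ide (und A)" "nabla A ** (ide (und A) || eta A) = ide (und A)"
  "nabla A ** sw (und A) (und A) = nabla A"
  "delta A ** eta A = eta A || eta A" "eps A ** nabla A = eps A || eps A" "eps A ** eta A = ide []"
 using assms unfolding hopf_def bim_def by blast+

lemma hopf_assoc: "hopf A ==> nabla A ** (nabla A || ide (und A)) = nabla A ** (ide (und A) || nabla A)"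
 and hopf_delta_nabla: "hopf A ==> delta A ** nabla A = (nabla A || nabla A) ** (ide (und A) || sw (und A) (und A) || ide (und A)) ** (delta A || delta A)"
 and hopf_antip: "hopf A ==> antip A (anti A)"
 unfolding hopf_def bim_def anti_def by (blast intro: someI)+

lemma anti_hom [simp]: "hopf A ==> ar (anti A)" "hopf A ==> src (anti A) = und A" "hopf A ==> trg (anti A) = und A"
 and anti_inv: "hopf A ==> nabla A ** (anti A || ide (und A)) ** delta A = eta A ** eps A"
 using hopf_antip unfolding antip_def by auto

context
 fixes A D assumes A [simp]: "hopf A" and D [simp]: "cc D"
begin

lemma cv_hom [simp]: "[|hom u (und D) (und A); hom v (und D) (und A)|] ==> ar (cv A D u v)"
 "[|hom u (und D) (und A); hom v (und D) (und A)|] ==> src (cv A D u v) = und D"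
 "[|hom u (und D) (und A); hom v (und D) (und A)|] ==> trg (cv A D u v) = und A"
 by (simp_all add: cv_def)

lemma nabla_pair: "nabla A ** pair D u v = cv A D u v" by (simp add: cv_def)

lemma cv_comm: assumes "hom u (und D) (und A)" "hom v (und D) (und A)"
 shows "cv A D u v = cv A D v u"
proof -
 have "cv A D u v = (nabla A ** sw (und A) (und A)) ** pair D u v" by (simp add: cv_def del: cp_assoc)
 also have "\<dots> = cv A D v u" unfolding cp_assoc using assms by (simp add: cv_def)
 finally show ?thesis .
qed

lemma cv_assoc: assumes "hom u (und D) (und A)" "hom v (und D) (und A)" "hom w (und D) (und A)"
 shows "cv A D (cv A D u v) w = cv A D u (cv A D v w)"
proof -
 have "cv A D (cv A D u v) w = nabla A ** (nabla A || ide (und A)) ** pair D u (pair D v w)"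
  using assms by (simp add: cv_def)
 also have "\<dots> = nabla A ** (ide (und A) || nabla A) ** pair D u (pair D v w)"
  by (simp only: cp_assoc[symmetric] hopf_assoc[OF A])
 also have "\<dots> = cv A D u (cv A D v w)" using assms by (simp add: cv_def)
 finally show ?thesis .
qed

lemma cv_left_comm: assumes "hom u (und D) (und A)" "hom v (und D) (und A)" "hom w (und D) (und A)"
 shows "cv A D u (cv A D v w) = cv A D v (cv A D u w)"
 using assms by (simp add: cv_assoc[symmetric] cv_comm[of u v])

lemma cv_unit [simp]: assumes "hom u (und D) (und A)"
 shows "cv A D (eta A ** eps D) u = u" "cv A D u (eta A ** eps D) = u"
proof -
 have "cv A D (eta A ** eps D) u = (nabla A ** (eta A || ide (und A))) ** pair D (eps D) u"
  unfolding cp_assoc using assms by (subst pair_ts) (simp_all add: cv_def)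
 thus 1: "cv A D (eta A ** eps D) u = u" using assms by (simp del: cp_assoc)
 show "cv A D u (eta A ** eps D) = u" using assms 1 by (subst cv_comm) simp_all
qed

text \<open>
 Comonoid homomorphisms are closed under convolution because the comultiplication of a bicommutative bimonoid is multiplicative.
\<close>

lemma cv_chom: assumes u [simp]: "chom D A u" and v [simp]: "chom D A v"
 shows "chom D A (cv A D u v)"
proof -
 have "delta A ** cv A D u v = (delta A ** nabla A) ** pair D u v" by (simp add: cv_def)
 also have "\<dots> = pair D (cv A D u v) (cv A D u v)"
  unfolding hopf_delta_nabla[OF A] by (simp add: cv_def)
 finally have 1: "delta A ** cv A D u v = pair D (cv A D u v) (cv A D u v)" .
 have "eps A ** cv A D u v = (eps A ** nabla A) ** pair D u v" by (simp add: cv_def del: hopfD)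
 also have "\<dots> = eps D" by simp
 finally show ?thesis using 1 by simp
qed

lemma unit_chom: "chom D A (eta A ** eps D)"
proof -
 have "delta A ** eta A ** eps D = (delta A ** eta A) ** eps D" by (simp only: cp_assoc)
 also have "\<dots> = (eta A || eta A) ** pair D (eps D) (eps D)" by (simp del: cp_assoc)
 also have "\<dots> = pair D (eta A ** eps D) (eta A ** eps D)"  by (simp del: pair_eps_left pair_eps_right)
 finally have 1: "delta A ** eta A ** eps D = pair D (eta A ** eps D) (eta A ** eps D)" .
 have "eps A ** eta A ** eps D = (eps A ** eta A) ** eps D" by (simp only: cp_assoc)
 also have "\<dots> = eps D" by (simp del: cp_assoc)
 finally show ?thesis using 1 by simp
qed

lemma cv_anti: assumes u: "chom D A u" shows "cv A D (anti A ** u) u = eta A ** eps D"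
proof -
 have "cv A D (anti A ** u) u = nabla A ** (anti A || ide (und A)) ** delta A ** u" using u by (simp add: cv_def)
 also have "\<dots> = (nabla A ** (anti A || ide (und A)) ** delta A) ** u" by simp
 also have "\<dots> = eta A ** eps A ** u" unfolding anti_inv[OF A] by simp
 finally show ?thesis using u by simp
qed

text \<open>
 Convolution inverses are unique. Antipode identities below are proved by exhibiting both sides as inverses of the same arrow.
\<close>

lemma cv_inv_unique:
 assumes "hom u (und D) (und A)" "hom v (und D) (und A)" "hom w (und D) (und A)"
  and "cv A D v u = eta A ** eps D" "cv A D w u = eta A ** eps D"
 shows "v = w"
proof -
 have "v = cv A D v (cv A D w u)" using assms by simp
 also have "\<dots> = cv A D w (cv A D v u)" using assms(1-3) by (rule_tac cv_left_comm)
 finally show ?thesis using assms by simp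
qed

end

end

context ssmc begin

subsection \<open>Duality\<close>

lemma op_hopf [simp]: "ssmc.hopf At ar trg src (\<lambda>g f. f ** g) ts ide (\<lambda>x y. sw y x) (du A) \<longleftrightarrow> hopf A"
 and op_anti [simp]: "ssmc.anti ar trg src (\<lambda>g f. f ** g) ts ide (du A) = anti A"
 and op_bim [simp]: "ssmc.bim At ar trg src (\<lambda>g f. f ** g) ts ide (\<lambda>x y. sw y x) (du A) \<longleftrightarrow> bim A"
 and op_pair: "ssmc.pair (\<lambda>g f. f ** g) ts (du A) u v = nabla A ** (u || v)"
proof -
 interpret op: ssmc At ar trg src "\<lambda>g f. f ** g" ts ide "\<lambda>x y. sw y x" by (rule ssmc_op)
 have a: "op.antip (du A) = antip A"
  unfolding op.antip_def antip_def du_sel cp_assoc by (intro ext) blast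
 show "op.anti (du A) = anti A" unfolding op.anti_def anti_def a ..
 show b: "op.bim (du A) \<longleftrightarrow> bim A"
  unfolding op.bim_def bim_def du_sel cp_assoc by (safe; simp only:)
 show "op.hopf (du A) \<longleftrightarrow> hopf A"
  unfolding op.hopf_def hopf_def a b du_sel by blast
 show "op.pair (du A) u v = nabla A ** (u || v)"
  unfolding op.pair_def du_sel ..
qed

subsection \<open>The antipode\<close>

context fixes A assumes A [simp]: "hopf A" begin

lemma nabla_as_cv: "nabla A = cv A (tb A A) (p1 A A) (p2 A A)"
 using pair_p1_p2[of A A] by (simp add: cv_def)

lemma nabla_chom: "chom (tb A A) A (nabla A)"
 unfolding nabla_as_cv using p1_chom[of A A] p2_chom[of A A] by (intro cv_chom) simp_all

lemma anti_nabla: "anti A ** nabla A = nabla A ** (anti A || anti A)"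
proof -
 let ?D = "tb A A" and ?x = "p1 A A" and ?y = "p2 A A" and ?S = "anti A"
 have x: "chom ?D A ?x" and y: "chom ?D A ?y" and n: "chom ?D A (nabla A)"
  using p1_chom[of A A] p2_chom[of A A] nabla_chom by simp_all
 have D: "cc ?D" by simp
 have h: "hom ?x (und ?D) (und A)" "hom ?y (und ?D) (und A)" "hom (?S ** ?x) (und ?D) (und A)"
  "hom (?S ** ?y) (und ?D) (und A)" by simp_all
 note hc = cv_hom[OF A D]
 have h2: "hom (cv A ?D ?x ?y) (und ?D) (und A)" "hom (cv A ?D (?S ** ?y) ?y) (und ?D) (und A)"
  "hom (cv A ?D (?S ** ?x) (?S ** ?y)) (und ?D) (und A)" "hom (?S ** nabla A) (und ?D) (und A)"
  using hc[OF h(1,2)] hc[OF h(4,2)] hc[OF h(3,4)] by simp_all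
 have 1: "cv A ?D (?S ** nabla A) (cv A ?D ?x ?y) = eta A ** eps ?D"
  using cv_anti[OF A D n] unfolding nabla_as_cv[symmetric] .
 note xx = cv_anti[OF A D x] and yy = cv_anti[OF A D y]
 have "cv A ?D (cv A ?D (?S ** ?x) (?S ** ?y)) (cv A ?D ?x ?y)
   = cv A ?D (?S ** ?x) (cv A ?D (?S ** ?y) (cv A ?D ?x ?y))"
  by (rule cv_assoc[OF A D h(3,4) h2(1)])
 also have "cv A ?D (?S ** ?y) (cv A ?D ?x ?y) = cv A ?D ?x (cv A ?D (?S ** ?y) ?y)"
  by (rule cv_left_comm[OF A D h(4,1,2)])
 also have "cv A ?D (?S ** ?x) \<dots> = cv A ?D (cv A ?D (?S ** ?x) ?x) (cv A ?D (?S ** ?y) ?y)"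
  by (rule cv_assoc[symmetric, OF A D h(3,1) h2(2)])
 also have "\<dots> = eta A ** eps ?D" unfolding xx yy by (rule cv_unit) simp_all
 finally have "?S ** nabla A = cv A ?D (?S ** ?x) (?S ** ?y)"
  by (rule cv_inv_unique[OF A D h2(1,4,3) 1])
 also have "\<dots> = nabla A ** (?S || ?S)"
  using ts_as_pair[of A A ?S ?S] by (simp add: cv_def)
 finally show ?thesis .
qed

lemma anti_eta: "anti A ** eta A = eta A"
proof -
 have "anti A ** eta A = nabla A ** (ide (und A) || eta A) ** anti A ** eta A"
  by (simp add: cp_assoc[symmetric] del: cp_assoc)
 also have "(ide (und A) || eta A) ** anti A ** eta A = (anti A || ide (und A)) ** (eta A || eta A)"
  using ic[of "ide (und A)" "anti A ** eta A" "eta A" "ide []"] ic[of "anti A" "eta A" "ide (und A)" "eta A"] by simp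
 also have "\<dots> = (anti A || ide (und A)) ** delta A ** eta A" by simp
 also have "nabla A ** \<dots> = (nabla A ** (anti A || ide (und A)) ** delta A) ** eta A" by (simp only: cp_assoc)
 also have "\<dots> = eta A ** (eps A ** eta A)" unfolding anti_inv[OF A] by (simp only: cp_assoc)
 also have "\<dots> = eta A" by simp
 finally show ?thesis .
qed

end

lemma anti_chom: assumes A [simp]: "hopf A" shows "chom A A (anti A)"
proof -
 have "delta A ** anti A = (anti A || anti A) ** delta A"
  using ssmc.anti_nabla[OF ssmc_op, of "du A"] by simp
 moreover have "eps A ** anti A = eps A"
  using ssmc.anti_eta[OF ssmc_op, of "du A"] by simp
 ultimately show ?thesis by (simp add: pair_def)
qed

lemma anti_hhom: "hopf A ==> hhom A A (anti A)"
 using anti_chom anti_nabla anti_eta by simp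

lemma anti_anti: assumes A [simp]: "hopf A" shows "anti A ** anti A = ide (und A)"
proof (rule cv_inv_unique[of A A "anti A"])
 show "cv A A (anti A ** anti A) (anti A) = eta A ** eps A"
  by (rule cv_anti) (simp_all add: anti_chom)
 have "cv A A (anti A) (ide (und A)) = eta A ** eps A"
  using cv_anti[of A A "ide (und A)"] chom_ide[of A] by simp
 thus "cv A A (ide (und A)) (anti A) = eta A ** eps A"
  by (subst cv_comm) simp_all
qed simp_all

lemma hhom_cv: assumes [simp]: "hopf A" "hopf B" "cc D" and f: "hhom A B f"
  and u: "hom u (und D) (und A)" "hom v (und D) (und A)"
 shows "f ** cv A D u v = cv B D (f ** u) (f ** v)"
proof -
 have "f ** cv A D u v = (f ** nabla A) ** pair D u v" by (simp add: cv_def)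
 also have "\<dots> = (nabla B ** (f || f)) ** pair D u v" using f by simp
 also have "\<dots> = cv B D (f ** u) (f ** v)" using f u by (simp add: cv_def)
 finally show ?thesis .
qed

lemma hhom_anti: assumes [simp]: "hopf A" "hopf B" and f: "hhom A B f"
 shows "f ** anti A = anti B ** f"
proof (rule cv_inv_unique[of B A f])
 have "cv B A (f ** anti A) (f ** ide (und A)) = f ** cv A A (anti A) (ide (und A))"
  using f by (intro hhom_cv[symmetric]) simp_all
 also have "cv A A (anti A) (ide (und A)) = eta A ** eps A"
  using cv_anti[of A A "ide (und A)"] chom_ide[of A] by simp
 also have "f ** eta A ** eps A = eta B ** eps A" using f by (simp add: cp_assoc[symmetric] del: cp_assoc)
 finally show "cv B A (f ** anti A) f = eta B ** eps A" using f by simp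
 show "cv B A (anti B ** f) f = eta B ** eps A" using f by (intro cv_anti) simp_all
qed (use f in simp_all)

lemma cv_comp: assumes "hopf A" "cc D" "cc E" "chom E D h" "hom u (und D) (und A)" "hom v (und D) (und A)"
 shows "cv A D u v ** h = cv A E (u ** h) (v ** h)"
 using assms pair_comp[of D E h u v] by (simp add: cv_def)

subsection \<open>Generic points\<close>

text \<open>
 The two projections of a product of comonoids are generic elements: their pair is the identity, so an equation between arrows out of the product may be tested on them.
\<close>

lemma generic2:
 assumes "cc A" "cc B"
 obtains D x y where "cc D" "und D = und A @ und B" "chom D A x" "chom D B y"
  "pair D x y = ide (und A @ und B)" "D = tb A B" "y = p2 A B" "x = p1 A B"
 using that[of "tb A B" "p1 A B" "p2 A B"] assms p1_chom p2_chom pair_p1_p2 by simp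

lemma generic3:
 assumes [simp]: "cc A" "cc B" "cc E"
 obtains D x y z where "cc D" "und D = und A @ und B @ und E" "chom D A x" "chom D B y" "chom D E z"
  "pair D x (pair D y z) = ide (und A @ und B @ und E)" "D = tb A (tb B E)"
  "x = p1 A (tb B E)" "y = p1 B E ** p2 A (tb B E)" "z = p2 B E ** p2 A (tb B E)"
proof -
 let ?E = "tb B E" let ?D = "tb A ?E" let ?w = "p2 A ?E"
 have w: "chom ?D ?E ?w" and x: "chom ?D A (p1 A ?E)" by (rule p2_chom p1_chom; simp)+
 have c: "cc ?D" "cc ?E" by simp_all
 note y = chom_comp[OF assms(2) c w p1_chom[OF assms(2,3)]]
  and z = chom_comp[OF assms(3) c w p2_chom[OF assms(2,3)]]
 have "pair ?D (p1 B E ** ?w) (p2 B E ** ?w) = pair ?E (p1 B E) (p2 B E) ** ?w"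
  by (rule pair_comp[symmetric]) (use w in simp_all)
 also have "\<dots> = ?w" by (simp add: pair_p1_p2 ide_app ide2_cp)
 finally have "pair ?D (p1 A ?E) (pair ?D (p1 B E ** ?w) (p2 B E ** ?w)) = ide (und A @ und B @ und E)"
  using pair_p1_p2[of A ?E] by simp
 thus ?thesis using that[of ?D "p1 A ?E" "p1 B E ** ?w" "p2 B E ** ?w"] x y z by simp
qed

section \<open>Stable quotients\<close>

definition epi :: "'a => bool" where
 "epi f \<longleftrightarrow> ar f \<and> (\<forall>g h. ar g --> ar h --> src g = trg f --> src h = trg f --> g ** f = h ** f --> g = h)"

lemma epi_cancel: "[|epi f; ar g; ar h; src g = trg f; src h = trg f; g ** f = h ** f|] ==> g = h"
 unfolding epi_def by blast

lemma epi_comp: "[|epi f; epi g; trg f = src g|] ==> epi (g ** f)"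
 unfolding epi_def[of "g ** f"]
proof (intro conjI allI impI)
 assume f: "epi f" and g: "epi g" and fg: "trg f = src g"
 hence [simp]: "ar f" "ar g" unfolding epi_def by auto
 show "ar (g ** f)" using fg by simp
 fix h k assume h: "ar h" "ar k" "src h = trg (g ** f)" "src k = trg (g ** f)" "h ** g ** f = k ** g ** f"
 have "h ** g = k ** g"
  by (rule epi_cancel[OF f]) (use h fg in \<open>simp_all add: cp_assoc\<close>)
 thus "h = k" by (rule epi_cancel[OF g, rotated -1]) (use h fg in simp_all)
qed

lemma epi_flip:
 assumes e: "epi (f || ide ys)" and [simp]: "ar f" "obs ys"
 shows "epi (ide ys || f)"
proof -
 have [simp]: "obs (src f)" "obs (trg f)" using src_obs trg_obs by auto
 have q: "(ide ys || f) ** sw (src f) ys = sw (trg f) ys ** (f || ide ys)"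
  by (rule sw_nat1[symmetric]) simp_all
 show ?thesis unfolding epi_def
 proof (intro conjI allI impI)
  fix g h assume [simp]: "ar g" "ar h" "src g = trg (ide ys || f)" "src h = trg (ide ys || f)"
   and gh: "g ** (ide ys || f) = h ** (ide ys || f)"
  have "(g ** (ide ys || f)) ** sw (src f) ys = (h ** (ide ys || f)) ** sw (src f) ys" by (simp only: gh)
  hence "(g ** sw (trg f) ys) ** (f || ide ys) = (h ** sw (trg f) ys) ** (f || ide ys)"
   unfolding cp_assoc q .
  hence "g ** sw (trg f) ys = h ** sw (trg f) ys" by (rule epi_cancel[OF e, rotated -1]) simp_all
  hence "(g ** sw (trg f) ys) ** sw ys (trg f) = (h ** sw (trg f) ys) ** sw ys (trg f)" by (simp only:)
  thus "g = h" by simp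
 qed simp
qed

definition coq :: "'a => 'a => 'a => bool" where
 "coq \<alpha> \<tau> p \<longleftrightarrow> ar p \<and> src p = trg \<alpha> \<and> p ** \<alpha> = p ** \<tau> \<and>
   (\<forall>h. ar h --> src h = trg \<alpha> --> h ** \<alpha> = h ** \<tau> --> (\<exists>!u. hom u (trg p) (trg h) \<and> u ** p = h))"

definition act :: "('o list, 'a) bimon => 'a => 'o list => bool" where
 "act A \<alpha> x \<longleftrightarrow> bim A \<and> obs x \<and> hom \<alpha> (und A @ x) x \<and>
   \<alpha> ** (nabla A || ide x) = \<alpha> ** (ide (und A) || \<alpha>) \<and> \<alpha> ** (eta A || ide x) = ide x"

text \<open>
 The stabilized object of an action, required to remain a coequalizer after tensoring with any object. Stability of the monoidal structure provides this, and it is what makes the quotient of a Hopf monoid again a Hopf monoid.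
\<close>

definition squot :: "('o list, 'a) bimon => 'a => 'a => bool" where
 "squot A \<alpha> p \<longleftrightarrow> ar p \<and> src p = trg \<alpha> \<and>
   (\<forall>ys. obs ys --> coq (\<alpha> || ide ys) (eps A || ide (trg \<alpha>) || ide ys) (p || ide ys))"

context
 fixes A \<alpha> x p
 assumes A [simp]: "obs (und A)" "ar (eps A)" "src (eps A) = und A" "trg (eps A) = []"
  and al [simp]: "ar \<alpha>" "src \<alpha> = und A @ x" "trg \<alpha> = x" and ob [simp]: "obs x"
  and p: "squot A \<alpha> p"
begin

lemma squot_hom [simp]: "ar p" "src p = x" "obs (trg p)"
 using p trg_obs unfolding squot_def by auto

lemma squot_eq: "p ** \<alpha> = p ** (eps A || ide x)"
proof -
 have "coq (\<alpha> || ide []) (eps A || ide x || ide []) (p || ide [])"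
  using p unfolding squot_def al(3) by (metis empty_subsetI list.set(1))
 hence "coq \<alpha> (eps A || ide x) p" by simp
 thus ?thesis unfolding coq_def by blast
qed

lemma descend:
 assumes "obs ys" "ar h" "src h = x @ ys" "h ** (\<alpha> || ide ys) = h ** (eps A || ide x || ide ys)"
 shows "\<exists>u. hom u (trg p @ ys) (trg h) \<and> u ** (p || ide ys) = h"
proof -
 have "coq (\<alpha> || ide ys) (eps A || ide x || ide ys) (p || ide ys)" using p assms unfolding squot_def by simp
 hence "\<exists>!u. hom u (trg (p || ide ys)) (trg h) \<and> u ** (p || ide ys) = h"
  using assms unfolding coq_def by simp
 thus ?thesis using assms by auto
qed

lemma descend0:
 assumes "ar h" "src h = x" "h ** \<alpha> = h ** (eps A || ide x)"
 shows "\<exists>u. hom u (trg p) (trg h) \<and> u ** p = h"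
 using descend[of "[]" h] assms by simp

lemma squot_epi: assumes "obs ys" shows "epi (p || ide ys)"
 unfolding epi_def
proof (intro conjI allI impI)
 have q: "coq (\<alpha> || ide ys) (eps A || ide x || ide ys) (p || ide ys)" using p assms unfolding squot_def by simp
 show "ar (p || ide ys)" using assms by simp
 fix g h assume g: "ar g" "ar h" "src g = trg (p || ide ys)" "src h = trg (p || ide ys)"
  and e: "g ** (p || ide ys) = h ** (p || ide ys)"
 have t: "trg g = trg h" using arg_cong[OF e, of trg] g assms by simp
 have "(p || ide ys) ** (\<alpha> || ide ys) = (p || ide ys) ** (eps A || ide x || ide ys)"
  using q unfolding coq_def by blast
 hence "(g ** (p || ide ys)) ** (\<alpha> || ide ys) = (g ** (p || ide ys)) ** (eps A || ide x || ide ys)"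
  by (simp only: cp_assoc)
 moreover have "ar (g ** (p || ide ys))" "src (g ** (p || ide ys)) = trg (\<alpha> || ide ys)" using g assms by simp_all
 ultimately have "\<exists>!u. hom u (trg (p || ide ys)) (trg (g ** (p || ide ys))) \<and> u ** (p || ide ys) = g ** (p || ide ys)"
  using q unfolding coq_def by blast
 thus "g = h" using g e t assms by auto
qed

lemma squot_epi0: "epi p" using squot_epi[of "[]"] by simp

lemma squot_epi_mid: assumes [simp]: "obs ys" "obs zs" shows "epi (ide ys || p || ide zs)"
 using epi_flip[of "p || ide zs" ys] squot_epi[of "zs @ ys"] by (simp add: ide_ide)

lemma squot_epi_right: assumes [simp]: "obs ys" shows "epi (ide ys || p)"
 using squot_epi_mid[of ys "[]"] by simp

lemma squot_epi2: "epi (p || p)"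
 using epi_comp[OF squot_epi_right[of x] squot_epi[of "trg p"]] ic[of p "ide x" "ide (trg p)" p] by simp

lemma squot_epi3: "epi (p || p || p)"
proof -
 have "epi ((p || ide (trg p @ trg p)) ** (ide x || p || ide (trg p)) ** (ide (x @ x) || p))"
  by (intro epi_comp squot_epi squot_epi_mid squot_epi_right) simp_all
 also have "(ide x || p || ide (trg p)) ** (ide (x @ x) || p) = ide x || p || p"
  using ic[of "ide x || p" "ide x || ide x" "ide (trg p)" p] by (simp add: ide_app cp_ide2)
 also have "(p || ide (trg p @ trg p)) ** (ide x || p || p) = p || p || p"
  using ic[of p "ide x" "ide (trg p @ trg p)" "p || p"] by simp
 finally show ?thesis .
qed

lemma descend_right:
 assumes [simp]: "obs ys" "ar h" "src h = ys @ x"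
  and e: "h ** (ide ys || \<alpha>) = h ** (ide ys || eps A || ide x)"
 shows "\<exists>u. hom u (ys @ trg p) (trg h) \<and> u ** (ide ys || p) = h"
proof -
 let ?h = "h ** sw x ys"
 have "?h ** (\<alpha> || ide ys) = (h ** (ide ys || \<alpha>)) ** sw (und A @ x) ys"
  using sw_nat1[of \<alpha> "und A @ x" x ys] by simp
 also have "\<dots> = h ** (ide ys || (eps A || ide x)) ** sw (und A @ x) ys" unfolding e by simp
 also have "(ide ys || (eps A || ide x)) ** sw (und A @ x) ys = sw x ys ** ((eps A || ide x) || ide ys)"
  by (rule sw_nat1[symmetric]) simp_all
 finally have "?h ** (\<alpha> || ide ys) = ?h ** (eps A || ide x || ide ys)" by simp
 then obtain u where u: "hom u (trg p @ ys) (trg h)" "u ** (p || ide ys) = ?h"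
  using descend[of ys ?h] by auto
 have "(u ** sw ys (trg p)) ** (ide ys || p) = (u ** (p || ide ys)) ** sw ys x"
  using sw_nat2[of p x "trg p" ys] by simp
 also have "\<dots> = h" unfolding u(2) by simp
 finally show ?thesis using u by (intro exI[of _ "u ** sw ys (trg p)"]) simp
qed

end

declare squot_hom [simp del]

end

context ssmc begin

lemma ic21: "[|ar a; ar b; ar c; ar f; ar g; trg f = src a @ src b; trg g = src c|]
  ==> (a || b || c) ** (f || g) = ((a || b) ** f) || (c ** g)"
 by (subst ts_assoc[symmetric], rule ic) simp_all

lemma ic22: "[|ar a; ar b; ar c; ar d; ar f; ar g; trg f = src a @ src b; trg g = src c @ src d|]
  ==> (a || b || c || d) ** (f || g) = ((a || b) ** f) || ((c || d) ** g)"
 by (rule ic21) simp_all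

lemma ic21': "[|ar a; ar b; ar c; ar f; ar g; src f = trg a @ trg b; src g = trg c|]
  ==> (f || g) ** (a || b || c) = (f ** (a || b)) || (g ** c)"
 by (subst ts_assoc[symmetric], rule ic) simp_all

lemma ic22': "[|ar a; ar b; ar c; ar d; ar f; ar g; src f = trg a @ trg b; src g = trg c @ trg d|]
  ==> (f || g) ** (a || b || c || d) = (f ** (a || b)) || (g ** (c || d))"
 by (rule ic21') simp_all

text \<open>
 Structure maps descend along a quotient whose tensor powers are epi, and the axioms descend with them because each may be tested after the quotient map.
\<close>

lemma quotient_hopf:
 assumes B [simp]: "hopf B" and p [simp]: "ar p" "src p = und B"
  and e1: "epi p" and e2: "epi (p || p)" and e3: "epi (p || p || p)"
  and m [simp]: "hom m (trg p @ trg p) (trg p)" and mp: "m ** (p || p) = p ** nabla B"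
  and d [simp]: "hom d (trg p) (trg p @ trg p)" and dp: "d ** p = (p || p) ** delta B"
  and e [simp]: "hom e (trg p) []" and ep: "e ** p = eps B"
  and s [simp]: "hom s (trg p) (trg p)" and sp: "s ** p = p ** anti B"
 defines "C \<equiv> \<lparr>und = trg p, nabla = m, eta = p ** eta B, delta = d, eps = e\<rparr>"
 shows "hopf C" and "hhom B C p" and "und C = trg p"
proof -
 let ?q = "ide (trg p)" and ?b = "ide (und B)"
 have q [simp]: "obs (trg p)" using trg_obs by simp
 have mp_r: "m ** (p || p) ** f = p ** nabla B ** f" for f using mp by (metis cp_assoc)
 have dp_r: "d ** p ** f = (p || p) ** delta B ** f" for f using dp by (metis cp_assoc)
 have ep_r: "e ** p ** f = eps B ** f" for f using ep by (metis cp_assoc)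
 have assoc: "m ** (m || ?q) = m ** (?q || m)"
 proof (rule epi_cancel[OF e3])
  have "(m || ?q) ** (p || p || p) = (p || p) ** (nabla B || ?b)"
   using ic[of m "p || p" ?q p] ic[of p "nabla B" p ?b] by (simp add: mp)
  moreover have "(?q || m) ** (p || p || p) = (p || p) ** (?b || nabla B)"
   using ic[of ?q p m "p || p"] ic[of p ?b p "nabla B"] by (simp add: mp)
  ultimately show "(m ** (m || ?q)) ** (p || p || p) = (m ** (?q || m)) ** (p || p || p)"
   by (simp add: mp_r hopf_assoc)
 qed simp_all
 have lu: "m ** ((p ** eta B) || ?q) = ?q"
 proof (rule epi_cancel[OF e1])
  have "((p ** eta B) || ?q) ** p = (p || p) ** (eta B || ?b)"
   using ic[of "p ** eta B" "ide []" ?q p] ic[of p "eta B" p ?b] by simp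
  thus "(m ** ((p ** eta B) || ?q)) ** p = ?q ** p" by (simp add: mp_r)
 qed simp_all
 have ru: "m ** (?q || (p ** eta B)) = ?q"
 proof (rule epi_cancel[OF e1])
  have "(?q || (p ** eta B)) ** p = (p || p) ** (?b || eta B)"
   using ic[of ?q p "p ** eta B" "ide []"] ic[of p ?b p "eta B"] by simp
  thus "(m ** (?q || (p ** eta B))) ** p = ?q ** p" by (simp add: mp_r)
 qed simp_all
 have coassoc: "(d || ?q) ** d = (?q || d) ** d"
 proof (rule epi_cancel[OF e1])
  have 1: "(d || ?q) ** (p || p) = (p || p || p) ** (delta B || ?b)"
   using ic[of d p ?q p] ic[of "p || p" "delta B" p ?b] by (simp add: dp)
  have 2: "(?q || d) ** (p || p) = (p || p || p) ** (?b || delta B)"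
  proof -
   have "(?q || d) ** (p || p) = (?q ** p) || (d ** p)" by (rule ic) simp_all
   also have "\<dots> = (p ** ?b) || ((p || p) ** delta B)" unfolding dp by simp
   also have "\<dots> = (p || p || p) ** (?b || delta B)" by (rule ic[symmetric]) simp_all
   finally show ?thesis .
  qed
  have "((d || ?q) ** d) ** p = ((d || ?q) ** (p || p)) ** delta B"
   by (simp only: cp_assoc dp)
  also have "\<dots> = (p || p || p) ** (delta B || ?b) ** delta B" unfolding 1 by (simp only: cp_assoc)
  also have "\<dots> = (p || p || p) ** (?b || delta B) ** delta B" by (simp only: cc_coassoc[OF hopf_cc[OF B]])
  also have "\<dots> = ((?q || d) ** (p || p)) ** delta B" unfolding 2 by (simp only: cp_assoc)
  also have "\<dots> = ((?q || d) ** d) ** p" by (simp only: cp_assoc dp)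
  finally show "((d || ?q) ** d) ** p = ((?q || d) ** d) ** p" .
 qed simp_all
 have lc: "(e || ?q) ** d = ?q"
 proof (rule epi_cancel[OF e1])
  have "(e || ?q) ** (p || p) = p ** (eps B || ?b)"
   using ic[of e p ?q p] ic[of "ide []" "eps B" p ?b] by (simp add: ep)
  hence "((e || ?q) ** (p || p)) ** delta B = p" by simp
  thus "((e || ?q) ** d) ** p = ?q ** p" by (simp add: dp)
 qed simp_all
 have rc: "(?q || e) ** d = ?q"
 proof (rule epi_cancel[OF e1])
  have "(?q || e) ** (p || p) = (?q ** p) || (e ** p)" by (rule ic) simp_all
  also have "\<dots> = (p ** ?b) || (ide [] ** eps B)" by (simp add: ep)
  also have "\<dots> = (p || ide []) ** (?b || eps B)" by (rule ic[symmetric]) simp_all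
  finally have 1: "(?q || e) ** (p || p) = p ** (?b || eps B)" by simp
  have "pair B ?b (eps B) = ?b" by simp
  hence 2: "(?b || eps B) ** delta B = ?b" unfolding pair_def .
  have "((?q || e) ** d) ** p = ((?q || e) ** (p || p)) ** delta B" by (simp only: cp_assoc dp)
  also have "\<dots> = p" unfolding 1 cp_assoc 2 by simp
  finally show "((?q || e) ** d) ** p = ?q ** p" by simp
 qed simp_all
 have compat: "d ** m = (m || m) ** (?q || sw (trg p) (trg p) || ?q) ** (d || d)"
 proof (rule epi_cancel[OF e2])
  let ?s = "sw (trg p) (trg p)" and ?t = "sw (und B) (und B)"
  have 1: "(d || d) ** (p || p) = (p || p || p || p) ** (delta B || delta B)"
   by (simp add: ic ic22 dp)
  have "?s ** (p || p) = (p || p) ** ?t" using sw_nat[of p p] by simp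
  hence 2: "(?q || ?s || ?q) ** (p || p || p || p) = (p || p || p || p) ** (?b || ?t || ?b)"
   by (simp add: ic ic21 ic21')
  have 3: "(m || m) ** (p || p || p || p) = (p || p) ** (nabla B || nabla B)"
   by (simp add: ic ic22' mp)
  have "((m || m) ** (?q || ?s || ?q) ** (d || d)) ** (p || p)
    = (m || m) ** ((?q || ?s || ?q) ** (p || p || p || p)) ** (delta B || delta B)"
   by (simp add: 1)
  also have "\<dots> = ((m || m) ** (p || p || p || p)) ** (?b || ?t || ?b) ** (delta B || delta B)"
   unfolding 2 by simp
  also have "\<dots> = (p || p) ** delta B ** nabla B"
   unfolding 3 hopf_delta_nabla[OF B] by simp
  finally show "(d ** m) ** (p || p) = ((m || m) ** (?q || ?s || ?q) ** (d || d)) ** (p || p)"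
   by (simp add: mp dp_r)
 qed simp_all
 have de: "d ** p ** eta B = (p ** eta B) || (p ** eta B)"
  using ic[of p "eta B" p "eta B"] by (simp add: dp_r)
 have em: "e ** m = e || e"
  by (rule epi_cancel[OF e2]) (simp_all add: mp ep_r, simp add: ic ep)
 have ee: "e ** p ** eta B = ide []" by (simp add: ep_r)
 have comm: "m ** sw (trg p) (trg p) = m"
 proof (rule epi_cancel[OF e2])
  show "(m ** sw (trg p) (trg p)) ** (p || p) = m ** (p || p)"
   using sw_nat[of p p] by (simp add: mp_r) (simp add: mp)
 qed simp_all
 have cocomm: "sw (trg p) (trg p) ** d = d"
 proof (rule epi_cancel[OF e1])
  have "(sw (trg p) (trg p) ** (p || p)) ** delta B = (p || p) ** delta B"
   using sw_nat[of p p] by simp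
  thus "(sw (trg p) (trg p) ** d) ** p = d ** p" by (simp add: dp)
 qed simp_all
 have inv: "m ** (s || ?q) ** d = (p ** eta B) ** e"
 proof (rule epi_cancel[OF e1])
  have "(s || ?q) ** (p || p) = (p || p) ** (anti B || ?b)"
   using ic[of s p ?q p] ic[of p "anti B" p ?b] by (simp add: sp)
  hence "m ** ((s || ?q) ** (p || p)) ** delta B = p ** eta B ** eps B"
   by (simp add: mp_r anti_inv)
  thus "(m ** (s || ?q) ** d) ** p = ((p ** eta B) ** e) ** p" by (simp add: dp ep)
 qed simp_all
 have "bim C" unfolding bim_def C_def
  using assoc lu ru coassoc lc rc compat de em ee by simp
 moreover have "antip C s" unfolding antip_def C_def using inv by simp
 ultimately show "hopf C" unfolding hopf_def using comm cocomm by (auto simp: C_def)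
 show "hhom B C p" using dp ep mp by (simp add: C_def pair_def)
 show "und C = trg p" by (simp add: C_def)
qed

text \<open>
 The cokernel of \<open>i\<close> in Hopf monoids is the stabilized object of the translation action of \<open>A\<close> on \<open>B\<close>.
\<close>

definition cok :: "('o list, 'a) bimon => ('o list, 'a) bimon => ('o list, 'a) bimon => 'a => 'a => bool" where
 "cok A B C i p \<longleftrightarrow> hopf A \<and> hopf B \<and> hopf C \<and> hhom A B i \<and> hhom B C p \<and>
   squot A (nabla B ** (i || ide (und B))) p"

context
 fixes A B i
 assumes A [simp]: "hopf A" and B [simp]: "hopf B" and i: "hhom A B i"
begin

lemma i_simps [simp]: "ar i" "src i = und A" "trg i = und B" "eps B ** i = eps A" "i ** eta A = eta B"
 using i by auto

abbreviation (input) "tact \<equiv> nabla B ** (i || ide (und B))"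

lemma translation_act: "act A tact (und B)"
proof -
 have bA: "bim A" using A unfolding hopf_def by blast
 have "tact ** (nabla A || ide (und B)) = nabla B ** ((i ** nabla A) || ide (und B))"
  using ic[of i "nabla A" "ide (und B)" "ide (und B)"] by simp
 also have "\<dots> = (nabla B ** (nabla B || ide (und B))) ** (i || i || ide (und B))"
  using ic[of "nabla B" "i || i" "ide (und B)" "ide (und B)"] i by simp
 also have "\<dots> = nabla B ** ((ide (und B) || nabla B) ** (i || i || ide (und B)))"
  by (simp add: hopf_assoc)
 also have "(ide (und B) || nabla B) ** (i || i || ide (und B)) = (i || ide (und B)) ** (ide (und A) || tact)"
  using ic[of "ide (und B)" i "nabla B" "i || ide (und B)"] ic[of i "ide (und A)" "ide (und B)" tact] by simp
 finally have 1: "tact ** (nabla A || ide (und B)) = tact ** (ide (und A) || tact)" by simp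
 have "tact ** (eta A || ide (und B)) = ide (und B)"
  using ic[of i "eta A" "ide (und B)" "ide (und B)"] by simp
 thus ?thesis unfolding act_def using 1 bA by simp
qed

context
 fixes p assumes p: "squot A tact p"
begin

lemma tact_hom: "ar tact" "src tact = und A @ und B" "trg tact = und B" by simp_all

lemmas epsA = ccD(1,5,6,7)[OF hopf_cc[OF A]]

lemmas tq_hom = squot_hom[OF epsA tact_hom hopfD(1)[OF B] p]

lemmas tq_epi = squot_epi0[OF epsA tact_hom hopfD(1)[OF B] p]
 squot_epi2[OF epsA tact_hom hopfD(1)[OF B] p]
 squot_epi3[OF epsA tact_hom hopfD(1)[OF B] p]
 squot_epi[OF epsA tact_hom hopfD(1)[OF B] p]
 squot_epi_right[OF epsA tact_hom hopfD(1)[OF B] p]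

text \<open>The quotient arrow does not see translation by points of \<open>A\<close>.\<close>

lemma tq_absorb:
 assumes D [simp]: "cc D" and x: "hom x (und D) (und A)" "eps A ** x = eps D" and y: "hom y (und D) (und B)"
 shows "p ** cv B D (i ** x) y = p ** y"
proof -
 have "p ** cv B D (i ** x) y = (p ** tact) ** pair D x y" using x y by (simp add: cv_def)
 also have "p ** tact = p ** (eps A || ide (und B))"
  by (rule squot_eq[OF epsA tact_hom hopfD(1)[OF B] p])
 finally show ?thesis using x y by simp
qed

lemma tq_zero: "p ** i = p ** eta B ** eps A"
 using tq_absorb[of A "ide (und A)" "eta B ** eps A"] by simp

lemma tq_mult: "\<exists>m. hom m (trg p @ trg p) (trg p) \<and> m ** (p || p) = p ** nabla B"
proof -
 note [simp] = tq_hom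
 let ?b = "ide (und B)"
 obtain D x y z where D [simp]: "cc D" and uD: "und D = und A @ und B @ und B"
  and x: "chom D A x" and y: "chom D B y" and z: "chom D B z"
  and g: "pair D x (pair D y z) = ide (und A @ und B @ und B)"
  using generic3[OF hopf_cc[OF A] hopf_cc[OF B] hopf_cc[OF B]] by blast
 have "(p ** nabla B ** (tact || ?b)) ** pair D x (pair D y z)
   = (p ** nabla B ** (eps A || ?b || ?b)) ** pair D x (pair D y z)"
  using x y z by (simp add: nabla_pair cv_assoc) (simp add: tq_absorb)
 hence "(p ** nabla B) ** (tact || ?b) = (p ** nabla B) ** (eps A || ?b || ?b)"
  unfolding g by (simp)
 then obtain h where h: "hom h (trg p @ und B) (trg p)" "h ** (p || ?b) = p ** nabla B"
  using descend[OF epsA tact_hom hopfD(1)[OF B] p, of "und B" "p ** nabla B"] by auto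
 have "h ** (ide (trg p) || tact) = h ** (ide (trg p) || eps A || ?b)"
 proof (rule epi_cancel[OF tq_epi(4)[of "und A @ und B"]])
  obtain D x y z where D [simp]: "cc D" and uD: "und D = und B @ und A @ und B"
   and x: "chom D B x" and y: "chom D A y" and z: "chom D B z"
   and g: "pair D x (pair D y z) = ide (und B @ und A @ und B)"
   using generic3[OF hopf_cc[OF B] hopf_cc[OF A] hopf_cc[OF B]] by blast
  have 1: "(h ** (ide (trg p) || k)) ** (p || ide (und A @ und B)) = p ** nabla B ** (?b || k)"
   if "hom k (und A @ und B) (und B)" for k
  proof -
   have "(ide (trg p) || k) ** (p || ide (und A @ und B)) = (p || ?b) ** (?b || k)"
    using that ic[of "ide (trg p)" p k "ide (und A @ und B)"] ic[of p ?b ?b k] by simp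
   thus ?thesis using h(2) by (metis cp_assoc)
  qed
  have "(p ** nabla B ** (?b || tact)) ** pair D x (pair D y z) = (p ** nabla B ** (?b || (eps A || ?b))) ** pair D x (pair D y z)"
   using x y z by (simp add: nabla_pair cv_left_comm[of B D x "i ** y" z]) (simp add: tq_absorb)
  hence "p ** nabla B ** (?b || tact) = p ** nabla B ** (?b || (eps A || ?b))"
   unfolding g by simp
  thus "(h ** (ide (trg p) || tact)) ** (p || ide (und A @ und B))
    = (h ** (ide (trg p) || eps A || ?b)) ** (p || ide (und A @ und B))"
   using 1[of tact] 1[of "eps A || ?b"] by simp
 qed (use h in simp_all)
 then obtain m where m: "hom m (trg p @ trg p) (trg p)" "m ** (ide (trg p) || p) = h"
  using descend_right[OF epsA tact_hom hopfD(1)[OF B] p, of "trg p" h] h by auto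
 have "m ** (p || p) = (m ** (ide (trg p) || p)) ** (p || ?b)"
  using ic[of "ide (trg p)" p p ?b] by simp
 thus ?thesis using m h by auto
qed

text \<open>
 A criterion for descent that is checked on generalized elements: it suffices that the value does not change under translation by points of \<open>A\<close>.
\<close>

lemma tq_descend:
 assumes "ar h" "src h = und B"
  and "\<And>D x y. cc D ==> chom D A x ==> chom D B y ==> h ** cv B D (i ** x) y = h ** y"
 shows "\<exists>u. hom u (trg p) (trg h) \<and> u ** p = h"
proof (rule descend0[OF epsA tact_hom hopfD(1)[OF B] p])
 obtain D x y where D [simp]: "cc D" and uD: "und D = und A @ und B"
  and x: "chom D A x" and y: "chom D B y" and g: "pair D x y = ide (und A @ und B)"
  using generic2[OF hopf_cc[OF A] hopf_cc[OF B]] by blast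
 have "(h ** tact) ** pair D x y = (h ** (eps A || ide (und B))) ** pair D x y"
  using assms x y by (simp add: nabla_pair)
 thus "h ** tact = h ** (eps A || ide (und B))" using assms(1,2) unfolding g by simp
qed (use assms in simp_all)

lemma tq_hopf: "\<exists>C. hopf C \<and> und C = trg p \<and> hhom B C p"
proof -
 note [simp] = tq_hom
 obtain m where m: "hom m (trg p @ trg p) (trg p)" "m ** (p || p) = p ** nabla B" using tq_mult by blast
 have "\<exists>d. hom d (trg p) (trg ((p || p) ** delta B)) \<and> d ** p = (p || p) ** delta B"
 proof (rule tq_descend)
  fix D x y assume c [simp]: "cc D" and x: "chom D A x" and y: "chom D B y"
  have "chom D B (cv B D (i ** x) y)" using x y i chom_comp[of B D A x i] by (intro cv_chom) simp_all
  thus "((p || p) ** delta B) ** cv B D (i ** x) y = ((p || p) ** delta B) ** y"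
   using x y by (simp add: tq_absorb)
 qed simp_all
 then obtain d where d: "hom d (trg p) (trg p @ trg p)" "d ** p = (p || p) ** delta B" by auto
 have "\<exists>e. hom e (trg p) (trg (eps B)) \<and> e ** p = eps B"
 proof (rule tq_descend)
  fix D x y assume c [simp]: "cc D" and x: "chom D A x" and y: "chom D B y"
  have "chom D B (cv B D (i ** x) y)" using x y i chom_comp[of B D A x i] by (intro cv_chom) simp_all
  thus "eps B ** cv B D (i ** x) y = eps B ** y" using y by simp
 qed simp_all
 then obtain e where e: "hom e (trg p) []" "e ** p = eps B" by auto
 have "\<exists>s. hom s (trg p) (trg (p ** anti B)) \<and> s ** p = p ** anti B"
 proof (rule tq_descend)
  fix D x y assume c [simp]: "cc D" and x: "chom D A x" and y: "chom D B y"
  have "anti B ** cv B D (i ** x) y = cv B D (anti B ** i ** x) (anti B ** y)"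
   by (rule hhom_cv[of B B D]) (use anti_hhom[OF B] x y in simp_all)
  also have "anti B ** i ** x = i ** anti A ** x"
   using hhom_anti[OF A B i] by (metis cp_assoc)
  finally show "(p ** anti B) ** cv B D (i ** x) y = (p ** anti B) ** y"
   using x y anti_chom[OF A] anti_chom[OF B] chom_comp[of A D A x "anti A"]
   by (simp add: tq_absorb)
 qed simp_all
 then obtain s where s: "hom s (trg p) (trg p)" "s ** p = p ** anti B" by auto
 show ?thesis
  using quotient_hopf[OF B tq_hom(1,2) tq_epi(1-3) m d e s] by blast
qed

lemma tq_universal:
 assumes C: "hopf C" "und C = trg p" "hhom B C p" and X [simp]: "hopf X" and j: "hhom B X j" "j ** i = eta X ** eps A"
 shows "\<exists>u. hhom C X u \<and> u ** p = j"
proof -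
 note [simp] = tq_hom C(1,2)
 have jj: "ar j" "src j = und B" "trg j = und X" using j(1) by blast+
 note [simp] = jj
 have "\<exists>u. hom u (trg p) (trg j) \<and> u ** p = j"
 proof (rule tq_descend)
  fix D x y assume c [simp]: "cc D" and x: "chom D A x" and y: "chom D B y"
  have "j ** cv B D (i ** x) y = cv X D (j ** i ** x) (j ** y)"
   by (rule hhom_cv) (use j x y in simp_all)
  also have "j ** i ** x = (j ** i) ** x" by simp
  also have "\<dots> = eta X ** eps D" using j(2) x by simp
  finally show "j ** cv B D (i ** x) y = j ** y" using y by simp
 qed (use j in simp_all)
 then obtain u where u: "hom u (trg p) (und X)" "u ** p = j" using j by auto
 note [simp] = u(1)
 have up: "u ** p ** f = j ** f" for f using u(2) by (metis cp_assoc)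
 have pC: "delta C ** p = pair B p p" "eps C ** p = eps B" "p ** nabla B = nabla C ** (p || p)" "p ** eta B = eta C"
  using C(3) by blast+
 have jX: "delta X ** j = pair B j j" "eps X ** j = eps B" "j ** nabla B = nabla X ** (j || j)" "j ** eta B = eta X"
  using j(1) by blast+
 have a1: "delta X ** u = pair C u u"
 proof (rule epi_cancel[OF tq_epi(1)])
  have "pair C u u ** p = pair B (u ** p) (u ** p)" by (rule pair_comp) (use pC in simp_all)
  thus "(delta X ** u) ** p = pair C u u ** p" using jX by (simp add: u(2))
 qed simp_all
 have a2: "eps X ** u = eps C"
  by (rule epi_cancel[OF tq_epi(1)]) (use pC jX in \<open>simp_all add: u(2)\<close>)
 have a3: "u ** nabla C = nabla X ** (u || u)"
 proof (rule epi_cancel[OF tq_epi(2)])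
  have "(u ** nabla C) ** (p || p) = j ** nabla B" using pC(3) by (simp add: up flip: pC(3))
  also have "\<dots> = (nabla X ** (u || u)) ** (p || p)" by (simp add: ic jX u(2))
  finally show "(u ** nabla C) ** (p || p) = (nabla X ** (u || u)) ** (p || p)" .
 qed simp_all
 have a4: "u ** eta C = eta X" unfolding pC(4)[symmetric] up jX(4) ..
 have "ar u" "src u = und C" "trg u = und X" by simp_all
 with a1 a2 a3 a4 u(2) show ?thesis by (intro exI[of _ u] conjI)
qed

end
end

declare i_simps [simp del]

end

context ssmc begin

section \<open>Integrals\<close>

text \<open>
 For a commutative monoid the left integral equation implies the right one.
\<close>

definition int :: "('o list, 'a) bimon => 'a => bool" where
 "int A \<phi> \<longleftrightarrow> hom \<phi> [] (und A) \<and> nabla A ** (\<phi> || ide (und A)) = \<phi> ** eps A"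

definition coint :: "('o list, 'a) bimon => 'a => bool" where
 "coint A l \<longleftrightarrow> hom l (und A) [] \<and> (l || ide (und A)) ** delta A = eta A ** l"

definition nint :: "('o list, 'a) bimon => 'a => bool" where
 "nint A \<phi> \<longleftrightarrow> int A \<phi> \<and> eps A ** \<phi> = ide []"

definition ncoint :: "('o list, 'a) bimon => 'a => bool" where
 "ncoint A l \<longleftrightarrow> coint A l \<and> l ** eta A = ide []"

text \<open>
 The kernel condition is the cokernel condition in the opposite category.
\<close>

definition kern :: "('o list, 'a) bimon => ('o list, 'a) bimon => ('o list, 'a) bimon => 'a => 'a => bool" where
 "kern A B C i p = ssmc.cok At ar trg src (\<lambda>g f. f ** g) ts ide (\<lambda>x y. sw y x) (du C) (du B) (du A) p i"

definition ses :: "('o list, 'a) bimon => ('o list, 'a) bimon => ('o list, 'a) bimon => 'a => 'a => bool" where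
 "ses A B C i p \<longleftrightarrow> cok A B C i p \<and> kern A B C i p"

lemma op_int [simp]: "ssmc.int ar trg src (\<lambda>g f. f ** g) ts ide (du A) l \<longleftrightarrow> coint A l"
 and op_coint [simp]: "ssmc.coint ar trg src (\<lambda>g f. f ** g) ts ide (du A) l \<longleftrightarrow> int A l"
 and op_nint [simp]: "ssmc.nint ar trg src (\<lambda>g f. f ** g) ts ide (du A) l \<longleftrightarrow> ncoint A l"
 and op_ncoint [simp]: "ssmc.ncoint ar trg src (\<lambda>g f. f ** g) ts ide (du A) l \<longleftrightarrow> nint A l"
 and op_cok: "ssmc.cok At ar trg src (\<lambda>g f. f ** g) ts ide (\<lambda>x y. sw y x) (du C) (du B) (du A) p i \<longleftrightarrow> kern A B C i p"
 and op_ses [simp]: "ssmc.ses At ar trg src (\<lambda>g f. f ** g) ts ide (\<lambda>x y. sw y x) (du C) (du B) (du A) p i \<longleftrightarrow> ses A B C i p"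
proof -
 interpret op: ssmc At ar trg src "\<lambda>g f. f ** g" ts ide "\<lambda>x y. sw y x" by (rule ssmc_op)
 show a: "op.int (du A) l \<longleftrightarrow> coint A l" unfolding op.int_def coint_def du_sel by blast
 show b: "op.coint (du A) l \<longleftrightarrow> int A l" unfolding op.coint_def int_def du_sel by blast
 show "op.nint (du A) l \<longleftrightarrow> ncoint A l" unfolding op.nint_def ncoint_def a du_sel ..
 show "op.ncoint (du A) l \<longleftrightarrow> nint A l" unfolding op.ncoint_def nint_def b du_sel ..
 show "op.cok (du C) (du B) (du A) p i \<longleftrightarrow> kern A B C i p" unfolding kern_def ..
 show "op.ses (du C) (du B) (du A) p i \<longleftrightarrow> ses A B C i p"
  unfolding op.ses_def ses_def op.kern_def kern_def du_du by blast
qed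

text \<open>
 The Eckmann-Hilton argument: composition and tensor product agree on scalars.
\<close>

lemma scalar_comm: "hom f [] [] ==> hom g [] [] ==> f ** g = g ** f"
proof -
 assume f: "hom f [] []" and g: "hom g [] []"
 have "f ** g = (f || ide []) ** (ide [] || g)" using f g by simp
 also have "\<dots> = (ide [] || g) ** (f || ide [])"
  using f g by (subst (1 2) ic) simp_all
 finally show ?thesis using f g by simp
qed

lemma pt_cp: assumes "ar \<phi>" "src \<phi> = []" "ar g" "trg g = ys"
 shows "(\<phi> || ide ys) ** g = \<phi> || g" "(ide ys || \<phi>) ** g = g || \<phi>"
proof -
 have o: "obs ys" using assms trg_obs by blast
 have "(\<phi> || ide ys) ** (ide [] || g) = (\<phi> ** ide []) || (ide ys ** g)"
  by (rule ic) (use assms o in simp_all)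
 thus "(\<phi> || ide ys) ** g = \<phi> || g" using assms by simp
 have "(ide ys || \<phi>) ** (g || ide []) = (ide ys ** g) || (\<phi> ** ide [])"
  by (rule ic) (use assms o in simp_all)
 thus "(ide ys || \<phi>) ** g = g || \<phi>" using assms by simp
qed

lemma wt_cp: assumes "ar l" "trg l = []" "ar g" "src g = ys"
 shows "g ** (l || ide ys) = l || g" "g ** (ide ys || l) = g || l"
proof -
 have o: "obs ys" using assms src_obs by blast
 have "(ide [] || g) ** (l || ide ys) = (ide [] ** l) || (g ** ide ys)"
  by (rule ic) (use assms o in simp_all)
 thus "g ** (l || ide ys) = l || g" using assms by simp
 have "(g || ide []) ** (ide ys || l) = (g ** ide ys) || (ide [] ** l)"
  by (rule ic) (use assms o in simp_all)
 thus "g ** (ide ys || l) = g || l" using assms by simp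
qed

lemma scalar_ts: "hom n [] [] ==> ar f ==> trg f = [] ==> n || f = n ** f"
 using pt_cp(1)[of n f "[]"] by simp

lemma wt_out: assumes "cc D" "frm D w" "trg w = []" "frm D u" "ar f" "src f = trg u"
 shows "f ** pair D w u = pair D w (f ** u)"
proof -
 have "(ide [] || f) ** pair D w u = pair D (ide [] ** w) (f ** u)"
  by (rule pair_ts) (use assms in simp_all)
 thus ?thesis using assms by simp
qed

lemma wt_left: assumes "cc D" "frm D w" "trg w = []" "frm D u" "frm D y"
 shows "pair D u (pair D w y) = pair D w (pair D u y)"
proof -
 have "pair D u (pair D w y) = pair D (pair D u w) y" by (rule pair_assoc[symmetric]) (use assms in simp_all)
 also have "pair D u w = pair D w u" by (rule pair_swap) (use assms in simp_all)
 also have "pair D (pair D w u) y = pair D w (pair D u y)" by (rule pair_assoc) (use assms in simp_all)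
 finally show ?thesis .
qed

lemma intD: assumes "int A \<phi>"
 shows "ar \<phi>" "src \<phi> = []" "trg \<phi> = und A" "nabla A ** (\<phi> || ide (und A)) = \<phi> ** eps A"
 using assms unfolding int_def by blast+

lemma cointD: assumes "coint A l"
 shows "ar l" "src l = und A" "trg l = []" "(l || ide (und A)) ** delta A = eta A ** l"
 using assms unfolding coint_def by blast+

lemma int_right: assumes [simp]: "hopf A" and f: "int A \<phi>" shows "nabla A ** (ide (und A) || \<phi>) = \<phi> ** eps A"
proof -
 note [simp] = intD(1-3)[OF f]
 have "ide (und A) || \<phi> = sw (und A) (und A) ** (\<phi> || ide (und A))"
  using sw_nat2[of \<phi> "[]" "und A" "und A"] sw_nat1[of \<phi> "[]" "und A" "und A"] by (simp add: sw_Nil_left)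
 hence "nabla A ** (ide (und A) || \<phi>) = (nabla A ** sw (und A) (und A)) ** (\<phi> || ide (und A))" by (simp only: cp_assoc)
 thus ?thesis using intD(4)[OF f] by (simp del: cp_assoc)
qed

lemma coint_right: "hopf A ==> coint A l ==> (ide (und A) || l) ** delta A = eta A ** l"
 using ssmc.int_right[OF ssmc_op, of "du A" l] by simp

lemma int_cv: assumes [simp]: "hopf A" "cc D" and f: "int A \<phi>" and x: "hom x (und D) (und A)"
 shows "cv A D (\<phi> ** eps D) x = \<phi> ** eps A ** x"
proof -
 note [simp] = intD(1-3)[OF f]
 have "cv A D (\<phi> ** eps D) x = (nabla A ** (\<phi> || ide (und A))) ** pair D (eps D) x"
  unfolding cp_assoc using x by (subst pair_ts) (simp_all add: cv_def)
 thus ?thesis unfolding intD(4)[OF f] using x by simp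
qed

text \<open>A cointegral is a weight concentrated at the unit.\<close>

lemma coint_pair: assumes [simp]: "hopf A" "cc D" and l: "coint A l" and x: "chom D A x"
 shows "pair D (l ** x) x = pair D (l ** x) (eta A ** eps D)"
proof -
 note [simp] = cointD(1-3)[OF l]
 have "pair D (l ** x) x = ((l || ide (und A)) ** delta A) ** x" using x by simp
 also have "\<dots> = eta A ** l ** x" unfolding cointD(4)[OF l] by simp
 also have "\<dots> = eta A ** pair D (l ** x) (eps D)" using x by simp
 also have "\<dots> = pair D (l ** x) (eta A ** eps D)" using x by (subst wt_out) (simp_all)
 finally show ?thesis .
qed

text \<open>
 Both integrals equal their product.
\<close>

lemma nint_unique: assumes [simp]: "hopf A" and f: "nint A \<phi>" and g: "nint A \<psi>" shows "\<phi> = \<psi>"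
proof -
 have fi: "int A \<phi>" "eps A ** \<phi> = ide []" and gi: "int A \<psi>" "eps A ** \<psi> = ide []"
  using f g unfolding nint_def by blast+
 note [simp] = intD(1-3)[OF fi(1)] intD(1-3)[OF gi(1)]
 have "nabla A ** (\<phi> || \<psi>) = (nabla A ** (\<phi> || ide (und A))) ** \<psi>"
  by (simp add: pt_cp)
 hence 1: "nabla A ** (\<phi> || \<psi>) = \<phi>" unfolding intD(4)[OF fi(1)] using gi(2) by simp
 have "nabla A ** (\<phi> || \<psi>) = (nabla A ** (ide (und A) || \<psi>)) ** \<phi>"
  by (simp add: pt_cp)
 hence "nabla A ** (\<phi> || \<psi>) = \<psi>" unfolding int_right[OF assms(1) gi(1)] using fi(2) by simp
 with 1 show ?thesis by simp
qed

lemma ncoint_unique: "hopf A ==> ncoint A l ==> ncoint A k ==> l = k"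
 using ssmc.nint_unique[OF ssmc_op, of "du A" l k] by simp

lemma anti_nint: assumes A [simp]: "hopf A" and f: "nint A \<phi>" shows "anti A ** \<phi> = \<phi>"
proof -
 have fi: "int A \<phi>" "eps A ** \<phi> = ide []" using f unfolding nint_def by blast+
 note [simp] = intD(1-3)[OF fi(1)]
 have ea: "eps A ** anti A = eps A" using anti_chom[OF A] by blast
 have "(anti A ** \<phi>) || ide (und A) = (anti A || anti A) ** (\<phi> || anti A)"
  by (subst ic) (simp_all add: anti_anti)
 hence "nabla A ** ((anti A ** \<phi>) || ide (und A)) = (nabla A ** (anti A || anti A)) ** (\<phi> || anti A)"
  by (simp only: cp_assoc)
 also have "\<dots> = anti A ** nabla A ** (\<phi> || ide (und A)) ** anti A"
  unfolding anti_nabla[OF A, symmetric] by (simp add: pt_cp)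
 also have "\<dots> = anti A ** (nabla A ** (\<phi> || ide (und A))) ** anti A" by (simp only: cp_assoc)
 also have "\<dots> = (anti A ** \<phi>) ** (eps A ** anti A)" unfolding intD(4)[OF fi(1)] by (simp only: cp_assoc)
 finally have "int A (anti A ** \<phi>)" unfolding int_def ea by simp
 moreover have "eps A ** anti A ** \<phi> = ide []" using ea fi(2) by (metis cp_assoc)
 ultimately have "nint A (anti A ** \<phi>)" unfolding nint_def by blast
 from nint_unique[OF A this f] show ?thesis .
qed

lemma ncoint_anti: "hopf A ==> ncoint A l ==> l ** anti A = l"
 using ssmc.anti_nint[OF ssmc_op, of "du A" l] by simp

section \<open>Integrals in short exact sequences\<close>

text \<open>
 Multiplication by an integral of \<open>A\<close> is invariant under translation by \<open>A\<close>, so it descends to a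
 \<open>B\<close>-linear arrow \<open>C \<rightarrow> B\<close>.
\<close>

definition norm_arr ::
  "('o list, 'a) bimon => ('o list, 'a) bimon => ('o list, 'a) bimon => 'a => 'a => 'a => 'a => bool" where
 "norm_arr A B C i p \<phi> s \<longleftrightarrow> hom s (und C) (und B) \<and> s ** p = nabla B ** ((i ** \<phi>) || ide (und B))"

context
 fixes A B C i p
 assumes c: "cok A B C i p"
begin

lemma cokD: "hopf A" "hopf B" "hopf C" "hhom A B i" "hhom B C p" "squot A (nabla B ** (i || ide (und B))) p"
 using c unfolding cok_def by blast+

lemma cok_hom: "ar i" "src i = und A" "trg i = und B" "eps B ** i = eps A" "i ** eta A = eta B"
 "ar p" "src p = und B" "trg p = und C" "eps C ** p = eps B" "p ** eta B = eta C"
 using cokD(4,5) by blast+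

lemmas cok_epi = tq_epi[OF cokD(1,2,4,6)]
lemmas cok_absorb = tq_absorb[OF cokD(1,2,4,6)]
lemmas cok_descend = tq_descend[OF cokD(1,2,4,6)]

lemma cok_zero: "p ** i = eta C ** eps A"
 using tq_zero[OF cokD(1,2,4,6)] cok_hom(10) by (metis cp_assoc)

text \<open>
 The image of an integral under a quotient map is invariant under the images of all points, and the quotient map is epi.
\<close>

lemma nint_quotient: assumes f: "nint B \<phi>" shows "nint C (p ** \<phi>)"
proof -
 note [simp] = cokD(1-3) cok_hom
 have fi: "int B \<phi>" "eps B ** \<phi> = ide []" using f unfolding nint_def by blast+
 note [simp] = intD(1-3)[OF fi(1)]
 have "nabla C ** ((p ** \<phi>) || ide (und C)) = (p ** \<phi>) ** eps C"
 proof (rule epi_cancel[OF cok_epi(1)])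
  have "((p ** \<phi>) || ide (und C)) ** p = (p || p) ** (\<phi> || ide (und B))"
   by (simp add: pt_cp ic)
  hence "(nabla C ** ((p ** \<phi>) || ide (und C))) ** p = (nabla C ** (p || p)) ** (\<phi> || ide (und B))"
   by (simp only: cp_assoc)
  also have "nabla C ** (p || p) = p ** nabla B" using cokD(5) by metis
  also have "(p ** nabla B) ** (\<phi> || ide (und B)) = p ** \<phi> ** eps B" by (simp only: cp_assoc intD(4)[OF fi(1)])
  finally show "(nabla C ** ((p ** \<phi>) || ide (und C))) ** p = ((p ** \<phi>) ** eps C) ** p" by simp
 qed simp_all
 moreover have "eps C ** p ** \<phi> = ide []" using fi(2) cok_hom(9) by (metis cp_assoc)
 ultimately show ?thesis unfolding nint_def int_def by simp
qed

lemma mult_point: assumes D: "cc D" and f: "hom \<phi> [] (und A)" and y: "hom y (und D) (und B)"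
 shows "(nabla B ** ((i ** \<phi>) || ide (und B))) ** y = cv B D (i ** \<phi> ** eps D) y"
proof -
 note [simp] = cokD(1-3) cok_hom D
 have "((i ** \<phi>) || ide (und B)) ** y = ((i ** \<phi>) || ide (und B)) ** pair D (eps D) y" using y by simp
 also have "\<dots> = pair D (i ** \<phi> ** eps D) y" using f y by (subst pair_ts) (simp_all)
 finally show ?thesis by (simp add: cv_def)
qed

lemma norm_arr_exists: assumes f: "int A \<phi>" shows "\<exists>s. norm_arr A B C i p \<phi> s"
proof -
 note [simp] = cokD(1-3) cok_hom intD(1-3)[OF f]
 let ?M = "nabla B ** ((i ** \<phi>) || ide (und B))"
 have "\<exists>u. hom u (trg p) (trg ?M) \<and> u ** p = ?M"
 proof (rule cok_descend)
  fix D x y assume D [simp]: "cc D" and x: "chom D A x" and y: "chom D B y"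
  have x1: "hom x (und D) (und A)" and y1: "hom y (und D) (und B)" and ex: "eps A ** x = eps D" using x y by blast+
  note [simp] = x1 y1
  have "?M ** cv B D (i ** x) y = cv B D (i ** \<phi> ** eps D) (cv B D (i ** x) y)"
   by (rule mult_point) simp_all
  also have "\<dots> = cv B D (cv B D (i ** \<phi> ** eps D) (i ** x)) y"
   by (rule cv_assoc[symmetric]) simp_all
  also have "cv B D (i ** \<phi> ** eps D) (i ** x) = i ** cv A D (\<phi> ** eps D) x"
   by (rule hhom_cv[symmetric, OF cokD(1,2) D cokD(4)]) simp_all
  also have "cv A D (\<phi> ** eps D) x = \<phi> ** eps D"
   using int_cv[OF cokD(1) D f x1] unfolding ex .
  also have "cv B D (i ** \<phi> ** eps D) y = ?M ** y"
   by (rule mult_point[symmetric]) simp_all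
  finally show "?M ** cv B D (i ** x) y = ?M ** y" .
 qed simp_all
 thus ?thesis unfolding norm_arr_def by auto
qed

lemma norm_arr_linear: assumes f: "int A \<phi>" and s: "norm_arr A B C i p \<phi> s"
 shows "nabla B ** (ide (und B) || s) = s ** nabla C ** (p || ide (und C))"
proof -
 note [simp] = cokD(1-3) cok_hom intD(1-3)[OF f]
 let ?M = "nabla B ** ((i ** \<phi>) || ide (und B))"
 have s1: "hom s (und C) (und B)" and sp: "s ** p = ?M" using s unfolding norm_arr_def by blast+
 note [simp] = s1
 show ?thesis
 proof (rule epi_cancel[OF cok_epi(5)[of "und B"]])
  obtain D x y where D [simp]: "cc D"
   and x: "chom D B x" and y: "chom D B y" and g: "pair D x y = ide (und B @ und B)"
   using generic2[OF hopf_cc[OF cokD(2)] hopf_cc[OF cokD(2)]] by blast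
  have x1: "hom x (und D) (und B)" and y1: "hom y (und D) (und B)" using x y by blast+
  note [simp] = x1 y1
  have "(nabla B ** (ide (und B) || ?M)) ** pair D x y = cv B D x (?M ** y)"
   by (simp add: nabla_pair)
  also have "\<dots> = cv B D x (cv B D (i ** \<phi> ** eps D) y)"
   by (subst mult_point[OF D]) simp_all
  also have "\<dots> = cv B D (i ** \<phi> ** eps D) (cv B D x y)"
   by (rule cv_left_comm) simp_all
  also have "\<dots> = (?M ** nabla B) ** pair D x y"
   unfolding cp_assoc[of ?M] nabla_pair[OF cokD(2) D] by (rule mult_point[OF D, symmetric]) simp_all
  finally have "nabla B ** (ide (und B) || ?M) = ?M ** nabla B" unfolding g by simp
  moreover have "(nabla B ** (ide (und B) || s)) ** (ide (und B) || p) = nabla B ** (ide (und B) || ?M)"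
   unfolding sp[symmetric] by (simp add: ic)
  moreover have "(s ** nabla C ** (p || ide (und C))) ** (ide (und B) || p) = s ** nabla C ** (p || p)"
   by (simp add: ic)
  moreover have "nabla C ** (p || p) = p ** nabla B" using cokD(5) by metis
  moreover have "s ** p ** nabla B = ?M ** nabla B" unfolding sp[symmetric] cp_assoc ..
  ultimately show "(nabla B ** (ide (und B) || s)) ** (ide (und B) || p)
    = (s ** nabla C ** (p || ide (und C))) ** (ide (und B) || p)" by metis
 qed simp_all
qed

text \<open>
 The section \<open>s\<close> is an average over \<open>A\<close>, so applied to an integral of \<open>C\<close> it is invariant under all of \<open>B\<close>.
\<close>

lemma nint_extension:
 assumes f: "nint A \<phi>" and g: "nint C \<psi>" and s: "norm_arr A B C i p \<phi> s"
 shows "nint B (s ** \<psi>)"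
proof -
 have fi: "int A \<phi>" "eps A ** \<phi> = ide []" and gi: "int C \<psi>" "eps C ** \<psi> = ide []"
  using f g unfolding nint_def by blast+
 note [simp] = cokD(1-3) cok_hom intD(1-3)[OF fi(1)] intD(1-3)[OF gi(1)]
 have s1: "hom s (und C) (und B)" and sp: "s ** p = nabla B ** ((i ** \<phi>) || ide (und B))"
  using s unfolding norm_arr_def by blast+
 note [simp] = s1
 have "sw (und B) (und B) ** ((s ** \<psi>) || ide (und B)) = ide (und B) || (s ** \<psi>)"
  using sw_nat1[of "s ** \<psi>" "[]" "und B" "und B"] by (simp add: sw_Nil_left)
 hence "nabla B ** ((s ** \<psi>) || ide (und B)) = nabla B ** (ide (und B) || (s ** \<psi>))"
  by (metis cp_assoc hopfD(10) cokD(2))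
 also have "\<dots> = (nabla B ** (ide (und B) || s)) ** (ide (und B) || \<psi>)"
  by (simp add: ic)
 also have "\<dots> = s ** nabla C ** (p || ide (und C)) ** (ide (und B) || \<psi>)"
  unfolding norm_arr_linear[OF fi(1) s] by (simp only: cp_assoc)
 also have "(p || ide (und C)) ** (ide (und B) || \<psi>) = (ide (und C) || \<psi>) ** p"
  by (simp add: ic pt_cp)
 also have "s ** nabla C ** (ide (und C) || \<psi>) ** p = s ** (nabla C ** (ide (und C) || \<psi>)) ** p"
  by (simp only: cp_assoc)
 also have "\<dots> = (s ** \<psi>) ** eps B" unfolding int_right[OF cokD(3) gi(1)] by simp
 finally have 1: "int B (s ** \<psi>)" unfolding int_def by simp
 have "eps B ** s = eps C"
 proof (rule epi_cancel[OF cok_epi(1)])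
  have ef: "eps B ** i ** \<phi> = ide []" using fi(2) cok_hom(4) by (metis cp_assoc)
  have "(eps B ** s) ** p = (eps B ** nabla B) ** ((i ** \<phi>) || ide (und B))" by (simp only: cp_assoc sp)
  also have "\<dots> = eps B" by (simp add: ic ef)
  finally show "(eps B ** s) ** p = eps C ** p" by simp
 qed simp_all
 hence "eps B ** s ** \<psi> = ide []" using gi(2) by (metis cp_assoc)
 with 1 show ?thesis unfolding nint_def by simp
qed

end

end

context ssmc begin

text \<open>
 The dual of the averaging section: a \<open>B\<close>-colinear arrow onto the kernel, obtained by restricting with the weight \<open>l p\<close>.
\<close>

definition conorm_arr ::
  "('o list, 'a) bimon => ('o list, 'a) bimon => ('o list, 'a) bimon => 'a => 'a => 'a => 'a => bool" where
 "conorm_arr A B C i p l r \<longleftrightarrow> hom r (und B) (und A) \<and> i ** r = ((l ** p) || ide (und B)) ** delta B"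

lemma op_norm_arr: "ssmc.norm_arr ar trg src (\<lambda>g f. f ** g) ts ide (du C) (du B) (du A) p i l r
  \<longleftrightarrow> conorm_arr A B C i p l r"
proof -
 interpret op: ssmc At ar trg src "\<lambda>g f. f ** g" ts ide "\<lambda>x y. sw y x" by (rule ssmc_op)
 show "op.norm_arr (du C) (du B) (du A) p i l r \<longleftrightarrow> conorm_arr A B C i p l r"
  unfolding op.norm_arr_def conorm_arr_def du_sel by blast
qed

lemma op_epi: "ssmc.epi ar trg src (\<lambda>g f. f ** g) f \<longleftrightarrow>
  ar f \<and> (\<forall>g h. ar g --> ar h --> trg g = src f --> trg h = src f --> f ** g = f ** h --> g = h)"
proof -
 interpret op: ssmc At ar trg src "\<lambda>g f. f ** g" ts ide "\<lambda>x y. sw y x" by (rule ssmc_op)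
 show "op.epi f \<longleftrightarrow> ar f \<and> (\<forall>g h. ar g --> ar h --> trg g = src f --> trg h = src f --> f ** g = f ** h --> g = h)"
  unfolding op.epi_def ..
qed

context
 fixes A B C i p
 assumes se: "ses A B C i p"
begin

lemma ses_cok: "cok A B C i p" using se unfolding ses_def by blast

lemma ses_opcok: "ssmc.cok At ar trg src (\<lambda>g f. f ** g) ts ide (\<lambda>x y. sw y x) (du C) (du B) (du A) p i"
 unfolding op_cok using se unfolding ses_def by blast

lemmas sesD = cokD[OF ses_cok] and ses_hom = cok_hom[OF ses_cok] and ses_absorb = cok_absorb[OF ses_cok]
 and ses_zero = cok_zero[OF ses_cok]

lemma ses_mono: "[|ar g; ar h; trg g = und A; trg h = und A; i ** g = i ** h|] ==> g = h"
 using ssmc.cok_epi(1)[OF ssmc_op ses_opcok, unfolded op_epi] ses_hom(2) by metis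

lemma ncoint_sub: "ncoint B l ==> ncoint A (l ** i)"
 using ssmc.nint_quotient[OF ssmc_op ses_opcok, of l] by simp

lemma conorm_arr_exists: "coint C l ==> \<exists>r. conorm_arr A B C i p l r"
 using ssmc.norm_arr_exists[OF ssmc_op ses_opcok, of l] by (simp add: op_norm_arr)

lemma ncoint_extension: "[|ncoint C l; ncoint A k; conorm_arr A B C i p l r|] ==> ncoint B (k ** r)"
 using ssmc.nint_extension[OF ssmc_op ses_opcok, of l k r] by (simp add: op_norm_arr)

context
 fixes l r
 assumes l: "coint C l" and r: "conorm_arr A B C i p l r"
begin

lemma conormD: "ar r" "src r = und B" "trg r = und A" "i ** r = ((l ** p) || ide (und B)) ** delta B"
 using r unfolding conorm_arr_def by blast+

lemma conorm_point: assumes D: "cc D" and y: "chom D B y" shows "i ** r ** y = pair D (l ** p ** y) y"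
proof -
 note [simp] = sesD(1-3) ses_hom D cointD(1-3)[OF l]
 have "i ** r ** y = (((l ** p) || ide (und B)) ** delta B) ** y" unfolding conormD(4)[symmetric] by (simp only: cp_assoc)
 thus ?thesis using y by simp
qed

lemma conorm_linear: "r ** nabla B ** (i || ide (und B)) = nabla A ** (ide (und A) || r)"
proof (rule ses_mono)
 note [simp] = sesD(1-3) ses_hom conormD(1-3) cointD(1-3)[OF l]
 obtain D x y where D [simp]: "cc D" and x: "chom D A x" and y: "chom D B y" and g: "pair D x y = ide (und A @ und B)"
  using generic2[OF hopf_cc[OF sesD(1)] hopf_cc[OF sesD(2)]] by blast
 have x1: "hom x (und D) (und A)" "eps A ** x = eps D" and y1: "hom y (und D) (und B)" using x y by blast+
 note [simp] = x1 y1
 let ?z = "cv B D (i ** x) y" and ?w = "l ** p ** y"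
 have ix: "chom D B (i ** x)" by (rule chom_comp[OF _ _ _ x]) (use sesD(4) in simp_all)
 have z: "chom D B ?z" by (rule cv_chom[OF sesD(2) D ix y])
 have "(i ** r ** nabla B ** (i || ide (und B))) ** pair D x y = i ** r ** ?z"
  by (simp add: nabla_pair)
 also have "\<dots> = pair D (l ** p ** ?z) ?z" by (rule conorm_point[OF D z])
 also have "p ** ?z = p ** y" by (rule ses_absorb) simp_all
 finally have 1: "(i ** r ** nabla B ** (i || ide (und B))) ** pair D x y = pair D ?w ?z" .
 have "(i ** nabla A ** (ide (und A) || r)) ** pair D x y = i ** cv A D x (r ** y)"
  by (simp add: nabla_pair)
 also have "\<dots> = cv B D (i ** x) (i ** r ** y)"
  by (rule hhom_cv[OF sesD(1,2) D sesD(4)]) simp_all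
 also have "\<dots> = nabla B ** pair D (i ** x) (pair D ?w y)"
  unfolding conorm_point[OF D y] cv_def ..
 also have "\<dots> = pair D ?w ?z"
  by (subst wt_left) (simp_all add: wt_out cv_def)
 finally show "i ** (r ** nabla B ** (i || ide (und B))) = i ** (nabla A ** (ide (und A) || r))"
  using 1 unfolding g by simp
qed (use sesD(1-3) ses_hom conormD(1-3) in simp_all)

lemma eps_conorm: "eps A ** r = l ** p"
proof -
 note [simp] = sesD(1-3) ses_hom conormD(1-3) cointD(1-3)[OF l]
 have "eps A ** r = eps B ** i ** r" using ses_hom(4) by (metis cp_assoc)
 also have "\<dots> = eps B ** pair B (l ** p) (ide (und B))" unfolding conormD(4) pair_def ..
 also have "\<dots> = l ** p" by (subst wt_out) simp_all
 finally show ?thesis .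
qed

lemma conorm_norm: assumes f: "int A \<phi>" and s: "norm_arr A B C i p \<phi> s" shows "r ** s = \<phi> ** l"
proof (rule epi_cancel[OF cok_epi(1)[OF ses_cok]])
 note [simp] = sesD(1-3) ses_hom conormD(1-3) cointD(1-3)[OF l] intD(1-3)[OF f]
 have s1: "hom s (und C) (und B)" and sp: "s ** p = nabla B ** ((i ** \<phi>) || ide (und B))"
  using s unfolding norm_arr_def by blast+
 note [simp] = s1
 have "(r ** s) ** p = (r ** nabla B ** (i || ide (und B))) ** (\<phi> || ide (und B))"
  unfolding cp_assoc sp by (simp add: ic)
 also have "\<dots> = nabla A ** (\<phi> || ide (und A)) ** r"
  unfolding conorm_linear by (simp add: ic pt_cp)
 also have "\<dots> = (nabla A ** (\<phi> || ide (und A))) ** r" by (simp only: cp_assoc)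
 also have "\<dots> = \<phi> ** eps A ** r" unfolding intD(4)[OF f] by (simp only: cp_assoc)
 also have "\<dots> = (\<phi> ** l) ** p" unfolding eps_conorm by (simp only: cp_assoc)
 finally show "(r ** s) ** p = (\<phi> ** l) ** p" .
 show "ar (r ** s)" "ar (\<phi> ** l)" "src (r ** s) = trg p" "src (\<phi> ** l) = trg p" by simp_all
qed

end

text \<open>
 The composite of the section given by \<open>\<phi>\<close> and the retraction given by \<open>l\<close> factors through a scalar, which turns the volume of \<open>B\<close> into the product of the two volumes.
\<close>

theorem extension:
 assumes "nint A \<phi>" "ncoint A k" "nint C \<psi>" "ncoint C l"
 shows "\<exists>\<Phi> L. nint B \<Phi> \<and> ncoint B L \<and> L ** \<Phi> = (k ** \<phi>) ** (l ** \<psi>)"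
proof -
 have f: "int A \<phi>" and l: "coint C l" using assms unfolding nint_def ncoint_def by blast+
 obtain s where s: "norm_arr A B C i p \<phi> s" using norm_arr_exists[OF ses_cok f] by blast
 obtain r where r: "conorm_arr A B C i p l r" using conorm_arr_exists[OF l] by blast
 have "nint B (s ** \<psi>)" by (rule nint_extension[OF ses_cok assms(1,3) s])
 moreover have "ncoint B (k ** r)" by (rule ncoint_extension[OF assms(4,2) r])
 moreover have "(k ** r) ** (s ** \<psi>) = k ** (r ** s) ** \<psi>" by (simp only: cp_assoc)
 hence "(k ** r) ** (s ** \<psi>) = (k ** \<phi>) ** (l ** \<psi>)"
  unfolding conorm_norm[OF l r f s] by (simp only: cp_assoc)
 ultimately show ?thesis by blast
qed

end

section \<open>The dual bimonoid\<close>

lemma generic4: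
 assumes [simp]: "cc A"
 obtains D x y z w where "cc D" "und D = und A @ und A @ und A @ und A" "chom D A x" "chom D A y" "chom D A z" "chom D A w"
  "pair D x (pair D y (pair D z w)) = ide (und A @ und A @ und A @ und A)"
proof -
 obtain E x y z where E [simp]: "cc E" and uE: "und E = und A @ und A @ und A" and x: "chom E A x" and y: "chom E A y" and z: "chom E A z"
  and g: "pair E x (pair E y z) = ide (und A @ und A @ und A)"
  using generic3[OF assms assms assms] by blast
 let ?D = "tb A E" let ?q = "p2 A E"
 have c: "cc ?D" by simp
 have q: "chom ?D E ?q" and w: "chom ?D A (p1 A E)" by (rule p2_chom p1_chom; simp)+
 note k = chom_comp[OF assms c E q]
 have "pair ?D (x ** ?q) (pair ?D (y ** ?q) (z ** ?q)) = pair E x (pair E y z) ** ?q"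
  using pair_comp[OF E c q, of x "pair E y z"] pair_comp[OF E c q, of y z] x y z by simp
 also have "\<dots> = ?q" unfolding g by (simp add: uE)
 finally have "pair ?D (p1 A E) (pair ?D (x ** ?q) (pair ?D (y ** ?q) (z ** ?q))) = ide (und A @ und A @ und A @ und A)"
  using pair_p1_p2[of A E] by (simp add: uE)
 moreover have "und ?D = und A @ und A @ und A @ und A" by (simp add: uE)
 ultimately show ?thesis using that[OF c _ w k[OF x] k[OF y] k[OF z]] by blast
qed

text \<open>
 With \<open>i\<close> suppressed, on group-like elements \<open>(a, b) \<mapsto> (a, S(a) b)\<close>.
\<close>

definition div_arr :: "('o list, 'a) bimon => ('o list, 'a) bimon => 'a => 'a" where
 "div_arr A B i = (ide (und A) || (nabla B ** ((i ** anti A) || ide (und B)))) ** (delta A || ide (und B))"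

text \<open>
 On elements \<open>b \<mapsto> t\<^sub>1 \<otimes> i(S(t\<^sub>2)) b\<close>: the coaction on \<open>B\<close> that corresponds to translation by \<open>A\<close> when \<open>A\<close> is identified with its dual through the integral \<open>t\<close>.
\<close>

definition hit :: "('o list, 'a) bimon => ('o list, 'a) bimon => 'a => 'a => 'a" where
 "hit A B i t = div_arr A B i ** (t || ide (und B))"

text \<open>
 On elements \<open>a \<otimes> b \<mapsto> a\<^sub>1 k(S(a\<^sub>2) b)\<close>. If \<open>A\<close> is the algebra of a finite group and \<open>k\<close> the coefficient of the unit, this is pointwise multiplication.
\<close>

definition diag_mult :: "('o list, 'a) bimon => 'a => 'a" where
 "diag_mult A k = (ide (und A) || (k ** nabla A ** (anti A || ide (und A)))) ** (delta A || ide (und A))"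

text \<open>
 The dual of \<open>A\<close> transported to the object of \<open>A\<close> by means of the integral \<open>t\<close> and the cointegral \<open>k\<close>, normalized by \<open>k t = 1\<close>. Its unit is \<open>t\<close> and its counit is \<open>k\<close>.
\<close>

definition dual_bimonoid :: "('o list, 'a) bimon => 'a => 'a => ('o list, 'a) bimon" where
 "dual_bimonoid A t k = \<lparr>und = und A, nabla = diag_mult A k, eta = t, delta = hit A A (ide (und A)) t, eps = k\<rparr>"

lemma cv_anti_left: assumes A: "hopf A" and D: "cc D" and u: "chom D A u" and v: "hom v (und D) (und A)"
 shows "cv A D (anti A ** u) (cv A D u v) = v" "cv A D u (cv A D (anti A ** u) v) = v"
proof -
 note [simp] = A D
 have u1: "hom u (und D) (und A)" using u by blast
 note [simp] = u1 v
 have "cv A D (anti A ** u) (cv A D u v) = cv A D (cv A D (anti A ** u) u) v"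
  by (rule cv_assoc[symmetric]) simp_all
 thus 1: "cv A D (anti A ** u) (cv A D u v) = v" unfolding cv_anti[OF A D u] by simp
 have "cv A D u (cv A D (anti A ** u) v) = cv A D (anti A ** u) (cv A D u v)"
  by (rule cv_left_comm) simp_all
 thus "cv A D u (cv A D (anti A ** u) v) = v" using 1 by simp
qed

context
 fixes A B i
 assumes A: "hopf A" and B: "hopf B" and i: "hhom A B i"
begin

lemma i_hom': "ar i" "src i = und A" "trg i = und B" "eps B ** i = eps A" "i ** eta A = eta B"
 using i by blast+

lemma div_hom: "ar (div_arr A B i)" "src (div_arr A B i) = und A @ und B" "trg (div_arr A B i) = und A @ und B"
 using A B i_hom' by (simp_all add: div_arr_def)

lemma div_pair: assumes D: "cc D" and u: "chom D A u" and v: "hom v (und D) (und B)"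
 shows "div_arr A B i ** pair D u v = pair D u (cv B D (i ** anti A ** u) v)"
proof -
 note [simp] = A B i_hom' D
 have u1: "hom u (und D) (und A)" and du: "delta A ** u = pair D u u" using u by blast+
 note [simp] = u1 v
 have "div_arr A B i ** pair D u v = (ide (und A) || (nabla B ** ((i ** anti A) || ide (und B)))) ** pair D (delta A ** u) v"
  by (simp add: div_arr_def)
 thus ?thesis unfolding du by (simp add: nabla_pair)
qed

end

end

context ssmc begin

text \<open>
 A delta function: the weight of the condition that two elements are equal.
\<close>

definition ev :: "('o list, 'a) bimon => 'a => ('o list, 'a) bimon => 'a => 'a => 'a" where
 "ev A k D u v = k ** cv A D (anti A ** u) v"

context
 fixes A t k
 assumes A: "hopf A" and t: "int A t" and k: "ncoint A k" and kt: "k ** t = ide []"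
begin

lemma k_coint: "coint A k" and k_eta: "k ** eta A = ide []"
 using k unfolding ncoint_def by blast+

lemmas t_hom = intD(1-3)[OF t] and k_hom = cointD(1-3)[OF k_coint]

lemma id_hhom: "hhom A A (ide (und A))" using chom_ide[OF hopf_cc[OF A]] A by (simp add: cp_ide2)

lemma diag_hom: "ar (diag_mult A k)" "src (diag_mult A k) = und A @ und A" "trg (diag_mult A k) = und A"
 using A k_hom by (simp_all add: diag_mult_def)

context
 fixes D assumes D: "cc D"
begin

lemma ev_hom: "hom u (und D) (und A) ==> hom v (und D) (und A) ==> hom (ev A k D u v) (und D) []"
 using A D k_hom by (simp add: ev_def)

lemma diag_pair: assumes u: "chom D A u" and v: "hom v (und D) (und A)"
 shows "diag_mult A k ** pair D u v = pair D u (ev A k D u v)"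
proof -
 note [simp] = A D k_hom
 have u1: "hom u (und D) (und A)" and du: "delta A ** u = pair D u u" using u by blast+
 note [simp] = u1 v
 have "diag_mult A k ** pair D u v = (ide (und A) || (k ** nabla A ** (anti A || ide (und A)))) ** pair D (delta A ** u) v"
  by (simp add: diag_mult_def)
 thus ?thesis unfolding du by (simp add: nabla_pair ev_def)
qed

lemma ev_comm: assumes u: "hom u (und D) (und A)" and v: "hom v (und D) (und A)"
 shows "ev A k D u v = ev A k D v u"
proof -
 note [simp] = A D k_hom u v
 have a: "anti A ** anti A ** u = u" using anti_anti[OF A] u by (metis cp_assoc ide_cp)
 have "ev A k D u v = (k ** anti A) ** cv A D (anti A ** u) v" unfolding ncoint_anti[OF A k] ev_def ..
 also have "\<dots> = k ** cv A D (anti A ** anti A ** u) (anti A ** v)"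
  unfolding cp_assoc by (subst hhom_cv[OF A A D anti_hhom[OF A]]) simp_all
 also have "\<dots> = ev A k D v u" unfolding a ev_def by (subst cv_comm) simp_all
 finally show ?thesis .
qed

lemma ev_subst: assumes u: "chom D A u" and v: "chom D A v"
 shows "pair D (ev A k D u v) v = pair D (ev A k D u v) u"
proof -
 note [simp] = A D k_hom
 have u1: "hom u (und D) (und A)" and v1: "hom v (und D) (und A)" using u v by blast+
 note [simp] = u1 v1
 let ?y = "cv A D (anti A ** u) v" and ?w = "ev A k D u v"
 have su: "chom D A (anti A ** u)" by (rule chom_comp[OF hopf_cc[OF A] D hopf_cc[OF A] u anti_chom[OF A]])
 have y: "chom D A ?y" by (rule cv_chom[OF A D su v])
 have w: "?w = k ** ?y" by (simp add: ev_def)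
 have w1: "hom ?w (und D) []" by (rule ev_hom) simp_all
 note [simp] = w1
 have "pair D ?w v = pair D ?w (cv A D u ?y)" using cv_anti_left(2)[OF A D u v1] by simp
 also have "\<dots> = nabla A ** pair D u (pair D ?w ?y)"
  unfolding cv_def[of A D u] by (subst wt_left) (simp_all add: wt_out)
 also have "pair D ?w ?y = pair D ?w (eta A ** eps D)"
  unfolding w by (rule coint_pair[OF A D k_coint y])
 also have "nabla A ** pair D u (pair D ?w (eta A ** eps D)) = pair D ?w (cv A D u (eta A ** eps D))"
  unfolding cv_def[of A D u] by (subst wt_left) (simp_all add: wt_out)
 finally show ?thesis by simp
qed

lemma ev_subst_ev: assumes u: "chom D A u" and v: "chom D A v" and w: "hom w (und D) (und A)"
 shows "pair D (ev A k D u v) (ev A k D v w) = pair D (ev A k D u v) (ev A k D u w)"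
proof -
 note [simp] = A D k_hom
 have u1: "hom u (und D) (und A)" and v1: "hom v (und D) (und A)" using u v by blast+
 have w1: "hom (ev A k D u v) (und D) []" by (rule ev_hom[OF u1 v1])
 note [simp] = u1 v1 w w1
 let ?f = "k ** nabla A ** (anti A || ide (und A))"
 have f: "ev A k D q w = ?f ** pair D q w" if "hom q (und D) (und A)" for q
  using that by (simp add: ev_def cv_def)
 have "pair D (ev A k D u v) (ev A k D v w) = ?f ** pair D (pair D (ev A k D u v) v) w"
  unfolding f[OF v1] by (subst pair_assoc, simp_all only: D, simp_all, subst (2) wt_out, simp_all add: wt_out)
 also have "\<dots> = pair D (ev A k D u v) (ev A k D u w)"
  unfolding f[OF u1] ev_subst[OF u v]
  by (subst pair_assoc, simp_all only: D, simp_all, subst wt_out, simp_all add: wt_out)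
 finally show ?thesis .
qed

end

lemma diag_assoc: "diag_mult A k ** (diag_mult A k || ide (und A)) = diag_mult A k ** (ide (und A) || diag_mult A k)"
proof -
 note [simp] = A k_hom diag_hom
 obtain D x y z where D [simp]: "cc D" and x: "chom D A x" and y: "chom D A y" and z: "chom D A z"
  and g: "pair D x (pair D y z) = ide (und A @ und A @ und A)"
  using generic3[OF hopf_cc[OF A] hopf_cc[OF A] hopf_cc[OF A]] by blast
 have h: "hom x (und D) (und A)" "hom y (und D) (und A)" "hom z (und D) (und A)" using x y z by blast+
 note [simp] = h ev_hom[OF D h(1,2)] ev_hom[OF D h(2,3)] ev_hom[OF D h(1,3)]
 let ?m = "diag_mult A k" and ?xy = "ev A k D x y" and ?xz = "ev A k D x z" and ?yz = "ev A k D y z"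
 have "(?m ** (?m || ide (und A))) ** pair D x (pair D y z) = ?m ** pair D x (pair D ?xy z)"
  by (simp add: diag_pair[OF D x])
 also have "\<dots> = pair D ?xy (?m ** pair D x z)"
  by (subst wt_left) (simp_all add: wt_out)
 also have "\<dots> = pair D (pair D ?xy ?xz) x"
  unfolding diag_pair[OF D x h(3)]
  by (subst pair_swap[of D ?xz x]) simp_all
 also have "pair D ?xy ?xz = pair D ?yz ?xy"
  unfolding ev_subst_ev[OF D x y h(3), symmetric] by (rule pair_swap) simp_all
 also have "pair D (pair D ?yz ?xy) x = pair D ?yz (pair D x ?xy)"
  by (subst pair_swap[of D ?xy x]) simp_all
 also have "\<dots> = ?m ** pair D ?yz (pair D x y)"
  by (subst wt_out) (simp_all add: diag_pair[OF D x])
 also have "pair D ?yz (pair D x y) = pair D x (pair D y ?yz)"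
  by (subst pair_swap[of D ?yz "pair D x y", symmetric]) simp_all
 also have "?m ** \<dots> = (?m ** (ide (und A) || ?m)) ** pair D x (pair D y z)"
  by (simp add: diag_pair[OF D y])
 finally show ?thesis unfolding g by simp
qed

lemma diag_comm: "diag_mult A k ** sw (und A) (und A) = diag_mult A k"
proof -
 note [simp] = A k_hom diag_hom
 obtain D x y where D [simp]: "cc D" and x: "chom D A x" and y: "chom D A y" and g: "pair D x y = ide (und A @ und A)"
  using generic2[OF hopf_cc[OF A] hopf_cc[OF A]] by blast
 have h: "hom x (und D) (und A)" "hom y (und D) (und A)" using x y by blast+
 note [simp] = h ev_hom[OF D h(1,2)]
 have "(diag_mult A k ** sw (und A) (und A)) ** pair D x y = pair D y (ev A k D y x)"
  by (simp add: diag_pair[OF D y])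
 also have "\<dots> = pair D (ev A k D x y) y"
  unfolding ev_comm[OF D h(2,1)] by (rule pair_swap) simp_all
 also have "\<dots> = pair D x (ev A k D x y)"
  unfolding ev_subst[OF D x y] by (rule pair_swap[symmetric]) simp_all
 also have "\<dots> = diag_mult A k ** pair D x y" by (rule diag_pair[OF D x h(2), symmetric])
 finally show ?thesis unfolding g by simp
qed

lemma nabla_t: "ar f ==> trg f = und A ==> nabla A ** (f || t) = t ** eps A ** f"
proof -
 note [simp] = A t_hom
 assume f: "ar f" "trg f = und A"
 have "nabla A ** (f || t) = (nabla A ** (ide (und A) || t)) ** f" using f by (simp add: pt_cp)
 thus ?thesis unfolding int_right[OF A t] by simp
qed

lemma counit_right: "(ide (und A) || eps A) ** delta A = ide (und A)"
 using pair_eps_right[of A "ide (und A)"] A by (simp add: pair_def del: pair_eps_right)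

lemma eps_anti: "eps A ** anti A = eps A" using anti_chom[OF A] by blast

lemma diag_unit: "diag_mult A k ** (ide (und A) || t) = ide (und A)" "diag_mult A k ** (t || ide (und A)) = ide (und A)"
proof -
 note [simp] = A k_hom diag_hom t_hom
 have kte: "k ** t ** eps A = eps A" using kt by (metis cp_assoc ide_cp ccD(5,7) hopf_cc[OF A])
 let ?K = "k ** nabla A ** (anti A || ide (und A))"
 have "(delta A || ide (und A)) ** (ide (und A) || t) = (ide (und A @ und A) || t) ** delta A"
  by (simp add: ic pt_cp)
 hence "diag_mult A k ** (ide (und A) || t) = ((ide (und A) || ?K) ** (ide (und A) || (ide (und A) || t))) ** delta A"
  by (simp add: diag_mult_def ide_app)
 also have "(ide (und A) || ?K) ** (ide (und A) || (ide (und A) || t)) = ide (und A) || (k ** nabla A ** (anti A || t))"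
  by (simp add: ic)
 also have "k ** nabla A ** (anti A || t) = eps A" by (simp add: nabla_t eps_anti kte)
 finally show 1: "diag_mult A k ** (ide (und A) || t) = ide (und A)" by (simp only: counit_right)
 have "sw (und A) (und A) ** (ide (und A) || t) = t || ide (und A)"
  using sw_nat2[of t "[]" "und A" "und A"] by (simp add: sw_Nil_right)
 hence "diag_mult A k ** (t || ide (und A)) = (diag_mult A k ** sw (und A) (und A)) ** (ide (und A) || t)"
  by (simp only: cp_assoc)
 thus "diag_mult A k ** (t || ide (und A)) = ide (und A)" unfolding diag_comm using 1 by simp
qed

lemma counit_div: assumes B: "hopf B" and i: "hhom A B i"
 shows "(k || ide (und B)) ** div_arr A B i = k || ide (und B)"
proof -
 note [simp] = A B k_hom i_hom'[OF A B i]
 let ?X = "nabla B ** ((i ** anti A) || ide (und B))"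
 have "(k || ide (und B)) ** div_arr A B i = (k || ?X) ** (delta A || ide (und B))"
  unfolding div_arr_def cp_assoc[symmetric] by (subst ic) simp_all
 also have "k || ?X = ?X ** (k || ide (und A @ und B))"
  by (rule wt_cp(1)[symmetric]) simp_all
 also have "(?X ** (k || ide (und A @ und B))) ** (delta A || ide (und B)) = ?X ** (((k || ide (und A)) ** delta A) || ide (und B))"
  by (simp add: ide_app ic21)
 also have "(k || ide (und A)) ** delta A = eta A ** k" by (rule cointD(4)[OF k_coint])
 also have "?X ** ((eta A ** k) || ide (und B)) = nabla B ** ((i ** (anti A ** eta A) ** k) || ide (und B))"
  by (simp add: ic)
 also have "i ** (anti A ** eta A) ** k = eta B ** k"
  unfolding anti_eta[OF A] using i_hom'(5)[OF A B i] by (metis cp_assoc)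
 also have "nabla B ** ((eta B ** k) || ide (und B)) = (nabla B ** (eta B || ide (und B))) ** (k || ide (und B))"
  unfolding cp_assoc by (subst ic) simp_all
 also have "\<dots> = k || ide (und B)" by (simp del: cp_assoc)
 finally show ?thesis .
qed

lemma hit_hom: assumes "hopf B" "hhom A B i"
 shows "ar (hit A B i t)" "src (hit A B i t) = und B" "trg (hit A B i t) = und A @ und B"
 using div_hom[OF A assms] assms(1) t_hom by (simp_all add: hit_def)

lemma hit_counit: assumes B: "hopf B" and i: "hhom A B i"
 shows "(k || ide (und B)) ** hit A B i t = ide (und B)"
proof -
 note [simp] = A B k_hom t_hom
 have "(k || ide (und B)) ** hit A B i t = ((k || ide (und B)) ** div_arr A B i) ** (t || ide (und B))"
  unfolding hit_def by (simp only: cp_assoc)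
 also have "\<dots> = (k ** t) || ide (und B)" unfolding counit_div[OF B i] by (simp add: ic)
 finally show ?thesis unfolding kt by simp
qed

lemma shear_t: "(ide (und A) || nabla A) ** (delta A || ide (und A)) ** (t || t) = t || t"
proof -
 note [simp] = A t_hom
 have "(delta A || ide (und A)) ** (t || t) = (ide (und A) || ide (und A) || t) ** delta A ** t"
  using pt_cp(2)[of t "delta A ** t" "und A @ und A"] by (simp add: ic ide_app)
 hence "(ide (und A) || nabla A) ** (delta A || ide (und A)) ** (t || t)
   = ((ide (und A) || nabla A) ** (ide (und A) || (ide (und A) || t))) ** delta A ** t" by simp
 also have "(ide (und A) || nabla A) ** (ide (und A) || (ide (und A) || t)) = ide (und A) || (t ** eps A)"
  by (subst ic) (simp_all add: int_right[OF A t])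
 also have "\<dots> ** delta A ** t = ((ide (und A) || t) ** ((ide (und A) || eps A) ** delta A)) ** t"
  by (simp add: ic_r)
 also have "\<dots> = t || t" unfolding counit_right by (simp add: pt_cp)
 finally show ?thesis .
qed

text \<open>
 Both sides rearrange the same diagram applied to \<open>t || t\<close>. They differ by a shear of the two parameters, under which \<open>t || t\<close> is invariant since \<open>t\<close> is an integral.
\<close>

lemma hit_coassoc: assumes B: "hopf B" and i: "hhom A B i"
 shows "(hit A A (ide (und A)) t || ide (und B)) ** hit A B i t = (ide (und A) || hit A B i t) ** hit A B i t"
proof -
 note dh = div_hom[OF A B i] and dg = div_hom[OF A A id_hhom]
 note [simp] = A B t_hom i_hom'[OF A B i] dh dg
 let ?a = "ide (und A)" and ?b = "ide (und B)"
 let ?H = "div_arr A B i" and ?G = "div_arr A A (ide (und A))"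
 let ?s = "sw (und A) (und A)"
 let ?N = "((?a || nabla A) ** (delta A || ?a)) || ?b"
 let ?Q1 = "(?a || ?H) ** (?s || ?b) ** (?a || ?H)" and ?Q2 = "(?G || ?b) ** (?a || ?H)"
 let ?T = "t || t || ?b"
 have st: "?s ** (t || ?a) = ?a || t"
  using sw_nat1[of t "[]" "und A" "und A"] by (simp add: sw_Nil_left)
 have stt: "?s ** (t || t) = t || t" using sw_nat[of t t] by (simp add: sw_Nil_left)
 have tH: "(t || ?a || ?b) ** ?H = (?a || ?H) ** (t || ?a || ?b)"
  using pt_cp(1)[of t ?H "und A @ und B"] by (simp add: ide_app ic cp_ide2)
 have tt: "(t || ?a || ?b) ** (t || ?b) = ?T" by (simp add: ic pt_cp ide_app[symmetric]) (simp add: pt_cp)?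
 have L: "(hit A A ?a t || ?b) ** hit A B i t = ?Q2 ** ?T"
 proof -
  have "hit A A ?a t || ?b = (?G || ?b) ** (t || ?a || ?b)" unfolding hit_def by (simp add: ic21')
  hence "(hit A A ?a t || ?b) ** hit A B i t = (?G || ?b) ** ((t || ?a || ?b) ** ?H) ** (t || ?b)"
   by (simp add: hit_def)
  also have "\<dots> = (?G || ?b) ** (?a || ?H) ** ((t || ?a || ?b) ** (t || ?b))" unfolding tH by (simp only: cp_assoc)
  finally show ?thesis unfolding tt by (simp only: cp_assoc)
 qed
 have R: "(?a || hit A B i t) ** hit A B i t = ?Q1 ** ?T"
 proof -
  have "?a || t || ?b = (?s || ?b) ** (t || ?a || ?b)" by (simp add: ic21' st)
  hence "?a || hit A B i t = (?a || ?H) ** (?s || ?b) ** (t || ?a || ?b)"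
   unfolding hit_def by (metis ic dh ide_cp cp_ide ar_ide src_ide trg_ide ar_ts t_hom hopfD(1) A B src_ts trg_ts append_Nil)
  hence "(?a || hit A B i t) ** hit A B i t = (?a || ?H) ** (?s || ?b) ** ((t || ?a || ?b) ** ?H) ** (t || ?b)"
   by (simp add: hit_def)
  also have "\<dots> = (?a || ?H) ** (?s || ?b) ** (?a || ?H) ** ((t || ?a || ?b) ** (t || ?b))" unfolding tH by (simp only: cp_assoc)
  finally show ?thesis unfolding tt by (simp only: cp_assoc)
 qed
 obtain D x y z where D [simp]: "cc D" and x: "chom D A x" and y: "chom D A y" and z: "chom D B z"
  and g: "pair D x (pair D y z) = ide (und A @ und A @ und B)"
  using generic3[OF hopf_cc[OF A] hopf_cc[OF A] hopf_cc[OF B]] by blast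
 have h: "hom x (und D) (und A)" "hom y (und D) (und A)" "hom z (und D) (und B)" using x y z by blast+
 note [simp] = h
 have xy: "chom D A (cv A D x y)" by (rule cv_chom[OF A D x y])
 have dx: "delta A ** x = pair D x x" using x by blast
 have di: "i ** anti A ** cv A D x y = cv B D (i ** anti A ** x) (i ** anti A ** y)"
  by (simp add: hhom_cv[OF A A D anti_hhom[OF A]] hhom_cv[OF A B D i])
 have "(?Q1 ** (?s || ?b)) ** pair D x (pair D y z)
   = pair D x (pair D y (cv B D (i ** anti A ** y) (cv B D (i ** anti A ** x) z)))"
  by (simp add: div_pair[OF A B i D x] div_pair[OF A B i D y])
 also have "\<dots> = pair D x (pair D y (cv B D (cv B D (i ** anti A ** x) (i ** anti A ** y)) z))"
  by (simp add: cv_assoc cv_left_comm[of B D "i ** anti A ** y"])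
 also have "\<dots> = (?Q2 ** ?N) ** pair D x (pair D y z)"
  by (simp add: div_pair[OF A B i D xy] div_pair[OF A A id_hhom D x] nabla_pair dx di cv_anti_left(1)[OF A D x])
 finally have "?Q1 ** (?s || ?b) = ?Q2 ** ?N" unfolding g by simp
 hence "(?Q1 ** (?s || ?b)) ** ?T = (?Q2 ** ?N) ** ?T" by (simp only:)
 moreover have "(?s || ?b) ** ?T = ?T" by (simp add: ic21' stt)
 moreover have "?N ** ?T = ?T" using shear_t by (simp add: ic21')
 ultimately show ?thesis unfolding L R by (simp only: cp_assoc)
qed

lemma hit_as_diag: "(ide (und A) || k) ** div_arr A A (ide (und A)) = diag_mult A k"
proof -
 note [simp] = A k_hom
 show ?thesis by (simp add: div_arr_def diag_mult_def ic_r)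
qed

lemma hit_counit_right: "(ide (und A) || k) ** hit A A (ide (und A)) t = ide (und A)"
 unfolding hit_def cp_assoc[symmetric] hit_as_diag by (rule diag_unit)

lemma hit_t: "hit A A (ide (und A)) t ** t = t || t"
proof -
 note [simp] = A t_hom
 let ?a = "ide (und A)"
 have "(delta A || ?a) ** (t || ?a) ** t = (?a || ?a || t) ** delta A ** t"
  using pt_cp(2)[of t "delta A ** t" "und A @ und A"] by (simp add: pt_cp ic ide_app)
 hence "hit A A ?a t ** t = ((?a || (nabla A ** (anti A || ?a))) ** (?a || (?a || t))) ** delta A ** t"
  by (simp add: hit_def div_arr_def)
 also have "(?a || (nabla A ** (anti A || ?a))) ** (?a || (?a || t)) = ?a || (t ** eps A)"
  by (simp add: ic nabla_t eps_anti)
 also have "\<dots> ** delta A ** t = ((?a || t) ** ((?a || eps A) ** delta A)) ** t"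
  by (simp add: ic_r)
 also have "\<dots> = t || t" unfolding counit_right by (simp add: pt_cp)
 finally show ?thesis .
qed

lemma k_diag: "k ** diag_mult A k = k || k"
proof -
 note [simp] = A k_hom div_hom[OF A A id_hhom]
 have "k ** diag_mult A k = (k ** (ide (und A) || k)) ** div_arr A A (ide (und A))"
  unfolding hit_as_diag[symmetric] by (simp only: cp_assoc)
 also have "k ** (ide (und A) || k) = k ** (k || ide (und A))"
  by (simp add: wt_cp)
 also have "(k ** (k || ide (und A))) ** div_arr A A (ide (und A)) = k ** (k || ide (und A))"
  unfolding cp_assoc counit_div[OF A id_hhom] ..
 finally show ?thesis by (simp add: wt_cp)
qed

lemma ev_div:
 assumes D: "cc D" and x: "chom D A x" and u: "chom D A u" and v: "hom v (und D) (und A)"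
 shows "ev A k D x (cv A D (anti A ** cv A D (anti A ** x) u) v) = ev A k D u v"
proof -
 have h: "hom x (und D) (und A)" "hom u (und D) (und A)" using x u by blast+
 note [simp] = A D h v k_hom
 have "anti A ** cv A D (anti A ** x) u = cv A D (anti A ** anti A ** x) (anti A ** u)"
  by (rule hhom_cv[OF A A D anti_hhom[OF A]]) simp_all
 also have "anti A ** anti A ** x = x" using anti_anti[OF A] h(1) by (metis cp_assoc ide_cp)
 finally have "cv A D (anti A ** x) (cv A D (anti A ** cv A D (anti A ** x) u) v)
   = cv A D (anti A ** x) (cv A D x (cv A D (anti A ** u) v))" by (simp add: cv_assoc)
 also have "\<dots> = cv A D (anti A ** u) v" by (rule cv_anti_left(1)[OF A D x]) simp_all
 finally show ?thesis by (simp add: ev_def)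
qed

lemma hit_diag:
 "hit A A (ide (und A)) t ** diag_mult A k
  = (diag_mult A k || diag_mult A k) ** (ide (und A) || sw (und A) (und A) || ide (und A))
    ** (hit A A (ide (und A)) t || hit A A (ide (und A)) t)"
proof -
 note dg = div_hom[OF A A id_hhom]
 note [simp] = A t_hom k_hom dg diag_hom
 let ?a = "ide (und A)" and ?H = "div_arr A A (ide (und A))" and ?m = "diag_mult A k"
 let ?s = "sw (und A) (und A)"
 let ?S = "?a || ?s || ?a"
 let ?R = "(?m || ?m) ** ?S ** (?H || ?H) ** ?S" and ?R' = "?H ** (?a || ?m) ** (?m || ?a || ?a)"
 obtain D x y u v where D [simp]: "cc D" and "und D = und A @ und A @ und A @ und A"
  and x: "chom D A x" and y: "chom D A y" and u: "chom D A u" and v: "chom D A v"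
  and g: "pair D x (pair D y (pair D u v)) = ide (und A @ und A @ und A @ und A)"
  by (rule generic4[OF hopf_cc[OF A]])
 have h: "hom x (und D) (und A)" "hom y (und D) (und A)" "hom u (und D) (und A)" "hom v (und D) (und A)"
  using x y u v by blast+
 let ?xy = "ev A k D x y" and ?uv = "ev A k D u v"
 note [simp] = h ev_hom[OF D h(1,2)] ev_hom[OF D h(3,4)]
 let ?xu = "cv A D (anti A ** x) u" and ?yv = "cv A D (anti A ** y) v"
 have xu: "chom D A ?xu"
  by (rule cv_chom[OF A D chom_comp[OF hopf_cc[OF A] D hopf_cc[OF A] x anti_chom[OF A]] u])
 have e0: "hom (ev A k D ?xu ?yv) (und D) []" by (rule ev_hom[OF D]) simp_all
 note [simp] = e0
 let ?r = "cv A D (anti A ** ?xu) v"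
 have "ev A k D ?xu ?yv = ev A k D y ?r"
  unfolding ev_def by (subst cv_left_comm) simp_all
 hence "pair D ?xy (ev A k D ?xu ?yv) = pair D ?xy (ev A k D x ?r)"
  using ev_subst_ev[OF D x y, of ?r] by simp
 also have "ev A k D x ?r = ?uv" by (rule ev_div[OF D x u h(4)])
 finally have e: "pair D ?xy (ev A k D ?xu ?yv) = pair D ?xy ?uv" .
 have "?R ** pair D x (pair D y (pair D u v)) = (?m || ?m) ** pair D x (pair D y (pair D ?xu ?yv))"
  by (simp add: div_pair[OF A A id_hhom D x] div_pair[OF A A id_hhom D y] cp_ide2)
 also have "\<dots> = pair D (pair D x ?xy) (pair D ?xu (ev A k D ?xu ?yv))"
  by (simp add: diag_pair[OF D x] diag_pair[OF D xu] del: pair_assoc)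
 also have "\<dots> = pair D x (pair D ?xy (pair D (ev A k D ?xu ?yv) ?xu))"
  by (subst pair_swap[of D "ev A k D ?xu ?yv" ?xu]) simp_all
 also have "\<dots> = pair D x (pair D (pair D ?xy (ev A k D ?xu ?yv)) ?xu)" by simp
 also have "\<dots> = pair D x (pair D ?xy (pair D ?uv ?xu))" unfolding e by simp
 also have "pair D ?uv ?xu = pair D ?xu ?uv" by (rule pair_swap[symmetric]) simp_all
 also have "pair D ?xu ?uv = cv A D (anti A ** x) (pair D u ?uv)"
 proof -
  have "cv A D (anti A ** x) (pair D u ?uv) = nabla A ** pair D (anti A ** x) (pair D ?uv u)"
   unfolding cv_def by (subst pair_swap[of D ?uv u]) simp_all
  also have "\<dots> = pair D ?uv ?xu" by (subst wt_left) (simp_all add: wt_out cv_def)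
  also have "\<dots> = pair D ?xu ?uv" by (rule pair_swap[symmetric]) simp_all
  finally show ?thesis by (rule sym)
 qed
 finally have r: "?R ** pair D x (pair D y (pair D u v)) = pair D x (pair D ?xy (cv A D (anti A ** x) (pair D u ?uv)))" .
 have "?R' ** pair D x (pair D y (pair D u v)) = ?H ** pair D x (pair D ?xy (pair D u ?uv))"
  by (simp add: diag_pair[OF D x] diag_pair[OF D u] wt_out)
 also have "\<dots> = pair D ?xy (?H ** pair D x (pair D u ?uv))"
  by (subst wt_left, simp_all, subst wt_out, simp_all)
 also have "?H ** pair D x (pair D u ?uv) = pair D x (cv A D (anti A ** x) (pair D u ?uv))"
  by (subst div_pair[OF A A id_hhom D x]) (simp_all)
 also have "pair D ?xy \<dots> = pair D x (pair D ?xy (cv A D (anti A ** x) (pair D u ?uv)))"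
  by (subst wt_left) simp_all
 finally have RR: "?R = ?R'" using r unfolding g by simp
 have st: "?s ** (t || ?a) = ?a || t"
  using sw_nat1[of t "[]" "und A" "und A"] by (simp add: sw_Nil_left)
 have "?S ** (t || t || ?a || ?a) = (t || ?a) || (t || ?a)"
 proof -
  have "(?s || ?a) ** (t || ?a || ?a) = ?a || t || ?a" by (simp add: ic21' st)
  thus ?thesis by (simp add: ic)
 qed
 hence "?R ** (t || t || ?a || ?a) = (?m || ?m) ** ?S ** ((?H || ?H) ** ((t || ?a) || (t || ?a)))"
  by (simp only: cp_assoc)
 also have "(?H || ?H) ** ((t || ?a) || (t || ?a)) = hit A A ?a t || hit A A ?a t"
  unfolding hit_def by (rule ic) simp_all
 finally have l: "(?m || ?m) ** ?S ** (hit A A ?a t || hit A A ?a t) = ?R' ** (t || t || ?a || ?a)"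
  unfolding RR ..
 have mt: "?m ** (t || t) = t"
 proof -
  have "?m ** (t || t) = (?m ** (?a || t)) ** t" by (simp add: pt_cp)
  thus ?thesis unfolding diag_unit by simp
 qed
 have "?R' ** (t || t || ?a || ?a) = ?H ** (?a || ?m) ** (t || ?a || ?a)"
  by (simp add: ic21' ic22' mt cp_ide2)
 also have "(?a || ?m) ** (t || ?a || ?a) = (t || ?a) ** ?m"
  by (simp add: ic pt_cp cp_ide2)
 finally show ?thesis unfolding l by (simp add: hit_def)
qed

theorem dual_bimonoid_bim: "bim (dual_bimonoid A t k)"
proof -
 note [simp] = A t_hom k_hom diag_hom hit_hom[OF A id_hhom]
 show ?thesis unfolding bim_def dual_bimonoid_def
  using diag_assoc diag_unit hit_coassoc[OF A id_hhom] hit_counit[OF A id_hhom] hit_counit_right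
   hit_diag hit_t k_diag kt by simp
qed

text \<open>
 Applying the cointegral recovers translation from \<open>hit\<close>. Consequently an arrow that is invariant under the coaction \<open>hit\<close> is invariant under translation by \<open>A\<close>.
\<close>

lemma hit_recovers: assumes B: "hopf B" and i: "hhom A B i"
 shows "((k ** nabla A) || ide (und B)) ** (ide (und A) || hit A B i t) = nabla B ** (i || ide (und B))"
proof -
 note dh = div_hom[OF A B i]
 note [simp] = A B t_hom k_hom i_hom'[OF A B i] dh
 let ?a = "ide (und A)" and ?b = "ide (und B)" and ?H = "div_arr A B i" and ?s = "sw (und A) (und A)"
 let ?U = "((k ** nabla A) || ?b) ** (?a || ?H) ** (?s || ?b)"
 let ?m2 = "(?a || (k ** nabla A)) ** (delta A || ?a)"
 let ?V = "nabla B ** (i || ?b) ** ((?m2 ** ?s) || ?b)"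
 obtain D x y z where D [simp]: "cc D" and x: "chom D A x" and y: "chom D A y" and z: "chom D B z"
  and g: "pair D x (pair D y z) = ide (und A @ und A @ und B)"
  using generic3[OF hopf_cc[OF A] hopf_cc[OF A] hopf_cc[OF B]] by blast
 have h: "hom x (und D) (und A)" "hom y (und D) (und A)" "hom z (und D) (und B)" using x y z by blast+
 note [simp] = h
 have dy: "delta A ** y = pair D y y" using y by blast
 have sy: "chom D A (anti A ** y)" by (rule chom_comp[OF hopf_cc[OF A] D hopf_cc[OF A] y anti_chom[OF A]])
 have ssy: "anti A ** anti A ** y = y" using anti_anti[OF A] h(2) by (metis cp_assoc ide_cp)
 let ?w = "k ** cv A D y x"
 have w: "?w = ev A k D (anti A ** y) x" by (simp add: ev_def ssy)
 have U: "?U ** pair D x (pair D y z) = pair D ?w (cv B D (i ** anti A ** x) z)"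
  by (simp add: div_pair[OF A B i D x] nabla_pair)
 let ?f = "nabla B ** ((i ** anti A) || ?b)"
 have f: "cv B D (i ** anti A ** q) z = ?f ** pair D q z" if "hom q (und D) (und A)" for q
  using that by (simp add: cv_def)
 have "pair D ?w (cv B D (i ** anti A ** x) z) = ?f ** pair D (pair D ?w x) z"
  unfolding f[OF h(1)] by (simp add: wt_out del: pair_ts)
 also have "pair D ?w x = pair D ?w (anti A ** y)"
  unfolding w by (rule ev_subst[OF D sy x])
 also have "?f ** pair D (pair D ?w (anti A ** y)) z = pair D ?w (cv B D (i ** anti A ** anti A ** y) z)"
  by (subst f) (simp_all add: wt_out del: pair_ts)
 finally have U2: "?U ** pair D x (pair D y z) = pair D ?w (cv B D (i ** y) z)" using U unfolding ssy by simp
 have "?V ** pair D x (pair D y z) = nabla B ** pair D (i ** y) (pair D ?w z)"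
  by (simp add: nabla_pair dy)
 also have "\<dots> = pair D ?w (cv B D (i ** y) z)"
  by (subst wt_left) (simp_all add: wt_out nabla_pair)
 finally have UV: "?U = ?V" using U2 unfolding g by simp
 have st: "?s ** (t || ?a) = ?a || t"
  using sw_nat1[of t "[]" "und A" "und A"] by (simp add: sw_Nil_left)
 have "?a || hit A B i t = (?a || ?H) ** (?a || (t || ?b))" by (simp add: hit_def ic)
 also have "?a || (t || ?b) = (?s || ?b) ** (t || ?a || ?b)" by (simp add: ic21' st)
 finally have "((k ** nabla A) || ?b) ** (?a || hit A B i t) = ?U ** (t || ?a || ?b)" by simp
 also have "\<dots> = nabla B ** (i || ?b) ** ((?m2 ** (?a || t)) || ?b)"
  unfolding UV by (simp add: ic21' st)
 also have "?m2 ** (?a || t) = ?a"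
 proof -
  have "(delta A || ?a) ** (?a || t) = (ide (und A @ und A) || t) ** delta A"
   by (simp add: ic pt_cp)
  hence "?m2 ** (?a || t) = ((?a || (k ** nabla A)) ** (?a || (?a || t))) ** delta A"
   by (simp add: ide_app)
  also have "(?a || (k ** nabla A)) ** (?a || (?a || t)) = ?a || (k ** (nabla A ** (?a || t)))"
   by (simp add: ic)
  also have "k ** (nabla A ** (?a || t)) = eps A"
   unfolding int_right[OF A t] using kt by (metis cp_assoc ide_cp ccD(5,7) hopf_cc[OF A])
  finally show ?thesis by (simp only: counit_right)
 qed
 finally show ?thesis by (simp add: cp_ide2)
qed

end

end

section \<open>Kernels of homomorphisms out of Hopf monoids of invertible volume\<close>

text \<open>
 The conditions speak of single atoms because they express stability of a given category whose objects are the atoms.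
\<close>

locale bssmc = ssmc +
 assumes stable: "[|act A \<alpha> x; length (und A) = 1; length x = 1|] ==> \<exists>p. squot A \<alpha> p \<and> length (trg p) = 1"
  and costable: "[|ssmc.act At ar trg src (\<lambda>g f. f ** g) ts ide (\<lambda>x y. sw y x) (du A) \<beta> x;
     length (und A) = 1; length x = 1|]
   ==> \<exists>q. ssmc.squot At ar trg src (\<lambda>g f. f ** g) ts ide (du A) \<beta> q \<and> length (src q) = 1"
begin

lemma bssmc_op: "bssmc At ar trg src (\<lambda>g f. f ** g) ts ide (\<lambda>x y. sw y x)"
proof -
 interpret op: ssmc At ar trg src "\<lambda>g f. f ** g" ts ide "\<lambda>x y. sw y x" by (rule ssmc_op)
 show ?thesis
 proof (unfold_locales, goal_cases)
  case (1 A \<alpha> x)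
  thus ?case using costable[of "du A" \<alpha> x] by simp
 next
  case (2 A \<beta> x)
  thus ?case using stable[of "du A" \<beta> x] by simp
 qed
qed

context
 fixes A B C i p \<Lambda> l \<phi> r v' k t
 assumes se: "ses A B C i p" and lA: "length (und A) = 1" and lB: "length (und B) = 1"
  and L: "nint B \<Lambda>" and ll: "ncoint B l"
  and v': "hom v' [] []" "l ** \<Lambda> ** v' = ide []"
  and ph: "ncoint C \<phi>" and r: "conorm_arr A B C i p \<phi> r"
  and k: "k = l ** i" and t: "t = r ** \<Lambda> ** v'"
begin

lemma k_phi_coint: "coint C \<phi>" and k_phi_eta: "\<phi> ** eta C = ide []"
 and k_L_int: "int B \<Lambda>" and k_L_eps: "eps B ** \<Lambda> = ide []" and k_l_coint: "coint B l" and k_l_eta: "l ** eta B = ide []"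
 using ph L ll unfolding nint_def ncoint_def by blast+

lemmas k_hopf = sesD(1-3)[OF se] and k_i = sesD(4)[OF se] and k_p = sesD(5)[OF se]
lemmas k_homs = ses_hom[OF se] conormD(1-3)[OF se k_phi_coint r] cointD(1-3)[OF k_phi_coint]
 intD(1-3)[OF k_L_int] cointD(1-3)[OF k_l_coint]

lemma k_ncoint: "ncoint A k" unfolding k by (rule ncoint_sub[OF se ll])

lemma l_i_r: "l ** i ** r = l"
proof -
 note [simp] = k_hopf k_homs
 have "l ** i ** r = l ** pair B (\<phi> ** p) (ide (und B))"
  unfolding conormD(4)[OF se k_phi_coint r] pair_def ..
 also have "\<dots> = ((\<phi> ** p) || l) ** delta B"
  by (subst wt_out) (simp_all add: pair_def)
 also have "(\<phi> ** p) || l = (\<phi> ** p) ** (ide (und B) || l)"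
  by (rule wt_cp(2)[symmetric]) simp_all
 also have "((\<phi> ** p) ** (ide (und B) || l)) ** delta B = (\<phi> ** p) ** ((ide (und B) || l) ** delta B)"
  by (simp only: cp_assoc)
 also have "\<dots> = \<phi> ** (p ** eta B) ** l" unfolding coint_right[OF k_hopf(2) k_l_coint] by (simp only: cp_assoc)
 also have "\<dots> = (\<phi> ** eta C) ** l" unfolding ses_hom(10)[OF se] by (simp only: cp_assoc)
 finally show ?thesis unfolding k_phi_eta by simp
qed

lemma r_int: "int A (r ** \<Lambda>)"
proof -
 note [simp] = k_hopf k_homs
 have "sw (und A) (und A) ** ((r ** \<Lambda>) || ide (und A)) = ide (und A) || (r ** \<Lambda>)"
  using sw_nat1[of "r ** \<Lambda>" "[]" "und A" "und A"] by (simp add: sw_Nil_left)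
 hence "nabla A ** ((r ** \<Lambda>) || ide (und A)) = nabla A ** (ide (und A) || (r ** \<Lambda>))"
  by (metis cp_assoc hopfD(10) k_hopf(1))
 also have "\<dots> = (nabla A ** (ide (und A) || r)) ** (ide (und A) || \<Lambda>)" by (simp add: ic)
 also have "\<dots> = r ** nabla B ** (i || \<Lambda>)"
  unfolding conorm_linear[OF se k_phi_coint r, symmetric] by (simp add: ic)
 also have "i || \<Lambda> = (ide (und B) || \<Lambda>) ** i" by (simp add: pt_cp)
 also have "r ** nabla B ** (ide (und B) || \<Lambda>) ** i = r ** (nabla B ** (ide (und B) || \<Lambda>)) ** i" by (simp only: cp_assoc)
 also have "\<dots> = (r ** \<Lambda>) ** eps A" unfolding int_right[OF k_hopf(2) k_L_int] by simp
 finally show ?thesis unfolding int_def by simp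
qed

lemma t_int: "int A t"
proof -
 note [simp] = k_hopf k_homs v'(1)
 have a: "nabla A ** (((r ** \<Lambda>) ** v') || ide (und A)) = (nabla A ** ((r ** \<Lambda>) || ide (und A))) ** (v' || ide (und A))"
  by (simp add: ic)
 also have "\<dots> = (r ** \<Lambda>) ** (eps A ** (v' || ide (und A)))" unfolding intD(4)[OF r_int] by simp
 also have "eps A ** (v' || ide (und A)) = v' ** eps A" using wt_cp(1)[of v' "eps A" "und A"] scalar_ts[of v' "eps A"] by simp
 finally show ?thesis unfolding int_def t by simp
qed

lemma k_t: "k ** t = ide []"
proof -
 have "k ** t = (l ** i ** r) ** \<Lambda> ** v'" unfolding k t by (simp only: cp_assoc)
 thus ?thesis unfolding l_i_r using v'(2) by simp
qed

lemma eps_t: "eps A ** t = (\<phi> ** p ** \<Lambda>) ** v'"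
proof -
 have "eps A ** t = (eps A ** r) ** \<Lambda> ** v'" unfolding t by (simp only: cp_assoc)
 thus ?thesis unfolding eps_conorm[OF se k_phi_coint r] by (simp only: cp_assoc)
qed

lemmas k_ctx = k_hopf(1) t_int k_ncoint k_t
lemmas k_t_hom = intD(1-3)[OF t_int]
lemmas k_k_hom = cointD(1-3)[OF k_coint[OF k_ctx]]
lemmas k_hit_hom = hit_hom[OF k_ctx k_hopf(2) k_i]

abbreviation (input) "hh \<equiv> hit A B i t"
abbreviation (input) "T0 \<equiv> (ide (und B) || (p ** anti B)) ** delta B ** \<Lambda>"

text \<open>
 Costability speaks of coactions of arbitrary bimonoids and therefore applies to the coaction \<open>hit\<close> of the dual bimonoid.
\<close>

lemma invariants_exist:
 "\<exists>\<kappa>. ar \<kappa> \<and> trg \<kappa> = und B \<and> hh ** \<kappa> = t || \<kappa> \<and>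
  (\<forall>h ys. ar h --> trg h = und B @ ys --> obs ys --> (hh || ide ys) ** h = t || h
    --> (\<exists>u. hom u (src h) (src \<kappa> @ ys) \<and> (\<kappa> || ide ys) ** u = h))"
proof -
 interpret op: ssmc At ar trg src "\<lambda>g f. f ** g" ts ide "\<lambda>x y. sw y x" by (rule ssmc_op)
 note [simp] = k_hopf k_homs k_t_hom k_k_hom k_hit_hom
 let ?A = "dual_bimonoid A t k"
 have s: "und ?A = und A" "nabla ?A = diag_mult A k" "eta ?A = t" "delta ?A = hit A A (ide (und A)) t" "eps ?A = k"
  by (simp_all add: dual_bimonoid_def)
 have "op.act (du ?A) hh (und B)"
  unfolding op.act_def op_bim du_sel s
  using dual_bimonoid_bim[OF k_ctx] hit_coassoc[OF k_ctx k_hopf(2) k_i] hit_counit[OF k_ctx k_hopf(2) k_i]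
  by simp
 then obtain \<kappa> where q: "op.squot (du ?A) hh \<kappa>" using costable[of ?A hh "und B"] lA lB s(1) by auto
 have ass: "obs (und (du ?A))" "ar (eps (du ?A))" "trg (eps (du ?A)) = und (du ?A)" "src (eps (du ?A)) = []"
  "ar hh" "trg hh = und (du ?A) @ und B" "src hh = und B" "obs (und B)"
  by (simp_all add: s)
 note kh = op.squot_hom[OF ass q] and ke = op.squot_eq[OF ass q]
 note [simp] = kh
 have e: "hh ** \<kappa> = t || \<kappa>" using ke by (simp add: s pt_cp)
 have "\<exists>u. hom u (src h) (src \<kappa> @ ys) \<and> (\<kappa> || ide ys) ** u = h"
  if h: "ar h" "trg h = und B @ ys" "obs ys" "(hh || ide ys) ** h = t || h" for h ys
 proof -
  have "(t || ide (und B) || ide ys) ** h = t || h"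
   using pt_cp(1)[of t h "und B @ ys"] h by (simp add: ide_app)
  hence "\<exists>u. (ar u \<and> trg u = src \<kappa> @ ys \<and> src u = src h) \<and> (\<kappa> || ide ys) ** u = h"
   using op.descend[OF ass q h(3,1,2)] h(4) by (simp add: s)
  thus ?thesis by blast
 qed
 with e kh show ?thesis by blast
qed

context
 fixes \<kappa>
 assumes ka: "ar \<kappa>" "trg \<kappa> = und B" and ke: "hh ** \<kappa> = t || \<kappa>"
begin

lemma kappa_obs: "obs (src \<kappa>)" using ka src_obs by blast

lemma kappa_invariant: "nabla B ** (i || \<kappa>) = eps A || \<kappa>"
proof -
 note [simp] = k_hopf k_homs k_t_hom k_k_hom k_hit_hom ka kappa_obs
 let ?a = "ide (und A)" and ?b = "ide (und B)"
 have "nabla B ** (i || \<kappa>) = (nabla B ** (i || ?b)) ** (?a || \<kappa>)" by (simp add: ic)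
 also have "\<dots> = ((k ** nabla A) || ?b) ** (?a || (hh ** \<kappa>))"
  unfolding hit_recovers[OF k_ctx k_hopf(2) k_i, symmetric] by (simp add: ic)
 also have "\<dots> = (k ** (nabla A ** (?a || t))) || \<kappa>"
  unfolding ke by (simp add: ic21')
 also have "k ** (nabla A ** (?a || t)) = eps A"
  unfolding int_right[OF k_hopf(1) t_int] using k_t by (metis cp_assoc ide_cp ccD(5,7) hopf_cc k_hopf(1))
 finally show ?thesis .
qed

text \<open>
 The pairing \<open>(x, b) \<mapsto> l(x b)\<close> of invariants with \<open>B\<close> depends only on the class of \<open>b\<close> in \<open>C\<close>.
\<close>

lemma theta_exists: "\<exists>\<theta>. hom \<theta> (src \<kappa> @ und C) [] \<and> \<theta> ** (ide (src \<kappa>) || p) = l ** nabla B ** (\<kappa> || ide (und B))"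
proof -
 note [simp] = k_hopf k_homs k_t_hom k_k_hom ka kappa_obs
 let ?a = "ide (und A)" and ?b = "ide (und B)" and ?K = "ide (src \<kappa>)"
 let ?h = "l ** nabla B ** (\<kappa> || ?b)" and ?ta = "nabla B ** (i || ?b)"
 have s1: "sw (und B) (und B) ** (\<kappa> || i) = (i || \<kappa>) ** sw (src \<kappa>) (und A)"
  using sw_nat[of \<kappa> i] by simp
 have s2: "(eps A || \<kappa>) ** sw (src \<kappa>) (und A) = \<kappa> || eps A"
  using sw_nat[of \<kappa> "eps A"] by (simp add: sw_Nil_right)
 have "nabla B ** (\<kappa> || i) = (nabla B ** sw (und B) (und B)) ** (\<kappa> || i)" by (simp del: cp_assoc)
 also have "\<dots> = (nabla B ** (i || \<kappa>)) ** sw (src \<kappa>) (und A)" by (simp only: cp_assoc s1)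
 also have "\<dots> = \<kappa> || eps A" unfolding kappa_invariant by (rule s2)
 finally have ki: "nabla B ** (\<kappa> || i) = \<kappa> || eps A" .
 have "?h ** (?K || ?ta) = l ** (nabla B ** (?b || nabla B)) ** (\<kappa> || i || ?b)"
  by (simp add: ic)
 also have "\<dots> = l ** nabla B ** ((nabla B ** (\<kappa> || i)) || ?b)"
  unfolding hopf_assoc[OF k_hopf(2), symmetric] by (simp add: ic21')
 also have "\<dots> = ?h ** (?K || eps A || ?b)"
  unfolding ki using ic[of \<kappa> ?K ?b "eps A || ?b"] by (simp add: ic)
 finally have "?h ** (?K || ?ta) = ?h ** (?K || eps A || ?b)" .
 hence "\<exists>u. hom u (src \<kappa> @ trg p) (trg ?h) \<and> u ** (?K || p) = ?h"
  by (intro descend_right[OF ccD(1,5,6,7)[OF hopf_cc[OF k_hopf(1)]] _ _ _ _ sesD(6)[OF se]]) simp_all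
 thus ?thesis by simp
qed

end

text \<open>
 The copairing \<open>\<Lambda>\<^sub>1 \<otimes> p S \<Lambda>\<^sub>2\<close> is invariant in its first variable, because translating it there amounts to translating \<open>\<Lambda>\<close> and changing the second variable by an element that \<open>p\<close> kills.
\<close>

lemma T0_coinvariant: "(hh || ide (und C)) ** T0 = t || T0"
proof -
 note dh = div_hom[OF k_hopf(1,2) k_i]
 note [simp] = k_hopf k_homs k_t_hom k_k_hom k_hit_hom dh
 let ?a = "ide (und A)" and ?b = "ide (und B)" and ?c = "ide (und C)" and ?H = "div_arr A B i"
 let ?T = "(?b || (p ** anti B)) ** delta B"
 let ?Y = "(?H || ?c) ** (?a || ?T)" and ?N = "(?a || (nabla B ** (i || ?b))) ** (delta A || ?b)"
 obtain D x z where D [simp]: "cc D" and x: "chom D A x" and z: "chom D B z" and g: "pair D x z = ide (und A @ und B)"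
  using generic2[OF hopf_cc[OF k_hopf(1)] hopf_cc[OF k_hopf(2)]] by blast
 have h: "hom x (und D) (und A)" "hom z (und D) (und B)" "eps A ** x = eps D" and dx: "delta A ** x = pair D x x" 
  and dz: "delta B ** z = pair D z z" using x z by blast+
 note [simp] = h
 have ix: "chom D B (i ** x)" by (rule chom_comp[OF hopf_cc[OF k_hopf(2)] D hopf_cc[OF k_hopf(1)] x]) (use k_i in blast)
 have xz: "chom D B (cv B D (i ** x) z)" by (rule cv_chom[OF k_hopf(2) D ix z])
 have dxz: "delta B ** cv B D (i ** x) z = pair D (cv B D (i ** x) z) (cv B D (i ** x) z)" using xz by blast
 have six: "anti B ** i ** x = i ** anti A ** x" using hhom_anti[OF k_hopf(1,2) k_i] by (metis cp_assoc)
 have sx: "eps A ** anti A ** x = eps D" using anti_chom[OF k_hopf(1)] h(3) by (metis cp_assoc)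
 have ps: "p ** anti B ** cv B D (i ** x) z = p ** anti B ** z"
 proof -
  have "anti B ** cv B D (i ** x) z = cv B D (i ** anti A ** x) (anti B ** z)"
   unfolding six[symmetric] by (rule hhom_cv[OF k_hopf(2,2) D anti_hhom[OF k_hopf(2)]]) simp_all
  thus ?thesis using ses_absorb[OF se D, of "anti A ** x" "anti B ** z"] sx by simp
 qed
 have iz: "cv B D (i ** anti A ** x) (cv B D (i ** x) z) = z"
  using cv_anti_left(1)[OF k_hopf(2) D ix h(2)] six by simp
 have "(?Y ** ?N) ** pair D x z = (?a || ?T) ** pair D x z"
  by (simp add: dx dz dxz ps iz nabla_pair div_pair[OF k_hopf(1,2) k_i D x])
 hence YN: "?Y ** ?N = ?a || ?T" unfolding g by simp
 have "?N ** (?a || \<Lambda>) = ?a || \<Lambda>"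
 proof -
  have "(delta A || ?b) ** (?a || \<Lambda>) = (ide (und A @ und A) || \<Lambda>) ** delta A" by (simp add: ic pt_cp)
  hence "?N ** (?a || \<Lambda>) = ((?a || (nabla B ** (i || ?b))) ** (?a || (?a || \<Lambda>))) ** delta A" by (simp add: ide_app)
  also have "(?a || (nabla B ** (i || ?b))) ** (?a || (?a || \<Lambda>)) = ?a || (nabla B ** (i || \<Lambda>))" by (simp add: ic)
  also have "nabla B ** (i || \<Lambda>) = (nabla B ** (?b || \<Lambda>)) ** i" by (simp add: pt_cp)
  also have "\<dots> = \<Lambda> ** eps A" unfolding int_right[OF k_hopf(2) k_L_int] by simp
  also have "(?a || (\<Lambda> ** eps A)) ** delta A = (?a || \<Lambda>) ** ((?a || eps A) ** delta A)" by (simp add: ic_r)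
  finally show ?thesis unfolding counit_right[OF k_ctx] by simp
 qed
 hence Y: "?Y ** (?a || \<Lambda>) = (?a || ?T) ** (?a || \<Lambda>)" using YN by (metis cp_assoc)
 have "hh || ?c = (?H || ?c) ** (t || ?b || ?c)" unfolding hit_def by (simp add: ic21')
 moreover have "(t || ?b || ?c) ** T0 = (?a || ?T) ** (?a || \<Lambda>) ** t"
 proof -
  have "(t || ide (und B @ und C)) ** T0 = t || T0" by (rule pt_cp) simp_all
  moreover have "(?a || ?T) ** (?a || \<Lambda>) ** t = t || T0" by (simp add: pt_cp ic)
  ultimately show ?thesis by (simp add: ide_app)
 qed
 ultimately have "(hh || ?c) ** T0 = (?H || ?c) ** (?a || ?T) ** (?a || \<Lambda>) ** t" by simp
 also have "\<dots> = t || T0"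
 proof -
  have "(?H || ?c) ** (?a || ?T) ** (?a || \<Lambda>) ** t = (?Y ** (?a || \<Lambda>)) ** t" by (simp only: cp_assoc)
  also have "\<dots> = ((?a || ?T) ** (?a || \<Lambda>)) ** t" unfolding Y ..
  finally show ?thesis by (simp add: pt_cp ic)
 qed
 finally show ?thesis .
qed

text \<open>
 The inverse is the pairing \<open>\<theta>\<close> applied to the copairing \<open>T\<close>. Multiplying by \<open>\<epsilon>t\<close> replaces the pairing by multiplication with \<open>t\<close>, and the antipode in the copairing then cancels, leaving \<open>l i t = 1\<close>.
\<close>

lemma eps_t_invertible: "\<exists>z. hom z [] [] \<and> (eps A ** t) ** z = ide []"
proof -
 note [simp] = k_hopf k_homs k_t_hom k_k_hom k_hit_hom
 let ?b = "ide (und B)" and ?c = "ide (und C)"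
 obtain \<kappa> where ka: "ar \<kappa>" "trg \<kappa> = und B" and ke: "hh ** \<kappa> = t || \<kappa>"
  and ku: "\<And>h ys. [|ar h; trg h = und B @ ys; obs ys; (hh || ide ys) ** h = t || h|]
    ==> \<exists>u. hom u (src h) (src \<kappa> @ ys) \<and> (\<kappa> || ide ys) ** u = h"
  using invariants_exist by blast
 note [simp] = ka kappa_obs[OF ka ke]
 let ?K = "ide (src \<kappa>)"
 obtain T where T: "hom T [] (src \<kappa> @ und C)" "(\<kappa> || ?c) ** T = T0"
  using ku[of T0 "und C"] T0_coinvariant by auto
 obtain \<theta> where th: "hom \<theta> (src \<kappa> @ und C) []" "\<theta> ** (?K || p) = l ** nabla B ** (\<kappa> || ?b)"
  using theta_exists[OF ka ke] by blast
 obtain s where s: "norm_arr A B C i p t s" using norm_arr_exists[OF ses_cok[OF se] t_int] by blast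
 have s1: "hom s (und C) (und B)" and sp: "s ** p = nabla B ** ((i ** t) || ?b)"
  using s unfolding norm_arr_def by blast+
 note [simp] = s1 T(1) th(1)
 let ?n = "eps A ** t" and ?M = "nabla B ** ((i ** t) || ?b)"
 have pn: "nabla C ** (p || p) = p ** nabla B" using k_p by metis
 have Mk: "?M ** \<kappa> = ?n || \<kappa>"
 proof -
  have "((i ** t) || ?b) ** \<kappa> = (i || \<kappa>) ** (t || ?K)"
   by (simp add: pt_cp ic)
  hence "?M ** \<kappa> = (nabla B ** (i || \<kappa>)) ** (t || ?K)" by (simp only: cp_assoc)
  thus ?thesis unfolding kappa_invariant[OF ka ke] by (simp add: ic)
 qed
 have n_theta: "?n ** \<theta> = l ** s ** nabla C ** ((p ** \<kappa>) || ?c)"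
 proof (rule epi_cancel[OF cok_epi(5)[OF ses_cok[OF se] kappa_obs[OF ka ke]]])
  have "(l ** s ** nabla C ** ((p ** \<kappa>) || ?c)) ** (?K || p) = l ** s ** (nabla C ** (p || p)) ** (\<kappa> || ?b)"
   by (simp add: ic)
  also have "\<dots> = l ** (s ** p) ** nabla B ** (\<kappa> || ?b)" unfolding pn by (simp only: cp_assoc)
  also have "\<dots> = l ** nabla B ** (((i ** t) || ?b) ** nabla B) ** (\<kappa> || ?b)" unfolding sp by (simp only: cp_assoc)
  also have "((i ** t) || ?b) ** nabla B = (?b || nabla B) ** ((i ** t) || ?b || ?b)"
   by (simp add: pt_cp ic ide_ide)
  also have "l ** nabla B ** ((?b || nabla B) ** ((i ** t) || ?b || ?b)) ** (\<kappa> || ?b)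
    = l ** (nabla B ** (?b || nabla B)) ** ((i ** t) || ?b || ?b) ** (\<kappa> || ?b)" by (simp only: cp_assoc)
  also have "\<dots> = l ** nabla B ** ((?M ** \<kappa>) || ?b)"
   unfolding hopf_assoc[OF k_hopf(2), symmetric] by (simp add: ic ic21 ic21')
  also have "\<dots> = l ** nabla B ** (?n || \<kappa> || ?b)" unfolding Mk by (simp only: ts_assoc)
  also have "\<dots> = ?n ** (l ** nabla B ** (\<kappa> || ?b))"
  proof -
   have "(l ** nabla B) ** (?n || (\<kappa> || ?b)) = (ide [] || (l ** nabla B)) ** (?n || (\<kappa> || ?b))" by simp
   also have "\<dots> = ?n || ((l ** nabla B) ** (\<kappa> || ?b))" by (subst ic) simp_all
   also have "\<dots> = ?n ** (l ** nabla B) ** (\<kappa> || ?b)" by (rule scalar_ts) simp_all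
   finally show ?thesis by (simp only: cp_assoc)
  qed
  finally show "(?n ** \<theta>) ** (?K || p) = (l ** s ** nabla C ** ((p ** \<kappa>) || ?c)) ** (?K || p)"
   unfolding cp_assoc th(2) by (rule sym)
 qed simp_all
 have "?n ** \<theta> ** T = (l ** s ** nabla C ** ((p ** \<kappa>) || ?c)) ** T" unfolding n_theta[symmetric] by (simp only: cp_assoc)
 also have "(p ** \<kappa>) || ?c = (p || ?c) ** (\<kappa> || ?c)" by (simp add: ic)
 also have "(l ** s ** nabla C ** (p || ?c) ** (\<kappa> || ?c)) ** T = l ** s ** nabla C ** (p || ?c) ** T0"
  by (simp only: cp_assoc T(2))
 also have "(p || ?c) ** T0 = (p || p) ** (?b || anti B) ** delta B ** \<Lambda>" by (simp add: ic_r)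
 also have "l ** s ** nabla C ** (p || p) ** (?b || anti B) ** delta B ** \<Lambda>
   = l ** (s ** p) ** (nabla B ** (?b || anti B) ** delta B) ** \<Lambda>"
  using pn by (metis cp_assoc)
 also have "nabla B ** (?b || anti B) ** delta B = eta B ** eps B"
 proof -
  have "cv B B ?b (anti B) = cv B B (anti B) ?b" by (rule cv_comm) simp_all
  also have "\<dots> = eta B ** eps B" using anti_inv[OF k_hopf(2)] by (simp add: cv_def pair_def)
  finally show ?thesis by (simp add: cv_def pair_def)
 qed
 also have "l ** (s ** p) ** (eta B ** eps B) ** \<Lambda> = l ** (s ** p) ** eta B ** (eps B ** \<Lambda>)" by (simp only: cp_assoc)
 also have "\<dots> = l ** nabla B ** (((i ** t) || ?b) ** eta B)" unfolding sp k_L_eps by simp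
 also have "((i ** t) || ?b) ** eta B = (?b || eta B) ** (i ** t)" by (simp add: pt_cp)
 also have "l ** nabla B ** (?b || eta B) ** (i ** t) = l ** (nabla B ** (?b || eta B)) ** (i ** t)" by (simp only: cp_assoc)
 also have "\<dots> = ide []" using k_t unfolding k by simp
 finally have "?n ** \<theta> ** T = ide []" .
 thus ?thesis by (intro exI[of _ "\<theta> ** T"]) simp
qed

end

text \<open>
 The central closure property: a kernel of an epimorphism from a Hopf monoid with invertible
 volume has both normalized integrals again, provided that the quotient has them.
\<close>

theorem kernel_good:
 assumes se: "ses A B C i p" and len: "length (und A) = 1" "length (und B) = 1"
  and L: "nint B \<Lambda>" and l: "ncoint B l" and v: "hom v [] []" "(l ** \<Lambda>) ** v = ide []"
  and ph: "ncoint C \<phi>"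
 shows "\<exists>\<Phi> k w. nint A \<Phi> \<and> ncoint A k \<and> (k ** \<Phi>) ** (\<phi> ** p ** \<Lambda>) = l ** \<Lambda>
   \<and> hom w [] [] \<and> (\<phi> ** p ** \<Lambda>) ** w = ide []"
proof -
 have pc: "coint C \<phi>" using ph unfolding ncoint_def by blast
 obtain r where r: "conorm_arr A B C i p \<phi> r" using conorm_arr_exists[OF se pc] by blast
 define k t where "k = l ** i" and "t = r ** \<Lambda> ** v"
 have v2: "l ** \<Lambda> ** v = ide []" using v(2) by (simp only: cp_assoc)
 note ctx = se len L l v(1) v2 ph r k_def t_def
 obtain z where z: "hom z [] []" "(eps A ** t) ** z = ide []" using eps_t_invertible[OF ctx] by blast
 note [simp] = k_homs[OF ctx] z(1) v(1) k_hopf[OF ctx]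
 let ?w = "v ** z" and ?u = "\<phi> ** p ** \<Lambda>"
 have uw: "?u ** ?w = ide []" using z(2) unfolding eps_t[OF ctx] by (simp only: cp_assoc)
 have wu: "?w ** ?u = ide []" using scalar_comm[of ?u ?w] uw by simp
 let ?P = "t ** z"
 have ti: "int A t" by (rule t_int[OF ctx])
 note [simp] = intD(1-3)[OF ti] intD(1-3)[OF r_int[OF ctx]]
 have "nabla A ** ((t ** z) || ide (und A)) = (nabla A ** (t || ide (und A))) ** (z || ide (und A))"
  by (simp add: ic)
 also have "\<dots> = t ** (eps A ** (z || ide (und A)))" unfolding intD(4)[OF ti] by simp
 also have "eps A ** (z || ide (und A)) = z ** eps A" using wt_cp(1)[of z "eps A" "und A"] scalar_ts[of z "eps A"] by simp
 finally have "int A ?P" unfolding int_def by simp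
 hence 1: "nint A ?P" unfolding nint_def using z(2) by simp
 have 2: "ncoint A k" by (rule k_ncoint[OF ctx])
 have "(k ** ?P) ** ?u = (l ** i ** r) ** \<Lambda> ** ?w ** ?u" unfolding k_def t_def by (simp only: cp_assoc)
 also have "\<dots> = l ** \<Lambda>" unfolding l_i_r[OF ctx] wu by simp
 finally show ?thesis using 1 2 uw by (intro exI[of _ ?P] exI[of _ k] exI[of _ ?w]) simp
qed

end

context smc begin

section \<open>Translation to the strictification\<close>

lemma sarI [simp]: "[|obs xs; obs ys; f \<in> Hom C (Jo xs) (Jo ys)|] ==> sar (Some (xs, f, ys))" by simp

lemma scp_eq: "[|f \<in> Hom C (Jo xs) (Jo ys); g \<in> Hom C (Jo ys) (Jo zs); obs xs; obs ys; obs zs|]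
  ==> scp (Some (ys, g, zs)) (Some (xs, f, ys)) = Some (xs, g oo f, zs)"
 by (simp add: scp_def)

lemma sts_eq:
 assumes "f \<in> Hom C (Jo xs) (Jo ys)" "g \<in> Hom C (Jo zs) (Jo ws)" "obs xs" "obs ys" "obs zs" "obs ws"
  and "mu ys ws = m" "mu_inv xs zs = n"
 shows "sts (Some (xs, f, ys)) (Some (zs, g, ws)) = Some (xs @ zs, m oo ((f ## g) oo n), ys @ ws)"
 using assms by (simp add: sts_def)

text \<open>
 The values that occur when diagrams on at most four atoms are translated back to the given category; together with \<open>sts_eq\<close> they turn strict equations into equations with explicit associators.
\<close>

lemma mu_small:
 "mu [a] [b] = Id C (a \<odot> b)" "mu [a] [b, c] = Id C (a \<odot> (b \<odot> c))"
 "mu [a] [b, c, d] = Id C (a \<odot> (b \<odot> (c \<odot> d)))"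
 "mu_inv [a] [b] = Id C (a \<odot> b)" "mu_inv [a] [b, c] = Id C (a \<odot> (b \<odot> c))"
 "mu_inv [a] [b, c, d] = Id C (a \<odot> (b \<odot> (c \<odot> d)))"
 "[|a \<in> Ob C; b \<in> Ob C; c \<in> Ob C|] ==> mu [a, b] [c] = assoc C a b c"
 "[|a \<in> Ob C; b \<in> Ob C; c \<in> Ob C|] ==> mu_inv [a, b] [c] = assoc_inv C a b c"
 "[|a \<in> Ob C; b \<in> Ob C; c \<in> Ob C; d \<in> Ob C|] ==> mu [a, b] [c, d] = assoc C a b (c \<odot> d)"
 "[|a \<in> Ob C; b \<in> Ob C; c \<in> Ob C; d \<in> Ob C|] ==> mu_inv [a, b] [c, d] = assoc_inv C a b (c \<odot> d)"
 "mu [] [] = lunit C \<I>" "mu [] [a] = lunit C a" "mu [a] [] = runit C a"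
 "mu_inv [] [] = lunit_inv C \<I>" "mu_inv [] [a] = lunit_inv C a" "mu_inv [a] [] = runit_inv C a"
 using Comp_Id[OF assoc_Hom] Id_Comp[OF assoc_Hom] Comp_Id[OF assoc_inv_Hom] Id_Comp[OF assoc_inv_Hom] by (simp_all add: tensor_Id tensor_Ob)

declare mu.simps [simp del] mu_inv.simps [simp del]

lemma Hom_obs: "f \<in> Hom C a b ==> a \<in> Ob C" "f \<in> Hom C a b ==> b \<in> Ob C"
 using Hom_Ob by blast+

lemma Id_drop: "f \<in> Hom C a b ==> Id C b oo (f oo Id C a) = f" "f \<in> Hom C a b ==> Id C b oo f = f"
  "f \<in> Hom C a b ==> f oo Id C a = f"
 by (simp_all add: Comp_Id Id_Comp)

context
 fixes a b c d e h
 assumes ob: "a \<in> Ob C" "b \<in> Ob C" "c \<in> Ob C" "d \<in> Ob C" "e \<in> Ob C" "h \<in> Ob C"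
begin

lemma t11: assumes "f \<in> Hom C a b" "g \<in> Hom C c d"
 shows "sts (Some ([a], f, [b])) (Some ([c], g, [d])) = Some ([a, c], f ## g, [b, d])"
 using assms ob Id_drop(1)[OF tensor_Hom[OF assms]] by (simp add: sts_eq mu_small)

lemma t21: assumes "f \<in> Hom C (a \<odot> b) c" "g \<in> Hom C d e"
 shows "sts (Some ([a, b], f, [c])) (Some ([d], g, [e])) = Some ([a, b, d], (f ## g) oo assoc_inv C a b d, [c, e])"
proof -
 have "(f ## g) oo assoc_inv C a b d \<in> Hom C (a \<odot> (b \<odot> d)) (c \<odot> e)" by (rule ty ob assms)+
 thus ?thesis using assms ob Id_drop(2) by (simp add: sts_eq mu_small)
qed

lemma t12: assumes "f \<in> Hom C a b" "g \<in> Hom C (c \<odot> d) e"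
 shows "sts (Some ([a], f, [b])) (Some ([c, d], g, [e])) = Some ([a, c, d], f ## g, [b, e])"
 using assms ob Id_drop(1)[OF tensor_Hom[OF assms]] by (simp add: sts_eq mu_small)

lemma u21: assumes "f \<in> Hom C a (b \<odot> c)" "g \<in> Hom C d e"
 shows "sts (Some ([a], f, [b, c])) (Some ([d], g, [e])) = Some ([a, d], assoc C b c e oo (f ## g), [b, c, e])"
 using assms ob Id_drop(3)[OF tensor_Hom[OF assms]] by (simp add: sts_eq mu_small)

lemma u12: assumes "f \<in> Hom C a b" "g \<in> Hom C c (d \<odot> e)"
 shows "sts (Some ([a], f, [b])) (Some ([c], g, [d, e])) = Some ([a, c], f ## g, [b, d, e])"
 using assms ob Id_drop(1)[OF tensor_Hom[OF assms]] by (simp add: sts_eq mu_small)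

lemma n01: assumes "f \<in> Hom C \<I> a" "g \<in> Hom C c d"
 shows "sts (Some ([], f, [a])) (Some ([c], g, [d])) = Some ([c], (f ## g) oo lunit_inv C c, [a, d])"
proof -
 have "(f ## g) oo lunit_inv C c \<in> Hom C c (a \<odot> d)" by (rule ty ob assms)+
 thus ?thesis using assms ob Id_drop(2) by (simp add: sts_eq mu_small)
qed

lemma n10: assumes "f \<in> Hom C \<I> a" "g \<in> Hom C c d"
 shows "sts (Some ([c], g, [d])) (Some ([], f, [a])) = Some ([c], (g ## f) oo runit_inv C c, [d, a])"
proof -
 have "(g ## f) oo runit_inv C c \<in> Hom C c (d \<odot> a)" by (rule ty ob assms)+
 thus ?thesis using assms ob Id_drop(2) by (simp add: sts_eq mu_small)
qed

lemma e01: assumes "f \<in> Hom C a \<I>" "g \<in> Hom C c d"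
 shows "sts (Some ([a], f, [])) (Some ([c], g, [d])) = Some ([a, c], lunit C d oo (f ## g), [d])"
 using assms ob Id_drop(3)[OF tensor_Hom[OF assms]] by (simp add: sts_eq mu_small)

lemma e10: assumes "f \<in> Hom C a \<I>" "g \<in> Hom C c d"
 shows "sts (Some ([c], g, [d])) (Some ([a], f, [])) = Some ([c, a], runit C d oo (g ## f), [d])"
 using assms ob Id_drop(3)[OF tensor_Hom[OF assms(2,1)]] by (simp add: sts_eq mu_small)

lemma n00: assumes "f \<in> Hom C \<I> a" "g \<in> Hom C \<I> b"
 shows "sts (Some ([], f, [a])) (Some ([], g, [b])) = Some ([], (f ## g) oo lunit_inv C \<I>, [a, b])"
proof -
 have "(f ## g) oo lunit_inv C \<I> \<in> Hom C \<I> (a \<odot> b)" by (rule ty ob assms)+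
 thus ?thesis using assms ob Id_drop(2) by (simp add: sts_eq mu_small)
qed

lemma e00: assumes "f \<in> Hom C a \<I>" "g \<in> Hom C b \<I>"
 shows "sts (Some ([a], f, [])) (Some ([b], g, [])) = Some ([a, b], lunit C \<I> oo (f ## g), [])"
 using assms ob Id_drop(3)[OF tensor_Hom[OF assms]] by (simp add: sts_eq mu_small)

lemma t22: assumes "f \<in> Hom C (a \<odot> b) c" "g \<in> Hom C (d \<odot> e) h"
 shows "sts (Some ([a, b], f, [c])) (Some ([d, e], g, [h])) = Some ([a, b, d, e], (f ## g) oo assoc_inv C a b (d \<odot> e), [c, h])"
proof -
 have "(f ## g) oo assoc_inv C a b (d \<odot> e) \<in> Hom C (a \<odot> (b \<odot> (d \<odot> e))) (c \<odot> h)" by (rule ty ob assms)+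
 thus ?thesis using assms ob Id_drop(2) by (simp add: sts_eq mu_small)
qed

lemma u22: assumes "f \<in> Hom C a (b \<odot> c)" "g \<in> Hom C d (e \<odot> h)"
 shows "sts (Some ([a], f, [b, c])) (Some ([d], g, [e, h])) = Some ([a, d], assoc C b c (e \<odot> h) oo (f ## g), [b, c, e, h])"
 using assms ob Id_drop(3)[OF tensor_Hom[OF assms]] by (simp add: sts_eq mu_small)

lemma ssw11: "ssw [a] [b] = Some ([a, b], symm C a b, [b, a])"
 using ob Id_drop(1)[OF symm_Hom[OF ob(1,2)]] by (simp add: ssw_def mu_small)

lemma swap_mid_Hom: "swap_mid C a b c d \<in> Hom C ((a \<odot> b) \<odot> (c \<odot> d)) ((a \<odot> c) \<odot> (b \<odot> d))"
 unfolding swap_mid_def by (rule ty ob)+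

lemma sw4: "sts (side [a]) (sts (ssw [b] [c]) (side [d]))
  = Some ([a, b, c, d], assoc C a c (b \<odot> d) oo (swap_mid C a b c d oo assoc_inv C a b (c \<odot> d)), [a, c, b, d])"
proof -
 let ?s = "assoc C c b d oo (symm C b c ## Id C d) oo assoc_inv C b c d"
 have s: "?s \<in> Hom C (b \<odot> (c \<odot> d)) (c \<odot> (b \<odot> d))" by (rule ty ob)+
 note t = ty ob s swap_mid_Hom
 have bc: "ssw [b] [c] = Some ([b, c], symm C b c, [c, b])"
  using ob Id_drop(1)[OF symm_Hom[OF ob(2,3)]] by (simp add: ssw_def mu_small)
 have 1: "sts (ssw [b] [c]) (side [d]) = Some ([b, c, d], ?s, [c, b, d])"
  using ob Id_Hom symm_Hom unfolding bc side_def by (simp add: sts_eq mu_small)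
 have is_: "Id C a ## ?s \<in> Hom C (a \<odot> (b \<odot> (c \<odot> d))) (a \<odot> (c \<odot> (b \<odot> d)))" by (rule t)+
 have 2: "sts (side [a]) (sts (ssw [b] [c]) (side [d])) = Some ([a, b, c, d], Id C a ## ?s, [a, c, b, d])"
  unfolding 1 unfolding side_def using ob Id_Hom s Id_drop(1)[OF is_] by (simp add: sts_eq mu_small)
 have "assoc C a c (b \<odot> d) oo (swap_mid C a b c d oo assoc_inv C a b (c \<odot> d)) = Id C a ## ?s"
 proof -
  let ?x = "assoc_inv C a c (b \<odot> d)" and ?y = "assoc C a b (c \<odot> d)" and ?z = "assoc_inv C a b (c \<odot> d)"
  have "swap_mid C a b c d oo ?z = (?x oo ((Id C a ## ?s) oo ?y)) oo ?z" by (simp only: swap_mid_def)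
  also have "\<dots> = ?x oo (((Id C a ## ?s) oo ?y) oo ?z)" by (rule Comp_assoc) (rule t is_)+
  also have "((Id C a ## ?s) oo ?y) oo ?z = (Id C a ## ?s) oo (?y oo ?z)" by (rule Comp_assoc) (rule t is_)+
  also have "?y oo ?z = Id C (a \<odot> (b \<odot> (c \<odot> d)))" by (rule assoc_assoc_inv) (rule t)+
  also have "(Id C a ## ?s) oo \<dots> = Id C a ## ?s" by (rule Id_drop(3)[OF is_])
  finally have "assoc C a c (b \<odot> d) oo (swap_mid C a b c d oo ?z) = assoc C a c (b \<odot> d) oo (?x oo (Id C a ## ?s))" by simp
  also have "\<dots> = Id C (a \<odot> (c \<odot> (b \<odot> d))) oo (Id C a ## ?s)"
   by (rule comp_rw1[OF assoc_assoc_inv]) (rule t is_)+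
  also have "\<dots> = Id C a ## ?s" by (rule Id_drop(2)[OF is_])
  finally show ?thesis .
 qed
 with 2 show ?thesis by simp
qed

end

text \<open>
 The strict version of a bimonoid, carried by a one-element list; \<open>unsb\<close> is its inverse.
\<close>

definition sb :: "('o, 'm) bimon => ('o list, ('o list \<times> 'm \<times> 'o list) option) bimon" where
 "sb A = \<lparr>und = [und A], nabla = Some ([und A, und A], nabla A, [und A]), eta = Some ([], eta A, [und A]),
   delta = Some ([und A], delta A, [und A, und A]), eps = Some ([und A], eps A, [])\<rparr>"

definition unsb :: "('o list, ('o list \<times> 'm \<times> 'o list) option) bimon => ('o, 'm) bimon" where
 "unsb A = \<lparr>und = hd (und A), nabla = sm (nabla A), eta = sm (eta A), delta = sm (delta A), eps = sm (eps A)\<rparr>"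

lemma sb_sel [simp]: "und (sb A) = [und A]" "nabla (sb A) = Some ([und A, und A], nabla A, [und A])"
 "eta (sb A) = Some ([], eta A, [und A])" "delta (sb A) = Some ([und A], delta A, [und A, und A])"
 "eps (sb A) = Some ([und A], eps A, [])"
 by (simp_all add: sb_def)

lemma sbind: "sar f ==> ssrc f = xs ==> strg f = ys ==> f = Some (xs, sm f, ys)"
 by (cases f) auto

interpretation S: ssmc "Ob C" sar ssrc strg scp sts side ssw by (rule strictification)

lemma assoc_move:
 assumes "a \<in> Ob C" "b \<in> Ob C" "c \<in> Ob C" "f \<in> Hom C ((a \<odot> b) \<odot> c) x" "g \<in> Hom C (a \<odot> (b \<odot> c)) x"
 shows "f oo assoc_inv C a b c = g \<longleftrightarrow> f = g oo assoc C a b c"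
proof
 note t = ty assms
 assume "f oo assoc_inv C a b c = g"
 hence "g oo assoc C a b c = (f oo assoc_inv C a b c) oo assoc C a b c" by simp
 also have "\<dots> = f oo (assoc_inv C a b c oo assoc C a b c)" by (rule Comp_assoc) (rule t)+
 finally show "f = g oo assoc C a b c" using assms by (simp add: assoc_inv_assoc Comp_Id)
next
 note t = ty assms
 assume e: "f = g oo assoc C a b c"
 have "(g oo assoc C a b c) oo assoc_inv C a b c = g oo (assoc C a b c oo assoc_inv C a b c)" by (rule Comp_assoc) (rule t)+
 thus "f oo assoc_inv C a b c = g" using assms e by (simp add: assoc_assoc_inv Comp_Id)
qed

lemma lunit_move:
 assumes "a \<in> Ob C" "f \<in> Hom C (\<I> \<odot> a) x" "g \<in> Hom C a x"
 shows "f oo lunit_inv C a = g \<longleftrightarrow> f = g oo lunit C a"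
proof
 note t = ty assms
 assume "f oo lunit_inv C a = g"
 hence "g oo lunit C a = (f oo lunit_inv C a) oo lunit C a" by simp
 also have "\<dots> = f oo (lunit_inv C a oo lunit C a)" by (rule Comp_assoc) (rule t)+
 finally show "f = g oo lunit C a" using assms by (simp add: lunit_inv_lunit Comp_Id)
next
 note t = ty assms
 assume e: "f = g oo lunit C a"
 have "(g oo lunit C a) oo lunit_inv C a = g oo (lunit C a oo lunit_inv C a)" by (rule Comp_assoc) (rule t)+
 thus "f oo lunit_inv C a = g" using assms e by (simp add: lunit_lunit_inv Comp_Id)
qed

lemma runit_move:
 assumes "a \<in> Ob C" "f \<in> Hom C (a \<odot> \<I>) x" "g \<in> Hom C a x"
 shows "f oo runit_inv C a = g \<longleftrightarrow> f = g oo runit C a"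
proof
 note t = ty assms
 assume "f oo runit_inv C a = g"
 hence "g oo runit C a = (f oo runit_inv C a) oo runit C a" by simp
 also have "\<dots> = f oo (runit_inv C a oo runit C a)" by (rule Comp_assoc) (rule t)+
 finally show "f = g oo runit C a" using assms by (simp add: runit_inv_runit Comp_Id)
next
 note t = ty assms
 assume e: "f = g oo runit C a"
 have "(g oo runit C a) oo runit_inv C a = g oo (runit C a oo runit_inv C a)" by (rule Comp_assoc) (rule t)+
 thus "f oo runit_inv C a = g" using assms e by (simp add: runit_runit_inv Comp_Id)
qed

text \<open>
 The two sets of axioms differ by associators and unitors at the ends, which are invertible and may be moved across.
\<close>

lemma bim_sb: "S.bim (sb A) \<longleftrightarrow> bimonoid C A"
proof (cases "und A \<in> Ob C \<and> nabla A \<in> Hom C (und A \<odot> und A) (und A) \<and> eta A \<in> Hom C \<I> (und A)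
  \<and> delta A \<in> Hom C (und A) (und A \<odot> und A) \<and> eps A \<in> Hom C (und A) \<I>")
 case False
 thus ?thesis unfolding S.bim_def bimonoid_def is_monoid_def is_comonoid_def by auto
next
 case True
 define a m e d p where "a = und A" and "m = nabla A" and "e = eta A" and "d = delta A" and "p = eps A"
 note D = a_def m_def e_def d_def p_def
 have h: "a \<in> Ob C" "m \<in> Hom C (a \<odot> a) a" "e \<in> Hom C \<I> a" "d \<in> Hom C a (a \<odot> a)" "p \<in> Hom C a \<I>"
  using True by (auto simp: D)
 let ?i = "Id C a"
 note t = ty h
 have ih: "?i \<in> Hom C a a" by (rule t)+
 have k: "(m ## ?i) oo assoc_inv C a a a \<in> Hom C (a \<odot> (a \<odot> a)) (a \<odot> a)" "?i ## m \<in> Hom C (a \<odot> (a \<odot> a)) (a \<odot> a)"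
  "(e ## ?i) oo lunit_inv C a \<in> Hom C a (a \<odot> a)" "(?i ## e) oo runit_inv C a \<in> Hom C a (a \<odot> a)"
  "assoc C a a a oo (d ## ?i) \<in> Hom C (a \<odot> a) (a \<odot> (a \<odot> a))" "?i ## d \<in> Hom C (a \<odot> a) (a \<odot> (a \<odot> a))"
  "lunit C a oo (p ## ?i) \<in> Hom C (a \<odot> a) a" "runit C a oo (?i ## p) \<in> Hom C (a \<odot> a) a"
  "(m ## m) oo assoc_inv C a a (a \<odot> a) \<in> Hom C (a \<odot> (a \<odot> (a \<odot> a))) (a \<odot> a)"
  "assoc C a a (a \<odot> a) oo (d ## d) \<in> Hom C (a \<odot> a) (a \<odot> (a \<odot> (a \<odot> a)))"
  "assoc C a a (a \<odot> a) oo (swap_mid C a a a a oo assoc_inv C a a (a \<odot> a)) \<in> Hom C (a \<odot> (a \<odot> (a \<odot> a))) (a \<odot> (a \<odot> (a \<odot> a)))"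
  "(e ## e) oo lunit_inv C \<I> \<in> Hom C \<I> (a \<odot> a)" "lunit C \<I> oo (p ## p) \<in> Hom C (a \<odot> a) \<I>"
  by (rule t swap_mid_Hom[OF h(1,1,1,1,1,1)])+
 note comp = t21[OF h(1,1,1,1,1,1)] t12[OF h(1,1,1,1,1,1)] u21[OF h(1,1,1,1,1,1)] u12[OF h(1,1,1,1,1,1)]
  n01[OF h(1,1,1,1,1,1)] n10[OF h(1,1,1,1,1,1)] e01[OF h(1,1,1,1,1,1)] e10[OF h(1,1,1,1,1,1)] n00[OF h(1,1,1,1,1,1)]
  e00[OF h(1,1,1,1,1,1)] t22[OF h(1,1,1,1,1,1)] u22[OF h(1,1,1,1,1,1)] sw4[OF h(1,1,1,1,1,1), unfolded side_def, simplified]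
 have mono: "m oo ((m ## ?i) oo assoc_inv C a a a) = m oo (?i ## m)
   \<longleftrightarrow> m oo (m ## ?i) = m oo ((?i ## m) oo assoc C a a a)"
 proof -
  have "(m oo (m ## ?i)) oo assoc_inv C a a a = m oo ((m ## ?i) oo assoc_inv C a a a)"
   by (rule Comp_assoc) (rule t)+
  moreover have "(m oo (?i ## m)) oo assoc C a a a = m oo ((?i ## m) oo assoc C a a a)"
   by (rule Comp_assoc) (rule t)+
  ultimately show ?thesis
   using assoc_move[OF h(1,1,1) Comp_Hom[OF tensor_Hom[OF h(2) ih] h(2)] Comp_Hom[OF k(2) h(2)]] by simp
 qed
 have lu: "m oo ((e ## ?i) oo lunit_inv C a) = ?i \<longleftrightarrow> m oo (e ## ?i) = lunit C a"
 proof -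
  have "(m oo (e ## ?i)) oo lunit_inv C a = m oo ((e ## ?i) oo lunit_inv C a)" by (rule Comp_assoc) (rule t)+
  thus ?thesis using lunit_move[OF h(1) Comp_Hom[OF tensor_Hom[OF h(3) ih] h(2)] ih] Id_Comp[OF lunit_Hom[OF h(1)]] by simp
 qed
 have ru: "m oo ((?i ## e) oo runit_inv C a) = ?i \<longleftrightarrow> m oo (?i ## e) = runit C a"
 proof -
  have "(m oo (?i ## e)) oo runit_inv C a = m oo ((?i ## e) oo runit_inv C a)" by (rule Comp_assoc) (rule t)+
  thus ?thesis using runit_move[OF h(1) Comp_Hom[OF tensor_Hom[OF ih h(3)] h(2)] ih] Id_Comp[OF runit_Hom[OF h(1)]] by simp
 qed
 have co: "(assoc C a a a oo (d ## ?i)) oo d = assoc C a a a oo ((d ## ?i) oo d)"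
  "(lunit C a oo (p ## ?i)) oo d = lunit C a oo ((p ## ?i) oo d)"
  "(runit C a oo (?i ## p)) oo d = runit C a oo ((?i ## p) oo d)"
  by (rule Comp_assoc, (rule t)+)+
 have cmp: "((m ## m) oo assoc_inv C a a (a \<odot> a)) oo ((assoc C a a (a \<odot> a) oo (swap_mid C a a a a oo assoc_inv C a a (a \<odot> a)))
   oo (assoc C a a (a \<odot> a) oo (d ## d))) = (m ## m) oo (swap_mid C a a a a oo (d ## d))"
 proof -
  let ?A = "assoc C a a (a \<odot> a)" and ?B = "assoc_inv C a a (a \<odot> a)" and ?W = "swap_mid C a a a a"
  note t = t swap_mid_Hom[OF h(1,1,1,1,1,1)]
  have aa: "Id C ((a \<odot> a) \<odot> (a \<odot> a)) oo x = x" if "x \<in> Hom C y ((a \<odot> a) \<odot> (a \<odot> a))" for x y using Id_Comp that by blast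
  have "(?A oo (?W oo ?B)) oo (?A oo (d ## d)) = ?A oo ((?W oo ?B) oo (?A oo (d ## d)))"
   by (rule Comp_assoc) (rule t)+
  also have "(?W oo ?B) oo (?A oo (d ## d)) = ?W oo (?B oo (?A oo (d ## d)))" by (rule Comp_assoc) (rule t)+
  also have "?B oo (?A oo (d ## d)) = Id C ((a \<odot> a) \<odot> (a \<odot> a)) oo (d ## d)"
   by (rule comp_rw1[OF assoc_inv_assoc]) (rule t)+
  also have "\<dots> = d ## d" by (rule aa) (rule t)+
  finally have 1: "(?A oo (?W oo ?B)) oo (?A oo (d ## d)) = ?A oo (?W oo (d ## d))" .
  have "((m ## m) oo ?B) oo (?A oo (?W oo (d ## d))) = (m ## m) oo (?B oo (?A oo (?W oo (d ## d))))"
   by (rule Comp_assoc) (rule t)+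
  also have "?B oo (?A oo (?W oo (d ## d))) = Id C ((a \<odot> a) \<odot> (a \<odot> a)) oo (?W oo (d ## d))"
   by (rule comp_rw1[OF assoc_inv_assoc]) (rule t)+
  also have "\<dots> = ?W oo (d ## d)" by (rule aa) (rule t)+
  finally show ?thesis unfolding 1 .
 qed
 have hs: "\<And>x f y. [|x \<in> Ob C; y \<in> Ob C; f \<in> Hom C x y|] ==> sar (Some ([x], f, [y]))" by simp
 note I = Unit_Ob tensor_Ob[OF h(1,1)]
 have k2: "(assoc C a a (a \<odot> a) oo (swap_mid C a a a a oo assoc_inv C a a (a \<odot> a))) oo (assoc C a a (a \<odot> a) oo (d ## d))
   \<in> Hom C (a \<odot> a) (a \<odot> (a \<odot> (a \<odot> a)))" by (rule Comp_Hom[OF k(10,11)])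
 note R = side_def comp scp_eq h ih k k2 I
 show ?thesis
  unfolding S.bim_def bimonoid_def is_monoid_def is_comonoid_def sb_sel D[symmetric]
  by (simp add: R mono lu ru co cmp)
qed

end

context ssmc begin

section \<open>Averaging over an integral\<close>

lemma hhom_comp: assumes h: "hopf A" "hopf B" "hopf D" and f: "hhom A B f" and g: "hhom B D g"
 shows "hhom A D (g ** f)"
proof -
 note [simp] = h
 have t: "hom f (und A) (und B)" "hom g (und B) (und D)" using f g by blast+
 note [simp] = t
 have c: "chom A D (g ** f)" by (rule chom_comp[of D A B]) (use h f g in \<open>blast intro: hopf_cc\<close>)+
 have fm: "f ** nabla A = nabla B ** (f || f)" "f ** eta A = eta B" using f by blast+
 have gm: "g ** nabla B = nabla D ** (g || g)" "g ** eta B = eta D" using g by blast+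
 have "(g ** f) ** nabla A = (g ** nabla B) ** (f || f)" unfolding cp_assoc fm ..
 also have "\<dots> = nabla D ** ((g ** f) || (g ** f))" unfolding gm by (simp add: ic)
 finally show ?thesis using c fm(2) gm(2) by simp
qed

text \<open>
 Coequalizers are determined up to isomorphism.
\<close>

lemma coq_iso:
 assumes q: "coq \<alpha> \<tau> p" and u: "hom u (trg p) y" and v: "hom v y (trg p)" "v ** u = ide (trg p)" "u ** v = ide y"
 shows "coq \<alpha> \<tau> (u ** p)"
proof -
 have p: "ar p" "src p = trg \<alpha>" "p ** \<alpha> = p ** \<tau>" using q unfolding coq_def by blast+
 note [simp] = u v(1) p(1,2)
 show ?thesis unfolding coq_def
 proof (intro conjI allI impI)
  show "(u ** p) ** \<alpha> = (u ** p) ** \<tau>" using p(3) by simp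
  fix h assume h: "ar h" "src h = trg \<alpha>" "h ** \<alpha> = h ** \<tau>"
  then obtain w where w: "hom w (trg p) (trg h)" "w ** p = h"
   and un: "\<And>w'. hom w' (trg p) (trg h) ==> w' ** p = h ==> w' = w"
   using q unfolding coq_def by blast
  note [simp] = w(1)
  show "\<exists>!w'. hom w' (trg (u ** p)) (trg h) \<and> w' ** u ** p = h"
  proof (rule ex1I[of _ "w ** v"])
   have "(w ** v) ** u ** p = w ** (v ** u) ** p" by simp
   thus "hom (w ** v) (trg (u ** p)) (trg h) \<and> (w ** v) ** u ** p = h" using w(2) v(2) by simp
   fix w' assume w': "hom w' (trg (u ** p)) (trg h) \<and> w' ** u ** p = h"
   hence "w' ** u = w" by (intro un) simp_all
   hence "w ** v = w' ** u ** v" by (metis cp_assoc)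
   thus "w' = w ** v" using v(3) w' by simp
  qed
 qed simp_all
qed

lemma squot_iso:
 assumes q: "squot A \<alpha> p" and u: "hom u (trg p) y" and v: "hom v y (trg p)" "v ** u = ide (trg p)" "u ** v = ide y"
 shows "squot A \<alpha> (u ** p)"
 unfolding squot_def
proof (intro conjI allI impI)
 have p: "ar p" "src p = trg \<alpha>" using q unfolding squot_def by blast+
 note [simp] = p u v(1)
 show "ar (u ** p)" "src (u ** p) = trg \<alpha>" by simp_all
 fix ys assume [simp]: "obs ys"
 have o: "obs y" "obs (trg p)" using trg_obs[of u] trg_obs[of p] u by simp_all
 have "coq (\<alpha> || ide ys) (eps A || ide (trg \<alpha>) || ide ys) ((u || ide ys) ** (p || ide ys))"
 proof (rule coq_iso[where v = "v || ide ys" and y = "y @ ys"])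
  show "coq (\<alpha> || ide ys) (eps A || ide (trg \<alpha>) || ide ys) (p || ide ys)" using q unfolding squot_def by simp
 qed (use o v(2,3) in \<open>simp_all add: ic ide_ide\<close>)
 thus "coq (\<alpha> || ide ys) (eps A || ide (trg \<alpha>) || ide ys) ((u ** p) || ide ys)" by (simp add: ic)
qed

lemma coq_change_object:
 assumes [simp]: "ar \<alpha>" "ar \<tau>" "src \<tau> = src \<alpha>" "trg \<tau> = trg \<alpha>" "ar p" "src p = trg \<alpha>"
  and k [simp]: "hom \<kappa> ys zs" "hom \<kappa>' zs ys" and kk: "\<kappa>' ** \<kappa> = ide ys" "\<kappa> ** \<kappa>' = ide zs"
  and q: "coq (\<alpha> || ide zs) (\<tau> || ide zs) (p || ide zs)"
 shows "coq (\<alpha> || ide ys) (\<tau> || ide ys) (p || ide ys)"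
proof -
 have o [simp]: "obs ys" "obs zs" using k src_obs[of \<kappa>] src_obs[of \<kappa>'] by simp_all
 have so [simp]: "obs (src \<alpha>)" "obs (trg \<alpha>)" "obs (trg p)" using src_obs[of \<alpha>] trg_obs[of \<alpha>] trg_obs[of p] by simp_all
 have qe: "(p ** \<alpha>) || ide zs = (p ** \<tau>) || ide zs" using q unfolding coq_def by (simp add: ic)
 have "(p ** \<alpha>) || ide ys = (ide (trg p) || \<kappa>') ** ((p ** \<alpha>) || ide zs) ** (ide (src \<alpha>) || \<kappa>)"
  by (simp add: ic kk)
 also have "\<dots> = (p ** \<tau>) || ide ys" unfolding qe by (simp add: ic kk)
 finally have 1: "(p || ide ys) ** (\<alpha> || ide ys) = (p || ide ys) ** (\<tau> || ide ys)" by (simp add: ic)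
 show ?thesis unfolding coq_def
 proof (intro conjI allI impI)
  fix h assume h: "ar h" "src h = trg (\<alpha> || ide ys)" "h ** (\<alpha> || ide ys) = h ** (\<tau> || ide ys)"
  note [simp] = h(1) and hs [simp] = h(2)[simplified]
  have U: "\<And>h. [|ar h; src h = trg (\<alpha> || ide zs); h ** (\<alpha> || ide zs) = h ** (\<tau> || ide zs)|]
    ==> \<exists>!w. hom w (trg (p || ide zs)) (trg h) \<and> w ** (p || ide zs) = h"
   using q unfolding coq_def by blast
  let ?h = "h ** (ide (trg \<alpha>) || \<kappa>')"
  have "?h ** (\<alpha> || ide zs) = (h ** (\<alpha> || ide ys)) ** (ide (src \<alpha>) || \<kappa>')" by (simp add: ic)
  also have "\<dots> = ?h ** (\<tau> || ide zs)" unfolding h(3) by (simp add: ic)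
  finally have e: "?h ** (\<alpha> || ide zs) = ?h ** (\<tau> || ide zs)" .
  have "\<exists>!w. hom w (trg (p || ide zs)) (trg ?h) \<and> w ** (p || ide zs) = ?h"
   by (rule U) (simp, simp, rule e)
  then obtain w where w: "hom w (trg p @ zs) (trg h)" "w ** (p || ide zs) = ?h"
   and un: "\<And>w'. hom w' (trg p @ zs) (trg h) ==> w' ** (p || ide zs) = ?h ==> w' = w"
   by auto
  note [simp] = w(1)
  show "\<exists>!w. hom w (trg (p || ide ys)) (trg h) \<and> w ** (p || ide ys) = h"
  proof (rule ex1I[of _ "w ** (ide (trg p) || \<kappa>)"])
   have "(w ** (ide (trg p) || \<kappa>)) ** (p || ide ys) = (w ** (p || ide zs)) ** (ide (trg \<alpha>) || \<kappa>)" by (simp add: ic)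
   also have "\<dots> = h" unfolding w(2) by (simp add: ic kk ide_ide cp_ide)
   finally show "hom (w ** (ide (trg p) || \<kappa>)) (trg (p || ide ys)) (trg h) \<and> (w ** (ide (trg p) || \<kappa>)) ** (p || ide ys) = h"
    by simp
   fix w' assume "hom w' (trg (p || ide ys)) (trg h) \<and> w' ** (p || ide ys) = h"
   hence w' [simp]: "hom w' (trg p @ ys) (trg h)" and e': "w' ** (p || ide ys) = h" by simp_all
   have "(w' ** (ide (trg p) || \<kappa>')) ** (p || ide zs) = (w' ** (p || ide ys)) ** (ide (trg \<alpha>) || \<kappa>')" by (simp add: ic)
   hence "w' ** (ide (trg p) || \<kappa>') = w" using e' by (intro un) simp_all
   hence "w ** (ide (trg p) || \<kappa>) = (w' ** (ide (trg p) || \<kappa>')) ** (ide (trg p) || \<kappa>)" by simp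
   also have "\<dots> = w'" by (simp add: ic kk ide_ide cp_ide)
   finally show "w' = w ** (ide (trg p) || \<kappa>)" by simp
  qed
 qed (use 1 in simp_all)
qed

text \<open>
 Coequalizing \<open>\<alpha>\<close> with the trivial action on a further factor \<open>ys\<close> is the same as coequalizing the tensor product of \<open>\<alpha>\<close> with the trivial action of \<open>A\<close> on \<open>ys\<close>. Thus stability with a trivial second action says that a stabilized object stays a coequalizer after tensoring.
\<close>

lemma tensor_trivial_action:
 assumes [simp]: "ar \<alpha>" "src \<alpha> = a @ x" "trg \<alpha> = x" "ar e" "src e = a" "trg e = []" "obs ys" "ar h" "src h = x @ ys"
  and h: "h ** (\<alpha> || ide ys) = h ** (e || ide x || ide ys)"
 shows "h ** (\<alpha> || e || ide ys) ** (ide a || sw a x || ide ys) = h ** (e || e || ide x || ide ys)"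
proof -
 have o [simp]: "obs a" "obs x" using src_obs[of \<alpha>] src_obs[of e] trg_obs[of \<alpha>] by auto
 have s: "(ide x || e) ** sw a x = e || ide x" using sw_nat[of e "ide x"] by (simp add: sw_Nil_left)
 have "\<alpha> || e || ide ys = (\<alpha> || ide ys) ** (ide (a @ x) || e || ide ys)"
  using ic[of \<alpha> "ide (a @ x)" "ide ys" "e || ide ys"] by simp
 also have "ide (a @ x) || e || ide ys = ide a || (ide x || e) || ide ys" by (simp add: ide_ide[symmetric] ts_assoc)
 finally have "(\<alpha> || e || ide ys) ** (ide a || sw a x || ide ys) = (\<alpha> || ide ys) ** (ide a || (ide x || e) || ide ys) ** (ide a || sw a x || ide ys)"
  by (simp only: cp_assoc)
 also have "(ide a || (ide x || e) || ide ys) ** (ide a || sw a x || ide ys) = ide a || e || ide x || ide ys"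
 proof -
  have "((ide x || e) || ide ys) ** (sw a x || ide ys) = ((ide x || e) ** sw a x) || ide ys"
   using ic[of "ide x || e" "sw a x" "ide ys" "ide ys"] by simp
  also have "\<dots> = e || ide x || ide ys" unfolding s by (simp add: ts_assoc)
  finally show ?thesis
   using ic[of "ide a" "ide a" "(ide x || e) || ide ys" "sw a x || ide ys"] by simp
 qed
 finally have "h ** (\<alpha> || e || ide ys) ** (ide a || sw a x || ide ys) = (h ** (\<alpha> || ide ys)) ** (ide a || e || ide x || ide ys)"
  by (simp only: cp_assoc)
 also have "\<dots> = h ** (e || ide x || ide ys) ** (ide a || e || ide x || ide ys)" unfolding h by (simp only: cp_assoc)
 also have "(e || ide x || ide ys) ** (ide a || e || ide x || ide ys) = e || e || ide x || ide ys"
  using ic[of e "ide a" "ide (x @ ys)" "e || ide (x @ ys)"] by (simp add: ide_ide)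
 finally show ?thesis .
qed

context
 fixes A \<alpha> x \<sigma>
 assumes act: "act A \<alpha> x" and s: "nint A \<sigma>"
begin

abbreviation (input) "avg \<equiv> \<alpha> ** (\<sigma> || ide x)"

lemma avg_simps [simp]: "obs x" "ar \<alpha>" "src \<alpha> = und A @ x" "trg \<alpha> = x" "obs (und A)" "ar (eps A)" "src (eps A) = und A" "trg (eps A) = []"
  "ar (nabla A)" "src (nabla A) = und A @ und A" "trg (nabla A) = und A" "ar \<sigma>" "src \<sigma> = []" "trg \<sigma> = und A" "eps A ** \<sigma> = ide []"
 using act s unfolding act_def bim_def nint_def int_def by blast+

lemma avg_absorb: "avg ** \<alpha> = avg ** (eps A || ide x)"
proof -
 have n: "nabla A ** (\<sigma> || ide (und A)) = \<sigma> ** eps A" using s unfolding nint_def int_def by blast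
 have "avg ** \<alpha> = (\<alpha> ** (ide (und A) || \<alpha>)) ** (\<sigma> || ide (und A @ x))"
  using pt_cp[of \<sigma> \<alpha>] by (simp add: ic)
 also have "\<alpha> ** (ide (und A) || \<alpha>) = \<alpha> ** (nabla A || ide x)" using act unfolding act_def by simp
 also have "(\<alpha> ** (nabla A || ide x)) ** (\<sigma> || ide (und A @ x)) = \<alpha> ** ((nabla A ** (\<sigma> || ide (und A))) || ide x)"
  using ic[of "nabla A" "\<sigma> || ide (und A)" "ide x" "ide x"] by (simp add: ide_ide)
 also have "\<dots> = avg ** (eps A || ide x)" unfolding n by (simp add: ic)
 finally show ?thesis .
qed

lemma avg_coinvariant: assumes [simp]: "ar h" "src h = x"
 shows "h ** \<alpha> = h ** (eps A || ide x) \<longleftrightarrow> h ** avg = h"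
proof
 assume "h ** \<alpha> = h ** (eps A || ide x)"
 hence "h ** avg = (h ** (eps A || ide x)) ** (\<sigma> || ide x)" by (metis cp_assoc)
 thus "h ** avg = h" by (simp add: ic)
next
 assume e: "h ** avg = h"
 have "h ** \<alpha> = h ** avg ** \<alpha>" using e by (metis cp_assoc)
 also have "\<dots> = h ** avg ** (eps A || ide x)" unfolding avg_absorb ..
 also have "\<dots> = h ** (eps A || ide x)" using e by (metis cp_assoc)
 finally show "h ** \<alpha> = h ** (eps A || ide x)" .
qed

lemma avg_idem: "avg ** avg = avg"
 using avg_coinvariant[of avg] avg_absorb by simp

lemma avg_invariant: assumes A: "hopf A" and [simp]: "ar j" "trg j = x"
 shows "\<alpha> ** (ide (und A) || j) = eps A || j \<longleftrightarrow> avg ** j = j"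
proof
 have sj: "(ide (und A) || j) ** (\<sigma> || ide (src j)) = (\<sigma> || ide x) ** j"
  using pt_cp[of \<sigma> j] by (simp add: ic src_obs)
 assume "\<alpha> ** (ide (und A) || j) = eps A || j"
 hence "avg ** j = (eps A || j) ** (\<sigma> || ide (src j))" using sj by (metis cp_assoc)
 thus "avg ** j = j" by (simp add: ic src_obs)
next
 have n: "nabla A ** (ide (und A) || \<sigma>) = \<sigma> ** eps A" using int_right[OF A] s unfolding nint_def by blast
 have e: "\<alpha> ** (ide (und A) || avg) = avg ** (eps A || ide x)"
 proof -
  have "\<alpha> ** (ide (und A) || avg) = (\<alpha> ** (ide (und A) || \<alpha>)) ** (ide (und A) || \<sigma> || ide x)" by (simp add: ic)
  also have "\<alpha> ** (ide (und A) || \<alpha>) = \<alpha> ** (nabla A || ide x)" using act unfolding act_def by simp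
  also have "(\<alpha> ** (nabla A || ide x)) ** (ide (und A) || \<sigma> || ide x) = \<alpha> ** ((nabla A ** (ide (und A) || \<sigma>)) || ide x)"
   using ic[of "nabla A" "ide (und A) || \<sigma>" "ide x" "ide x"] by simp
  also have "\<dots> = avg ** (eps A || ide x)" unfolding n by (simp add: ic)
  finally show ?thesis .
 qed
 assume j: "avg ** j = j"
 have "\<alpha> ** (ide (und A) || j) = \<alpha> ** (ide (und A) || (avg ** j))" unfolding j ..
 also have "\<dots> = (\<alpha> ** (ide (und A) || avg)) ** (ide (und A) || j)" by (simp add: ic)
 also have "\<dots> = avg ** (eps A || ide x) ** (ide (und A) || j)" unfolding e by (simp only: cp_assoc)
 also have "(eps A || ide x) ** (ide (und A) || j) = eps A || j" by (simp add: ic)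
 also have "\<dots> = j ** (eps A || ide (src j))" using ic[of "ide []" "eps A" j "ide (src j)"] by (simp add: src_obs cp_ide)
 also have "avg ** \<dots> = (avg ** j) ** (eps A || ide (src j))" by (simp only: cp_assoc)
 also have "\<dots> = j ** (eps A || ide (src j))" unfolding j ..
 also have "\<dots> = eps A || j" using ic[of "ide []" "eps A" j "ide (src j)"] by (simp add: src_obs cp_ide)
 finally show "\<alpha> ** (ide (und A) || j) = eps A || j" .
qed

end

definition ract :: "('o list, 'a) bimon => 'a => 'o list => bool" where
 "ract A \<alpha> x \<longleftrightarrow> bim A \<and> obs x \<and> hom \<alpha> (x @ und A) x \<and>
   \<alpha> ** (\<alpha> || ide (und A)) = \<alpha> ** (ide x || nabla A) \<and> \<alpha> ** (ide x || eta A) = ide x"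

text \<open>
 Since \<open>A\<close> is commutative, right actions are left actions.
\<close>

lemma ract_act:
 assumes A: "hopf A" and r: "ract A \<alpha> x"
 shows "act A (\<alpha> ** sw (und A) x) x"
proof -
 let ?a = "und A"
 have al [simp]: "obs x" "ar \<alpha>" "src \<alpha> = x @ ?a" "trg \<alpha> = x" using r unfolding ract_def by blast+
 have ass: "\<alpha> ** (\<alpha> || ide ?a) = \<alpha> ** (ide x || nabla A)" and un: "\<alpha> ** (ide x || eta A) = ide x"
  using r unfolding ract_def by blast+
 note [simp] = A hopfD(1-10)[OF A]
 have n: "nabla A ** sw ?a ?a = nabla A" using A unfolding hopf_def by blast
 have 0: "ide ?a || (\<alpha> ** sw ?a x) = (ide ?a || \<alpha>) ** (ide ?a || sw ?a x)" by (simp add: ic)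
 have "(\<alpha> ** sw ?a x) ** (ide ?a || (\<alpha> ** sw ?a x)) = \<alpha> ** (sw ?a x ** (ide ?a || \<alpha>)) ** (ide ?a || sw ?a x)"
  unfolding 0 by (simp only: cp_assoc)
 also have "sw ?a x ** (ide ?a || \<alpha>) = (\<alpha> || ide ?a) ** sw ?a (x @ ?a)" by (rule sw_nat2) simp_all
 also have "sw ?a (x @ ?a) = (ide x || sw ?a ?a) ** (sw ?a x || ide ?a)" by (rule sw_hex) simp_all
 also have "\<alpha> ** ((\<alpha> || ide ?a) ** (ide x || sw ?a ?a) ** (sw ?a x || ide ?a)) ** (ide ?a || sw ?a x)
   = (\<alpha> ** (\<alpha> || ide ?a)) ** (ide x || sw ?a ?a) ** (sw ?a x || ide ?a) ** (ide ?a || sw ?a x)" by (simp only: cp_assoc)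
 also have "(sw ?a x || ide ?a) ** (ide ?a || sw ?a x) = sw (?a @ ?a) x" by (rule sw_hex2[symmetric]) simp_all
 also have "(\<alpha> ** (\<alpha> || ide ?a)) ** (ide x || sw ?a ?a) ** sw (?a @ ?a) x
   = \<alpha> ** ((ide x || nabla A) ** (ide x || sw ?a ?a)) ** sw (?a @ ?a) x" unfolding ass by (simp only: cp_assoc)
 also have "(ide x || nabla A) ** (ide x || sw ?a ?a) = ide x || nabla A" using n ic[of "ide x" "ide x" "nabla A" "sw ?a ?a"] by simp
 also have "(ide x || nabla A) ** sw (?a @ ?a) x = sw ?a x ** (nabla A || ide x)" by (rule sw_nat1[symmetric]) simp_all
 finally have 1: "(\<alpha> ** sw ?a x) ** (nabla A || ide x) = (\<alpha> ** sw ?a x) ** (ide ?a || (\<alpha> ** sw ?a x))"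
  by (simp only: cp_assoc)
 have "sw ?a x ** (eta A || ide x) = (ide x || eta A) ** sw [] x" by (rule sw_nat1) simp_all
 hence 2: "(\<alpha> ** sw ?a x) ** (eta A || ide x) = ide x" using un by (simp add: sw_Nil_left)
 show ?thesis unfolding act_def using 1 2 A[unfolded hopf_def] by simp
qed

text \<open>
 The idempotent \<open>e\<close> is the action of the integral. Its splitting is at once the invariant and the stabilized object.
\<close>

lemma left_average:
 assumes A: "hopf A" and s: "nint A \<sigma>" and a: "act A \<alpha> x"
 shows "\<exists>e. hom e x x \<and> e ** e = e
  \<and> (\<forall>j. ar j --> trg j = x --> (\<alpha> ** (ide (und A) || j) = eps A || j \<longleftrightarrow> e ** j = j))
  \<and> (\<forall>h. ar h --> src h = x --> (h ** \<alpha> = h ** (eps A || ide x) \<longleftrightarrow> h ** e = h))"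
proof (rule exI[of _ "avg \<alpha> x \<sigma>"], intro conjI allI impI)
 note [simp] = avg_simps[OF a s]
 show "ar (avg \<alpha> x \<sigma>)" "src (avg \<alpha> x \<sigma>) = x" "trg (avg \<alpha> x \<sigma>) = x" by simp_all
qed (use avg_idem[OF a s] avg_invariant[OF a s A] avg_coinvariant[OF a s] in simp_all)

lemma right_average:
 assumes A: "hopf A" and s: "nint A \<sigma>" and r: "ract A \<alpha> x"
 shows "\<exists>e. hom e x x \<and> e ** e = e
  \<and> (\<forall>j. ar j --> trg j = x --> (\<alpha> ** (j || ide (und A)) = j || eps A \<longleftrightarrow> e ** j = j))
  \<and> (\<forall>h. ar h --> src h = x --> (h ** \<alpha> = h ** (ide x || eps A) \<longleftrightarrow> h ** e = h))"
proof -
 let ?a = "und A" and ?L = "\<alpha> ** sw (und A) x"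
 have al [simp]: "obs x" "ar \<alpha>" "src \<alpha> = x @ ?a" "trg \<alpha> = x" using r unfolding ract_def by blast+
 note [simp] = ccD(1,5,6,7)[OF hopf_cc[OF A]]
 have cancel: "f ** sw ?a y = g ** sw ?a y \<longleftrightarrow> f = g" if "ar f" "ar g" "src f = y @ ?a" "src g = y @ ?a" "obs y" for f g y
 proof
  assume e: "f ** sw ?a y = g ** sw ?a y"
  have "(f ** sw ?a y) ** sw y ?a = (g ** sw ?a y) ** sw y ?a" unfolding e ..
  thus "f = g" using that by (simp add: cp_ide)
 qed simp
 have 1: "?L ** (ide ?a || j) = eps A || j \<longleftrightarrow> \<alpha> ** (j || ide ?a) = j || eps A" if [simp]: "ar j" "trg j = x" for j
 proof -
  have o [simp]: "obs (src j)" using src_obs[of j] by simp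
  have "sw ?a x ** (ide ?a || j) = (j || ide ?a) ** sw ?a (src j)" by (rule sw_nat2) simp_all
  hence l: "?L ** (ide ?a || j) = (\<alpha> ** (j || ide ?a)) ** sw ?a (src j)" by (simp only: cp_assoc)
  have rr: "eps A || j = (j || eps A) ** sw ?a (src j)" using sw_nat[of "eps A" j] by (simp add: sw_Nil_left)
  show ?thesis unfolding l rr by (rule cancel) simp_all
 qed
 have 2: "h ** ?L = h ** (eps A || ide x) \<longleftrightarrow> h ** \<alpha> = h ** (ide x || eps A)" if [simp]: "ar h" "src h = x" for h
 proof -
  have rr: "eps A || ide x = (ide x || eps A) ** sw ?a x" using sw_nat[of "eps A" "ide x"] by (simp add: sw_Nil_left)
  have "h ** ?L = h ** (eps A || ide x) \<longleftrightarrow> (h ** \<alpha>) ** sw ?a x = (h ** (ide x || eps A)) ** sw ?a x"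
   unfolding rr by (simp only: cp_assoc)
  also have "\<dots> \<longleftrightarrow> h ** \<alpha> = h ** (ide x || eps A)" by (rule cancel) simp_all
  finally show ?thesis .
 qed
 from left_average[OF A s ract_act[OF A r]] 1 2 show ?thesis by metis
qed

text \<open>
 The stabilized object of the regular action is the unit, with projection the counit.
\<close>

lemma regular_coinvariant: assumes [simp]: "hopf A" "ar h" "src h = und A" and e: "h ** nabla A = h ** (eps A || ide (und A))"
 shows "h = (h ** eta A) ** eps A"
proof -
 have "h = h ** nabla A ** (ide (und A) || eta A)" by simp
 also have "\<dots> = (h ** (eps A || ide (und A))) ** (ide (und A) || eta A)" unfolding e[symmetric] by (simp only: cp_assoc)
 also have "\<dots> = h ** (eps A || eta A)" by (simp add: ic)
 also have "eps A || eta A = eta A ** eps A" using wt_cp(1)[of "eps A" "eta A"] by simp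
 finally show ?thesis by simp
qed

text \<open>
 Smallness applied to the regular action makes the counit invertible on invariants, and the inverse picks out a normalized integral.
\<close>

lemma nint_of_invariant:
 assumes A [simp]: "hopf A" and i [simp]: "hom i z (und A)" "hom g [] z" and e: "nabla A ** (ide (und A) || i) = eps A || i"
  and g: "(eps A ** i) ** g = ide []"
 shows "nint A (i ** g)"
proof -
 have "nabla A ** (ide (und A) || (i ** g)) = (nabla A ** (ide (und A) || i)) ** (ide (und A) || g)" by (simp add: ic)
 also have "\<dots> = (i ** g) ** eps A" unfolding e using wt_cp(1)[of "eps A" "i ** g"] by (simp add: ic)
 finally have r: "nabla A ** (ide (und A) || (i ** g)) = (i ** g) ** eps A" .
 have "(i ** g) || ide (und A) = sw (und A) (und A) ** (ide (und A) || (i ** g))"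
  using sw_nat[of "ide (und A)" "i ** g"] by (simp add: sw_Nil_right)
 hence "nabla A ** ((i ** g) || ide (und A)) = (nabla A ** sw (und A) (und A)) ** (ide (und A) || (i ** g))" by (simp only: cp_assoc)
 thus ?thesis using r g unfolding nint_def int_def by simp
qed

end

context bssmc begin

text \<open>
 A cokernel among Hopf monoids agrees with the stable quotient, which has the same universal property. Hence it is a coequalizer of objects as well.
\<close>

lemma cok_of_universal:
 assumes h: "hopf A" "hopf B" "hopf D" and len: "length (und A) = 1" "length (und B) = 1"
  and i: "hhom A B i" and p: "hhom B D p" and pi: "p ** i = eta D ** eps A"
  and ex: "\<And>X j. [|hopf X; length (und X) = 1; hhom B X j; j ** i = eta X ** eps A|] ==> \<exists>u. hhom D X u \<and> u ** p = j"
  and un: "\<And>u. [|hhom D D u; u ** p = p|] ==> u = ide (und D)"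
 shows "cok A B D i p"
proof -
 note [simp] = h
 obtain q where q: "squot A (nabla B ** (i || ide (und B))) q" "length (trg q) = 1"
  using stable[OF translation_act[OF h(1,2) i] len] by blast
 obtain E where E: "hopf E" "und E = trg q" "hhom B E q" using tq_hopf[OF h(1,2) i q(1)] by blast
 note qq = tq_hom[OF h(1,2) i q(1)]
 have qz: "q ** i = eta E ** eps A"
  using tq_zero[OF h(1,2) i q(1)] E(3) by (metis cp_assoc)
 obtain u where u: "hhom D E u" "u ** p = q" using ex[OF E(1) _ E(3) qz] q(2) E(2) by auto
 obtain v where v: "hhom E D v" "v ** q = p" using tq_universal[OF h(1,2) i q(1) E h(3) p pi] by blast
 have uh: "hom u (und D) (und E)" and vh: "hom v (und E) (und D)" and ph: "hom p (und B) (und D)" and qh: "hom q (und B) (und E)"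
  using u v p E(3) by blast+
 note [simp] = uh vh ph qh E(1)
 have "(v ** u) ** p = p" using u(2) v(2) by simp
 hence vu: "v ** u = ide (und D)" using un[of "v ** u"] hhom_comp[OF h(3) E(1) h(3) u(1) v(1)] by blast
 have uv: "u ** v = ide (trg q)" unfolding E(2)[symmetric]
  by (rule epi_cancel[OF tq_epi(1)[OF h(1,2) i q(1)]]) (use u(2) v(2) in simp_all)
 have vq: "hom v (trg q) (und D)" "hom u (und D) (trg q)" using uh vh E(2) by metis+
 have "squot A (nabla B ** (i || ide (und B))) (v ** q)"
  by (rule squot_iso[OF q(1) vq uv vu])
 hence "squot A (nabla B ** (i || ide (und B))) p" unfolding v(2) .
 thus ?thesis unfolding cok_def using h i p by blast
qed

end

context smc begin

interpretation S: ssmc "Ob C" sar ssrc strg scp sts side ssw by (rule strictification)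

lemmas stc =
 t11[OF _ _ _ _ Unit_Ob Unit_Ob] t21[OF _ _ _ _ _ Unit_Ob] t12[OF _ _ _ _ _ Unit_Ob]
 u21[OF _ _ _ _ _ Unit_Ob] u12[OF _ _ _ _ _ Unit_Ob]
 n01[OF _ Unit_Ob _ _ Unit_Ob Unit_Ob] n10[OF _ Unit_Ob _ _ Unit_Ob Unit_Ob]
 e01[OF _ Unit_Ob _ _ Unit_Ob Unit_Ob] e10[OF _ Unit_Ob _ _ Unit_Ob Unit_Ob]
 n00[OF _ _ Unit_Ob Unit_Ob Unit_Ob Unit_Ob] e00[OF _ _ Unit_Ob Unit_Ob Unit_Ob Unit_Ob]
 t22 u22 ssw11[OF _ _ Unit_Ob Unit_Ob Unit_Ob Unit_Ob]
 side_def scp_eq Unit_Ob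

lemma bimD: assumes "bimonoid C A"
 shows "und A \<in> Ob C" "nabla A \<in> Hom C (und A \<odot> und A) (und A)" "eta A \<in> Hom C \<I> (und A)"
  "delta A \<in> Hom C (und A) (und A \<odot> und A)" "eps A \<in> Hom C (und A) \<I>"
 using assms unfolding bimonoid_def is_monoid_def is_comonoid_def by blast+

lemma Jo2 [simp]: "Jo [a, b] = a \<odot> b" by simp

section \<open>Hopf monoids and integrals in the strictification\<close>

lemma hopf_sb: "S.hopf (sb A) \<longleftrightarrow> hopf_monoid C A \<and> bicommutative C A"
proof (cases "bimonoid C A")
 case False
 thus ?thesis unfolding S.hopf_def bim_sb hopf_monoid_def by simp
next
 case B: True
 note [simp] = bimD[OF B] tensor_Hom Id_Hom Comp_Hom[OF bimD(4)[OF B]] symm_Hom tensor_Ob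
 let ?a = "und A"
 have c: "S.bim (sb A)" "nabla A oo symm C ?a ?a \<in> Hom C (?a \<odot> ?a) ?a" using B bim_sb by blast (rule ty bimD[OF B])+
 have t: "(s ## Id C ?a) oo delta A \<in> Hom C ?a (?a \<odot> ?a)" "(Id C ?a ## s) oo delta A \<in> Hom C ?a (?a \<odot> ?a)"
  if "s \<in> Hom C ?a ?a" for s by (rule ty bimD[OF B] that)+
 have ant: "S.antip (sb A) (Some ([?a], s, [?a])) \<longleftrightarrow>
   s \<in> Hom C ?a ?a \<and> nabla A oo ((s ## Id C ?a) oo delta A) = eta A oo eps A" for s
  unfolding S.antip_def using t by (cases "s \<in> Hom C ?a ?a") (simp_all add: stc)
 have co: "S.hopf (sb A) \<longleftrightarrow> bicommutative C A \<and> (\<exists>T. S.antip (sb A) T)"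
  unfolding S.hopf_def bicommutative_def using c(1) by (simp add: stc)
 show ?thesis
 proof
  assume h: "S.hopf (sb A)"
  define s where "s = sm (S.anti (sb A))"
  have an: "S.anti (sb A) = Some ([?a], s, [?a])" unfolding s_def using S.anti_hom[OF h] by (intro sbind) simp_all
  have s: "s \<in> Hom C ?a ?a" "nabla A oo ((s ## Id C ?a) oo delta A) = eta A oo eps A"
   using S.hopf_antip[OF h] ant unfolding an by blast+
  have "S.cv (sb A) (sb A) (side [?a]) (S.anti (sb A)) = scp (eta (sb A)) (eps (sb A))"
   using S.cv_comm[OF h S.hopf_cc[OF h], of "side [?a]" "S.anti (sb A)"] S.anti_inv[OF h] S.anti_hom[OF h]
   by (simp add: S.cv_def S.pair_def)
  hence "nabla A oo ((Id C ?a ## s) oo delta A) = eta A oo eps A"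
   using s(1) t[OF s(1)] unfolding an S.cv_def S.pair_def by (simp add: stc)
  thus "hopf_monoid C A \<and> bicommutative C A" using s h co B unfolding hopf_monoid_def by blast
 next
  assume "hopf_monoid C A \<and> bicommutative C A"
  thus "S.hopf (sb A)" unfolding co hopf_monoid_def using ant by blast
 qed
qed

lemma hhom_sb:
 assumes "bimonoid C A" "bimonoid C B"
 shows "S.hhom (sb A) (sb B) (Some ([und A], f, [und B])) \<longleftrightarrow> bimonoid_hom C A B f"
proof (cases "f \<in> Hom C (und A) (und B)")
 case False thus ?thesis unfolding bimonoid_hom_def by simp
next
 case True
 note [simp] = True bimD[OF assms(1)] bimD[OF assms(2)] tensor_Hom Id_Hom tensor_Ob
 show ?thesis unfolding bimonoid_hom_def S.pair_def by (auto simp add: stc)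
qed

lemma sb_unsb: "[|S.bim A; length (und A) = 1|] ==> sb (unsb A) = A"
proof -
 assume b: "S.bim A" and "length (und A) = 1"
 then obtain a where a: "und A = [a]" by (auto simp: length_Suc_conv)
 have "nabla A = Some (und A @ und A, sm (nabla A), und A)" "eta A = Some ([], sm (eta A), und A)"
  "delta A = Some (und A, sm (delta A), und A @ und A)" "eps A = Some (und A, sm (eps A), [])"
  using b unfolding S.bim_def by (blast intro: sbind)+
 thus "sb (unsb A) = A" using a by (cases A) (simp add: sb_def unsb_def)
qed

lemma counit_slide: assumes "a \<in> Ob C" "c \<in> Ob C" "f \<in> Hom C \<I> a" "g \<in> Hom C c \<I>"
 shows "runit C a oo (f ## g) = (f oo g) oo lunit C c" "lunit C a oo (g ## f) = (f oo g) oo runit C c"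
proof -
 note t = ty assms
 have "f ## g = (f oo Id C \<I>) ## (Id C \<I> oo g)" using assms by (simp add: Comp_Id Id_Comp)
 also have "\<dots> = (f ## Id C \<I>) oo (Id C \<I> ## g)" by (rule tensor_Comp) (rule t)+
 finally have "runit C a oo (f ## g) = runit C a oo ((f ## Id C \<I>) oo (Id C \<I> ## g))" by simp
 also have "\<dots> = f oo (runit C \<I> oo (Id C \<I> ## g))" by (rule comp_rw[OF runit_nat]) (rule t)+
 also have "runit C \<I> oo (Id C \<I> ## g) = g oo lunit C c" unfolding lunit_eq_runit[symmetric] by (rule lunit_nat) (rule t)+
 also have "f oo (g oo lunit C c) = (f oo g) oo lunit C c" by (rule Comp_assoc[symmetric]) (rule t)+
 finally show "runit C a oo (f ## g) = (f oo g) oo lunit C c" .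
 have "g ## f = (Id C \<I> oo g) ## (f oo Id C \<I>)" using assms by (simp add: Comp_Id Id_Comp)
 also have "\<dots> = (Id C \<I> ## f) oo (g ## Id C \<I>)" by (rule tensor_Comp) (rule t)+
 finally have "lunit C a oo (g ## f) = lunit C a oo ((Id C \<I> ## f) oo (g ## Id C \<I>))" by simp
 also have "\<dots> = f oo (lunit C \<I> oo (g ## Id C \<I>))" by (rule comp_rw[OF lunit_nat]) (rule t)+
 also have "lunit C \<I> oo (g ## Id C \<I>) = g oo runit C c" unfolding lunit_eq_runit by (rule runit_nat) (rule t)+
 also have "f oo (g oo runit C c) = (f oo g) oo runit C c" by (rule Comp_assoc[symmetric]) (rule t)+
 finally show "lunit C a oo (g ## f) = (f oo g) oo runit C c" .
qed

text \<open>
 The right integral equation follows from the left one by commutativity.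
\<close>

lemma nint_sb:
 assumes h: "S.hopf (sb A)"
 shows "S.nint (sb A) (Some ([], \<phi>, [und A])) \<longleftrightarrow> integral C A \<phi> \<and> eps A oo \<phi> = Id C \<I>"
proof (cases "\<phi> \<in> Hom C \<I> (und A)")
 case False thus ?thesis unfolding S.nint_def S.int_def integral_def by simp
next
 case ph: True
 have B: "bimonoid C A" using h bim_sb unfolding S.hopf_def by blast
 note t = ty ph bimD[OF B]
 note [simp] = ph bimD[OF B] tensor_Hom Id_Hom tensor_Ob
 let ?a = "und A"
 have k: "(\<phi> ## Id C ?a) oo lunit_inv C ?a \<in> Hom C ?a (?a \<odot> ?a)" "(Id C ?a ## \<phi>) oo runit_inv C ?a \<in> Hom C ?a (?a \<odot> ?a)"
  by (rule t)+
 have l: "nabla A oo ((\<phi> ## Id C ?a) oo lunit_inv C ?a) = \<phi> oo eps A \<longleftrightarrow> nabla A oo (\<phi> ## Id C ?a) = runit C ?a oo (\<phi> ## eps A)"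
 proof -
  have "nabla A oo (\<phi> ## Id C ?a) \<in> Hom C (\<I> \<odot> ?a) ?a" "\<phi> oo eps A \<in> Hom C ?a ?a" by (rule t)+
  moreover have "(nabla A oo (\<phi> ## Id C ?a)) oo lunit_inv C ?a = nabla A oo ((\<phi> ## Id C ?a) oo lunit_inv C ?a)"
   by (rule Comp_assoc) (rule t)+
  ultimately show ?thesis using lunit_move[of ?a "nabla A oo (\<phi> ## Id C ?a)" ?a "\<phi> oo eps A"]
   by (simp add: counit_slide(1)[of ?a ?a])
 qed
 have r: "nabla A oo ((Id C ?a ## \<phi>) oo runit_inv C ?a) = \<phi> oo eps A \<longleftrightarrow> nabla A oo (Id C ?a ## \<phi>) = lunit C ?a oo (eps A ## \<phi>)"
 proof -
  have "nabla A oo (Id C ?a ## \<phi>) \<in> Hom C (?a \<odot> \<I>) ?a" "\<phi> oo eps A \<in> Hom C ?a ?a" by (rule t)+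
  moreover have "(nabla A oo (Id C ?a ## \<phi>)) oo runit_inv C ?a = nabla A oo ((Id C ?a ## \<phi>) oo runit_inv C ?a)"
   by (rule Comp_assoc) (rule t)+
  ultimately show ?thesis using runit_move[of ?a "nabla A oo (Id C ?a ## \<phi>)" ?a "\<phi> oo eps A"]
   by (simp add: counit_slide(2)[of ?a ?a])
 qed
 have i: "S.int (sb A) (Some ([], \<phi>, [?a])) \<longleftrightarrow> nabla A oo (\<phi> ## Id C ?a) = runit C ?a oo (\<phi> ## eps A)"
  unfolding l[symmetric] S.int_def using k by (simp add: stc)
 have "nabla A oo (Id C ?a ## \<phi>) = lunit C ?a oo (eps A ## \<phi>)" if "S.int (sb A) (Some ([], \<phi>, [?a]))"
  unfolding r[symmetric] using S.int_right[OF h that] k by (simp add: stc)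
 thus ?thesis using i unfolding S.nint_def integral_def by (auto simp: stc)
qed

lemma ncoint_sb:
 assumes h: "S.hopf (sb A)"
 shows "S.ncoint (sb A) (Some ([und A], l, [])) \<longleftrightarrow> cointegral C A l \<and> l oo eta A = Id C \<I>"
proof (cases "l \<in> Hom C (und A) \<I>")
 case False thus ?thesis unfolding S.ncoint_def S.coint_def cointegral_def by simp
next
 case l: True
 have B: "bimonoid C A" using h bim_sb unfolding S.hopf_def by blast
 note t = ty l bimD[OF B]
 note [simp] = l bimD[OF B] tensor_Hom Id_Hom tensor_Ob
 let ?a = "und A"
 have k: "lunit C ?a oo (l ## Id C ?a) \<in> Hom C (?a \<odot> ?a) ?a" "runit C ?a oo (Id C ?a ## l) \<in> Hom C (?a \<odot> ?a) ?a"
  by (rule t)+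
 have as: "(lunit C ?a oo (l ## Id C ?a)) oo delta A = lunit C ?a oo ((l ## Id C ?a) oo delta A)"
  "(runit C ?a oo (Id C ?a ## l)) oo delta A = runit C ?a oo ((Id C ?a ## l) oo delta A)"
  by (rule Comp_assoc, (rule t)+)+
 have i: "S.coint (sb A) (Some ([?a], l, [])) \<longleftrightarrow> lunit C ?a oo ((l ## Id C ?a) oo delta A) = eta A oo l"
  unfolding S.coint_def using k as by (simp add: stc)
 have "runit C ?a oo ((Id C ?a ## l) oo delta A) = eta A oo l" if "S.coint (sb A) (Some ([?a], l, []))"
  using S.coint_right[OF h that] k as by (simp add: stc)
 thus ?thesis using i unfolding S.ncoint_def cointegral_def by (auto simp: stc)
qed

lemma nintE: assumes "S.hopf (sb A)" "S.nint (sb A) \<Phi>"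
 shows "\<Phi> = Some ([], normalized_integral C A, [und A])"
proof -
 have "\<Phi> = Some ([], sm \<Phi>, [und A])" using assms(2) unfolding S.nint_def S.int_def by (intro sbind) auto
 moreover have "normalized_integral C A = sm \<Phi>" unfolding normalized_integral_def
 proof (rule the_equality)
  show "integral C A (sm \<Phi>) \<and> eps A oo sm \<Phi> = Id C \<I>" using nint_sb[OF assms(1)] assms(2) calculation by metis
  fix \<phi> assume "integral C A \<phi> \<and> eps A oo \<phi> = Id C \<I>"
  hence "S.nint (sb A) (Some ([], \<phi>, [und A]))" using nint_sb[OF assms(1)] by simp
  from S.nint_unique[OF assms(1) this assms(2)] show "\<phi> = sm \<Phi>" by (metis sm.simps(1))
 qed
 ultimately show ?thesis by simp
qed

lemma ncointE: assumes "S.hopf (sb A)" "S.ncoint (sb A) l"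
 shows "l = Some ([und A], normalized_cointegral C A, [])"
proof -
 have "l = Some ([und A], sm l, [])" using assms(2) unfolding S.ncoint_def S.coint_def by (intro sbind) auto
 moreover have "normalized_cointegral C A = sm l" unfolding normalized_cointegral_def
 proof (rule the_equality)
  show "cointegral C A (sm l) \<and> sm l oo eta A = Id C \<I>" using ncoint_sb[OF assms(1)] assms(2) calculation by metis
  fix \<phi> assume "cointegral C A \<phi> \<and> \<phi> oo eta A = Id C \<I>"
  hence "S.ncoint (sb A) (Some ([und A], \<phi>, []))" using ncoint_sb[OF assms(1)] by simp
  from S.ncoint_unique[OF assms(1) this assms(2)] show "\<phi> = sm l" by (metis sm.simps(1))
 qed
 ultimately show ?thesis by simp
qed

text \<open>
 An object of arrows fixed by an idempotent from the left and one of arrows fixed from the right both split the idempotent, so that the composite between them is invertible.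
\<close>

lemma idempotent_splits:
 assumes he: "has_equalizers C" and e: "e \<in> Hom C X X" "e oo e = e"
  and Q: "\<And>J j. Q J j \<longleftrightarrow> j \<in> Hom C J X \<and> e oo j = j"
  and R: "\<And>x h. R x h \<longleftrightarrow> h \<in> Hom C X x \<and> h oo e = h"
 defines "UI \<equiv> \<lambda>I i. Q I i \<and> (\<forall>J j. Q J j --> (\<exists>!u. u \<in> Hom C J I \<and> i oo u = j))"
  and "UP \<equiv> \<lambda>P p. R P p \<and> (\<forall>x h. R x h --> (\<exists>!u. u \<in> Hom C P x \<and> u oo p = h))"
 shows "(\<exists>I i. UI I i) \<and> (\<exists>P p. UP P p) \<and> (\<forall>I i P p. UI I i \<and> UP P p --> iso_arr C I P (p oo i))"
proof -
 have X: "X \<in> Ob C" using e(1) Hom_obs by blast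
 obtain I i where eq: "is_equalizer C X X e (Id C X) I i"
  using he e(1) Id_Hom[OF X] unfolding has_equalizers_def by blast
 have i: "i \<in> Hom C I X" "e oo i = i" using eq Id_Comp unfolding is_equalizer_def by auto
 have ui: "\<exists>!u. u \<in> Hom C J I \<and> i oo u = j" if "j \<in> Hom C J X" "e oo j = j" for J j
  using eq that Id_Comp[of j J X] unfolding is_equalizer_def by auto
 obtain r where r: "r \<in> Hom C X I" "i oo r = e" using ui[OF e] by blast
 have ri: "r oo i = Id C I"
 proof -
  have "i oo (r oo i) = i" using Comp_assoc[OF i(1) r(1) i(1)] r(2) i(2) by simp
  moreover have "i oo Id C I = i" "Id C I \<in> Hom C I I" "r oo i \<in> Hom C I I" using i r Comp_Id Comp_Hom Id_Hom Hom_obs by auto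
  ultimately show ?thesis using ui[OF i] by blast
 qed
 have UI: "UI I i" unfolding UI_def Q using i ui by blast
 have re: "r oo e = r" using Comp_assoc[OF r(1) i(1) r(1)] r(2) ri Id_Comp[OF r(1)] by simp
 have UP: "UP I r" unfolding UP_def R
 proof (intro conjI allI impI r(1) re)
  fix x h assume h: "h \<in> Hom C X x \<and> h oo e = h"
  show "\<exists>!u. u \<in> Hom C I x \<and> u oo r = h"
  proof (rule ex1I[of _ "h oo i"])
   show "h oo i \<in> Hom C I x \<and> (h oo i) oo r = h" using h i r Comp_Hom Comp_assoc[of r X I i X h x] by auto
   fix u assume "u \<in> Hom C I x \<and> u oo r = h"
   thus "u = h oo i" using Comp_assoc[of i I X r I u x] i r ri Comp_Id by auto
  qed
 qed
 have iso: "iso_arr C J P (p oo j)" if j: "UI J j" and p: "UP P p" for J j P p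
 proof -
  have jt: "j \<in> Hom C J X" "e oo j = j" and pt: "p \<in> Hom C X P" "p oo e = p" using j p unfolding UI_def UP_def Q R by auto
  obtain s where s: "s \<in> Hom C X J" "j oo s = e" using j e unfolding UI_def Q by blast
  obtain q where q: "q \<in> Hom C P X" "q oo p = e" using p e unfolding UP_def R by blast
  have ob: "J \<in> Ob C" "P \<in> Ob C" using jt pt Hom_obs by blast+
  note t = Comp_Hom jt(1) pt(1) s(1) q(1) e(1) Id_Hom ob
  have sj: "s oo j = Id C J"
  proof -
   have "j oo (s oo j) = j" using Comp_assoc[OF jt(1) s(1) jt(1)] s(2) jt(2) by simp
   moreover have "j oo Id C J = j" by (rule Comp_Id[OF jt(1)])
   moreover have "s oo j \<in> Hom C J J" "Id C J \<in> Hom C J J" by (rule t)+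
   moreover have "\<exists>!u. u \<in> Hom C J J \<and> j oo u = j" using j jt unfolding UI_def Q by blast
   ultimately show ?thesis by blast
  qed
  have pq: "p oo q = Id C P"
  proof -
   have "(p oo q) oo p = p" using Comp_assoc[OF pt(1) q(1) pt(1)] q(2) pt(2) by simp
   moreover have "Id C P oo p = p" by (rule Id_Comp[OF pt(1)])
   moreover have "p oo q \<in> Hom C P P" "Id C P \<in> Hom C P P" by (rule t)+
   moreover have "\<exists>!u. u \<in> Hom C P P \<and> u oo p = p" using p pt unfolding UP_def R by blast
   ultimately show ?thesis by blast
  qed
  have "(s oo q) oo (p oo j) = s oo (q oo (p oo j))" by (rule Comp_assoc) (rule t)+
  also have "q oo (p oo j) = e oo j" by (rule comp_rw1[OF q(2)]) (rule t)+
  finally have 1: "(s oo q) oo (p oo j) = Id C J" using jt sj by simp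
  have "(p oo j) oo (s oo q) = p oo (j oo (s oo q))" by (rule Comp_assoc) (rule t)+
  also have "j oo (s oo q) = e oo q" by (rule comp_rw1[OF s(2)]) (rule t)+
  also have "p oo (e oo q) = p oo q" by (rule comp_rw1[OF pt(2)]) (rule t)+
  finally have 2: "(p oo j) oo (s oo q) = Id C P" using pq by simp
  have "p oo j \<in> Hom C J P" "s oo q \<in> Hom C P J" by (rule t)+
  with 1 2 show ?thesis unfolding iso_arr_def inverse_arrs_def by blast
 qed
 from UI UP iso show ?thesis by blast
qed

end

context ssmc begin

lemma trivial_act: assumes b: "bim A" and [simp]: "obs y" shows "act A (eps A || ide y) y"
proof -
 have [simp]: "obs (und A)" "ar (eps A)" "src (eps A) = und A" "trg (eps A) = []" "ar (nabla A)" "src (nabla A) = und A @ und A"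
  "trg (nabla A) = und A" "ar (eta A)" "src (eta A) = []" "trg (eta A) = und A" "eps A ** eta A = ide []"
  and n: "eps A ** nabla A = eps A || eps A"
  using b unfolding bim_def by blast+
 have "(eps A || ide y) ** (ide (und A) || eps A || ide y) = eps A || eps A || ide y"
  using ic[of "eps A" "ide (und A)" "ide y" "eps A || ide y"] by simp
 thus ?thesis using b n unfolding act_def by (simp add: ic ts_assoc)
qed

end

context smc begin

interpretation S: ssmc "Ob C" sar ssrc strg scp sts side ssw by (rule strictification)

abbreviation oact where
 "oact A \<beta> x \<equiv> ssmc.act (Ob C) sar strg ssrc (\<lambda>g f. scp f g) sts side (\<lambda>x y. ssw y x) (S.du A) \<beta> x"
abbreviation oract where
 "oract A \<beta> x \<equiv> ssmc.ract (Ob C) sar strg ssrc (\<lambda>g f. scp f g) sts side (\<lambda>x y. ssw y x) (S.du A) \<beta> x"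

section \<open>Bismall Hopf monoids are those with integrals and cointegrals\<close>

lemma assoc_move2:
 assumes "a \<in> Ob C" "b \<in> Ob C" "c \<in> Ob C" "\<alpha> \<in> Hom C x y" "u \<in> Hom C ((a \<odot> b) \<odot> c) x" "v \<in> Hom C (a \<odot> (b \<odot> c)) x"
 shows "\<alpha> oo (u oo assoc_inv C a b c) = \<alpha> oo v \<longleftrightarrow> \<alpha> oo u = \<alpha> oo (v oo assoc C a b c)"
proof -
 note t = ty assms
 have "(\<alpha> oo u) oo assoc_inv C a b c = \<alpha> oo (u oo assoc_inv C a b c)" by (rule Comp_assoc) (rule t)+
 moreover have "(\<alpha> oo v) oo assoc C a b c = \<alpha> oo (v oo assoc C a b c)" by (rule Comp_assoc) (rule t)+
 ultimately show ?thesis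
  using assoc_move[OF assms(1-3) Comp_Hom[OF assms(5,4)] Comp_Hom[OF assms(6,4)]] by simp
qed

lemma lunit_move2:
 assumes "a \<in> Ob C" "\<alpha> \<in> Hom C x a" "u \<in> Hom C (\<I> \<odot> a) x"
 shows "\<alpha> oo (u oo lunit_inv C a) = Id C a \<longleftrightarrow> \<alpha> oo u = lunit C a"
proof -
 note t = ty assms
 have "(\<alpha> oo u) oo lunit_inv C a = \<alpha> oo (u oo lunit_inv C a)" by (rule Comp_assoc) (rule t)+
 thus ?thesis using lunit_move[OF assms(1) Comp_Hom[OF assms(3,2)] Id_Hom[OF assms(1)]] Id_Comp[OF lunit_Hom[OF assms(1)]] by simp
qed

lemma runit_move2:
 assumes "a \<in> Ob C" "\<alpha> \<in> Hom C x a" "u \<in> Hom C (a \<odot> \<I>) x"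
 shows "\<alpha> oo (u oo runit_inv C a) = Id C a \<longleftrightarrow> \<alpha> oo u = runit C a"
proof -
 note t = ty assms
 have "(\<alpha> oo u) oo runit_inv C a = \<alpha> oo (u oo runit_inv C a)" by (rule Comp_assoc) (rule t)+
 thus ?thesis using runit_move[OF assms(1) Comp_Hom[OF assms(3,2)] Id_Hom[OF assms(1)]] Id_Comp[OF runit_Hom[OF assms(1)]] by simp
qed

lemma act_sb: assumes B: "bimonoid C A" and X: "X \<in> Ob C" and al: "\<alpha> \<in> Hom C (und A \<odot> X) X"
 shows "S.act (sb A) (Some ([und A, X], \<alpha>, [X])) [X] \<longleftrightarrow> left_action C A \<alpha> X"
proof -
 let ?a = "und A"
 note t = ty X al bimD[OF B]
 note [simp] = X al bimD[OF B] tensor_Hom Id_Hom tensor_Ob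
 have k: "(nabla A ## Id C X) oo assoc_inv C ?a ?a X \<in> Hom C (?a \<odot> (?a \<odot> X)) (?a \<odot> X)"
  "(eta A ## Id C X) oo lunit_inv C X \<in> Hom C X (?a \<odot> X)" by (rule t)+
 have 1: "\<alpha> oo ((nabla A ## Id C X) oo assoc_inv C ?a ?a X) = \<alpha> oo (Id C ?a ## \<alpha>)
   \<longleftrightarrow> \<alpha> oo (nabla A ## Id C X) = \<alpha> oo ((Id C ?a ## \<alpha>) oo assoc C ?a ?a X)" by (rule assoc_move2) (rule t)+
 have 2: "\<alpha> oo ((eta A ## Id C X) oo lunit_inv C X) = Id C X \<longleftrightarrow> \<alpha> oo (eta A ## Id C X) = lunit C X"
  by (rule lunit_move2) (rule t)+
 show ?thesis unfolding S.act_def left_action_def using B k 1 2 by (simp add: stc bim_sb)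
qed

lemma ract_sb: assumes B: "bimonoid C A" and X: "X \<in> Ob C" and al: "\<alpha> \<in> Hom C (X \<odot> und A) X"
 shows "S.ract (sb A) (Some ([X, und A], \<alpha>, [X])) [X] \<longleftrightarrow> right_action C A \<alpha> X"
proof -
 let ?a = "und A"
 note t = ty X al bimD[OF B]
 note [simp] = X al bimD[OF B] tensor_Hom Id_Hom tensor_Ob
 have k: "(\<alpha> ## Id C ?a) oo assoc_inv C X ?a ?a \<in> Hom C (X \<odot> (?a \<odot> ?a)) (X \<odot> ?a)"
  "(Id C X ## eta A) oo runit_inv C X \<in> Hom C X (X \<odot> ?a)" by (rule t)+
 have 1: "\<alpha> oo ((\<alpha> ## Id C ?a) oo assoc_inv C X ?a ?a) = \<alpha> oo (Id C X ## nabla A)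
   \<longleftrightarrow> \<alpha> oo (\<alpha> ## Id C ?a) = \<alpha> oo ((Id C X ## nabla A) oo assoc C X ?a ?a)" by (rule assoc_move2) (rule t)+
 have 2: "\<alpha> oo ((Id C X ## eta A) oo runit_inv C X) = Id C X \<longleftrightarrow> \<alpha> oo (Id C X ## eta A) = runit C X"
  by (rule runit_move2) (rule t)+
 show ?thesis unfolding S.ract_def right_action_def using B k 1 2 by (simp add: stc bim_sb)
qed

lemma coact_sb: assumes B: "bimonoid C A" and Y: "Y \<in> Ob C" and be: "\<beta> \<in> Hom C Y (und A \<odot> Y)"
 shows "oact (sb A) (Some ([Y], \<beta>, [und A, Y])) [Y] \<longleftrightarrow> left_coaction C A \<beta> Y"
proof -
 let ?a = "und A"
 note t = ty Y be bimD[OF B]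
 note [simp] = Y be bimD[OF B] tensor_Hom Id_Hom tensor_Ob
 have k: "assoc C ?a ?a Y oo (delta A ## Id C Y) \<in> Hom C (?a \<odot> Y) (?a \<odot> (?a \<odot> Y))"
  "lunit C Y oo (eps A ## Id C Y) \<in> Hom C (?a \<odot> Y) Y" by (rule t)+
 have 1: "(assoc C ?a ?a Y oo (delta A ## Id C Y)) oo \<beta> = assoc C ?a ?a Y oo ((delta A ## Id C Y) oo \<beta>)"
  "(lunit C Y oo (eps A ## Id C Y)) oo \<beta> = lunit C Y oo ((eps A ## Id C Y) oo \<beta>)"
  by (rule Comp_assoc, (rule t)+)+
 show ?thesis unfolding ssmc.act_def[OF S.ssmc_op] left_coaction_def using B k 1 by (simp add: stc bim_sb)
qed

lemma rcoact_sb: assumes B: "bimonoid C A" and Y: "Y \<in> Ob C" and be: "\<beta> \<in> Hom C Y (Y \<odot> und A)"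
 shows "oract (sb A) (Some ([Y], \<beta>, [Y, und A])) [Y] \<longleftrightarrow> right_coaction C A \<beta> Y"
proof -
 let ?a = "und A"
 note t = ty Y be bimD[OF B]
 note [simp] = Y be bimD[OF B] tensor_Hom Id_Hom tensor_Ob
 have k: "assoc C Y ?a ?a oo (\<beta> ## Id C ?a) \<in> Hom C (Y \<odot> ?a) (Y \<odot> (?a \<odot> ?a))"
  "runit C Y oo (Id C Y ## eps A) \<in> Hom C (Y \<odot> ?a) Y" by (rule t)+
 have 1: "(assoc C Y ?a ?a oo (\<beta> ## Id C ?a)) oo \<beta> = assoc C Y ?a ?a oo ((\<beta> ## Id C ?a) oo \<beta>)"
  "(runit C Y oo (Id C Y ## eps A)) oo \<beta> = runit C Y oo ((Id C Y ## eps A) oo \<beta>)"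
  by (rule Comp_assoc, (rule t)+)+
 show ?thesis unfolding ssmc.ract_def[OF S.ssmc_op] right_coaction_def using B k 1 by (simp add: stc bim_sb)
qed

lemma arrow_splits:
 assumes he: "has_equalizers C" and e: "sar e" "ssrc e = [X]" "strg e = [X]" "scp e e = e"
  and Q: "\<And>J j. Q J j ==> j \<in> Hom C J X" "\<And>J j. j \<in> Hom C J X ==> Q J j \<longleftrightarrow> scp e (Some ([J], j, [X])) = Some ([J], j, [X])"
  and R: "\<And>x h. R x h ==> h \<in> Hom C X x" "\<And>x h. h \<in> Hom C X x ==> R x h \<longleftrightarrow> scp (Some ([X], h, [x])) e = Some ([X], h, [x])"
 shows "(\<exists>I i. Q I i \<and> (\<forall>J j. Q J j --> (\<exists>!u. u \<in> Hom C J I \<and> i oo u = j))) \<and>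
  (\<exists>P p. R P p \<and> (\<forall>x h. R x h --> (\<exists>!u. u \<in> Hom C P x \<and> u oo p = h))) \<and>
  (\<forall>I i P p. (Q I i \<and> (\<forall>J j. Q J j --> (\<exists>!u. u \<in> Hom C J I \<and> i oo u = j)))
   \<and> (R P p \<and> (\<forall>x h. R x h --> (\<exists>!u. u \<in> Hom C P x \<and> u oo p = h))) --> iso_arr C I P (p oo i))"
proof (rule idempotent_splits[OF he])
 have es: "e = Some ([X], sm e, [X])" by (rule sbind[OF e(1-3)])
 show h: "sm e \<in> Hom C X X" using sm_Hom[OF e(1-3)] by simp
 have X: "X \<in> Ob C" using h Hom_obs by blast
 note [simp] = h X
 show "sm e oo sm e = sm e" using e(4) by (subst (asm) (1 2 3) es) (simp add: stc)
 show "Q J j \<longleftrightarrow> j \<in> Hom C J X \<and> sm e oo j = j" for J j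
 proof (cases "j \<in> Hom C J X")
  case True
  thus ?thesis unfolding Q(2)[OF True] using Hom_obs(1)[OF True] by (subst es) (simp add: stc)
 qed (use Q(1) in blast)
 show "R x h \<longleftrightarrow> h \<in> Hom C X x \<and> h oo sm e = h" for x h
 proof (cases "h \<in> Hom C X x")
  case True
  thus ?thesis unfolding R(2)[OF True] using Hom_obs(2)[OF True] by (subst es) (simp add: stc)
 qed (use R(1) in blast)
qed

lemma is_coequalizer_iff: "is_coequalizer C b X f g P p \<longleftrightarrow>
  (p \<in> Hom C X P \<and> p oo f = p oo g) \<and> (\<forall>x h. (h \<in> Hom C X x \<and> h oo f = h oo g) --> (\<exists>!u. u \<in> Hom C P x \<and> u oo p = h))"
 unfolding is_coequalizer_def by blast

lemma is_equalizer_iff: "is_equalizer C X b f g I i \<longleftrightarrow>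
  (i \<in> Hom C I X \<and> f oo i = g oo i) \<and> (\<forall>x h. (h \<in> Hom C x X \<and> f oo h = g oo h) --> (\<exists>!u. u \<in> Hom C x I \<and> i oo u = h))"
 unfolding is_equalizer_def by blast

lemma small_of_nint:
 assumes he: "has_equalizers C" and h: "S.hopf (sb A)" and n: "S.nint (sb A) \<sigma>"
 shows "small C A"
proof -
 have B: "bimonoid C A" using h bim_sb unfolding S.hopf_def by blast
 let ?a = "und A"
 note [simp] = bimD[OF B] tensor_Hom Id_Hom tensor_Ob
 have L: "(\<exists>I i. left_invariant C A \<alpha> X I i) \<and> (\<exists>P p. left_stab C A \<alpha> X P p) \<and>
    (\<forall>I i P p. left_invariant C A \<alpha> X I i \<and> left_stab C A \<alpha> X P p --> iso_arr C I P (p oo i))"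
  if act: "left_action C A \<alpha> X" for \<alpha> X
 proof -
  have X [simp]: "X \<in> Ob C" and al [simp]: "\<alpha> \<in> Hom C (?a \<odot> X) X" using act unfolding left_action_def by blast+
  have k: "lunit C X oo (eps A ## Id C X) \<in> Hom C (?a \<odot> X) X" by (rule ty X bimD[OF B])+
  obtain e where e: "sar e" "ssrc e = [X]" "strg e = [X]" "scp e e = e"
   and ej: "\<And>j. sar j ==> strg j = [X] ==> (scp (Some ([?a, X], \<alpha>, [X])) (sts (side (und (sb A))) j) = sts (eps (sb A)) j \<longleftrightarrow> scp e j = j)"
   and eh: "\<And>h. sar h ==> ssrc h = [X] ==> (scp h (Some ([?a, X], \<alpha>, [X])) = scp h (sts (eps (sb A)) (side [X])) \<longleftrightarrow> scp h e = h)"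
   using S.left_average[OF h n act_sb[OF B X al, THEN iffD2, OF act]] by blast
  show ?thesis unfolding left_invariant_def left_stab_def is_coequalizer_iff
  proof (rule arrow_splits[OF he e])
   fix J j assume j: "j \<in> Hom C J X"
   note [simp] = j Hom_obs(1)[OF j]
   show "left_inv_arr C A \<alpha> X J j \<longleftrightarrow> scp e (Some ([J], j, [X])) = Some ([J], j, [X])"
    using ej[of "Some ([J], j, [X])"] unfolding left_inv_arr_def by (simp add: stc)
  next
   fix x h assume j: "h \<in> Hom C X x"
   note [simp] = j Hom_obs(2)[OF j]
   show "h \<in> Hom C X x \<and> h oo \<alpha> = h oo (lunit C X oo (eps A ## Id C X)) \<longleftrightarrow> scp (Some ([X], h, [x])) e = Some ([X], h, [x])"
    using eh[of "Some ([X], h, [x])"] k by (simp add: stc)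
  qed (auto simp: left_inv_arr_def)
 qed
 have R: "(\<exists>I i. right_invariant C A \<alpha> X I i) \<and> (\<exists>P p. right_stab C A \<alpha> X P p) \<and>
    (\<forall>I i P p. right_invariant C A \<alpha> X I i \<and> right_stab C A \<alpha> X P p --> iso_arr C I P (p oo i))"
  if act: "right_action C A \<alpha> X" for \<alpha> X
 proof -
  have X [simp]: "X \<in> Ob C" and al [simp]: "\<alpha> \<in> Hom C (X \<odot> ?a) X" using act unfolding right_action_def by blast+
  have k: "runit C X oo (Id C X ## eps A) \<in> Hom C (X \<odot> ?a) X" by (rule ty X bimD[OF B])+
  obtain e where e: "sar e" "ssrc e = [X]" "strg e = [X]" "scp e e = e"
   and ej: "\<And>j. sar j ==> strg j = [X] ==> (scp (Some ([X, ?a], \<alpha>, [X])) (sts j (side (und (sb A)))) = sts j (eps (sb A)) \<longleftrightarrow> scp e j = j)"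
   and eh: "\<And>h. sar h ==> ssrc h = [X] ==> (scp h (Some ([X, ?a], \<alpha>, [X])) = scp h (sts (side [X]) (eps (sb A))) \<longleftrightarrow> scp h e = h)"
   using S.right_average[OF h n ract_sb[OF B X al, THEN iffD2, OF act]] by blast
  show ?thesis unfolding right_invariant_def right_stab_def is_coequalizer_iff
  proof (rule arrow_splits[OF he e])
   fix J j assume j: "j \<in> Hom C J X"
   note [simp] = j Hom_obs(1)[OF j]
   show "right_inv_arr C A \<alpha> X J j \<longleftrightarrow> scp e (Some ([J], j, [X])) = Some ([J], j, [X])"
    using ej[of "Some ([J], j, [X])"] unfolding right_inv_arr_def by (simp add: stc)
  next
   fix x h assume j: "h \<in> Hom C X x"
   note [simp] = j Hom_obs(2)[OF j]
   show "h \<in> Hom C X x \<and> h oo \<alpha> = h oo (runit C X oo (Id C X ## eps A)) \<longleftrightarrow> scp (Some ([X], h, [x])) e = Some ([X], h, [x])"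
    using eh[of "Some ([X], h, [x])"] k by (simp add: stc)
  qed (auto simp: right_inv_arr_def)
 qed
 show ?thesis unfolding small_def using B L R by blast
qed

lemma cosmall_of_ncoint:
 assumes he: "has_equalizers C" and h: "S.hopf (sb A)" and n: "S.ncoint (sb A) l"
 shows "cosmall C A"
proof -
 have B: "bimonoid C A" using h bim_sb unfolding S.hopf_def by blast
 let ?a = "und A"
 note [simp] = bimD[OF B] tensor_Hom Id_Hom tensor_Ob
 have oh: "ssmc.hopf (Ob C) sar strg ssrc (\<lambda>g f. scp f g) sts side (\<lambda>x y. ssw y x) (S.du (sb A))" using h by simp
 have on: "ssmc.nint sar strg ssrc (\<lambda>g f. scp f g) sts side (S.du (sb A)) l" using n by simp
 have L: "(\<exists>Q q. left_coinvariant C A \<beta> Y Q q) \<and> (\<exists>E e. left_costab C A \<beta> Y E e) \<and>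
    (\<forall>Q q E e. left_coinvariant C A \<beta> Y Q q \<and> left_costab C A \<beta> Y E e --> iso_arr C E Q (q oo e))"
  if act: "left_coaction C A \<beta> Y" for \<beta> Y
 proof -
  have Y [simp]: "Y \<in> Ob C" and be [simp]: "\<beta> \<in> Hom C Y (?a \<odot> Y)" using act unfolding left_coaction_def by blast+
  have k: "(eta A ## Id C Y) oo lunit_inv C Y \<in> Hom C Y (?a \<odot> Y)" by (rule ty Y bimD[OF B])+
  obtain e where e: "sar e" "ssrc e = [Y]" "strg e = [Y]" "scp e e = e"
   and ej: "\<And>j. sar j ==> ssrc j = [Y] ==> (scp (sts (side (und (sb A))) j) (Some ([Y], \<beta>, [?a, Y])) = sts (eta (sb A)) j \<longleftrightarrow> scp j e = j)"
   and eh: "\<And>h. sar h ==> strg h = [Y] ==> (scp (Some ([Y], \<beta>, [?a, Y])) h = scp (sts (eta (sb A)) (side [Y])) h \<longleftrightarrow> scp e h = h)"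
   using ssmc.left_average[OF S.ssmc_op oh on coact_sb[OF B Y be, THEN iffD2, OF act]] unfolding S.du_sel by blast
  have "(\<exists>E e. left_costab C A \<beta> Y E e) \<and> (\<exists>Q q. left_coinvariant C A \<beta> Y Q q) \<and>
    (\<forall>E e Q q. left_costab C A \<beta> Y E e \<and> left_coinvariant C A \<beta> Y Q q --> iso_arr C E Q (q oo e))"
   unfolding left_coinvariant_def left_costab_def is_equalizer_iff
  proof (rule arrow_splits[OF he e])
   fix J j assume j: "j \<in> Hom C Y J"
   note [simp] = j Hom_obs(2)[OF j]
   have "(eta A ## j) oo lunit_inv C Y \<in> Hom C Y (?a \<odot> J)" by (rule ty j Y bimD[OF B])+
   thus "left_coinv_arr C A \<beta> Y J j \<longleftrightarrow> scp (Some ([Y], j, [J])) e = Some ([Y], j, [J])"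
    using ej[of "Some ([Y], j, [J])"] unfolding left_coinv_arr_def by (simp add: stc)
  next
   fix x h assume j: "h \<in> Hom C x Y"
   note [simp] = j Hom_obs(1)[OF j]
   show "h \<in> Hom C x Y \<and> \<beta> oo h = ((eta A ## Id C Y) oo lunit_inv C Y) oo h \<longleftrightarrow> scp e (Some ([x], h, [Y])) = Some ([x], h, [Y])"
    using eh[of "Some ([x], h, [Y])"] k by (simp add: stc)
  qed (auto simp: left_coinv_arr_def)
  thus ?thesis by blast
 qed
 have R: "(\<exists>Q q. right_coinvariant C A \<beta> Y Q q) \<and> (\<exists>E e. right_costab C A \<beta> Y E e) \<and>
    (\<forall>Q q E e. right_coinvariant C A \<beta> Y Q q \<and> right_costab C A \<beta> Y E e --> iso_arr C E Q (q oo e))"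
  if act: "right_coaction C A \<beta> Y" for \<beta> Y
 proof -
  have Y [simp]: "Y \<in> Ob C" and be [simp]: "\<beta> \<in> Hom C Y (Y \<odot> ?a)" using act unfolding right_coaction_def by blast+
  have k: "(Id C Y ## eta A) oo runit_inv C Y \<in> Hom C Y (Y \<odot> ?a)" by (rule ty Y bimD[OF B])+
  obtain e where e: "sar e" "ssrc e = [Y]" "strg e = [Y]" "scp e e = e"
   and ej: "\<And>j. sar j ==> ssrc j = [Y] ==> (scp (sts j (side (und (sb A)))) (Some ([Y], \<beta>, [Y, ?a])) = sts j (eta (sb A)) \<longleftrightarrow> scp j e = j)"
   and eh: "\<And>h. sar h ==> strg h = [Y] ==> (scp (Some ([Y], \<beta>, [Y, ?a])) h = scp (sts (side [Y]) (eta (sb A))) h \<longleftrightarrow> scp e h = h)"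
   using ssmc.right_average[OF S.ssmc_op oh on rcoact_sb[OF B Y be, THEN iffD2, OF act]] unfolding S.du_sel by blast
  have "(\<exists>E e. right_costab C A \<beta> Y E e) \<and> (\<exists>Q q. right_coinvariant C A \<beta> Y Q q) \<and>
    (\<forall>E e Q q. right_costab C A \<beta> Y E e \<and> right_coinvariant C A \<beta> Y Q q --> iso_arr C E Q (q oo e))"
   unfolding right_coinvariant_def right_costab_def is_equalizer_iff
  proof (rule arrow_splits[OF he e])
   fix J j assume j: "j \<in> Hom C Y J"
   note [simp] = j Hom_obs(2)[OF j]
   have "(j ## eta A) oo runit_inv C Y \<in> Hom C Y (J \<odot> ?a)" by (rule ty j Y bimD[OF B])+
   thus "right_coinv_arr C A \<beta> Y J j \<longleftrightarrow> scp (Some ([Y], j, [J])) e = Some ([Y], j, [J])"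
    using ej[of "Some ([Y], j, [J])"] unfolding right_coinv_arr_def by (simp add: stc)
  next
   fix x h assume j: "h \<in> Hom C x Y"
   note [simp] = j Hom_obs(1)[OF j]
   show "h \<in> Hom C x Y \<and> \<beta> oo h = ((Id C Y ## eta A) oo runit_inv C Y) oo h \<longleftrightarrow> scp e (Some ([x], h, [Y])) = Some ([x], h, [Y])"
    using eh[of "Some ([x], h, [Y])"] k by (simp add: stc)
  qed (auto simp: right_coinv_arr_def)
  thus ?thesis by blast
 qed
 show ?thesis unfolding cosmall_def using B L R by blast
qed

lemma nint_of_small:
 assumes h: "S.hopf (sb A)" and sm: "small C A"
 shows "\<exists>\<sigma>. S.nint (sb A) \<sigma>"
proof -
 have B: "bimonoid C A" using h bim_sb unfolding S.hopf_def by blast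
 let ?a = "und A"
 note [simp] = bimD[OF B] tensor_Hom Id_Hom tensor_Ob
 have act: "left_action C A (nabla A) ?a" using B unfolding left_action_def bimonoid_def is_monoid_def by simp
 have ee: "eps A oo eta A = Id C \<I>" using B unfolding bimonoid_def by blast
 have k: "lunit C ?a oo (eps A ## Id C ?a) \<in> Hom C (?a \<odot> ?a) ?a" by (rule ty bimD[OF B])+
 have st: "left_stab C A (nabla A) ?a \<I> (eps A)" unfolding left_stab_def is_coequalizer_iff
 proof (intro conjI allI impI)
  have "scp (eps (sb A)) (nabla (sb A)) = scp (eps (sb A)) (sts (eps (sb A)) (side [?a]))"
   using S.wt_cp(1)[of "eps (sb A)" "eps (sb A)" "[?a]"] h unfolding S.hopf_def S.bim_def by simp
  thus "eps A oo nabla A = eps A oo (lunit C ?a oo (eps A ## Id C ?a))" using k by (simp add: stc)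
  fix x f assume f: "f \<in> Hom C ?a x \<and> f oo nabla A = f oo (lunit C ?a oo (eps A ## Id C ?a))"
  have x: "x \<in> Ob C" using f Hom_obs by blast
  have "Some ([?a], f, [x]) = scp (scp (Some ([?a], f, [x])) (eta (sb A))) (eps (sb A))"
   by (rule S.regular_coinvariant[OF h]) (use f x k in \<open>simp_all add: stc\<close>)
  hence fe: "f = (f oo eta A) oo eps A" using f x Comp_Hom[OF bimD(3)[OF B], of f x] by (simp add: stc)
  show "\<exists>!u. u \<in> Hom C \<I> x \<and> u oo eps A = f"
  proof (rule ex1I[of _ "f oo eta A"])
   show "f oo eta A \<in> Hom C \<I> x \<and> (f oo eta A) oo eps A = f" using f fe Comp_Hom[OF bimD(3)[OF B], of f x] by simp
   fix u assume u: "u \<in> Hom C \<I> x \<and> u oo eps A = f"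
   hence "f oo eta A = u oo (eps A oo eta A)" using Comp_assoc[OF bimD(3)[OF B] bimD(5)[OF B], of u x] by auto
   thus "u = f oo eta A" using u ee Comp_Id[of u \<I> x] by simp
  qed
 qed simp
 obtain J i where i: "left_invariant C A (nabla A) ?a J i" and "iso_arr C J \<I> (eps A oo i)"
  using sm act st unfolding small_def by metis
 then obtain g where g: "g \<in> Hom C \<I> J" "(eps A oo i) oo g = Id C \<I>" unfolding iso_arr_def inverse_arrs_def by blast
 have it: "i \<in> Hom C J ?a" "nabla A oo (Id C ?a ## i) = lunit C ?a oo (eps A ## i)"
  using i unfolding left_invariant_def left_inv_arr_def by blast+
 have [simp]: "J \<in> Ob C" "eps A oo i \<in> Hom C J \<I>" using Hom_obs(2)[OF g(1)] Comp_Hom[OF it(1) bimD(5)[OF B]] by auto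
 have "S.nint (sb A) (scp (Some ([J], i, [?a])) (Some ([], g, [J])))"
  by (rule S.nint_of_invariant[OF h, of _ "[J]"]) (use it g in \<open>simp_all add: stc\<close>)
 thus ?thesis by blast
qed

lemma ncoint_of_cosmall:
 assumes h: "S.hopf (sb A)" and sm: "cosmall C A"
 shows "\<exists>l. S.ncoint (sb A) l"
proof -
 have B: "bimonoid C A" using h bim_sb unfolding S.hopf_def by blast
 let ?a = "und A"
 note [simp] = bimD[OF B] tensor_Hom Id_Hom tensor_Ob
 have oh: "ssmc.hopf (Ob C) sar strg ssrc (\<lambda>g f. scp f g) sts side (\<lambda>x y. ssw y x) (S.du (sb A))" using h by simp
 have act: "left_coaction C A (delta A) ?a" using B unfolding left_coaction_def bimonoid_def is_comonoid_def by simp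
 have ee: "eps A oo eta A = Id C \<I>" using B unfolding bimonoid_def by blast
 have k: "(eta A ## Id C ?a) oo lunit_inv C ?a \<in> Hom C ?a (?a \<odot> ?a)" by (rule ty bimD[OF B])+
 have st: "left_costab C A (delta A) ?a \<I> (eta A)" unfolding left_costab_def is_equalizer_iff
 proof (intro conjI allI impI)
  have "scp (delta (sb A)) (eta (sb A)) = scp (sts (eta (sb A)) (side [?a])) (eta (sb A))"
   using S.pt_cp(1)[of "eta (sb A)" "eta (sb A)" "[?a]"] h unfolding S.hopf_def S.bim_def by simp
  thus "delta A oo eta A = ((eta A ## Id C ?a) oo lunit_inv C ?a) oo eta A" using k by (simp add: stc)
  fix x f assume f: "f \<in> Hom C x ?a \<and> delta A oo f = ((eta A ## Id C ?a) oo lunit_inv C ?a) oo f"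
  have x: "x \<in> Ob C" using f Hom_obs by blast
  have "Some ([x], f, [?a]) = scp (eps (S.du (sb A))) (scp (eta (S.du (sb A))) (Some ([x], f, [?a])))"
   by (rule ssmc.regular_coinvariant[OF S.ssmc_op oh]) (use f x k in \<open>simp_all add: stc\<close>)
  hence fe: "f = eta A oo (eps A oo f)" using f x Comp_Hom[OF _ bimD(5)[OF B], of f x] by (simp add: stc)
  show "\<exists>!u. u \<in> Hom C x \<I> \<and> eta A oo u = f"
  proof (rule ex1I[of _ "eps A oo f"])
   show "eps A oo f \<in> Hom C x \<I> \<and> eta A oo (eps A oo f) = f" using f fe Comp_Hom[OF _ bimD(5)[OF B], of f x] by simp
   fix u assume u: "u \<in> Hom C x \<I> \<and> eta A oo u = f"
   hence "eps A oo f = (eps A oo eta A) oo u" using Comp_assoc[OF _ bimD(3)[OF B] bimD(5)[OF B], of u x] by auto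
   thus "u = eps A oo f" using u ee Id_Comp[of u x \<I>] by simp
  qed
 qed simp
 obtain Q q where q: "left_coinvariant C A (delta A) ?a Q q" and "iso_arr C \<I> Q (q oo eta A)"
  using sm act st unfolding cosmall_def by metis
 then obtain g where g: "g \<in> Hom C Q \<I>" "g oo (q oo eta A) = Id C \<I>" unfolding iso_arr_def inverse_arrs_def by blast
 have qt: "q \<in> Hom C ?a Q" "(Id C ?a ## q) oo delta A = (eta A ## q) oo lunit_inv C ?a"
  using q unfolding left_coinvariant_def left_coinv_arr_def by blast+
 have [simp]: "Q \<in> Ob C" "q oo eta A \<in> Hom C \<I> Q" using Hom_obs(1)[OF g(1)] Comp_Hom[OF bimD(3)[OF B] qt(1)] by auto
 have "(eta A ## q) oo lunit_inv C ?a \<in> Hom C ?a (?a \<odot> Q)" by (rule ty qt bimD[OF B])+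
 hence "ssmc.nint sar strg ssrc (\<lambda>g f. scp f g) sts side (S.du (sb A)) (scp (Some ([Q], g, [])) (Some ([?a], q, [Q])))"
  by (intro ssmc.nint_of_invariant[OF S.ssmc_op oh, of _ "[Q]"]) (use qt g in \<open>simp_all add: stc\<close>)
 thus ?thesis by auto
qed

text \<open>
 Smallness corresponds to integrals and cosmallness to cointegrals, by averaging in one direction and the regular (co)action in the other.
\<close>

lemma bismall_iff:
 assumes "has_equalizers C" "S.hopf (sb A)"
 shows "bismall C A \<longleftrightarrow> (\<exists>\<sigma>. S.nint (sb A) \<sigma>) \<and> (\<exists>l. S.ncoint (sb A) l)"
 using small_of_nint cosmall_of_ncoint nint_of_small ncoint_of_cosmall assms unfolding bismall_def by blast

end

context smc begin

interpretation S: ssmc "Ob C" sar ssrc strg scp sts side ssw by (rule strictification)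

section \<open>Stability of the strictification\<close>

lemma coequalizer_iso:
 assumes q: "is_coequalizer C b X f g R r" and u: "iso_arr C R P u" and p: "u oo r = p"
  and fg: "f \<in> Hom C b X" "g \<in> Hom C b X"
 shows "is_coequalizer C b X f g P p"
proof -
 obtain v where v: "u \<in> Hom C R P" "v \<in> Hom C P R" "v oo u = Id C R" "u oo v = Id C P"
  using u unfolding iso_arr_def inverse_arrs_def by blast
 have r: "r \<in> Hom C X R" "r oo f = r oo g" using q unfolding is_coequalizer_def by blast+
 have vp: "v oo p = r" using Comp_assoc[OF r(1) v(1,2)] v(3) Id_Comp[OF r(1)] p by simp
 have pt: "p \<in> Hom C X P" using Comp_Hom[OF r(1) v(1)] p by simp
 show ?thesis unfolding is_coequalizer_def
 proof (intro conjI allI ballI impI)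
  show "p oo f = p oo g" using Comp_assoc[OF fg(1) r(1) v(1)] Comp_assoc[OF fg(2) r(1) v(1)] r(2) p by simp
 next
  fix x h assume h: "h \<in> Hom C X x" "h oo f = h oo g"
  obtain w where w: "w \<in> Hom C R x" "w oo r = h" and un: "\<And>w'. w' \<in> Hom C R x ==> w' oo r = h ==> w' = w"
   using q h unfolding is_coequalizer_def by blast
  show "\<exists>!u. u \<in> Hom C P x \<and> u oo p = h"
  proof (rule ex1I[of _ "w oo v"])
   show "w oo v \<in> Hom C P x \<and> (w oo v) oo p = h" using Comp_Hom[OF v(2) w(1)] Comp_assoc[OF pt v(2) w(1)] vp w by simp
   fix w' assume w': "w' \<in> Hom C P x \<and> w' oo p = h"
   hence "w' oo u = w" using Comp_Hom[OF v(1)] Comp_assoc[OF r(1) v(1), of w' x] p by (intro un) auto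
   thus "w' = w oo v" using Comp_assoc[OF v(2,1), of w' x] w' v(4) Comp_Id[of w' P x] by auto
  qed
 qed (rule pt)
qed

lemma equalizer_iso:
 assumes q: "is_equalizer C X b f g R r" and u: "iso_arr C P R u" and p: "r oo u = p"
  and fg: "f \<in> Hom C X b" "g \<in> Hom C X b"
 shows "is_equalizer C X b f g P p"
proof -
 obtain v where v: "u \<in> Hom C P R" "v \<in> Hom C R P" "v oo u = Id C P" "u oo v = Id C R"
  using u unfolding iso_arr_def inverse_arrs_def by blast
 have r: "r \<in> Hom C R X" "f oo r = g oo r" using q unfolding is_equalizer_def by blast+
 have vp: "p oo v = r" using Comp_assoc[OF v(2,1) r(1)] v(4) Comp_Id[OF r(1)] p by simp
 have pt: "p \<in> Hom C P X" using Comp_Hom[OF v(1) r(1)] p by simp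
 show ?thesis unfolding is_equalizer_def
 proof (intro conjI allI ballI impI)
  show "f oo p = g oo p" using Comp_assoc[OF v(1) r(1) fg(1)] Comp_assoc[OF v(1) r(1) fg(2)] r(2) p by simp
 next
  fix x h assume h: "h \<in> Hom C x X" "f oo h = g oo h"
  obtain w where w: "w \<in> Hom C x R" "r oo w = h" and un: "\<And>w'. w' \<in> Hom C x R ==> r oo w' = h ==> w' = w"
   using q h unfolding is_equalizer_def by blast
  show "\<exists>!u. u \<in> Hom C x P \<and> p oo u = h"
  proof (rule ex1I[of _ "v oo w"])
   show "v oo w \<in> Hom C x P \<and> p oo (v oo w) = h" using Comp_Hom[OF w(1) v(2)] Comp_assoc[OF w(1) v(2) pt] vp w by simp
   fix w' assume w': "w' \<in> Hom C x P \<and> p oo w' = h"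
   hence "u oo w' = w" using Comp_Hom[OF _ v(1)] Comp_assoc[OF _ v(1) r(1), of w' x] p by (intro un) auto
   thus "w' = v oo w" using Comp_assoc[OF _ v(1,2), of w' x] w' v(3) Id_Comp[of w' x P] by auto
  qed
 qed (rule pt)
qed

text \<open>
 The trivial action of \<open>A\<close> on \<open>Y\<close> has stabilized object \<open>Y\<close> itself, so stability makes \<open>p \<boxtimes> id\<close> a coequalizer.
\<close>

lemma tensor_stab:
 assumes st: "left_stable C" and hc: "has_coequalizers C" and act: "left_action C A f X"
  and p: "left_stab C A f X P p" and Y: "Y \<in> Ob C"
 defines "T \<equiv> lunit C Y oo (eps A ## Id C Y)"
 shows "is_coequalizer C ((und A \<odot> und A) \<odot> (X \<odot> Y)) (X \<odot> Y) ((f ## T) oo swap_mid C (und A) (und A) X Y)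
   (lunit C (X \<odot> Y) oo ((lunit C \<I> oo (eps A ## eps A)) ## Id C (X \<odot> Y))) (P \<odot> Y) (p ## Id C Y)"
proof -
 let ?a = "und A"
 have B: "bimonoid C A" and X: "X \<in> Ob C" and f: "f \<in> Hom C (?a \<odot> X) X" using act unfolding left_action_def by blast+
 note [simp] = bimD[OF B] tensor_Hom Id_Hom tensor_Ob X Y f
 have T: "T \<in> Hom C (?a \<odot> Y) Y" unfolding T_def by (rule ty Y bimD[OF B])+
 note t = ty bimD[OF B] X Y f T swap_mid_Hom[OF bimD(1)[OF B] bimD(1)[OF B] X Y Unit_Ob Unit_Ob]
 have "S.act (sb A) (sts (eps (sb A)) (side [Y])) [Y]" by (rule S.trivial_act) (simp_all add: bim_sb B)
 moreover have "sts (eps (sb A)) (side [Y]) = Some ([?a, Y], T, [Y])" by (simp add: stc T_def)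
 ultimately have tact: "left_action C A T Y" using act_sb[OF B Y T] by metis
 have tst: "left_stab C A T Y Y (Id C Y)" unfolding left_stab_def is_coequalizer_iff T_def[symmetric]
 proof (intro conjI allI impI)
  fix x h assume h: "h \<in> Hom C Y x \<and> h oo T = h oo T"
  thus "\<exists>!u. u \<in> Hom C Y x \<and> u oo Id C Y = h" by (metis Comp_Id)
 qed simp_all
 let ?f = "(f ## T) oo swap_mid C ?a ?a X Y"
 let ?g = "lunit C (X \<odot> Y) oo ((lunit C \<I> oo (eps A ## eps A)) ## Id C (X \<odot> Y))"
 have fg: "?f \<in> Hom C ((?a \<odot> ?a) \<odot> (X \<odot> Y)) (X \<odot> Y)" "?g \<in> Hom C ((?a \<odot> ?a) \<odot> (X \<odot> Y)) (X \<odot> Y)"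
  by (rule t)+
 obtain R r where r: "is_coequalizer C ((?a \<odot> ?a) \<odot> (X \<odot> Y)) (X \<odot> Y) ?f ?g R r"
  using hc fg unfolding has_coequalizers_def by blast
 hence "left_stab C (tensor_bimon C A A) ?f (X \<odot> Y) R r" unfolding left_stab_def tensor_bimon_def by simp
 then obtain u where "iso_arr C R (P \<odot> Y) u" "u oo r = p ## Id C Y"
  using st act tact p tst unfolding left_stable_def by blast
 thus ?thesis using coequalizer_iso[OF r _ _ fg] by blast
qed

lemma tensor_costab:
 assumes st: "left_costable C" and hc: "has_equalizers C" and act: "left_coaction C A f X"
  and p: "left_costab C A f X P p" and Y: "Y \<in> Ob C"
 defines "T \<equiv> (eta A ## Id C Y) oo lunit_inv C Y"
 shows "is_equalizer C (X \<odot> Y) ((und A \<odot> und A) \<odot> (X \<odot> Y)) (swap_mid C (und A) X (und A) Y oo (f ## T))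
   ((((eta A ## eta A) oo lunit_inv C \<I>) ## Id C (X \<odot> Y)) oo lunit_inv C (X \<odot> Y)) (P \<odot> Y) (p ## Id C Y)"
proof -
 let ?a = "und A"
 have B: "bimonoid C A" and X: "X \<in> Ob C" and f: "f \<in> Hom C X (?a \<odot> X)" using act unfolding left_coaction_def by blast+
 note [simp] = bimD[OF B] tensor_Hom Id_Hom tensor_Ob X Y f
 have T: "T \<in> Hom C Y (?a \<odot> Y)" unfolding T_def by (rule ty Y bimD[OF B])+
 note t = ty bimD[OF B] X Y f T swap_mid_Hom[OF bimD(1)[OF B] X bimD(1)[OF B] Y Unit_Ob Unit_Ob]
 have "oact (sb A) (sts (eta (sb A)) (side [Y])) [Y]"
  using ssmc.trivial_act[OF S.ssmc_op, of "S.du (sb A)" "[Y]"] by (simp add: bim_sb B)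
 moreover have "sts (eta (sb A)) (side [Y]) = Some ([Y], T, [?a, Y])" by (simp add: stc T_def)
 ultimately have tact: "left_coaction C A T Y" using coact_sb[OF B Y T] by metis
 have tst: "left_costab C A T Y Y (Id C Y)" unfolding left_costab_def is_equalizer_iff T_def[symmetric]
 proof (intro conjI allI impI)
  fix x h assume h: "h \<in> Hom C x Y \<and> T oo h = T oo h"
  thus "\<exists>!u. u \<in> Hom C x Y \<and> Id C Y oo u = h" by (metis Id_Comp)
 qed simp_all
 let ?f = "swap_mid C ?a X ?a Y oo (f ## T)"
 let ?g = "(((eta A ## eta A) oo lunit_inv C \<I>) ## Id C (X \<odot> Y)) oo lunit_inv C (X \<odot> Y)"
 have fg: "?f \<in> Hom C (X \<odot> Y) ((?a \<odot> ?a) \<odot> (X \<odot> Y))" "?g \<in> Hom C (X \<odot> Y) ((?a \<odot> ?a) \<odot> (X \<odot> Y))"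
  by (rule t)+
 obtain R r where r: "is_equalizer C (X \<odot> Y) ((?a \<odot> ?a) \<odot> (X \<odot> Y)) ?f ?g R r"
  using hc fg unfolding has_equalizers_def by blast
 hence "left_costab C (tensor_bimon C A A) ?f (X \<odot> Y) R r" unfolding left_costab_def tensor_bimon_def by simp
 then obtain u where "iso_arr C (P \<odot> Y) R u" "r oo u = p ## Id C Y"
  using st act tact p tst unfolding left_costable_def by blast
 thus ?thesis using equalizer_iso[OF r _ _ fg] by blast
qed

lemma ex1_sb:
 assumes "obs xs" "obs ys" "obs vs" "q \<in> Hom C (Jo vs) (Jo xs)"
  and "\<exists>!w. w \<in> Hom C (Jo xs) (Jo ys) \<and> w oo q = k"
 shows "\<exists>!u. (sar u \<and> ssrc u = xs \<and> strg u = ys) \<and> scp u (Some (vs, q, xs)) = Some (vs, k, ys)"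
proof -
 obtain w where w: "w \<in> Hom C (Jo xs) (Jo ys)" "w oo q = k"
  and un: "\<And>v. v \<in> Hom C (Jo xs) (Jo ys) ==> v oo q = k ==> v = w" using assms(5) by blast
 show ?thesis
 proof (rule ex1I[of _ "Some (xs, w, ys)"])
  fix u assume u: "(sar u \<and> ssrc u = xs \<and> strg u = ys) \<and> scp u (Some (vs, q, xs)) = Some (vs, k, ys)"
  then obtain m where m: "u = Some (xs, m, ys)" using sbind by blast
  hence "m \<in> Hom C (Jo xs) (Jo ys)" "m oo q = k" using u scp_eq[of q vs xs m ys] assms by auto
  thus "u = Some (xs, w, ys)" using un m by blast
 qed (use w assms in \<open>simp add: scp_eq\<close>)
qed

lemma ex1_sb':
 assumes "obs xs" "obs ys" "obs vs" "q \<in> Hom C (Jo ys) (Jo vs)"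
  and "\<exists>!w. w \<in> Hom C (Jo xs) (Jo ys) \<and> q oo w = k"
 shows "\<exists>!u. (sar u \<and> strg u = ys \<and> ssrc u = xs) \<and> scp (Some (ys, q, vs)) u = Some (xs, k, vs)"
proof -
 obtain w where w: "w \<in> Hom C (Jo xs) (Jo ys)" "q oo w = k"
  and un: "\<And>v. v \<in> Hom C (Jo xs) (Jo ys) ==> q oo v = k ==> v = w" using assms(5) by blast
 show ?thesis
 proof (rule ex1I[of _ "Some (xs, w, ys)"])
  fix u assume u: "(sar u \<and> strg u = ys \<and> ssrc u = xs) \<and> scp (Some (ys, q, vs)) u = Some (xs, k, vs)"
  then obtain m where m: "u = Some (xs, m, ys)" using sbind by blast
  hence "m \<in> Hom C (Jo xs) (Jo ys)" "q oo m = k" using u scp_eq[of m xs ys q vs] assms by auto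
  thus "u = Some (xs, w, ys)" using un m by blast
 qed (use w assms in \<open>simp add: scp_eq\<close>)
qed

lemma coq_sb:
 assumes st: "left_stable C" and hc: "has_coequalizers C" and act: "left_action C A f X"
  and p: "left_stab C A f X P p" and Y: "Y \<in> Ob C"
 shows "S.coq (sts (Some ([und A, X], f, [X])) (side [Y])) (sts (sts (eps (sb A)) (side [X])) (side [Y])) (sts (Some ([X], p, [P])) (side [Y]))"
proof -
 let ?a = "und A"
 have B: "bimonoid C A" and X: "X \<in> Ob C" and f: "f \<in> Hom C (?a \<odot> X) X" using act unfolding left_action_def by blast+
 have pt: "p \<in> Hom C X P" "p oo f = p oo (lunit C X oo (eps A ## Id C X))"
  using p unfolding left_stab_def is_coequalizer_def by blast+
 have P: "P \<in> Ob C" using pt(1) Hom_obs by blast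
 define T where "T = lunit C Y oo (eps A ## Id C Y)"
 have T: "T \<in> Hom C (?a \<odot> Y) Y" unfolding T_def by (rule ty Y bimD[OF B])+
 note aa = bimD(1)[OF B]
 note t = ty bimD[OF B] X Y P f T pt(1) swap_mid_Hom[OF aa aa X Y Unit_Ob Unit_Ob]
 let ?f = "(f ## T) oo swap_mid C ?a ?a X Y"
 let ?g = "lunit C (X \<odot> Y) oo ((lunit C \<I> oo (eps A ## eps A)) ## Id C (X \<odot> Y))"
 let ?i = "assoc_inv C ?a ?a (X \<odot> Y)"
 have tq: "is_coequalizer C ((?a \<odot> ?a) \<odot> (X \<odot> Y)) (X \<odot> Y) ?f ?g (P \<odot> Y) (p ## Id C Y)"
  using tensor_stab[OF st hc act p Y] unfolding T_def .
 have k: "lunit C X oo (eps A ## Id C X) \<in> Hom C (?a \<odot> X) X" by (rule t)+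
 note [simp] = bimD[OF B] tensor_Hom Id_Hom tensor_Ob X Y P f T pt(1)
 let ?al = "Some ([?a, X], f, [X])" and ?p = "Some ([X], p, [P])"
 have px: "sts ?p (side [Y]) = Some ([X, Y], p ## Id C Y, [P, Y])" by (simp add: stc)
 have S1: "scp ?p ?al = scp ?p (sts (eps (sb A)) (side [X]))" using pt(2) k by (simp add: stc)
 have absorb: "scp (sts ?p (side [Y])) (sts ?al (side [Y])) = scp (sts ?p (side [Y])) (sts (sts (eps (sb A)) (side [X])) (side [Y]))"
 proof -
  have "scp (sts ?p (side [Y])) (sts ?al (side [Y])) = sts (scp ?p ?al) (side [Y])" by (subst S.ic) simp_all
  also have "\<dots> = scp (sts ?p (side [Y])) (sts (sts (eps (sb A)) (side [X])) (side [Y]))"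
   unfolding S1 by (subst S.ic) (simp_all del: S.ts_assoc)
  finally show ?thesis .
 qed
 have tE: "sts (eps (sb A)) (side [Y]) = Some ([?a, Y], T, [Y])" by (simp add: stc T_def)
 have c1: "scp (sts ?al (sts (eps (sb A)) (side [Y]))) (sts (side [?a]) (sts (ssw [?a] [X]) (side [Y])))
   = Some ([?a, ?a, X, Y], ?f oo ?i, [X, Y])"
 proof -
  let ?A = "assoc C ?a X (?a \<odot> Y)" and ?B = "assoc_inv C ?a X (?a \<odot> Y)" and ?W = "swap_mid C ?a ?a X Y"
  have 1: "sts ?al (Some ([?a, Y], T, [Y])) = Some ([?a, X, ?a, Y], (f ## T) oo ?B, [X, Y])" by (simp add: stc)
  have ta: "?A oo (?W oo ?i) \<in> Hom C (?a \<odot> (?a \<odot> (X \<odot> Y))) (?a \<odot> (X \<odot> (?a \<odot> Y)))"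
   "(f ## T) oo ?B \<in> Hom C (?a \<odot> (X \<odot> (?a \<odot> Y))) (X \<odot> Y)" by (rule t)+
  have "((f ## T) oo ?B) oo (?A oo (?W oo ?i)) = (f ## T) oo (?B oo (?A oo (?W oo ?i)))" by (rule Comp_assoc) (rule t)+
  also have "?B oo (?A oo (?W oo ?i)) = Id C ((?a \<odot> X) \<odot> (?a \<odot> Y)) oo (?W oo ?i)" by (rule comp_rw1[OF assoc_inv_assoc]) (rule t)+
  also have "\<dots> = ?W oo ?i" by (rule Id_Comp) (rule t)+
  also have "(f ## T) oo (?W oo ?i) = ?f oo ?i" by (rule Comp_assoc[symmetric]) (rule t)+
  finally show ?thesis unfolding tE 1 sw4[OF aa aa X Y Unit_Ob Unit_Ob] using ta by (simp add: scp_eq)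
 qed
 have c2: "sts (eps (sb A)) (sts (eps (sb A)) (sts (side [X]) (side [Y]))) = Some ([?a, ?a, X, Y], ?g oo ?i, [X, Y])"
 proof -
  have le: "lunit C \<I> oo (eps A ## eps A) \<in> Hom C (?a \<odot> ?a) \<I>" by (rule t)+
  have "sts (eps (sb A)) (sts (eps (sb A)) (sts (side [X]) (side [Y]))) = sts (sts (eps (sb A)) (eps (sb A))) (side [X, Y])"
   using S.ide_ide[of "[X]" "[Y]"] by (simp add: S.ts_assoc)
  also have "sts (eps (sb A)) (eps (sb A)) = Some ([?a, ?a], lunit C \<I> oo (eps A ## eps A), [])" by (simp add: stc)
  also have "sts \<dots> (side [X, Y]) = Some ([?a, ?a, X, Y], lunit C (X \<odot> Y) oo (((lunit C \<I> oo (eps A ## eps A)) ## Id C (X \<odot> Y)) oo ?i), [X, Y])"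
   unfolding side_def using le by (simp add: sts_eq mu_small mu.simps(1))
  also have "lunit C (X \<odot> Y) oo (((lunit C \<I> oo (eps A ## eps A)) ## Id C (X \<odot> Y)) oo ?i) = ?g oo ?i"
   by (rule Comp_assoc[symmetric]) (rule t)+
  finally show ?thesis .
 qed
 show ?thesis unfolding S.coq_def
 proof (intro conjI allI impI absorb)
  fix h assume h: "sar h" "ssrc h = strg (sts ?al (side [Y]))"
   and e: "scp h (sts ?al (side [Y])) = scp h (sts (sts (eps (sb A)) (side [X])) (side [Y]))"
  have hs: "ssrc h = [X, Y]" using h by simp
  obtain zs where zs: "strg h = zs" "obs zs" using sarD[OF h(1)] by blast
  have hh: "h = Some ([X, Y], sm h, zs)" by (rule sbind[OF h(1) hs zs(1)])
  have hm: "sm h \<in> Hom C (X \<odot> Y) (Jo zs)" using sm_Hom[OF h(1) hs zs(1)] by simp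
  have "scp h (scp (sts ?al (sts (eps (sb A)) (side [Y]))) (sts (side [?a]) (sts (ssw [?a] [X]) (side [Y]))))
    = scp h (sts (eps (sb A)) (sts (eps (sb A)) (sts (side [X]) (side [Y]))))"
   by (rule S.tensor_trivial_action) (use h hs e in \<open>simp_all add: S.ts_assoc\<close>)
  moreover have "?f oo ?i \<in> Hom C (?a \<odot> (?a \<odot> (X \<odot> Y))) (X \<odot> Y)" "?g oo ?i \<in> Hom C (?a \<odot> (?a \<odot> (X \<odot> Y))) (X \<odot> Y)" by (rule t)+
  ultimately have "sm h oo (?f oo ?i) = sm h oo (?g oo ?i)" unfolding c1 c2 using zs(2) hm by (subst (asm) (1 2) hh) (simp add: scp_eq)
  moreover have "(sm h oo ?f) oo ?i = sm h oo (?f oo ?i)" "(sm h oo ?g) oo ?i = sm h oo (?g oo ?i)" by (rule Comp_assoc, (rule t hm)+)+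
  moreover have hf: "sm h oo ?f \<in> Hom C ((?a \<odot> ?a) \<odot> (X \<odot> Y)) (Jo zs)" "sm h oo ?g \<in> Hom C ((?a \<odot> ?a) \<odot> (X \<odot> Y)) (Jo zs)" by (rule t hm)+
  ultimately have "sm h oo ?f = sm h oo ?g"
   using iso_cancel_right[OF assoc_inv_Hom assoc_Hom assoc_inv_assoc, of ?a ?a "X \<odot> Y" "sm h oo ?f" "Jo zs" "sm h oo ?g"] by simp
  hence "\<exists>!w. w \<in> Hom C (P \<odot> Y) (Jo zs) \<and> w oo (p ## Id C Y) = sm h" using tq hm unfolding is_coequalizer_def by blast
  hence "\<exists>!u. (sar u \<and> ssrc u = [P, Y] \<and> strg u = zs) \<and> scp u (Some ([X, Y], p ## Id C Y, [P, Y])) = Some ([X, Y], sm h, zs)"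
   by (intro ex1_sb) (simp_all add: zs)
  thus "\<exists>!u. (sar u \<and> ssrc u = strg (sts ?p (side [Y])) \<and> strg u = strg h) \<and> scp u (sts ?p (side [Y])) = h"
   unfolding px zs(1) using hh by simp
 qed simp_all
qed

lemma squot_sb:
 assumes st: "left_stable C" and hc: "has_coequalizers C" and act: "left_action C A f X"
  and p: "left_stab C A f X P p"
 shows "S.squot (sb A) (Some ([und A, X], f, [X])) (Some ([X], p, [P]))"
 unfolding S.squot_def
proof (intro conjI allI impI)
 let ?a = "und A"
 have B: "bimonoid C A" and X: "X \<in> Ob C" and f: "f \<in> Hom C (?a \<odot> X) X" using act unfolding left_action_def by blast+
 have pt: "p \<in> Hom C X P" using p unfolding left_stab_def is_coequalizer_def by blast+
 note [simp] = bimD[OF B] X f pt Hom_obs(2)[OF pt] tensor_Ob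
 show "sar (Some ([X], p, [P]))" "ssrc (Some ([X], p, [P])) = strg (Some ([?a, X], f, [X]))" by simp_all
 fix ys assume ys: "obs ys"
 let ?Y = "Jo ys"
 have Y [simp]: "?Y \<in> Ob C" using Jo_Ob[OF ys] .
 have i [simp]: "Id C ?Y \<in> Hom C ?Y ?Y" using Id_Hom Y by blast
 have kk: "scp (Some ([?Y], Id C ?Y, ys)) (Some (ys, Id C ?Y, [?Y])) = side ys" "scp (Some (ys, Id C ?Y, [?Y])) (Some ([?Y], Id C ?Y, ys)) = side [?Y]"
  using ys Id_Comp[OF i] by (simp_all add: scp_eq side_def)
 have "S.coq (sts (Some ([?a, X], f, [X])) (side ys)) (sts (sts (eps (sb A)) (side [X])) (side ys)) (sts (Some ([X], p, [P])) (side ys))"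
  by (rule S.coq_change_object[OF _ _ _ _ _ _ _ _ _ _ coq_sb[OF st hc act p Y], of "Some (ys, Id C ?Y, [?Y])" ys "Some ([?Y], Id C ?Y, ys)"])
   (use ys kk in simp_all)
 thus "S.coq (sts (Some ([?a, X], f, [X])) (side ys)) (sts (eps (sb A)) (sts (side (strg (Some ([?a, X], f, [X])))) (side ys))) (sts (Some ([X], p, [P])) (side ys))"
  by (simp add: S.ts_assoc)
qed

lemma coq_sb':
 assumes st: "left_costable C" and hc: "has_equalizers C" and act: "left_coaction C A f X"
  and p: "left_costab C A f X P p" and Y: "Y \<in> Ob C"
 shows "ssmc.coq sar strg ssrc (\<lambda>g f. scp f g) (sts (Some ([X], f, [und A, X])) (side [Y]))
   (sts (sts (eta (sb A)) (side [X])) (side [Y])) (sts (Some ([P], p, [X])) (side [Y]))"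
proof -
 let ?a = "und A"
 have B: "bimonoid C A" and X: "X \<in> Ob C" and f: "f \<in> Hom C X (?a \<odot> X)" using act unfolding left_coaction_def by blast+
 have pt: "p \<in> Hom C P X" "f oo p = ((eta A ## Id C X) oo lunit_inv C X) oo p"
  using p unfolding left_costab_def is_equalizer_def by blast+
 have P: "P \<in> Ob C" using pt(1) Hom_obs by blast
 define T where "T = (eta A ## Id C Y) oo lunit_inv C Y"
 have T: "T \<in> Hom C Y (?a \<odot> Y)" unfolding T_def by (rule ty Y bimD[OF B])+
 note aa = bimD(1)[OF B]
 note t = ty bimD[OF B] X Y P f T pt(1) swap_mid_Hom[OF aa X aa Y Unit_Ob Unit_Ob]
 let ?f = "swap_mid C ?a X ?a Y oo (f ## T)"
 let ?g = "(((eta A ## eta A) oo lunit_inv C \<I>) ## Id C (X \<odot> Y)) oo lunit_inv C (X \<odot> Y)"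
 let ?i = "assoc C ?a ?a (X \<odot> Y)"
 have tq: "is_equalizer C (X \<odot> Y) ((?a \<odot> ?a) \<odot> (X \<odot> Y)) ?f ?g (P \<odot> Y) (p ## Id C Y)"
  using tensor_costab[OF st hc act p Y] unfolding T_def .
 have k: "(eta A ## Id C X) oo lunit_inv C X \<in> Hom C X (?a \<odot> X)" by (rule t)+
 note [simp] = bimD[OF B] tensor_Hom Id_Hom tensor_Ob X Y P f T pt(1)
 let ?al = "Some ([X], f, [?a, X])" and ?p = "Some ([P], p, [X])"
 have px: "sts ?p (side [Y]) = Some ([P, Y], p ## Id C Y, [X, Y])" by (simp add: stc)
 have S1: "scp ?al ?p = scp (sts (eta (sb A)) (side [X])) ?p" using pt(2) k by (simp add: stc)
 have absorb: "scp (sts ?al (side [Y])) (sts ?p (side [Y])) = scp (sts (sts (eta (sb A)) (side [X])) (side [Y])) (sts ?p (side [Y]))"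
 proof -
  have "scp (sts ?al (side [Y])) (sts ?p (side [Y])) = sts (scp ?al ?p) (side [Y])" by (subst S.ic) simp_all
  also have "\<dots> = scp (sts (sts (eta (sb A)) (side [X])) (side [Y])) (sts ?p (side [Y]))"
   unfolding S1 by (subst S.ic) (simp_all del: S.ts_assoc)
  finally show ?thesis .
 qed
 have tE: "sts (eta (sb A)) (side [Y]) = Some ([Y], T, [?a, Y])" by (simp add: stc T_def)
 have c1: "scp (sts (side [?a]) (sts (ssw [X] [?a]) (side [Y]))) (sts ?al (sts (eta (sb A)) (side [Y])))
   = Some ([X, Y], ?i oo ?f, [?a, ?a, X, Y])"
 proof -
  let ?A = "assoc C ?a X (?a \<odot> Y)" and ?B = "assoc_inv C ?a X (?a \<odot> Y)" and ?W = "swap_mid C ?a X ?a Y"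
  have 1: "sts ?al (Some ([Y], T, [?a, Y])) = Some ([X, Y], ?A oo (f ## T), [?a, X, ?a, Y])" by (simp add: stc)
  have ta: "?i oo (?W oo ?B) \<in> Hom C (?a \<odot> (X \<odot> (?a \<odot> Y))) (?a \<odot> (?a \<odot> (X \<odot> Y)))"
   "?A oo (f ## T) \<in> Hom C (X \<odot> Y) (?a \<odot> (X \<odot> (?a \<odot> Y)))" by (rule t)+
  have "(?i oo (?W oo ?B)) oo (?A oo (f ## T)) = ?i oo ((?W oo ?B) oo (?A oo (f ## T)))" by (rule Comp_assoc) (rule t)+
  also have "(?W oo ?B) oo (?A oo (f ## T)) = ?W oo (?B oo (?A oo (f ## T)))" by (rule Comp_assoc) (rule t)+
  also have "?B oo (?A oo (f ## T)) = Id C ((?a \<odot> X) \<odot> (?a \<odot> Y)) oo (f ## T)" by (rule comp_rw1[OF assoc_inv_assoc]) (rule t)+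
  also have "\<dots> = f ## T" by (rule Id_Comp) (rule t)+
  finally show ?thesis unfolding tE 1 sw4[OF aa X aa Y Unit_Ob Unit_Ob] using ta by (simp add: scp_eq)
 qed
 have c2: "sts (eta (sb A)) (sts (eta (sb A)) (sts (side [X]) (side [Y]))) = Some ([X, Y], ?i oo ?g, [?a, ?a, X, Y])"
 proof -
  have le: "(eta A ## eta A) oo lunit_inv C \<I> \<in> Hom C \<I> (?a \<odot> ?a)" by (rule t)+
  have "sts (eta (sb A)) (sts (eta (sb A)) (sts (side [X]) (side [Y]))) = sts (sts (eta (sb A)) (eta (sb A))) (side [X, Y])"
   using S.ide_ide[of "[X]" "[Y]"] by (simp add: S.ts_assoc)
  also have "sts (eta (sb A)) (eta (sb A)) = Some ([], (eta A ## eta A) oo lunit_inv C \<I>, [?a, ?a])" by (simp add: stc)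
  also have "sts \<dots> (side [X, Y]) = Some ([X, Y], ?i oo ?g, [?a, ?a, X, Y])"
   unfolding side_def using le by (simp add: sts_eq mu_small mu_inv.simps(1))
  finally show ?thesis .
 qed
 show ?thesis unfolding ssmc.coq_def[OF S.ssmc_op]
 proof (intro conjI allI impI absorb)
  fix h assume h: "sar h" "strg h = ssrc (sts ?al (side [Y]))"
   and e: "scp (sts ?al (side [Y])) h = scp (sts (sts (eta (sb A)) (side [X])) (side [Y])) h"
  have hs: "strg h = [X, Y]" using h by simp
  obtain zs where zs: "ssrc h = zs" "obs zs" using sarD[OF h(1)] by blast
  have hh: "h = Some (zs, sm h, [X, Y])" by (rule sbind[OF h(1) zs(1) hs])
  have hm: "sm h \<in> Hom C (Jo zs) (X \<odot> Y)" using sm_Hom[OF h(1) zs(1) hs] by simp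
  have "scp (scp (sts (side [?a]) (sts (ssw [X] [?a]) (side [Y]))) (sts ?al (sts (eta (sb A)) (side [Y])))) h
    = scp (sts (eta (sb A)) (sts (eta (sb A)) (sts (side [X]) (side [Y])))) h"
   by (rule ssmc.tensor_trivial_action[OF S.ssmc_op, of ?al "[?a]" "[X]" "eta (sb A)" "[Y]" h])
    (use h hs e in \<open>simp_all add: S.ts_assoc\<close>)
  moreover have "?i oo ?f \<in> Hom C (X \<odot> Y) (?a \<odot> (?a \<odot> (X \<odot> Y)))" "?i oo ?g \<in> Hom C (X \<odot> Y) (?a \<odot> (?a \<odot> (X \<odot> Y)))" by (rule t)+
  ultimately have "(?i oo ?f) oo sm h = (?i oo ?g) oo sm h" unfolding c1 c2 using zs(2) hm by (subst (asm) (1 2) hh) (simp add: scp_eq)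
  moreover have "(?i oo ?f) oo sm h = ?i oo (?f oo sm h)" "(?i oo ?g) oo sm h = ?i oo (?g oo sm h)" by (rule Comp_assoc, (rule t hm)+)+
  moreover have hf: "?f oo sm h \<in> Hom C (Jo zs) ((?a \<odot> ?a) \<odot> (X \<odot> Y))" "?g oo sm h \<in> Hom C (Jo zs) ((?a \<odot> ?a) \<odot> (X \<odot> Y))" by (rule t hm)+
  ultimately have "?f oo sm h = ?g oo sm h"
   using iso_cancel_left[OF assoc_Hom assoc_inv_Hom assoc_inv_assoc, of ?a ?a "X \<odot> Y" "?f oo sm h" "Jo zs" "?g oo sm h"] by simp
  hence "\<exists>!w. w \<in> Hom C (Jo zs) (P \<odot> Y) \<and> (p ## Id C Y) oo w = sm h" using tq hm unfolding is_equalizer_def by blast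
  hence "\<exists>!u. (sar u \<and> strg u = [P, Y] \<and> ssrc u = zs) \<and> scp (Some ([P, Y], p ## Id C Y, [X, Y])) u = Some (zs, sm h, [X, Y])"
   by (intro ex1_sb') (simp_all add: zs)
  thus "\<exists>!u. (sar u \<and> strg u = ssrc (sts ?p (side [Y])) \<and> ssrc u = ssrc h) \<and> scp (sts ?p (side [Y])) u = h"
   unfolding px zs(1) using hh by simp
 qed simp_all
qed

lemma squot_sb':
 assumes st: "left_costable C" and hc: "has_equalizers C" and act: "left_coaction C A f X"
  and p: "left_costab C A f X P p"
 shows "ssmc.squot (Ob C) sar strg ssrc (\<lambda>g f. scp f g) sts side (S.du (sb A)) (Some ([X], f, [und A, X])) (Some ([P], p, [X]))"
 unfolding ssmc.squot_def[OF S.ssmc_op]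
proof (intro conjI allI impI)
 let ?a = "und A"
 have B: "bimonoid C A" and X: "X \<in> Ob C" and f: "f \<in> Hom C X (?a \<odot> X)" using act unfolding left_coaction_def by blast+
 have pt: "p \<in> Hom C P X" using p unfolding left_costab_def is_equalizer_def by blast+
 note [simp] = bimD[OF B] X f pt Hom_obs(1)[OF pt] tensor_Ob
 show "sar (Some ([P], p, [X]))" "strg (Some ([P], p, [X])) = ssrc (Some ([X], f, [?a, X]))" by simp_all
 fix ys assume ys: "obs ys"
 let ?Y = "Jo ys"
 have Y [simp]: "?Y \<in> Ob C" using Jo_Ob[OF ys] .
 have i [simp]: "Id C ?Y \<in> Hom C ?Y ?Y" using Id_Hom Y by blast
 have kk: "scp (Some ([?Y], Id C ?Y, ys)) (Some (ys, Id C ?Y, [?Y])) = side ys" "scp (Some (ys, Id C ?Y, [?Y])) (Some ([?Y], Id C ?Y, ys)) = side [?Y]"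
  using ys Id_Comp[OF i] by (simp_all add: scp_eq side_def)
 have "ssmc.coq sar strg ssrc (\<lambda>g f. scp f g) (sts (Some ([X], f, [?a, X])) (side ys)) (sts (sts (eta (sb A)) (side [X])) (side ys)) (sts (Some ([P], p, [X])) (side ys))"
  by (rule ssmc.coq_change_object[OF S.ssmc_op _ _ _ _ _ _ _ _ _ _ coq_sb'[OF st hc act p Y], of "Some ([?Y], Id C ?Y, ys)" ys "Some (ys, Id C ?Y, [?Y])"])
   (use ys kk in simp_all)
 thus "ssmc.coq sar strg ssrc (\<lambda>g f. scp f g) (sts (Some ([X], f, [?a, X])) (side ys)) (sts (eps (S.du (sb A))) (sts (side (ssrc (Some ([X], f, [?a, X])))) (side ys))) (sts (Some ([P], p, [X])) (side ys))"
  by (simp add: S.ts_assoc)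
qed

lemma bssmc_C:
 assumes he: "has_equalizers C" and hc: "has_coequalizers C" and bi: "bistable C"
 shows "bssmc (Ob C) sar ssrc strg scp sts side ssw"
proof (unfold_locales, goal_cases)
 case (1 A \<alpha> x)
 then obtain X where x: "x = [X]" by (auto simp: length_Suc_conv)
 have b: "S.bim A" using 1(1) unfolding S.act_def by blast
 define B where "B = unsb A"
 have A: "A = sb B" using sb_unsb[OF b 1(2)] by (simp add: B_def)
 have B: "bimonoid C B" using b bim_sb A by simp
 have "\<alpha> = Some ([und B, X], sm \<alpha>, [X])" using 1(1) unfolding S.act_def by (intro sbind) (simp_all add: A x)
 then obtain f where f: "\<alpha> = Some ([und B, X], f, [X])" by blast
 have fh: "X \<in> Ob C" "f \<in> Hom C (und B \<odot> X) X" using 1(1) unfolding S.act_def f x by auto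
 have act: "left_action C B f X" using 1(1) act_sb[OF B fh] unfolding A f x by blast
 have "lunit C X oo (eps B ## Id C X) \<in> Hom C (und B \<odot> X) X" by (rule ty fh bimD[OF B])+
 then obtain P p where p: "left_stab C B f X P p"
  using hc fh(2) unfolding has_coequalizers_def left_stab_def by blast
 have ls: "left_stable C" using bi unfolding bistable_def stable_def by blast
 show ?case using squot_sb[OF ls hc act p] unfolding A f by (intro exI[of _ "Some ([X], p, [P])"]) simp
next
 case (2 A \<alpha> x)
 then obtain X where x: "x = [X]" by (auto simp: length_Suc_conv)
 have b: "S.bim A" using 2(1) unfolding ssmc.act_def[OF S.ssmc_op] by simp
 define B where "B = unsb A"
 have A: "A = sb B" using sb_unsb[OF b 2(2)] by (simp add: B_def)
 have B: "bimonoid C B" using b bim_sb A by simp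
 have "\<alpha> = Some ([X], sm \<alpha>, [und B, X])" using 2(1) unfolding ssmc.act_def[OF S.ssmc_op] by (intro sbind) (simp_all add: A x)
 then obtain f where f: "\<alpha> = Some ([X], f, [und B, X])" by blast
 have fh: "X \<in> Ob C" "f \<in> Hom C X (und B \<odot> X)" using 2(1) unfolding ssmc.act_def[OF S.ssmc_op] f x by auto
 have act: "left_coaction C B f X" using 2(1) coact_sb[OF B fh] unfolding A f x by blast
 have "(eta B ## Id C X) oo lunit_inv C X \<in> Hom C X (und B \<odot> X)" by (rule ty fh bimD[OF B])+
 then obtain P p where p: "left_costab C B f X P p"
  using he fh(2) unfolding has_equalizers_def left_costab_def by blast
 have ls: "left_costable C" using bi unfolding bistable_def costable_def by blast
 show ?case using squot_sb'[OF ls he act p] unfolding A f by (intro exI[of _ "Some ([P], p, [X])"]) simp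
qed

end

section \<open>Kernels and cokernels of a composite\<close>

definition opc :: "('o, 'm) cat => ('o, 'm) cat" where
 "opc C = \<lparr>Ob = Ob C, Hom = (\<lambda>a b. Hom C b a), Id = Id C, Comp = (\<lambda>g f. Comp C f g)\<rparr>"

lemma opc_sel [simp]: "Ob (opc C) = Ob C" "Hom (opc C) a b = Hom C b a" "Id (opc C) = Id C" "Comp (opc C) g f = Comp C f g"
 by (simp_all add: opc_def)

lemma opc_opc [simp]: "opc (opc C) = C" by (simp add: opc_def)

lemma opc_zero_ob [simp]: "zero_ob (opc C) z \<longleftrightarrow> zero_ob C z" unfolding zero_ob_def by auto

lemma opc_zero_arr [simp]: "zero_arr (opc C) a b f \<longleftrightarrow> zero_arr C b a f" unfolding zero_arr_def by auto

lemma opc_kernel [simp]: "is_kernel (opc C) a b f k i \<longleftrightarrow> is_cokernel C b a f k i"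
 and opc_cokernel [simp]: "is_cokernel (opc C) a b f k i \<longleftrightarrow> is_kernel C b a f k i"
 unfolding is_kernel_def is_cokernel_def by auto

lemma opc_mono [simp]: "mono_arr (opc C) a b f \<longleftrightarrow> epi_arr C b a f"
 and opc_epi [simp]: "epi_arr (opc C) a b f \<longleftrightarrow> mono_arr C b a f"
 unfolding mono_arr_def epi_arr_def by auto

lemma zero_obE: assumes "zero_ob C z" "a \<in> Ob C" "b \<in> Ob C"
 obtains g h where "g \<in> Hom C a z" "h \<in> Hom C z b"
proof -
 note u = bspec[OF conjunct2[OF assms(1)[unfolded zero_ob_def]]]
 show ?thesis
  using that u[OF assms(2), THEN conjunct1, THEN ex1_implies_ex] u[OF assms(3), THEN conjunct2, THEN ex1_implies_ex] by metis
qed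

text \<open>
 The consequences of being abelian that the sequence of kernels and cokernels needs. The list is self-dual, which gives the cokernel half of each argument by passing to the opposite category.
\<close>

locale normal_category = category C for C :: "('o, 'm) cat" (structure) +
 assumes zero_object: "\<exists>z. zero_ob C z"
  and kernel_ex: "f \<in> Hom C a b ==> \<exists>k i. is_kernel C a b f k i"
  and cokernel_ex: "f \<in> Hom C a b ==> \<exists>c p. is_cokernel C a b f c p"
  and mono_normal: "mono_arr C a b f ==> \<exists>c g. is_kernel C b c g a f"
  and epi_normal: "epi_arr C a b f ==> \<exists>c g. is_cokernel C c a g b f"
  and mono_if: "[|f \<in> Hom C a b; \<And>x j. [|j \<in> Hom C x a; zero_arr C x b (f \<cdot> j)|] ==> zero_arr C x a j|] ==> mono_arr C a b f"
  and epi_if: "[|f \<in> Hom C a b; \<And>x j. [|j \<in> Hom C b x; zero_arr C a x (j \<cdot> f)|] ==> zero_arr C b x j|] ==> epi_arr C a b f"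
begin

lemma opposite: "normal_category (opc C)"
proof (unfold_locales, goal_cases)
 case (1 f a b) thus ?case using Hom_Ob[of f b a] by simp
next
 case (2 a) thus ?case using Id_Hom by simp
next
 case (3 f a b g c) thus ?case using Comp_Hom[of g c b f a] by simp
next
 case (4 f a b) thus ?case using Id_Comp by simp
next
 case (5 f a b) thus ?case using Comp_Id by simp
next
 case (6 f a b g c h d) thus ?case using Comp_assoc[of h d c g b f a] by simp
next
 case 7 thus ?case using zero_object by simp
next
 case (8 f a b) thus ?case using cokernel_ex[of f b a] by simp
next
 case (9 f a b) thus ?case using kernel_ex[of f b a] by simp
next
 case (10 a b f) thus ?case using epi_normal[of b a f] by simp
next
 case (11 a b f) thus ?case using mono_normal[of b a f] by simp
next
 case (12 f a b)
 have "epi_arr C b a f" by (rule epi_if) (use 12 in auto)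
 thus ?case by simp
next
 case (13 f a b)
 have "mono_arr C b a f" by (rule mono_if) (use 13 in auto)
 thus ?case by simp
qed

lemma zero_Hom: "zero_arr C a b f ==> f \<in> Hom C a b"
 unfolding zero_arr_def using Comp_Hom by blast

lemma zero_left: assumes "zero_arr C a b f" "g \<in> Hom C b c" shows "zero_arr C a c (g \<cdot> f)"
proof -
 obtain z p h where z: "zero_ob C z" "p \<in> Hom C a z" "h \<in> Hom C z b" "f = h \<cdot> p" using assms(1) unfolding zero_arr_def by blast
 hence "g \<cdot> f = (g \<cdot> h) \<cdot> p" "g \<cdot> h \<in> Hom C z c" using assms(2) Comp_assoc Comp_Hom by auto
 thus ?thesis using z unfolding zero_arr_def by blast
qed

lemma zero_right: assumes "zero_arr C a b f" "g \<in> Hom C c a" shows "zero_arr C c b (f \<cdot> g)"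
proof -
 obtain z p h where z: "zero_ob C z" "p \<in> Hom C a z" "h \<in> Hom C z b" "f = h \<cdot> p" using assms(1) unfolding zero_arr_def by blast
 hence "f \<cdot> g = h \<cdot> (p \<cdot> g)" "p \<cdot> g \<in> Hom C c z" using assms(2) Comp_assoc Comp_Hom by auto
 thus ?thesis using z unfolding zero_arr_def by blast
qed

lemma zero_unique: assumes "zero_arr C a b f" "zero_arr C a b g" shows "f = g"
proof -
 obtain z p h where z: "zero_ob C z" "p \<in> Hom C a z" "h \<in> Hom C z b" "f = h \<cdot> p" using assms(1) unfolding zero_arr_def by blast
 obtain z' p' h' where z': "zero_ob C z'" "p' \<in> Hom C a z'" "h' \<in> Hom C z' b" "g = h' \<cdot> p'" using assms(2) unfolding zero_arr_def by blast
 have ob: "a \<in> Ob C" "b \<in> Ob C" "z' \<in> Ob C" using z z' Hom_Ob by blast+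
 obtain w where w: "w \<in> Hom C z' z" using z(1) ob unfolding zero_ob_def by blast
 have "w \<cdot> p' = p" using z(1,2) Comp_Hom[OF z'(2) w] ob(1) unfolding zero_ob_def by blast
 moreover have "h \<cdot> w = h'" using z'(1,3) Comp_Hom[OF w z(3)] ob(2) unfolding zero_ob_def by blast
 ultimately show ?thesis using Comp_assoc[OF z'(2) w z(3)] z(4) z'(4) by simp
qed

lemma zero_ex: assumes "a \<in> Ob C" "b \<in> Ob C" shows "\<exists>f. zero_arr C a b f"
proof -
 obtain z where z: "zero_ob C z" using zero_object by blast
 then obtain g h where "g \<in> Hom C a z" "h \<in> Hom C z b" using zero_obE assms by metis
 with z have "zero_arr C a b (h \<cdot> g)" unfolding zero_arr_def by blast
 thus ?thesis ..
qed

lemma mono_zero: assumes m: "mono_arr C a b m" and f: "f \<in> Hom C x a" and z: "zero_arr C x b (m \<cdot> f)"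
 shows "zero_arr C x a f"
proof -
 have mh: "m \<in> Hom C a b" using m unfolding mono_arr_def by blast
 obtain o' where o': "zero_arr C x a o'" using zero_ex f Hom_Ob by blast
 have "m \<cdot> f = m \<cdot> o'" using zero_unique z zero_left[OF o' mh] by blast
 hence "f = o'" using m f zero_Hom[OF o'] unfolding mono_arr_def by blast
 thus ?thesis using o' by simp
qed

lemma kernel_mono: assumes "is_kernel C a b f k i" shows "mono_arr C k a i"
 unfolding mono_arr_def
proof (intro conjI allI ballI impI)
 have k: "f \<in> Hom C a b" "i \<in> Hom C k a" "zero_arr C k b (f \<cdot> i)"
  "\<And>x j. j \<in> Hom C x a ==> zero_arr C x b (f \<cdot> j) ==> \<exists>!u. u \<in> Hom C x k \<and> i \<cdot> u = j"
  using assms unfolding is_kernel_def by blast+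
 show "i \<in> Hom C k a" by (rule k)
 fix x g h assume g: "g \<in> Hom C x k" "h \<in> Hom C x k" "i \<cdot> g = i \<cdot> h"
 have "zero_arr C x b (f \<cdot> (i \<cdot> g))" using zero_right[OF k(3) g(1)] Comp_assoc[OF g(1) k(2) k(1)] by simp
 from k(4)[OF Comp_Hom[OF g(1) k(2)] this] show "g = h" using g by metis
qed

lemma kernelE: assumes "is_kernel C a b f k i" "j \<in> Hom C x a" "zero_arr C x b (f \<cdot> j)"
 obtains u where "u \<in> Hom C x k" "i \<cdot> u = j"
 using assms unfolding is_kernel_def by blast

lemma kernelI:
 assumes "f \<in> Hom C a b" "mono_arr C k a i" "zero_arr C k b (f \<cdot> i)"
  and "\<And>x j. [|j \<in> Hom C x a; zero_arr C x b (f \<cdot> j)|] ==> \<exists>u. u \<in> Hom C x k \<and> i \<cdot> u = j"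
 shows "is_kernel C a b f k i"
 using assms unfolding is_kernel_def mono_arr_def by blast

lemma mono_comp_cancel: assumes "mono_arr C a c (g \<cdot> f)" "f \<in> Hom C a b" "g \<in> Hom C b c" shows "mono_arr C a b f"
 using assms Comp_assoc unfolding mono_arr_def by metis

lemma mono_comp: assumes f: "mono_arr C a b f" and g: "mono_arr C b c g" shows "mono_arr C a c (g \<cdot> f)"
 unfolding mono_arr_def
proof (intro conjI allI ballI impI)
 have t: "f \<in> Hom C a b" "g \<in> Hom C b c" using f g unfolding mono_arr_def by blast+
 show "g \<cdot> f \<in> Hom C a c" using t Comp_Hom by blast
 fix x u v assume u: "u \<in> Hom C x a" "v \<in> Hom C x a" "(g \<cdot> f) \<cdot> u = (g \<cdot> f) \<cdot> v"
 hence "g \<cdot> (f \<cdot> u) = g \<cdot> (f \<cdot> v)" using Comp_assoc t by auto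
 hence "f \<cdot> u = f \<cdot> v" using g u t Comp_Hom unfolding mono_arr_def by blast
 thus "u = v" using f u unfolding mono_arr_def by blast
qed

lemma kernel_of_mono_comp:
 assumes m: "mono_arr C b c m" and f: "f \<in> Hom C a b"
 shows "is_kernel C a c (m \<cdot> f) k i \<longleftrightarrow> is_kernel C a b f k i"
proof -
 have mh: "m \<in> Hom C b c" using m unfolding mono_arr_def by blast
 have z: "zero_arr C x c ((m \<cdot> f) \<cdot> j) \<longleftrightarrow> zero_arr C x b (f \<cdot> j)" if j: "j \<in> Hom C x a" for x j
  using Comp_assoc[OF j f mh] mono_zero[OF m Comp_Hom[OF j f]] zero_left[OF _ mh] by metis
 show ?thesis unfolding is_kernel_def using z f Comp_Hom[OF f mh] by blast
qed

text \<open>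
 The image is the kernel of the cokernel.
\<close>

lemma factor: assumes f: "f \<in> Hom C a b"
 obtains j e m where "epi_arr C a j e" "mono_arr C j b m" "m \<cdot> e = f"
proof -
 obtain c p where cok: "is_cokernel C a b f c p" using cokernel_ex f by blast
 have p: "p \<in> Hom C b c" "zero_arr C a c (p \<cdot> f)" using cok unfolding is_cokernel_def by blast+
 obtain j m where k: "is_kernel C b c p j m" using kernel_ex p by blast
 have m: "m \<in> Hom C j b" "zero_arr C j c (p \<cdot> m)" using k unfolding is_kernel_def by blast+
 note mm = kernel_mono[OF k]
 obtain e where e: "e \<in> Hom C a j" "m \<cdot> e = f" using kernelE[OF k f p(2)] by blast
 have "epi_arr C a j e"
 proof (rule epi_if[OF e(1)])
  fix x y assume y: "y \<in> Hom C j x" "zero_arr C a x (y \<cdot> e)"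
  obtain k' i where ki: "is_kernel C j x y k' i" using kernel_ex y(1) by blast
  have i: "i \<in> Hom C k' j" "zero_arr C k' x (y \<cdot> i)" using ki unfolding is_kernel_def by blast+
  obtain e' where e': "e' \<in> Hom C a k'" "i \<cdot> e' = e" using kernelE[OF ki e(1) y(2)] by blast
  have mi: "mono_arr C k' b (m \<cdot> i)" by (rule mono_comp[OF kernel_mono[OF ki] mm])
  obtain d q where q: "is_kernel C b d q k' (m \<cdot> i)" using mono_normal[OF mi] by blast
  have qh: "q \<in> Hom C b d" "zero_arr C k' d (q \<cdot> (m \<cdot> i))" using q unfolding is_kernel_def by blast+
  have "q \<cdot> f = (q \<cdot> (m \<cdot> i)) \<cdot> e'"
   using e' e i(1) m(1) qh(1) Comp_assoc[OF e'(1) i(1) m(1)] Comp_assoc[OF e'(1) Comp_Hom[OF i(1) m(1)] qh(1)] by simp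
  hence "zero_arr C a d (q \<cdot> f)" using zero_right[OF qh(2) e'(1)] by simp
  then obtain w where w: "w \<in> Hom C c d" "w \<cdot> p = q" using cok qh(1) unfolding is_cokernel_def by blast
  have "zero_arr C j d (q \<cdot> m)" using zero_left[OF m(2) w(1)] Comp_assoc[OF m(1) p(1) w(1)] w(2) by simp
  then obtain x' where x: "x' \<in> Hom C j k'" "(m \<cdot> i) \<cdot> x' = m" using kernelE[OF q m(1)] by blast
  have "m \<cdot> (i \<cdot> x') = m \<cdot> Id C j" using Comp_assoc[OF x(1) i(1) m(1)] x(2) Comp_Id[OF m(1)] by simp
  hence "i \<cdot> x' = Id C j" using mm Comp_Hom[OF x(1) i(1)] Id_Hom Hom_Ob[OF m(1)] unfolding mono_arr_def by blast
  hence "y = (y \<cdot> i) \<cdot> x'" using Comp_assoc[OF x(1) i(1) y(1)] Comp_Id[OF y(1)] by simp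
  thus "zero_arr C j x y" using zero_right[OF i(2) x(1)] by simp
 qed
 thus ?thesis using that mm e(2) by blast
qed

lemma epi_cokernel_of_kernel:
 assumes e: "epi_arr C a b e" and k: "is_kernel C a b e k i"
 shows "is_cokernel C k a i b e"
proof -
 obtain c g where g: "is_cokernel C c a g b e" using epi_normal[OF e] by blast
 have gh: "g \<in> Hom C c a" "e \<in> Hom C a b" "zero_arr C c b (e \<cdot> g)" using g unfolding is_cokernel_def by blast+
 have ih: "i \<in> Hom C k a" "zero_arr C k b (e \<cdot> i)" using k unfolding is_kernel_def by blast+
 obtain g' where g': "g' \<in> Hom C c k" "i \<cdot> g' = g" using kernelE[OF k gh(1,3)] by blast
 show ?thesis unfolding is_cokernel_def
 proof (intro conjI allI ballI impI ih gh(2))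
  fix x j assume j: "j \<in> Hom C a x" "zero_arr C k x (j \<cdot> i)"
  have "zero_arr C c x (j \<cdot> g)" using zero_right[OF j(2) g'(1)] Comp_assoc[OF g'(1) ih(1) j(1)] g'(2) by simp
  thus "\<exists>!u. u \<in> Hom C b x \<and> u \<cdot> e = j" using g j(1) unfolding is_cokernel_def by blast
 qed
qed

definition exact :: "'o => 'o => 'o => 'm => 'm => bool" where
 "exact a b c i p \<longleftrightarrow> is_kernel C b c p a i \<and> is_cokernel C a b i c p"

text \<open>
 For an epi \<open>e\<close> the map induced on kernels is epi. Let \<open>m1\<close> be its image and \<open>c\<close> an arrow with kernel \<open>b m1\<close>; then \<open>c e\<close> vanishes on \<open>Ker (h e)\<close> and hence factors through the coimage of \<open>h e\<close>, so \<open>c\<close> vanishes on \<open>Ker h\<close> and \<open>m1\<close> is invertible.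
\<close>

lemma exact_kernels:
 assumes e: "epi_arr C a m e" and h: "h \<in> Hom C m d"
  and ka: "is_kernel C a m e k i" and kl: "is_kernel C a d (h \<cdot> e) l j" and kn: "is_kernel C m d h n b"
 shows "\<exists>s t. exact k l n s t"
proof -
 have eh: "e \<in> Hom C a m" using e unfolding epi_arr_def by blast
 have ih: "i \<in> Hom C k a" "zero_arr C k m (e \<cdot> i)" using ka unfolding is_kernel_def by blast+
 have jh: "j \<in> Hom C l a" "zero_arr C l d ((h \<cdot> e) \<cdot> j)" using kl unfolding is_kernel_def by blast+
 have bh: "b \<in> Hom C n m" "zero_arr C n d (h \<cdot> b)" using kn unfolding is_kernel_def by blast+
 note bm = kernel_mono[OF kn] and jm = kernel_mono[OF kl]
 have "zero_arr C l d (h \<cdot> (e \<cdot> j))" using jh Comp_assoc[OF jh(1) eh h] by simp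
 then obtain t where t: "t \<in> Hom C l n" "b \<cdot> t = e \<cdot> j" using kernelE[OF kn Comp_Hom[OF jh(1) eh]] by blast
 have "zero_arr C k d ((h \<cdot> e) \<cdot> i)" using zero_left[OF ih(2) h] Comp_assoc[OF ih(1) eh h] by simp
 then obtain s where s: "s \<in> Hom C k l" "j \<cdot> s = i" using kernelE[OF kl ih(1)] by blast
 have bt: "b \<cdot> (t \<cdot> r) = e \<cdot> (j \<cdot> r)" if "r \<in> Hom C x l" for r x
  using Comp_assoc[OF that t(1) bh(1)] Comp_assoc[OF that jh(1) eh] t(2) by simp
 have kt: "is_kernel C l n t k s"
 proof (rule kernelI[OF t(1)])
  show "mono_arr C k l s" using mono_comp_cancel[of k a j s l] kernel_mono[OF ka] s jh(1) by simp
  have "zero_arr C k m (b \<cdot> (t \<cdot> s))" using bt[OF s(1)] s(2) ih(2) by simp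
  thus "zero_arr C k n (t \<cdot> s)" by (rule mono_zero[OF bm Comp_Hom[OF s(1) t(1)]])
  fix x r assume r: "r \<in> Hom C x l" "zero_arr C x n (t \<cdot> r)"
  have "zero_arr C x m (e \<cdot> (j \<cdot> r))" using zero_left[OF r(2) bh(1)] bt[OF r(1)] by simp
  then obtain w where w: "w \<in> Hom C x k" "i \<cdot> w = j \<cdot> r" using kernelE[OF ka Comp_Hom[OF r(1) jh(1)]] by blast
  have "j \<cdot> (s \<cdot> w) = j \<cdot> r" using Comp_assoc[OF w(1) s(1) jh(1)] s(2) w(2) by simp
  hence "s \<cdot> w = r" using jm Comp_Hom[OF w(1) s(1)] r(1) unfolding mono_arr_def by blast
  thus "\<exists>u. u \<in> Hom C x k \<and> s \<cdot> u = r" using w by blast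
 qed
 have "epi_arr C l n t"
 proof (rule epi_if[OF t(1)])
  fix x y assume y: "y \<in> Hom C n x" "zero_arr C l x (y \<cdot> t)"
  obtain o' e1 m1 where f1: "epi_arr C l o' e1" "mono_arr C o' n m1" "m1 \<cdot> e1 = t" using factor[OF t(1)] by blast
  have h1: "e1 \<in> Hom C l o'" "m1 \<in> Hom C o' n" using f1 unfolding epi_arr_def mono_arr_def by blast+
  obtain w c where c: "is_kernel C m w c o' (b \<cdot> m1)" using mono_normal[OF mono_comp[OF f1(2) bm]] by blast
  have ch: "c \<in> Hom C m w" "zero_arr C o' w (c \<cdot> (b \<cdot> m1))" using c unfolding is_kernel_def by blast+
  have bm1: "b \<cdot> m1 \<in> Hom C o' m" by (rule Comp_Hom[OF h1(2) bh(1)])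
  have "(c \<cdot> e) \<cdot> j = c \<cdot> (b \<cdot> t)" using Comp_assoc[OF jh(1) eh ch(1)] t(2) by simp
  also have "\<dots> = (c \<cdot> (b \<cdot> m1)) \<cdot> e1"
   using Comp_assoc[OF h1(1) bm1 ch(1)] Comp_assoc[OF h1 bh(1)] f1(3) by simp
  finally have cz: "zero_arr C l w ((c \<cdot> e) \<cdot> j)" using zero_right[OF ch(2) h1(1)] by simp
  obtain q e3 m3 where f3: "epi_arr C m q e3" "mono_arr C q d m3" "m3 \<cdot> e3 = h" using factor[OF h] by blast
  have h3: "e3 \<in> Hom C m q" "m3 \<in> Hom C q d" using f3 unfolding epi_arr_def mono_arr_def by blast+
  have ee: "epi_arr C a q (e3 \<cdot> e)" using normal_category.mono_comp[OF opposite, of q m e3 a e] e f3(1) by simp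
  have "is_kernel C a q (e3 \<cdot> e) l j"
   using kl kernel_of_mono_comp[OF f3(2) Comp_Hom[OF eh h3(1)]] Comp_assoc[OF eh h3] f3(3) by simp
  hence "is_cokernel C l a j q (e3 \<cdot> e)" by (rule epi_cokernel_of_kernel[OF ee])
  then obtain v where v: "v \<in> Hom C q w" "v \<cdot> (e3 \<cdot> e) = c \<cdot> e"
   using cz Comp_Hom[OF eh ch(1)] unfolding is_cokernel_def by blast
  have "(v \<cdot> e3) \<cdot> e = c \<cdot> e" using Comp_assoc[OF eh h3(1) v(1)] v(2) by simp
  hence ve: "v \<cdot> e3 = c" using e Comp_Hom[OF h3(1) v(1)] ch(1) unfolding epi_arr_def by blast
  have "zero_arr C n q (e3 \<cdot> b)"
   by (rule mono_zero[OF f3(2) Comp_Hom[OF bh(1) h3(1)]]) (use bh(2) Comp_assoc[OF bh(1) h3] f3(3) in simp)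
  hence "zero_arr C n w (c \<cdot> b)" using zero_left[OF _ v(1)] Comp_assoc[OF bh(1) h3(1) v(1)] ve by metis
  then obtain x' where x: "x' \<in> Hom C n o'" "(b \<cdot> m1) \<cdot> x' = b" using kernelE[OF c bh(1)] by blast
  have "b \<cdot> (m1 \<cdot> x') = b \<cdot> Id C n" using Comp_assoc[OF x(1) h1(2) bh(1)] x(2) Comp_Id[OF bh(1)] by simp
  hence mx: "m1 \<cdot> x' = Id C n" using bm Comp_Hom[OF x(1) h1(2)] Id_Hom Hom_Ob[OF bh(1)] unfolding mono_arr_def by blast
  have ym: "y \<cdot> m1 \<in> Hom C o' x" by (rule Comp_Hom[OF h1(2) y(1)])
  have "zero_arr C l x ((y \<cdot> m1) \<cdot> e1)" using y(2) Comp_assoc[OF h1 y(1)] f1(3) by simp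
  hence "zero_arr C o' x (y \<cdot> m1)"
   using normal_category.mono_zero[OF opposite, of o' l e1 "y \<cdot> m1" x] f1(1) ym by simp
  hence "zero_arr C n x ((y \<cdot> m1) \<cdot> x')" using x(1) by (rule zero_right)
  thus "zero_arr C n x y" using Comp_assoc[OF x(1) h1(2) y(1)] mx Comp_Id[OF y(1)] by simp
 qed
 from epi_cokernel_of_kernel[OF this kt] kt show ?thesis unfolding exact_def by blast
qed

text \<open>
 The object \<open>X\<close> is the kernel of \<open>Ker g \<rightarrow> Cok f\<close>. It is also the kernel of \<open>g\<close> restricted to the image of \<open>f\<close>, both being the intersection of \<open>Ker g\<close> with that image.
\<close>

lemma kernel_half:
 assumes f: "f \<in> Hom C a b" and g: "g \<in> Hom C b d"
  and kf: "is_kernel C a b f Kf kf" and kgf: "is_kernel C a d (g \<cdot> f) Kgf kgf" and kg: "is_kernel C b d g Kg k"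
  and cf: "is_cokernel C a b f Cf c"
  and q: "epi_arr C Kg I q" and n: "mono_arr C I Cf n" and nq: "n \<cdot> q = c \<cdot> k"
 shows "\<exists>X s t x. exact Kf Kgf X s t \<and> exact X Kg I x q"
proof -
 obtain M e m where F: "epi_arr C a M e" "mono_arr C M b m" "m \<cdot> e = f" using factor[OF f] by blast
 have eh: "e \<in> Hom C a M" and mh: "m \<in> Hom C M b" using F unfolding epi_arr_def mono_arr_def by blast+
 have kh: "k \<in> Hom C Kg b" "zero_arr C Kg d (g \<cdot> k)" using kg unfolding is_kernel_def by blast+
 have ch: "c \<in> Hom C b Cf" "zero_arr C a Cf (c \<cdot> f)" using cf unfolding is_cokernel_def by blast+
 have qh: "q \<in> Hom C Kg I" using q unfolding epi_arr_def by blast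
 note km = kernel_mono[OF kg]
 have "is_cokernel C M b m Cf c"
  using normal_category.kernel_of_mono_comp[OF opposite, of M a e m b Cf c] F(1,3) mh cf by simp
 hence mk: "is_kernel C b Cf c M m"
  using normal_category.epi_cokernel_of_kernel[OF opposite, of b M m Cf c] F(2) by simp
 have cm: "zero_arr C M Cf (c \<cdot> m)" using mk unfolding is_kernel_def by blast
 obtain X x where x: "is_kernel C Kg Cf (c \<cdot> k) X x" using kernel_ex Comp_Hom[OF kh(1) ch(1)] by blast
 have xh: "x \<in> Hom C X Kg" "zero_arr C X Cf ((c \<cdot> k) \<cdot> x)" using x unfolding is_kernel_def by blast+
 have "zero_arr C X Cf (c \<cdot> (k \<cdot> x))" using xh(2) Comp_assoc[OF xh(1) kh(1) ch(1)] by simp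
 then obtain y where y: "y \<in> Hom C X M" "m \<cdot> y = k \<cdot> x" using kernelE[OF mk Comp_Hom[OF xh(1) kh(1)]] by blast
 have "is_kernel C M d (g \<cdot> m) X y"
 proof (rule kernelI[OF Comp_Hom[OF mh g]])
  show "mono_arr C X M y" using mono_comp_cancel[of X b m y M] y mh mono_comp[OF kernel_mono[OF x] km] by simp
  have "(g \<cdot> m) \<cdot> y = (g \<cdot> k) \<cdot> x" using Comp_assoc[OF y(1) mh g] Comp_assoc[OF xh(1) kh(1) g] y(2) by simp
  thus "zero_arr C X d ((g \<cdot> m) \<cdot> y)" using zero_right[OF kh(2) xh(1)] by simp
  fix z t assume t: "t \<in> Hom C z M" "zero_arr C z d ((g \<cdot> m) \<cdot> t)"
  have "zero_arr C z d (g \<cdot> (m \<cdot> t))" using t Comp_assoc[OF t(1) mh g] by simp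
  then obtain s where s: "s \<in> Hom C z Kg" "k \<cdot> s = m \<cdot> t" using kernelE[OF kg Comp_Hom[OF t(1) mh]] by blast
  have "zero_arr C z Cf ((c \<cdot> k) \<cdot> s)"
   using zero_right[OF cm t(1)] Comp_assoc[OF t(1) mh ch(1)] Comp_assoc[OF s(1) kh(1) ch(1)] s(2) by simp
  then obtain r where r: "r \<in> Hom C z X" "x \<cdot> r = s" using kernelE[OF x s(1)] by blast
  have "m \<cdot> (y \<cdot> r) = m \<cdot> t"
   using Comp_assoc[OF r(1) y(1) mh] Comp_assoc[OF r(1) xh(1) kh(1)] y(2) r(2) s(2) by simp
  hence "y \<cdot> r = t" using F(2) Comp_Hom[OF r(1) y(1)] t(1) unfolding mono_arr_def by blast
  thus "\<exists>u. u \<in> Hom C z X \<and> y \<cdot> u = t" using r by blast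
 qed
 moreover have "is_kernel C a M e Kf kf" using kf kernel_of_mono_comp[OF F(2) eh] F(3) by simp
 moreover have "is_kernel C a d ((g \<cdot> m) \<cdot> e) Kgf kgf" using kgf Comp_assoc[OF eh mh g] F(3) by simp
 ultimately obtain s t where "exact Kf Kgf X s t" using exact_kernels[OF F(1) Comp_Hom[OF mh g]] by blast
 moreover have "is_kernel C Kg I q X x" using x kernel_of_mono_comp[OF n qh] nq by simp
 hence "exact X Kg I x q" using epi_cokernel_of_kernel[OF q] unfolding exact_def by blast
 ultimately show ?thesis by blast
qed

theorem kernel_cokernel_sequence:
 assumes f: "f \<in> Hom C a b" and g: "g \<in> Hom C b d"
  and kf: "is_kernel C a b f Kf kf" and kgf: "is_kernel C a d (g \<cdot> f) Kgf kgf" and kg: "is_kernel C b d g Kg k"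
  and cf: "is_cokernel C a b f Cf c" and cgf: "is_cokernel C a d (g \<cdot> f) Cgf cgf" and cg: "is_cokernel C b d g Cg cg"
 shows "\<exists>X I Y i1 p1 i2 p2 i3 p3 i4 p4.
   exact Kf Kgf X i1 p1 \<and> exact X Kg I i2 p2 \<and> exact I Cf Y i3 p3 \<and> exact Y Cgf Cg i4 p4"
proof -
 have kh: "k \<in> Hom C Kg b" using kg unfolding is_kernel_def by blast
 have ch: "c \<in> Hom C b Cf" using cf unfolding is_cokernel_def by blast
 obtain I q n where F: "epi_arr C Kg I q" "mono_arr C I Cf n" "n \<cdot> q = c \<cdot> k" using factor[OF Comp_Hom[OF kh ch]] by blast
 obtain X s t x where 1: "exact Kf Kgf X s t" "exact X Kg I x q" using kernel_half[OF f g kf kgf kg cf F] by blast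
 have "\<exists>Y s t x. normal_category.exact (opc C) Cg Cgf Y s t \<and> normal_category.exact (opc C) Y Cf I x n"
  by (rule normal_category.kernel_half[OF opposite, of g d b f a Cg cg Cgf cgf Cf c Kg k I n q]) (use assms F in simp_all)
 then obtain Y s' t' y where 2: "exact Y Cgf Cg t' s'" "exact I Cf Y n y"
  unfolding exact_def normal_category.exact_def[OF opposite] by auto
 from 1 2 show ?thesis by blast
qed

end

text \<open>In a preadditive category an arrow is mono as soon as it cancels zero arrows.\<close>

context abelian_category
begin

definition additive :: "('a => 'a => 'b => 'b => 'b) => ('a => 'a => 'b) => bool" where
 "additive pl ze \<longleftrightarrow>
   (\<forall>a b. a \<in> Ob C --> b \<in> Ob C --> comm_group \<lparr>carrier = Hom C a b, mult = pl a b, one = ze a b\<rparr>) \<and>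
   (\<forall>a b c f f' g. f \<in> Hom C a b --> f' \<in> Hom C a b --> g \<in> Hom C b c --> g \<cdot> pl a b f f' = pl a c (g \<cdot> f) (g \<cdot> f')) \<and>
   (\<forall>a b c f g g'. f \<in> Hom C a b --> g \<in> Hom C b c --> g' \<in> Hom C b c --> pl b c g g' \<cdot> f = pl a c (g \<cdot> f) (g' \<cdot> f)) \<and>
   (\<forall>a b. a \<in> Ob C --> b \<in> Ob C --> zero_arr C a b (ze a b)) \<and>
   (\<forall>a b f. zero_arr C a b f --> f = ze a b)"

lemma additiveD: assumes "additive pl ze"
 shows "\<And>a b. a \<in> Ob C ==> b \<in> Ob C ==> comm_group \<lparr>carrier = Hom C a b, mult = pl a b, one = ze a b\<rparr>"
  "\<And>a b c f f' g. f \<in> Hom C a b ==> f' \<in> Hom C a b ==> g \<in> Hom C b c ==> g \<cdot> pl a b f f' = pl a c (g \<cdot> f) (g \<cdot> f')"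
  "\<And>a b c f g g'. f \<in> Hom C a b ==> g \<in> Hom C b c ==> g' \<in> Hom C b c ==> pl b c g g' \<cdot> f = pl a c (g \<cdot> f) (g' \<cdot> f)"
  "\<And>a b. a \<in> Ob C ==> b \<in> Ob C ==> zero_arr C a b (ze a b)"
  "\<And>a b f. zero_arr C a b f ==> f = ze a b"
 using assms unfolding additive_def by blast+

lemma additive_structure: "\<exists>plus zero. additive plus zero"
proof -
 obtain plus zero where
  G: "\<And>a b. a \<in> Ob C ==> b \<in> Ob C ==> comm_group \<lparr>carrier = Hom C a b, mult = plus a b, one = zero a b\<rparr>"
  and L: "\<And>a b c f f' g. f \<in> Hom C a b ==> f' \<in> Hom C a b ==> g \<in> Hom C b c ==> g \<cdot> plus a b f f' = plus a c (g \<cdot> f) (g \<cdot> f')"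
  and R: "\<And>a b c f g g'. f \<in> Hom C a b ==> g \<in> Hom C b c ==> g' \<in> Hom C b c ==> plus b c g g' \<cdot> f = plus a c (g \<cdot> f) (g' \<cdot> f)"
 proof -
  from preadditive obtain plus zero where
   P: "\<forall>a \<in> Ob C. \<forall>b \<in> Ob C. comm_group \<lparr>carrier = Hom C a b, mult = plus a b, one = zero a b\<rparr>"
   "\<forall>a b c. \<forall>f \<in> Hom C a b. \<forall>f' \<in> Hom C a b. \<forall>g \<in> Hom C b c. \<forall>g' \<in> Hom C b c.
    g \<cdot> plus a b f f' = plus a c (g \<cdot> f) (g \<cdot> f') \<and> plus b c g g' \<cdot> f = plus a c (g \<cdot> f) (g' \<cdot> f)"
   unfolding preadditive_def by blast
  show ?thesis by (rule that[of plus zero]) (use P in blast)+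
 qed
 have zH: "zero a b \<in> Hom C a b" if "a \<in> Ob C" "b \<in> Ob C" for a b
 proof -
  interpret g: comm_group "\<lparr>carrier = Hom C a b, mult = plus a b, one = zero a b\<rparr>" by (rule G[OF that])
  show ?thesis using g.one_closed by simp
 qed
 have idem: "f = zero a b" if "f \<in> Hom C a b" "plus a b f f = f" for a b f
 proof -
  interpret g: comm_group "\<lparr>carrier = Hom C a b, mult = plus a b, one = zero a b\<rparr>" using G that(1) Hom_Ob by blast
  show ?thesis using that g.l_cancel_one[of f f] by simp
 qed
 have zz: "plus a b (zero a b) (zero a b) = zero a b" if "a \<in> Ob C" "b \<in> Ob C" for a b
 proof -
  interpret g: comm_group "\<lparr>carrier = Hom C a b, mult = plus a b, one = zero a b\<rparr>" by (rule G[OF that])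
  show ?thesis using g.r_one[OF g.one_closed] by simp
 qed
 obtain z where z: "zero_ob C z" using zero_ob by blast
 have zo: "z \<in> Ob C" using z unfolding zero_ob_def by blast
 have fact: "h \<cdot> g = zero a b" if z: "zero_ob C z" and g: "g \<in> Hom C a z" and h: "h \<in> Hom C z b" for a b g h z
 proof (rule idem)
  have ob: "a \<in> Ob C" "b \<in> Ob C" "z \<in> Ob C" using g h Hom_Ob by blast+
  show "h \<cdot> g \<in> Hom C a b" by (rule Comp_Hom[OF g h])
  have "g = zero a z" using z g zH[OF ob(1,3)] ob unfolding zero_ob_def by blast
  thus "plus a b (h \<cdot> g) (h \<cdot> g) = h \<cdot> g" using L[OF g g h] zz[OF ob(1,3)] by simp
 qed
 have Z: "zero_arr C a b (zero a b)" if ob: "a \<in> Ob C" "b \<in> Ob C" for a b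
 proof -
  obtain g h where gh: "g \<in> Hom C a z" "h \<in> Hom C z b" using zero_obE[OF z ob] by metis
  have "zero a b = h \<cdot> g" using fact[OF z gh] by simp
  thus ?thesis using z gh unfolding zero_arr_def by blast
 qed
 have U: "f = zero a b" if "zero_arr C a b f" for a b f using that fact unfolding zero_arr_def by blast
 have "additive plus zero" unfolding additive_def
  by (intro conjI allI impI; (rule G L R Z U; assumption))
 thus ?thesis by blast
qed

lemma mono_if_cancels_zero:
 assumes f: "f \<in> Hom C a b" and c: "\<And>x j. [|j \<in> Hom C x a; zero_arr C x b (f \<cdot> j)|] ==> zero_arr C x a j"
 shows "mono_arr C a b f"
 unfolding mono_arr_def
proof (intro conjI allI ballI impI f)
 fix x g h assume g: "g \<in> Hom C x a" and h: "h \<in> Hom C x a" and e: "f \<cdot> g = f \<cdot> h"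
 obtain plus zero where A: "additive plus zero" using additive_structure by blast
 note G = additiveD(1)[OF A] and L = additiveD(2)[OF A] and Z = additiveD(4,5)[OF A]
 have ob: "x \<in> Ob C" "a \<in> Ob C" "b \<in> Ob C" using f g Hom_Ob by blast+
 interpret g: comm_group "\<lparr>carrier = Hom C x a, mult = plus x a, one = zero x a\<rparr>" by (rule G[OF ob(1,2)])
 define k where "k = inv\<^bsub>\<lparr>carrier = Hom C x a, mult = plus x a, one = zero x a\<rparr>\<^esub> h"
 have k: "k \<in> Hom C x a" "plus x a h k = zero x a" using g.inv_closed[of h] g.r_inv[of h] h unfolding k_def by simp_all
 have gk: "plus x a g k \<in> Hom C x a" using g.m_closed[of g k] g k by simp
 have "f \<cdot> plus x a g k = f \<cdot> zero x a" using L[OF g k(1) f] L[OF h k(1) f] e k(2) by simp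
 moreover have "zero_arr C x b (f \<cdot> zero x a)"
 proof -
  obtain z p q where z: "zero_ob C z" "p \<in> Hom C x z" "q \<in> Hom C z a" "zero x a = q \<cdot> p"
   using Z(1)[OF ob(1,2)] unfolding zero_arr_def by blast
  thus ?thesis using Comp_assoc[OF z(2,3) f] Comp_Hom[OF z(3) f] unfolding zero_arr_def by metis
 qed
 ultimately have "plus x a g k = zero x a" using c[OF gk] Z(2) by simp
 hence "plus x a g k = plus x a h k" using k(2) by simp
 thus "g = h" using g.right_cancel[of k g h] g h k(1) by simp
qed

lemma epi_if_cancels_zero:
 assumes f: "f \<in> Hom C a b" and c: "\<And>x j. [|j \<in> Hom C b x; zero_arr C a x (j \<cdot> f)|] ==> zero_arr C b x j"
 shows "epi_arr C a b f"
 unfolding epi_arr_def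
proof (intro conjI allI ballI impI f)
 fix x g h assume g: "g \<in> Hom C b x" and h: "h \<in> Hom C b x" and e: "g \<cdot> f = h \<cdot> f"
 obtain plus zero where A: "additive plus zero" using additive_structure by blast
 note G = additiveD(1)[OF A] and L = additiveD(3)[OF A] and Z = additiveD(4,5)[OF A]
 have ob: "x \<in> Ob C" "a \<in> Ob C" "b \<in> Ob C" using f g Hom_Ob by blast+
 interpret g: comm_group "\<lparr>carrier = Hom C b x, mult = plus b x, one = zero b x\<rparr>" by (rule G[OF ob(3,1)])
 define k where "k = inv\<^bsub>\<lparr>carrier = Hom C b x, mult = plus b x, one = zero b x\<rparr>\<^esub> h"
 have k: "k \<in> Hom C b x" "plus b x h k = zero b x" using g.inv_closed[of h] g.r_inv[of h] h unfolding k_def by simp_all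
 have gk: "plus b x g k \<in> Hom C b x" using g.m_closed[of g k] g k by simp
 have "plus b x g k \<cdot> f = zero b x \<cdot> f" using L[OF f g k(1)] L[OF f h k(1)] e k(2) by simp
 moreover have "zero_arr C a x (zero b x \<cdot> f)"
 proof -
  obtain z p q where z: "zero_ob C z" "p \<in> Hom C b z" "q \<in> Hom C z x" "zero b x = q \<cdot> p"
   using Z(1)[OF ob(3,1)] unfolding zero_arr_def by blast
  thus ?thesis using Comp_assoc[OF f z(2,3)] Comp_Hom[OF f z(2)] unfolding zero_arr_def by metis
 qed
 ultimately have "plus b x g k = zero b x" using c[OF gk] Z(2) by simp
 hence "plus b x g k = plus b x h k" using k(2) by simp
 thus "g = h" using g.right_cancel[of k g h] g h k(1) by simp
qed

end

lemma abelian_normal: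
 fixes C :: "('o, 'm) cat"
 assumes "abelian_category C" shows "normal_category C"
proof -
 interpret abelian_category C by (rule assms)
 show ?thesis
  by unfold_locales (use zero_ob kernels cokernels mono_kernel epi_cokernel mono_if_cancels_zero epi_if_cancels_zero in blast)+
qed

context ssmc begin

lemma unit_hhom: assumes A [simp]: "hopf A" and B [simp]: "hopf B" shows "hhom A B (eta B ** eps A)"
proof -
 have c: "chom A B (eta B ** eps A)" by (rule unit_chom) simp_all
 have ea: "eps A ** nabla A = eps A || eps A" "eps A ** eta A = ide []" using A unfolding hopf_def bim_def by blast+
 have "(eta B ** eps A) || (eta B ** eps A) = (eta B || ide (und B)) ** (eps A || (eta B ** eps A))" by (simp add: ic)
 hence "nabla B ** ((eta B ** eps A) || (eta B ** eps A)) = (nabla B ** (eta B || ide (und B))) ** (eps A || (eta B ** eps A))"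
  by (simp only: cp_assoc)
 also have "\<dots> = eps A || (eta B ** eps A)" by simp
 also have "\<dots> = eta B ** (eps A || eps A)" using ic[of "ide []" "eps A" "eta B" "eps A"] by simp
 finally have "(eta B ** eps A) ** nabla A = nabla B ** ((eta B ** eps A) || (eta B ** eps A))" using ea(1) by simp
 thus ?thesis using c ea(2) by simp
qed

text \<open>
 Homomorphisms into a commutative monoid are closed under convolution; the identity is tested on two generic elements.
\<close>

lemma cv_hhom: assumes A [simp]: "hopf A" and B [simp]: "hopf B" and f: "hhom A B f" and g: "hhom A B g"
 shows "hhom A B (cv B A f g)"
proof -
 have fh: "hom f (und A) (und B)" "hom g (und A) (und B)" using f g by blast+
 have fc: "chom A B f" "chom A B g" using f g by blast+
 note [simp] = fh
 let ?h = "cv B A f g"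
 have hc: "chom A B ?h" by (rule cv_chom) (use fc in \<open>simp_all\<close>)
 have hh: "hom ?h (und A) (und B)" using hc by blast
 note [simp] = hh
 obtain D x y where D [simp]: "cc D" and Dx: "chom D A x" and Dy: "chom D A y" and id: "pair D x y = ide (und A @ und A)"
  using generic2[OF hopf_cc[OF A] hopf_cc[OF A]] by blast
 have xh: "hom x (und D) (und A)" "hom y (und D) (und A)" using Dx Dy by blast+
 note [simp] = xh
 have nc: "chom D A (cv A D x y)" by (rule cv_chom) (use Dx Dy in simp_all)
 have n: "nabla A = cv A D x y" unfolding cv_def id by simp
 have m: "cv B D (u ** x) (u ** y) = nabla B ** (u || u)" if "hom u (und A) (und B)" for u
 proof -
  have "(u || u) ** (x || y) = (u ** x) || (u ** y)" by (rule ic) (use that in simp_all)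
  hence "pair D (u ** x) (u ** y) = (u || u) ** pair D x y" unfolding pair_def by (metis cp_assoc)
  also have "\<dots> = u || u" unfolding id using that by simp
  finally show ?thesis unfolding cv_def by simp
 qed
 have "?h ** nabla A = cv B D (f ** cv A D x y) (g ** cv A D x y)" unfolding n by (rule cv_comp) (use nc in simp_all)
 also have "f ** cv A D x y = cv B D (f ** x) (f ** y)" by (rule hhom_cv) (use f in simp_all)
 also have "g ** cv A D x y = cv B D (g ** x) (g ** y)" by (rule hhom_cv) (use g in simp_all)
 also have "cv B D (cv B D (f ** x) (f ** y)) (cv B D (g ** x) (g ** y)) = cv B D (cv B D (f ** x) (g ** x)) (cv B D (f ** y) (g ** y))"
  by (simp add: cv_assoc cv_left_comm)
 also have "cv B D (f ** x) (g ** x) = ?h ** x" by (rule cv_comp[symmetric]) (use Dx in simp_all)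
 also have "cv B D (f ** y) (g ** y) = ?h ** y" by (rule cv_comp[symmetric]) (use Dy in simp_all)
 also have "cv B D (?h ** x) (?h ** y) = nabla B ** (?h || ?h)" by (rule m[OF hh])
 finally have 1: "?h ** nabla A = nabla B ** (?h || ?h)" .
 have de: "delta A ** eta A = eta A || eta A" using A unfolding hopf_def bim_def by blast
 have fe: "f ** eta A = eta B" "g ** eta A = eta B" using f g by blast+
 have "?h ** eta A = nabla B ** (f || g) ** (eta A || eta A)" unfolding cv_def pair_def using de by simp
 also have "(f || g) ** (eta A || eta A) = (f ** eta A) || (g ** eta A)" by (rule ic) simp_all
 also have "\<dots> = (eta B || ide (und B)) ** eta B" unfolding fe using pt_cp[of "eta B" "eta B"] by simp
 also have "nabla B ** (eta B || ide (und B)) ** eta B = (nabla B ** (eta B || ide (und B))) ** eta B" by (simp only: cp_assoc)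
 also have "\<dots> = eta B" by simp
 finally have 2: "?h ** eta A = eta B" .
 from hc 1 2 show ?thesis by blast
qed

lemma cv_restrict: assumes A [simp]: "hopf A" "hopf B" "hopf D" and f: "hhom A B f" and g: "hhom A B g" and k: "hhom D A k"
  and z: "g ** k = eta B ** eps D"
 shows "cv B A f g ** k = f ** k"
proof -
 have t: "hom f (und A) (und B)" "hom g (und A) (und B)" "hom k (und D) (und A)" and kc: "chom D A k" using f g k by blast+
 note [simp] = t
 have "cv B A f g ** k = cv B D (f ** k) (g ** k)" by (rule cv_comp) (use kc in simp_all)
 thus ?thesis unfolding z by simp
qed

end

context bssmc begin

lemma kern_of_universal:
 assumes h: "hopf A" "hopf B" "hopf D" and len: "length (und B) = 1" "length (und D) = 1"
  and i: "hhom A B i" and p: "hhom B D p" and pi: "p ** i = eta D ** eps A"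
  and ex: "\<And>X j. [|hopf X; length (und X) = 1; hhom X B j; p ** j = eta D ** eps X|] ==> \<exists>u. hhom X A u \<and> i ** u = j"
  and un: "\<And>u. [|hhom A A u; i ** u = i|] ==> u = ide (und A)"
 shows "kern A B D i p"
 unfolding kern_def
proof (rule bssmc.cok_of_universal[OF bssmc_op], goal_cases)
 case (9 X j)
 have "hopf (du X)" using op_hopf[of "du X"] 9(1) by simp
 moreover have "hhom (du X) B j" using 9(3) by (auto simp: op_pair pair_def)
 ultimately obtain u where u: "hhom (du X) A u" "i ** u = j" using ex[of "du X" j] 9(2,4) by auto
 thus ?case by (intro exI[of _ u]) (auto simp: op_pair pair_def)
next
 case (10 u)
 have "hhom A A u" using 10(1) by (auto simp: op_pair pair_def)
 thus ?case using un 10(2) by simp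
qed (use h len i p pi in \<open>auto simp: op_pair pair_def\<close>)

end

context normal_category begin

lemma kernel_iso:
 assumes k: "is_kernel C a b f k i" and k': "is_kernel C a b f k' i'"
 shows "\<exists>u v. u \<in> Hom C k k' \<and> v \<in> Hom C k' k \<and> v \<cdot> u = Id C k \<and> u \<cdot> v = Id C k'"
proof -
 have i: "i \<in> Hom C k a" "zero_arr C k b (f \<cdot> i)" and i': "i' \<in> Hom C k' a" "zero_arr C k' b (f \<cdot> i')"
  using k k' unfolding is_kernel_def by blast+
 obtain u where u: "u \<in> Hom C k k'" "i' \<cdot> u = i" using kernelE[OF k' i] by blast
 obtain v where v: "v \<in> Hom C k' k" "i \<cdot> v = i'" using kernelE[OF k i'] by blast
 have "i \<cdot> (v \<cdot> u) = i \<cdot> Id C k" using Comp_assoc[OF u(1) v(1) i(1)] u(2) v(2) Comp_Id[OF i(1)] by simp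
 hence 1: "v \<cdot> u = Id C k" using kernel_mono[OF k] Comp_Hom[OF u(1) v(1)] Id_Hom Hom_Ob[OF u(1)] unfolding mono_arr_def by blast
 have "i' \<cdot> (u \<cdot> v) = i' \<cdot> Id C k'" using Comp_assoc[OF v(1) u(1) i'(1)] u(2) v(2) Comp_Id[OF i'(1)] by simp
 hence "u \<cdot> v = Id C k'" using kernel_mono[OF k'] Comp_Hom[OF v(1) u(1)] Id_Hom Hom_Ob[OF u(1)] unfolding mono_arr_def by blast
 with 1 u v show ?thesis by blast
qed

lemma cokernel_iso:
 assumes "is_cokernel C a b f k i" "is_cokernel C a b f k' i'"
 shows "\<exists>u v. u \<in> Hom C k k' \<and> v \<in> Hom C k' k \<and> v \<cdot> u = Id C k \<and> u \<cdot> v = Id C k'"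
 using normal_category.kernel_iso[OF opposite, of b a f k i k' i'] assms by auto

lemma exact_of_epi: assumes "epi_arr C a b e" shows "\<exists>k i. exact k a b i e"
proof -
 have "e \<in> Hom C a b" using assms unfolding epi_arr_def by blast
 then obtain k i where k: "is_kernel C a b e k i" using kernel_ex by blast
 thus ?thesis using epi_cokernel_of_kernel[OF assms k] unfolding exact_def by blast
qed

lemma exact_of_mono: assumes "mono_arr C a b m" shows "\<exists>c p. exact a b c m p"
 using normal_category.exact_of_epi[OF opposite, of b a m] assms
 unfolding exact_def normal_category.exact_def[OF opposite] by auto

lemma iso_mono_epi: assumes u: "u \<in> Hom C a b" "v \<in> Hom C b a" "v \<cdot> u = Id C a"
 shows "mono_arr C a b u" "epi_arr C b a v"
proof -
 show "mono_arr C a b u" unfolding mono_arr_def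
 proof (intro conjI allI ballI impI u(1))
  fix x g h assume g: "g \<in> Hom C x a" "h \<in> Hom C x a" "u \<cdot> g = u \<cdot> h"
  hence "(v \<cdot> u) \<cdot> g = (v \<cdot> u) \<cdot> h" using Comp_assoc[OF g(1) u(1,2)] Comp_assoc[OF g(2) u(1,2)] by simp
  thus "g = h" using u(3) Id_Comp[OF g(1)] Id_Comp[OF g(2)] by simp
 qed
 show "epi_arr C b a v" unfolding epi_arr_def
 proof (intro conjI allI ballI impI u(2))
  fix x g h assume g: "g \<in> Hom C a x" "h \<in> Hom C a x" "g \<cdot> v = h \<cdot> v"
  hence "g \<cdot> (v \<cdot> u) = h \<cdot> (v \<cdot> u)" using Comp_assoc[OF u(1,2) g(1)] Comp_assoc[OF u(1,2) g(2)] by simp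
  thus "g = h" using u(3) Comp_Id[OF g(1)] Comp_Id[OF g(2)] by simp
 qed
qed

end

section \<open>Index of Fredholm homomorphisms\<close>

locale hopf_index = smc C for C :: "('o, 'm) smcat" (structure) +
 assumes he: "has_equalizers C" and hc: "has_coequalizers C" and bi: "bistable C"
  and ab: "abelian_category (Hopf_bc C)"
begin

interpretation S: bssmc "Ob C" sar ssrc strg scp sts side ssw by (rule bssmc_C[OF he hc bi])

abbreviation H :: "(('o, 'm) bimon, 'm) cat" where "H \<equiv> Hopf_bc C"

interpretation N: normal_category H by (rule abelian_normal[OF ab])

definition lf :: "('o, 'm) bimon => ('o, 'm) bimon => 'm => ('o list \<times> 'm \<times> 'o list) option" where
 "lf A B f = Some ([und A], f, [und B])"

lemma H_Ob: "A \<in> Ob H \<longleftrightarrow> S.hopf (sb A)" by (simp add: Hopf_bc_def hopf_sb)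

lemma hopf_bimonoid: "S.hopf (sb A) ==> bimonoid C A" using bim_sb unfolding S.hopf_def by blast

lemma H_Hom: "f \<in> Hom H A B \<longleftrightarrow> S.hopf (sb A) \<and> S.hopf (sb B) \<and> S.hhom (sb A) (sb B) (lf A B f)"
proof (cases "S.hopf (sb A) \<and> S.hopf (sb B)")
 case True
 have "S.hhom (sb A) (sb B) (lf A B f) \<longleftrightarrow> bimonoid_hom C A B f"
  unfolding lf_def by (rule hhom_sb) (use True hopf_bimonoid in blast)+
 moreover have "f \<in> Hom H A B \<longleftrightarrow> bimonoid_hom C A B f" using True by (simp add: Hopf_bc_def hopf_sb)
 ultimately show ?thesis using True by blast
next
 case False
 thus ?thesis by (auto simp: Hopf_bc_def hopf_sb)
qed

lemma H_sel [simp]: "Comp H g f = g oo f" "Id H A = Id C (und A)" by (simp_all add: Hopf_bc_def)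

lemma H_Hom_und: "f \<in> Hom H A B ==> f \<in> Hom C (und A) (und B)"
 by (simp add: Hopf_bc_def bimonoid_hom_def)

lemma H_ObD: "A \<in> Ob H ==> bimonoid C A" using H_Ob hopf_bimonoid by blast

lemma lf_comp: assumes "f \<in> Hom C (und A) (und B)" "g \<in> Hom C (und B) (und D)"
 shows "lf A D (g oo f) = scp (lf B D g) (lf A B f)"
 using assms Hom_obs[OF assms(1)] Hom_obs[OF assms(2)] unfolding lf_def by (simp add: scp_eq)

lemma lf_zero: assumes "A \<in> Ob H" "B \<in> Ob H"
 shows "lf A B (eta B oo eps A) = scp (eta (sb B)) (eps (sb A))"
 using bimD[OF H_ObD[OF assms(1)]] bimD[OF H_ObD[OF assms(2)]] unfolding lf_def by (simp add: scp_eq Unit_Ob)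

lemma zero_hom: "A \<in> Ob H ==> B \<in> Ob H ==> eta B oo eps A \<in> Hom H A B"
 unfolding H_Hom using lf_zero S.unit_hhom H_Ob by metis

text \<open>
 The zero arrow is \<open>\<eta> \<epsilon>\<close>, because on a zero object the identity is the only endomorphism.
\<close>

lemma H_zero: "zero_arr H A B f \<longleftrightarrow> A \<in> Ob H \<and> B \<in> Ob H \<and> f = eta B oo eps A"
proof
 assume "zero_arr H A B f"
 then obtain z g h where z: "zero_ob H z" "g \<in> Hom H A z" "h \<in> Hom H z B" "f = h oo g" unfolding zero_arr_def by auto
 have ob: "A \<in> Ob H" "B \<in> Ob H" "z \<in> Ob H" using z N.Hom_Ob by blast+
 note b = bimD[OF H_ObD[OF ob(1)]] bimD[OF H_ObD[OF ob(2)]] bimD[OF H_ObD[OF ob(3)]]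
 have g: "g \<in> Hom C (und A) (und z)" "eps z oo g = eps A" and h: "h \<in> Hom C (und z) (und B)" "h oo eta z = eta B"
  using z(2,3) by (simp_all add: Hopf_bc_def bimonoid_hom_def)
 have "\<exists>!w. w \<in> Hom H z z" using z(1) ob(3) unfolding zero_ob_def by blast
 moreover have "Id C (und z) \<in> Hom H z z" using N.Id_Hom[OF ob(3)] by simp
 ultimately have "Id C (und z) = eta z oo eps z" using zero_hom[OF ob(3,3)] by blast
 hence "g = (eta z oo eps z) oo g" using Id_Comp[OF g(1)] by simp
 also have "\<dots> = eta z oo eps A" using Comp_assoc[OF g(1) b(15) b(13)] g(2) by simp
 finally have "f = (h oo eta z) oo eps A" using Comp_assoc[OF b(5) b(13) h(1)] z(4) by simp
 thus "A \<in> Ob H \<and> B \<in> Ob H \<and> f = eta B oo eps A" using h ob by simp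
next
 assume a: "A \<in> Ob H \<and> B \<in> Ob H \<and> f = eta B oo eps A"
 then obtain g where "zero_arr H A B g" using N.zero_ex by blast
 then obtain z where z: "zero_ob H z" unfolding zero_arr_def by blast
 hence ob: "z \<in> Ob H" unfolding zero_ob_def by blast
 note b = bimD[OF H_ObD[of A]] bimD[OF H_ObD[of B]] bimD[OF H_ObD[OF ob]]
 have ee: "eps z oo eta z = Id C \<I>" using H_ObD[OF ob] unfolding bimonoid_def by blast
 have "(eta B oo eps z) oo (eta z oo eps A) = eta B oo (eps z oo (eta z oo eps A))"
  by (rule Comp_assoc[of _ "und A" "und z" _ \<I>]) (use a b Comp_Hom in blast)+
 also have "eps z oo (eta z oo eps A) = eps A" using Comp_assoc[OF b(5) b(13,15)] a ee Id_Comp[OF b(5)] by simp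
 finally have "f = (eta B oo eps z) oo (eta z oo eps A)" using a by simp
 moreover have "eta B oo eps z \<in> Hom H z B" "eta z oo eps A \<in> Hom H A z" using a ob zero_hom by blast+
 ultimately show "zero_arr H A B f" using z unfolding zero_arr_def by auto
qed

lemma unsb_hopf: assumes "S.hopf X" "length (und X) = 1" shows "X = sb (unsb X)" "unsb X \<in> Ob H"
 using assms sb_unsb[of X] unfolding H_Ob S.hopf_def by auto

lemma hhom_lf: assumes "S.hhom (sb A) (sb B) j" shows "j = lf A B (sm j)"
proof -
 have "sar j" "ssrc j = [und A]" "strg j = [und B]" using assms sb_sel(1) by metis+
 thus ?thesis unfolding lf_def by (rule sbind)
qed

lemma lf_inj: "lf A B f = lf A B g \<longleftrightarrow> f = g" by (simp add: lf_def)

lemma cok_sb: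
 assumes c: "is_cokernel H A B i D p"
 shows "S.cok (sb A) (sb B) (sb D) (lf A B i) (lf B D p)"
proof -
 have t: "i \<in> Hom H A B" "p \<in> Hom H B D" "zero_arr H A D (p oo i)"
  and u: "\<And>X j. j \<in> Hom H B X ==> zero_arr H A X (j oo i) ==> \<exists>!u. u \<in> Hom H D X \<and> u oo p = j"
  using c unfolding is_cokernel_def by auto
 have ob: "A \<in> Ob H" "B \<in> Ob H" "D \<in> Ob H" using t N.Hom_Ob by blast+
 have ic: "i \<in> Hom C (und A) (und B)" "p \<in> Hom C (und B) (und D)" using t H_Hom_und by blast+
 show ?thesis
 proof (rule S.cok_of_universal)
  show "S.hopf (sb A)" "S.hopf (sb B)" "S.hopf (sb D)" "length (und (sb A)) = 1" "length (und (sb B)) = 1" using ob H_Ob by simp_all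
  show "S.hhom (sb A) (sb B) (lf A B i)" "S.hhom (sb B) (sb D) (lf B D p)" using t unfolding H_Hom by blast+
  show "scp (lf B D p) (lf A B i) = scp (eta (sb D)) (eps (sb A))"
   using t(3) lf_comp[OF ic] lf_zero[OF ob(1,3)] unfolding H_zero by simp
 next
  fix X j assume X: "S.hopf X" "length (und X) = 1" "S.hhom (sb B) X j" "scp j (lf A B i) = scp (eta X) (eps (sb A))"
  define Y where "Y = unsb X"
  have Y: "X = sb Y" "Y \<in> Ob H" using unsb_hopf[OF X(1,2)] by (simp_all add: Y_def)
  have jl: "j = lf B Y (sm j)" using X(3) hhom_lf unfolding Y(1) by blast
  have jH: "sm j \<in> Hom H B Y" unfolding H_Hom using X(1,3) jl ob H_Ob unfolding Y(1) by metis
  have "lf A Y (sm j oo i) = lf A Y (eta Y oo eps A)"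
   using lf_comp[OF ic(1) H_Hom_und[OF jH]] jl X(4) lf_zero[OF ob(1) Y(2)] unfolding Y(1) by simp
  hence "zero_arr H A Y (sm j oo i)" unfolding H_zero lf_inj using ob Y by simp
  then obtain w where w: "w \<in> Hom H D Y" "w oo p = sm j" using u[OF jH] by blast
  have "scp (lf D Y w) (lf B D p) = j" using lf_comp[OF ic(2) H_Hom_und[OF w(1)]] w(2) jl by simp
  thus "\<exists>u. S.hhom (sb D) X u \<and> scp u (lf B D p) = j" using w(1) unfolding H_Hom Y(1) by blast
 next
  fix w assume w: "S.hhom (sb D) (sb D) w" "scp w (lf B D p) = lf B D p"
  have wl: "w = lf D D (sm w)" using hhom_lf[OF w(1)] .
  have wH: "sm w \<in> Hom H D D" unfolding H_Hom using w wl ob H_Ob by metis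
  have "sm w oo p = p" using lf_comp[OF ic(2) H_Hom_und[OF wH]] w(2) wl lf_inj by metis
  moreover have "Id C (und D) oo p = p" by (rule Id_Comp[OF ic(2)])
  ultimately have "sm w = Id C (und D)" using u[OF t(2,3)] wH N.Id_Hom[OF ob(3)] by auto
  thus "w = side (und (sb D))" using wl by (simp add: lf_def side_def)
 qed
qed

lemma kern_sb:
 assumes c: "is_kernel H B D p A i"
 shows "S.kern (sb A) (sb B) (sb D) (lf A B i) (lf B D p)"
proof -
 have t: "i \<in> Hom H A B" "p \<in> Hom H B D" "zero_arr H A D (p oo i)"
  and u: "\<And>X j. j \<in> Hom H X B ==> zero_arr H X D (p oo j) ==> \<exists>!u. u \<in> Hom H X A \<and> i oo u = j"
  using c unfolding is_kernel_def by auto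
 have ob: "A \<in> Ob H" "B \<in> Ob H" "D \<in> Ob H" using t N.Hom_Ob by blast+
 have ic: "i \<in> Hom C (und A) (und B)" "p \<in> Hom C (und B) (und D)" using t H_Hom_und by blast+
 show ?thesis
 proof (rule S.kern_of_universal)
  show "S.hopf (sb A)" "S.hopf (sb B)" "S.hopf (sb D)" "length (und (sb B)) = 1" "length (und (sb D)) = 1" using ob H_Ob by simp_all
  show "S.hhom (sb A) (sb B) (lf A B i)" "S.hhom (sb B) (sb D) (lf B D p)" using t unfolding H_Hom by blast+
  show "scp (lf B D p) (lf A B i) = scp (eta (sb D)) (eps (sb A))"
   using t(3) lf_comp[OF ic] lf_zero[OF ob(1,3)] unfolding H_zero by simp
 next
  fix X j assume X: "S.hopf X" "length (und X) = 1" "S.hhom X (sb B) j" "scp (lf B D p) j = scp (eta (sb D)) (eps X)"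
  define Y where "Y = unsb X"
  have Y: "X = sb Y" "Y \<in> Ob H" using unsb_hopf[OF X(1,2)] by (simp_all add: Y_def)
  have jl: "j = lf Y B (sm j)" using X(3) hhom_lf unfolding Y(1) by blast
  have jH: "sm j \<in> Hom H Y B" unfolding H_Hom using X(1,3) jl ob H_Ob unfolding Y(1) by metis
  have "lf Y D (p oo sm j) = lf Y D (eta D oo eps Y)"
   using lf_comp[OF H_Hom_und[OF jH] ic(2)] jl X(4) lf_zero[OF Y(2) ob(3)] unfolding Y(1) by simp
  hence "zero_arr H Y D (p oo sm j)" unfolding H_zero lf_inj using ob Y by simp
  then obtain w where w: "w \<in> Hom H Y A" "i oo w = sm j" using u[OF jH] by blast
  have "scp (lf A B i) (lf Y A w) = j" using lf_comp[OF H_Hom_und[OF w(1)] ic(1)] w(2) jl by simp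
  thus "\<exists>u. S.hhom X (sb A) u \<and> scp (lf A B i) u = j" using w(1) unfolding H_Hom Y(1) by blast
 next
  fix w assume w: "S.hhom (sb A) (sb A) w" "scp (lf A B i) w = lf A B i"
  have wl: "w = lf A A (sm w)" using hhom_lf[OF w(1)] .
  have wH: "sm w \<in> Hom H A A" unfolding H_Hom using w wl ob H_Ob by metis
  have "i oo sm w = i" using lf_comp[OF H_Hom_und[OF wH] ic(1)] w(2) wl lf_inj by metis
  moreover have "i oo Id C (und A) = i" by (rule Comp_Id[OF ic(1)])
  ultimately have "sm w = Id C (und A)" using u[OF t(1,3)] wH N.Id_Hom[OF ob(1)] by auto
  thus "w = side (und (sb A))" using wl by (simp add: lf_def side_def)
 qed
qed

lemma exact_ses: "N.exact A B D i p ==> S.ses (sb A) (sb B) (sb D) (lf A B i) (lf B D p)"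
 unfolding N.exact_def S.ses_def using cok_sb kern_sb by blast

end

context normal_category begin

lemma cokernelE: assumes "is_cokernel C a b f c p" "j \<in> Hom C b x" "zero_arr C a x (j \<cdot> f)"
 obtains u where "u \<in> Hom C c x" "u \<cdot> p = j"
 using assms unfolding is_cokernel_def by blast

lemma image_kernel:
 assumes c: "is_cokernel C a b f c p" and c': "is_cokernel C a b f c' p'"
 shows "is_kernel C b c p k i \<longleftrightarrow> is_kernel C b c' p' k i"
proof -
 have p: "p \<in> Hom C b c" "zero_arr C a c (p \<cdot> f)" "p' \<in> Hom C b c'" "zero_arr C a c' (p' \<cdot> f)"
  using c c' unfolding is_cokernel_def by blast+
 obtain w where w: "w \<in> Hom C c c'" "w \<cdot> p = p'" using cokernelE[OF c p(3,4)] by blast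
 obtain w' where w': "w' \<in> Hom C c' c" "w' \<cdot> p' = p" using cokernelE[OF c' p(1,2)] by blast
 have z: "zero_arr C x c (p \<cdot> j) \<longleftrightarrow> zero_arr C x c' (p' \<cdot> j)" if j: "j \<in> Hom C x b" for x j
  using zero_left[OF _ w(1)] zero_left[OF _ w'(1)] Comp_assoc[OF j p(1) w(1)] Comp_assoc[OF j p(3) w'(1)] w(2) w'(2) by metis
 show ?thesis unfolding is_kernel_def using p z by blast
qed

end

context hopf_index begin

interpretation S: bssmc "Ob C" sar ssrc strg scp sts side ssw by (rule bssmc_C[OF he hc bi])
interpretation N: normal_category H by (rule abelian_normal[OF ab])

abbreviation E where "E \<equiv> End_Unit C"
abbreviation V where "V \<equiv> vol_inv C"
definition sc :: "'m => ('o list \<times> 'm \<times> 'o list) option" where "sc x = Some ([], x, [])"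

lemma E_sel [simp]: "carrier E = Hom C \<I> \<I>" "x \<otimes>\<^bsub>E\<^esub> y = x oo y" "\<one>\<^bsub>E\<^esub> = Id C \<I>"
 by (simp_all add: End_Unit_def)

lemma sc_hom: "sar f \<and> ssrc f = [] \<and> strg f = [] \<longleftrightarrow> (\<exists>x \<in> Hom C \<I> \<I>. f = sc x)"
 unfolding sc_def using sbind[of f "[]" "[]"] sm_Hom[of f "[]" "[]"] by auto

lemma sc_comp: "x \<in> Hom C \<I> \<I> ==> y \<in> Hom C \<I> \<I> ==> scp (sc x) (sc y) = sc (x oo y)"
 unfolding sc_def by (simp add: scp_eq)

lemma sc_inj: "sc x = sc y \<longleftrightarrow> x = y" by (simp add: sc_def)
lemma sc_one: "side [] = sc (Id C \<I>)" by (simp add: sc_def side_def)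

lemma E_comm: assumes "x \<in> Hom C \<I> \<I>" "y \<in> Hom C \<I> \<I>" shows "x oo y = y oo x"
proof -
 have "scp (sc x) (sc y) = scp (sc y) (sc x)" by (rule S.scalar_comm) (use assms sc_hom in blast)+
 thus ?thesis using assms by (simp add: sc_comp sc_inj)
qed

lemma E_comm_monoid: "comm_monoid E"
proof (rule comm_monoidI, unfold E_sel, goal_cases)
 case (1 x y) thus ?case using Comp_Hom by blast
next
 case 2 show ?case by (rule Id_Hom[OF Unit_Ob])
next
 case (3 x y z) thus ?case using Comp_assoc by blast
next
 case (4 x) thus ?case using Id_Comp by blast
next
 case (5 x y) thus ?case by (rule E_comm)
qed

interpretation E: comm_monoid E by (rule E_comm_monoid)

text \<open>The objects that admit both normalized integrals and have an invertible inverse volume.\<close>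

definition good :: "('o, 'm) bimon => bool" where
 "good A \<longleftrightarrow> A \<in> Ob H \<and> bismall C A \<and> V A \<in> Units E"

lemma bismall_vol:
 assumes A: "A \<in> Ob H" and n: "S.nint (sb A) \<sigma>" and l: "S.ncoint (sb A) l"
 shows "bismall C A" "V A \<in> Hom C \<I> \<I>" "scp l \<sigma> = sc (V A)"
proof -
 have h: "S.hopf (sb A)" using A H_Ob by blast
 show "bismall C A" using bismall_iff[OF he h] n l by blast
 note e = nintE[OF h n] ncointE[OF h l]
 have t: "normalized_integral C A \<in> Hom C \<I> (und A)" "normalized_cointegral C A \<in> Hom C (und A) \<I>"
  using n l nint_sb[OF h] ncoint_sb[OF h] e unfolding integral_def cointegral_def by metis+
 have a: "und A \<in> Ob C" using t Hom_obs by blast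
 show v: "V A \<in> Hom C \<I> \<I>" unfolding vol_inv_def by (rule Comp_Hom[OF t])
 show "scp l \<sigma> = sc (V A)" unfolding e(1) unfolding e(2) sc_def vol_inv_def using t a by (simp add: scp_eq)
qed

lemma goodE: assumes "good A"
 obtains \<sigma> l v where "S.nint (sb A) \<sigma>" "S.ncoint (sb A) l" "scp l \<sigma> = sc (V A)" "V A \<in> Hom C \<I> \<I>"
  "v \<in> Hom C \<I> \<I>" "V A oo v = Id C \<I>" "v oo V A = Id C \<I>"
proof -
 have A: "A \<in> Ob H" "bismall C A" "V A \<in> Units E" using assms unfolding good_def by blast+
 obtain \<sigma> l where n: "S.nint (sb A) \<sigma>" "S.ncoint (sb A) l" using bismall_iff[OF he] A H_Ob by blast
 moreover obtain v where "v \<in> Hom C \<I> \<I>" "v oo V A = Id C \<I>" "V A oo v = Id C \<I>" using A(3) unfolding Units_def by auto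
 ultimately show ?thesis using that bismall_vol[OF A(1) n] by blast
qed

lemma goodI:
 assumes "A \<in> Ob H" "S.nint (sb A) \<sigma>" "S.ncoint (sb A) l" "v \<in> Hom C \<I> \<I>" "V A oo v = Id C \<I>"
 shows "good A"
 using assms bismall_vol[OF assms(1-3)] E_comm unfolding good_def Units_def by auto

lemma exactD: assumes "N.exact A B D i p" shows "A \<in> Ob H" "B \<in> Ob H" "D \<in> Ob H"
 using assms N.Hom_Ob unfolding N.exact_def is_kernel_def by blast+

lemma good_extension:
 assumes ex: "N.exact A B D i p" and A: "good A" and D: "good D"
 shows "good B" "V B = V A oo V D"
proof -
 obtain \<phi> k a where a: "S.nint (sb A) \<phi>" "S.ncoint (sb A) k" "scp k \<phi> = sc (V A)" "V A \<in> Hom C \<I> \<I>" "a \<in> Hom C \<I> \<I>" "V A oo a = Id C \<I>"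
  using goodE[OF A] by metis
 obtain \<psi> l d where d: "S.nint (sb D) \<psi>" "S.ncoint (sb D) l" "scp l \<psi> = sc (V D)" "V D \<in> Hom C \<I> \<I>" "d \<in> Hom C \<I> \<I>" "V D oo d = Id C \<I>"
  using goodE[OF D] by metis
 obtain \<Phi> L where n: "S.nint (sb B) \<Phi>" "S.ncoint (sb B) L" "scp L \<Phi> = scp (scp k \<phi>) (scp l \<psi>)"
  using S.extension[OF exact_ses[OF ex] a(1,2) d(1,2)] by blast
 have B: "B \<in> Ob H" by (rule exactD(2)[OF ex])
 show v: "V B = V A oo V D" using bismall_vol(3)[OF B n(1,2)] n(3) a d by (simp add: sc_comp sc_inj)
 have "V B oo (d oo a) = Id C \<I>"
 proof -
  have "(V A oo V D) oo (d oo a) = V A oo (V D oo (d oo a))" by (rule Comp_assoc[OF Comp_Hom[OF a(5) d(5)] d(4) a(4)])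
  also have "V D oo (d oo a) = (V D oo d) oo a" by (rule Comp_assoc[OF a(5) d(5) d(4), symmetric])
  also have "\<dots> = a" unfolding d(6) by (rule Id_Comp[OF a(5)])
  finally show ?thesis unfolding v a(6) .
 qed
 thus "good B" by (rule goodI[OF B n(1,2) Comp_Hom[OF a(5) d(5)]])
qed

text \<open>
 As a quotient of \<open>A\<close>, the object \<open>I\<close> inherits a normalized integral, so its volume is defined; it is the scalar that relates the volumes of \<open>K\<close> and \<open>A\<close>.
\<close>

lemma good_kernel:
 assumes ex: "N.exact K A I i p" and A: "good A" and c: "S.ncoint (sb I) \<phi>"
 shows "good K" "good I" "V K oo V I = V A"
proof -
 obtain \<Lambda> l v where a: "S.nint (sb A) \<Lambda>" "S.ncoint (sb A) l" "scp l \<Lambda> = sc (V A)" "V A \<in> Hom C \<I> \<I>" "v \<in> Hom C \<I> \<I>" "V A oo v = Id C \<I>"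
  using goodE[OF A] by metis
 note s = exact_ses[OF ex]
 have ob: "K \<in> Ob H" "I \<in> Ob H" using exactD[OF ex] by blast+
 have vs: "sar (sc v) \<and> ssrc (sc v) = [] \<and> strg (sc v) = []" using sc_hom a(5) by blast
 have vv: "scp (scp l \<Lambda>) (sc v) = side []" using a by (simp add: sc_comp sc_one)
 obtain \<Phi> k w where k: "S.nint (sb K) \<Phi>" "S.ncoint (sb K) k" "scp (scp k \<Phi>) (scp \<phi> (scp (lf A I p) \<Lambda>)) = scp l \<Lambda>"
  "sar w \<and> ssrc w = [] \<and> strg w = []" "scp (scp \<phi> (scp (lf A I p) \<Lambda>)) w = side []"
  using S.kernel_good[OF s _ _ a(1,2) vs vv c] by auto
 have nI: "S.nint (sb I) (scp (lf A I p) \<Lambda>)" by (rule S.nint_quotient[OF _ a(1)]) (use s[unfolded S.ses_def] in blast)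
 note VI = bismall_vol[OF ob(2) nI c] and VK = bismall_vol[OF ob(1) k(1,2)]
 show kv: "V K oo V I = V A" using k(3) VI VK a(3) by (simp add: sc_comp sc_inj)
 obtain w' where w: "w' \<in> Hom C \<I> \<I>" "w = sc w'" using k(4) sc_hom by blast
 have "V I oo w' = Id C \<I>" using k(5) w VI by (simp add: sc_comp sc_one sc_inj)
 thus "good I" using goodI[OF ob(2) nI c w(1)] by blast
 have "V K oo (V I oo v) = Id C \<I>" using kv a(6) Comp_assoc[OF a(5) VI(2) VK(2)] by simp
 thus "good K" by (rule goodI[OF ob(1) k(1,2) Comp_Hom[OF a(5) VI(2)]])
qed

lemma good_cokernel:
 assumes ex: "N.exact I A Q i p" and A: "good A" and c: "S.nint (sb I) \<psi>"
 shows "good I" "good Q" "V I oo V Q = V A"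
proof -
 obtain \<Lambda> l v where a: "S.nint (sb A) \<Lambda>" "S.ncoint (sb A) l" "scp l \<Lambda> = sc (V A)" "V A \<in> Hom C \<I> \<I>" "v \<in> Hom C \<I> \<I>" "V A oo v = Id C \<I>"
  "v oo V A = Id C \<I>"
  using goodE[OF A] by metis
 note s = exact_ses[OF ex]
 have ob: "I \<in> Ob H" "Q \<in> Ob H" using exactD[OF ex] by blast+
 have vs: "sar (sc v) \<and> strg (sc v) = [] \<and> ssrc (sc v) = []" using sc_hom a(5) by blast
 have vv: "scp (sc v) (scp l \<Lambda>) = side []" using a by (simp add: sc_comp sc_one)
 have on: "ssmc.ses (Ob C) sar strg ssrc (\<lambda>g f. scp f g) sts side (\<lambda>x y. ssw y x) (S.du (sb Q)) (S.du (sb A)) (S.du (sb I)) (lf A Q p) (lf I A i)"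
  "ssmc.nint sar strg ssrc (\<lambda>g f. scp f g) sts side (S.du (sb A)) l"
  "ssmc.ncoint sar strg ssrc (\<lambda>g f. scp f g) sts side (S.du (sb A)) \<Lambda>"
  "ssmc.ncoint sar strg ssrc (\<lambda>g f. scp f g) sts side (S.du (sb I)) \<psi>" using s a c by simp_all
 have len: "length (und (S.du (sb Q))) = 1" "length (und (S.du (sb A))) = 1" by simp_all
 obtain \<Phi> k w where k: "S.ncoint (sb Q) \<Phi>" "S.nint (sb Q) k" "scp (scp (scp l (lf I A i)) \<psi>) (scp \<Phi> k) = scp l \<Lambda>"
  "sar w \<and> strg w = [] \<and> ssrc w = []" "scp w (scp (scp l (lf I A i)) \<psi>) = side []"
  using bssmc.kernel_good[OF S.bssmc_op on(1) len on(2,3) vs vv on(4)] unfolding S.op_nint S.op_ncoint by blast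
 have nI: "S.ncoint (sb I) (scp l (lf I A i))" by (rule S.ncoint_sub[OF s a(2)])
 note VI = bismall_vol[OF ob(1) c nI] and VQ = bismall_vol[OF ob(2) k(2,1)]
 show kv: "V I oo V Q = V A" using k(3)[unfolded VI(3) VQ(3) a(3)] VI(2) VQ(2) by (simp add: sc_comp sc_inj)
 obtain w' where w: "w' \<in> Hom C \<I> \<I>" "w = sc w'" using k(4) sc_hom by blast
 have "w' oo V I = Id C \<I>" using k(5)[unfolded VI(3) w(2)] w(1) VI(2) by (simp add: sc_comp sc_one sc_inj)
 thus "good I" using goodI[OF ob(1) c nI w(1)] E_comm[OF w(1) VI(2)] by simp
 have "V Q oo (V I oo v) = (V I oo V Q) oo v" using Comp_assoc[OF a(5) VI(2) VQ(2)] E_comm[OF VI(2) VQ(2)] by simp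
 hence "V Q oo (V I oo v) = Id C \<I>" unfolding kv a(6) .
 thus "good Q" by (rule goodI[OF ob(2) k(2,1) Comp_Hom[OF a(5) VI(2)]])
qed

text \<open>
 The image \<open>J\<close> inherits the integral of \<open>A\<close> and the cointegral of \<open>B\<close>, so both of the previous lemmas apply to it.
\<close>

lemma good_middle:
 assumes 1: "N.exact K A J k e" and 2: "N.exact J B Q m c" and A: "good A" and B: "good B"
 shows "good K" "good J" "good Q" "V K oo V J = V A" "V J oo V Q = V B"
proof -
 obtain \<Lambda> l where a: "S.nint (sb A) \<Lambda>" "S.ncoint (sb B) l" using goodE[OF A] goodE[OF B] by metis
 have n: "S.nint (sb J) (scp (lf A J e) \<Lambda>)" by (rule S.nint_quotient[OF _ a(1)]) (use exact_ses[OF 1, unfolded S.ses_def] in blast)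
 have l: "S.ncoint (sb J) (scp l (lf J B m))" by (rule S.ncoint_sub[OF exact_ses[OF 2] a(2)])
 show "good K" "good J" "V K oo V J = V A" using good_kernel[OF 1 A l] by blast+
 show "good Q" "V J oo V Q = V B" using good_cokernel[OF 2 B n] by blast+
qed

lemma zero_good: assumes A: "A \<in> Ob H" and z: "Id C (und A) = eta A oo eps A"
 shows "good A" "V A = Id C \<I>"
proof -
 have h: "S.hopf (sb A)" using A H_Ob by blast
 have zz: "side [und A] = scp (eta (sb A)) (eps (sb A))" using z lf_zero[OF A A] by (simp add: lf_def side_def)
 have b: "S.bim (sb A)" using h unfolding S.hopf_def by blast
 have n: "S.nint (sb A) (eta (sb A))" using b unfolding S.nint_def S.int_def S.bim_def zz[symmetric] by (simp add: zz)
 have l: "S.ncoint (sb A) (eps (sb A))" using b unfolding S.ncoint_def S.coint_def S.bim_def zz[symmetric] by (simp add: zz)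
 have "sc (V A) = sc (Id C \<I>)" using bismall_vol(3)[OF A n l] b unfolding S.bim_def sc_one by metis
 thus v: "V A = Id C \<I>" by (simp add: sc_inj)
 show "good A" by (rule goodI[OF A n l Id_Hom[OF Unit_Ob]]) (simp add: v Id_Comp[OF Id_Hom[OF Unit_Ob]])
qed

lemma zero_goodI: assumes "zero_arr H A A (Id C (und A))" shows "good A" "V A = Id C \<I>"
 using zero_good assms unfolding H_zero by blast+

lemma mono_kernel_zero: assumes "mono_arr H A B m" "is_kernel H A B m K i" shows "good K" "V K = Id C \<I>"
proof -
 have i: "i \<in> Hom H K A" "zero_arr H K B (m oo i)" using assms(2) unfolding is_kernel_def by auto
 have "zero_arr H K A i" using N.mono_zero[OF assms(1) i(1)] i(2) by simp
 hence "zero_arr H K A (i oo Id C (und K))" using N.Comp_Id[OF i(1)] by simp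
 hence "zero_arr H K K (Id C (und K))" using N.mono_zero[OF N.kernel_mono[OF assms(2)], of "Id C (und K)" K] N.Id_Hom N.Hom_Ob[OF i(1)] by simp
 thus "good K" "V K = Id C \<I>" by (rule zero_goodI)+
qed

lemma epi_cokernel_zero: assumes "epi_arr H A B e" "is_cokernel H A B e Q p" shows "good Q" "V Q = Id C \<I>"
proof -
 have p: "p \<in> Hom H B Q" "zero_arr H A Q (p oo e)" using assms(2) unfolding is_cokernel_def by auto
 have eh: "e \<in> Hom H A B" using assms(1) unfolding epi_arr_def by blast
 have ob: "Q \<in> Ob H" "B \<in> Ob H" using N.Hom_Ob[OF p(1)] by blast+
 obtain o' where o': "zero_arr H B Q o'" using N.zero_ex[OF ob(2,1)] by blast
 have "p oo e = o' oo e" using N.zero_unique[OF p(2)] N.zero_right[OF o' eh] by simp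
 hence po: "p = o'" using assms(1) p(1) N.zero_Hom[OF o'] unfolding epi_arr_def by simp
 have u: "\<exists>!u. u \<in> Hom H Q Q \<and> u oo p = p" using assms(2) p unfolding is_cokernel_def by auto
 have idp: "Id C (und Q) \<in> Hom H Q Q" "Id C (und Q) oo p = p" using N.Id_Hom[OF ob(1)] N.Id_Comp[OF p(1)] by simp_all
 obtain z where z: "zero_arr H Q Q z" using N.zero_ex[OF ob(1,1)] by blast
 have "zero_arr H B Q (z oo p)" using N.zero_right[OF z p(1)] by simp
 hence "z oo p = p" using N.zero_unique[OF _ o'] po by blast
 hence "Id C (und Q) = z" using u idp N.zero_Hom[OF z] by blast
 thus "good Q" "V Q = Id C \<I>" using zero_goodI z by simp_all
qed

lemma good_iso:
 assumes u: "u \<in> Hom H A B" "v \<in> Hom H B A" "v oo u = Id C (und A)" "u oo v = Id C (und B)" and A: "good A"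
 shows "good B" "V B = V A"
proof -
 have e: "mono_arr H A B u" "epi_arr H A B u" "mono_arr H B A v"
  using N.iso_mono_epi[OF u(1,2)] N.iso_mono_epi[OF u(2,1)] u(3,4) by simp_all
 obtain K i where 1: "N.exact K A B i u" using N.exact_of_epi[OF e(2)] by blast
 obtain Q p where 2: "N.exact B A Q v p" using N.exact_of_mono[OF e(3)] by blast
 have K: "V K = Id C \<I>" using mono_kernel_zero(2)[OF e(1)] 1 unfolding N.exact_def by blast
 note m = good_middle[OF 1 2 A A]
 show "good B" by (rule m(2))
 have "V B \<in> Hom C \<I> \<I>" using m(2) unfolding good_def Units_def by auto
 thus "V B = V A" using m(4) K Id_Comp by metis
qed

lemma good_carrier: "good A ==> V A \<in> Hom C \<I> \<I>" "good A ==> V A \<in> Units E"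
 unfolding good_def Units_def by auto

text \<open>
 Kernels and cokernels are unique up to isomorphism, and good objects with their volumes are invariant under isomorphism; any choice of them computes the index.
\<close>

lemma fredholm_iff:
 assumes k: "is_kernel H A B f K i" and c: "is_cokernel H A B f Q p"
 shows "fredholm C A B f \<longleftrightarrow> good K \<and> good Q"
  and "good K ==> good Q ==> Ind C A B f = V Q oo inv\<^bsub>E\<^esub> (V K)"
proof -
 have f: "f \<in> Hom H A B" using k unfolding is_kernel_def by blast
 obtain i' where k': "is_kernel H A B f (Ker H A B f) i'" unfolding Ker_def using someI_ex[of "\<lambda>k. \<exists>i. is_kernel H A B f k i"] k by blast
 obtain p' where c': "is_cokernel H A B f (Cok H A B f) p'" unfolding Cok_def using someI_ex[of "\<lambda>c. \<exists>p. is_cokernel H A B f c p"] c by blast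
 have obs: "Ker H A B f \<in> Ob H" "Cok H A B f \<in> Ob H"
  using k' c' N.Hom_Ob unfolding is_kernel_def is_cokernel_def by blast+
 have fr: "fredholm C A B f \<longleftrightarrow> good (Ker H A B f) \<and> good (Cok H A B f)"
  unfolding fredholm_def good_def using f obs by auto
 have K: "good (Ker H A B f) \<longleftrightarrow> good K" "good K ==> V (Ker H A B f) = V K"
  using N.kernel_iso[OF k k'] good_iso H_sel by metis+
 have Q: "good (Cok H A B f) \<longleftrightarrow> good Q" "good Q ==> V (Cok H A B f) = V Q"
  using N.cokernel_iso[OF c c'] good_iso H_sel by metis+
 show "fredholm C A B f \<longleftrightarrow> good K \<and> good Q" using fr K Q by blast
 show "good K ==> good Q ==> Ind C A B f = V Q oo inv\<^bsub>E\<^esub> (V K)" unfolding Ind_def using K Q by simp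
qed

lemma fredholmE:
 assumes "fredholm C A B f"
 obtains K i Q p where "f \<in> Hom H A B" "is_kernel H A B f K i" "is_cokernel H A B f Q p" "good K" "good Q"
  "Ind C A B f = V Q oo inv\<^bsub>E\<^esub> (V K)"
proof -
 have f: "f \<in> Hom H A B" using assms unfolding fredholm_def by blast
 obtain K i Q p where k: "is_kernel H A B f K i" "is_cokernel H A B f Q p" using N.kernel_ex[OF f] N.cokernel_ex[OF f] by blast
 show ?thesis using that[OF f k] fredholm_iff[OF k] assms by blast
qed

lemma Ind_char:
 assumes "good K" "good Q"
 shows "x = V Q oo inv\<^bsub>E\<^esub> (V K) \<longleftrightarrow> x \<in> Hom C \<I> \<I> \<and> x oo V K = V Q"
proof -
 note K = good_carrier[OF assms(1)] and Q = good_carrier[OF assms(2)]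
 note t = K(1) Q(1) E.Units_inv_closed[OF K(2), simplified] E.Units_r_inv[OF K(2), simplified] E.Units_l_inv[OF K(2), simplified]
 show ?thesis
 proof
  assume x: "x = V Q oo inv\<^bsub>E\<^esub> (V K)"
  have "x oo V K = V Q" unfolding x using Comp_assoc[OF t(1,3,2)] t(5) Comp_Id[OF t(2)] by simp
  thus "x \<in> Hom C \<I> \<I> \<and> x oo V K = V Q" unfolding x using Comp_Hom[OF t(3,2)] by simp
 next
  assume x: "x \<in> Hom C \<I> \<I> \<and> x oo V K = V Q"
  thus "x = V Q oo inv\<^bsub>E\<^esub> (V K)" using Comp_assoc[OF t(3,1), of x \<I>] t(4) Comp_Id[of x \<I> \<I>] by simp
 qed
qed

text \<open>
 The middle terms \<open>X\<close>, \<open>I\<close>, \<open>Y\<close> cancel in the alternating product of volumes.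
\<close>

lemma fredholm_comp:
 assumes f: "fredholm C A B f" and g: "fredholm C B D g"
 shows "fredholm C A D (g oo f)" "Ind C A D (g oo f) = Ind C B D g oo Ind C A B f"
proof -
 obtain Kf kf Cf cf where F: "f \<in> Hom H A B" "is_kernel H A B f Kf kf" "is_cokernel H A B f Cf cf" "good Kf" "good Cf"
  "Ind C A B f = V Cf oo inv\<^bsub>E\<^esub> (V Kf)" using fredholmE[OF f] by metis
 obtain Kg kg Cg cg where G: "g \<in> Hom H B D" "is_kernel H B D g Kg kg" "is_cokernel H B D g Cg cg" "good Kg" "good Cg"
  "Ind C B D g = V Cg oo inv\<^bsub>E\<^esub> (V Kg)" using fredholmE[OF g] by metis
 have gf: "g oo f \<in> Hom H A D" using N.Comp_Hom[OF F(1) G(1)] by simp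
 obtain K k Q c where kc: "is_kernel H A D (g oo f) K k" "is_cokernel H A D (g oo f) Q c"
  using N.kernel_ex[OF gf] N.cokernel_ex[OF gf] by blast
 obtain X I Y i1 p1 i2 p2 i3 p3 i4 p4 where ex:
  "N.exact Kf K X i1 p1" "N.exact X Kg I i2 p2" "N.exact I Cf Y i3 p3" "N.exact Y Q Cg i4 p4"
  using N.kernel_cokernel_sequence[OF F(1) G(1) F(2) _ G(2) F(3) _ G(3)] kc by (metis H_sel(1))
 note m = good_middle[OF ex(2,3) G(4) F(5)]
 note K = good_extension[OF ex(1) F(4) m(1)] and Q = good_extension[OF ex(4) m(3) G(5)]
 show "fredholm C A D (g oo f)" using fredholm_iff(1)[OF kc] K Q by blast
 have If: "Ind C A B f \<in> Hom C \<I> \<I>" "Ind C A B f oo V Kf = V Cf" using Ind_char[OF F(4,5)] F(6) by blast+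
 have Ig: "Ind C B D g \<in> Hom C \<I> \<I>" "Ind C B D g oo V Kg = V Cg" using Ind_char[OF G(4,5)] G(6) by blast+
 note car = good_carrier(1)[OF m(1)] good_carrier(1)[OF m(2)] good_carrier(1)[OF m(3)] good_carrier(1)[OF F(4)]
  good_carrier(1)[OF F(5)] good_carrier(1)[OF G(5)]
 note ac = E.m_assoc[simplified] E.m_comm[simplified] E.m_lcomm[simplified]
 have "(Ind C B D g oo Ind C A B f) oo V K = (Ind C B D g oo V X) oo (Ind C A B f oo V Kf)"
  unfolding K(2) using If(1) Ig(1) car Comp_Hom by (simp add: ac)
 also have "\<dots> = (Ind C B D g oo V X) oo (V I oo V Y)" unfolding If(2) m(5) ..
 also have "\<dots> = (Ind C B D g oo (V X oo V I)) oo V Y" using Ig(1) car Comp_Hom by (simp add: ac)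
 also have "\<dots> = V Y oo V Cg" unfolding m(4) Ig(2) using car by (simp add: ac)
 finally have "(Ind C B D g oo Ind C A B f) oo V K = V Q" unfolding Q(2) .
 hence "Ind C B D g oo Ind C A B f = V Q oo inv\<^bsub>E\<^esub> (V K)" using Ind_char[OF K(1) Q(1)] Comp_Hom[OF If(1) Ig(1)] by blast
 thus "Ind C A D (g oo f) = Ind C B D g oo Ind C A B f" using fredholm_iff(2)[OF kc K(1) Q(1)] by simp
qed

lemma fredholm_cancel:
 assumes f: "fredholm C A B f" and g: "g \<in> Hom H B D" and gf: "fredholm C A D (g oo f)"
 shows "fredholm C B D g"
proof -
 obtain Kf kf Cf cf where F: "f \<in> Hom H A B" "is_kernel H A B f Kf kf" "is_cokernel H A B f Cf cf" "good Kf" "good Cf"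
  using fredholmE[OF f] by metis
 obtain K k Q c where G: "is_kernel H A D (g oo f) K k" "is_cokernel H A D (g oo f) Q c" "good K" "good Q"
  using fredholmE[OF gf] by metis
 obtain Kg kg Cg cg where kc: "is_kernel H B D g Kg kg" "is_cokernel H B D g Cg cg" using N.kernel_ex[OF g] N.cokernel_ex[OF g] by blast
 obtain X I Y i1 p1 i2 p2 i3 p3 i4 p4 where ex:
  "N.exact Kf K X i1 p1" "N.exact X Kg I i2 p2" "N.exact I Cf Y i3 p3" "N.exact Y Q Cg i4 p4"
  using N.kernel_cokernel_sequence[OF F(1) g F(2) _ kc(1) F(3) _ kc(2)] G by (metis H_sel(1))
 note m = good_middle[OF ex(3,4) F(5) G(4)]
 obtain \<psi> where "S.nint (sb Kf) \<psi>" using goodE[OF F(4)] by metis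
 from good_cokernel(2)[OF ex(1) G(3) this] have X: "good X" .
 have "good Kg" by (rule good_extension(1)[OF ex(2) X m(1)])
 thus ?thesis using fredholm_iff(1)[OF kc] m(3) by blast
qed

lemma Ind_M_inv: assumes "fredholm C A B f" shows "Ind C A B f \<in> M_inv C"
proof -
 obtain K Q where G: "good K" "good Q" "Ind C A B f = V Q oo inv\<^bsub>E\<^esub> (V K)" using fredholmE[OF assms] by metis
 have gen: "V D \<in> vol_generators C" "inv\<^bsub>E\<^esub> (V D) \<in> vol_generators C" if D: "good D" for D
 proof -
  have d: "bismall C D" "hopf_monoid C D" "bicommutative C D" using D unfolding good_def Hopf_bc_def by auto
  note u = good_carrier[OF D]
  note i = E.Units_inv_closed[OF u(2), simplified] E.Units_r_inv[OF u(2), simplified] E.Units_l_inv[OF u(2), simplified]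
  show "V D \<in> vol_generators C" unfolding vol_generators_def using u d by blast
  show "inv\<^bsub>E\<^esub> (V D) \<in> vol_generators C" unfolding vol_generators_def using i d by blast
 qed
 have "Ind C A B f \<in> M C" unfolding M_def
 proof (rule InterI)
  fix X assume "X \<in> {X. submonoid X E \<and> vol_generators C \<subseteq> X}"
  hence X: "submonoid X E" "vol_generators C \<subseteq> X" by auto
  have "V Q \<otimes>\<^bsub>E\<^esub> inv\<^bsub>E\<^esub> (V K) \<in> X" by (rule submonoid.m_closed[OF X(1)]) (use gen G X(2) in blast)+
  thus "Ind C A B f \<in> X" unfolding G(3) by simp
 qed
 moreover have "V Q \<otimes>\<^bsub>E\<^esub> inv\<^bsub>E\<^esub> (V K) \<in> Units E"
  using E.Units_m_closed good_carrier(2) G(1,2) E.Units_inv_Units by blast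
 ultimately show ?thesis unfolding M_inv_def G(3) by simp
qed

lemma fredholm_id: assumes A: "A \<in> Ob H" shows "fredholm C A A (Id C (und A))" "Ind C A A (Id C (und A)) = Id C \<I>"
proof -
 have i: "Id C (und A) \<in> Hom H A A" using N.Id_Hom[OF A] by simp
 have me: "mono_arr H A A (Id C (und A))" "epi_arr H A A (Id C (und A))"
  using N.iso_mono_epi[OF i i] N.Comp_Id[OF i] by simp_all
 obtain K k Q c where kc: "is_kernel H A A (Id C (und A)) K k" "is_cokernel H A A (Id C (und A)) Q c"
  using N.kernel_ex[OF i] N.cokernel_ex[OF i] by blast
 note K = mono_kernel_zero[OF me(1) kc(1)] and Q = epi_cokernel_zero[OF me(2) kc(2)]
 show "fredholm C A A (Id C (und A))" using fredholm_iff(1)[OF kc] K Q by blast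
 have "Id C \<I> = V Q oo inv\<^bsub>E\<^esub> (V K)" using Ind_char[OF K(1) Q(1)] K(2) Q(2) Id_Hom[OF Unit_Ob] Id_Comp by metis
 thus "Ind C A A (Id C (und A)) = Id C \<I>" using fredholm_iff(2)[OF kc K(1) Q(1)] by simp
qed

text \<open>
 The kernel of a finite homomorphism is mono, and its cokernel is the image.
\<close>

lemma finite_kernel_fredholm:
 assumes "finite_hom C A B e"
 obtains K k where "is_kernel H A B e K k" "fredholm C K A k"
proof -
 have e: "e \<in> Hom H A B" and Im: "bismall C (Im H A B e)" "V (Im H A B e) \<in> Units E" using assms unfolding finite_hom_def by blast+
 obtain J q m where F: "epi_arr H A J q" "mono_arr H J B m" "m oo q = e" using N.factor[OF e] by auto
 have mh: "m \<in> Hom H J B" and qh: "q \<in> Hom H A J" using F unfolding mono_arr_def epi_arr_def by blast+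
 obtain K k where ex: "N.exact K A J k q" using N.exact_of_epi[OF F(1)] by blast
 have ke: "is_kernel H A B e K k"
  using N.kernel_of_mono_comp[OF F(2) qh, of K k] ex F(3) unfolding N.exact_def by simp
 have im: "is_image H A B e J m"
 proof -
  obtain c p where c: "N.exact J B c m p" using N.exact_of_mono[OF F(2)] by blast
  have "is_cokernel H A B e c p"
   using normal_category.kernel_of_mono_comp[OF N.opposite, of J A q m B c p] F(1,3) mh c unfolding N.exact_def by simp
  thus ?thesis using c unfolding is_image_def N.exact_def by blast
 qed
 obtain m' where im': "is_image H A B e (Im H A B e) m'" unfolding Im_def using someI_ex[of "\<lambda>m. \<exists>i. is_image H A B e m i"] im by blast
 obtain c' p' where c': "is_cokernel H A B e c' p'" "is_kernel H B c' p' (Im H A B e) m'" using im' unfolding is_image_def by blast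
 have "Im H A B e \<in> Ob H" using c'(2) N.Hom_Ob unfolding is_kernel_def by blast
 hence gI: "good (Im H A B e)" using Im unfolding good_def by blast
 obtain c p where c: "is_cokernel H A B e c p" "is_kernel H B c p J m" using im unfolding is_image_def by blast
 from N.image_kernel[OF c(1) c'(1)] c'(2)
 have "is_kernel H B c p (Im H A B e) m'" by blast
 from N.kernel_iso[OF this c(2)] obtain u v where uv: "u \<in> Hom H (Im H A B e) J" "v \<in> Hom H J (Im H A B e)"
  "v oo u = Id C (und (Im H A B e))" "u oo v = Id C (und J)" by auto
 have J: "good J" by (rule good_iso(1)[OF uv gI])
 have kh: "k \<in> Hom H K A" using ke unfolding is_kernel_def by blast
 obtain Z z where Z: "is_kernel H K A k Z z" using N.kernel_ex[OF kh] by blast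
 have "fredholm C K A k"
  using fredholm_iff(1)[OF Z, of J q] mono_kernel_zero(1)[OF N.kernel_mono[OF ke] Z] J ex unfolding N.exact_def by blast
 with that ke show ?thesis by blast
qed

lemma lf_convolution:
 assumes "f \<in> Hom H A B" "g \<in> Hom H A B"
 shows "lf A B (convolution C A B f g) = S.cv (sb B) (sb A) (lf A B f) (lf A B g)"
proof -
 have ob: "A \<in> Ob H" "B \<in> Ob H" using N.Hom_Ob[OF assms(1)] by blast+
 note b = bimD[OF H_ObD[OF ob(1)]] bimD[OF H_ObD[OF ob(2)]]
 have h: "f \<in> Hom C (und A) (und B)" "g \<in> Hom C (und A) (und B)" using assms H_Hom_und by blast+
 note [simp] = b h tensor_Hom tensor_Ob
 have "(f ## g) oo delta A \<in> Hom C (und A) (und B \<odot> und B)" by (rule ty b h)+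
 thus ?thesis unfolding lf_def convolution_def S.cv_def S.pair_def by (simp add: stc)
qed

lemma fredholm_finite_perturbation:
 assumes f: "fredholm C A B f" and e: "finite_hom C A B e"
 shows "fredholm C A B (convolution C A B f e)" "Ind C A B (convolution C A B f e) = Ind C A B f"
proof -
 let ?g = "convolution C A B f e"
 have fH: "f \<in> Hom H A B" and eH: "e \<in> Hom H A B" using f e unfolding fredholm_def finite_hom_def by blast+
 obtain K k where k: "is_kernel H A B e K k" "fredholm C K A k" using finite_kernel_fredholm[OF e] by blast
 have kH: "k \<in> Hom H K A" "zero_arr H K B (e oo k)" using k(1) unfolding is_kernel_def by auto
 have S1: "S.hopf (sb K)" "S.hopf (sb A)" "S.hopf (sb B)" "S.hhom (sb A) (sb B) (lf A B f)" "S.hhom (sb A) (sb B) (lf A B e)" "S.hhom (sb K) (sb A) (lf K A k)"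
  using fH eH kH(1) unfolding H_Hom by blast+
 have g: "?g \<in> Hom H A B" unfolding H_Hom lf_convolution[OF fH eH] using S.cv_hhom[OF S1(2-5)] S1 by blast
 have z: "scp (lf A B e) (lf K A k) = scp (eta (sb B)) (eps (sb K))"
  using kH(2) lf_comp[OF H_Hom_und[OF kH(1)] H_Hom_und[OF eH]] lf_zero unfolding H_zero by metis
 have "lf K B (?g oo k) = scp (lf A B ?g) (lf K A k)" by (rule lf_comp[OF H_Hom_und[OF kH(1)] H_Hom_und[OF g]])
 also have "\<dots> = scp (lf A B f) (lf K A k)" unfolding lf_convolution[OF fH eH] by (rule S.cv_restrict[OF S1(2,3,1,4-6) z])
 also have "\<dots> = lf K B (f oo k)" by (rule lf_comp[symmetric, OF H_Hom_und[OF kH(1)] H_Hom_und[OF fH]])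
 finally have gk: "?g oo k = f oo k" unfolding lf_inj .
 note fk = fredholm_comp[OF k(2) f]
 show G: "fredholm C A B ?g" by (rule fredholm_cancel[OF k(2) g]) (use fk gk in simp)
 have "Ind C A B ?g oo Ind C K A k = Ind C A B f oo Ind C K A k"
  using fk(2) fredholm_comp(2)[OF k(2) G] gk by simp
 moreover have "Ind C K A k \<in> Units E" "Ind C A B ?g \<in> Units E" "Ind C A B f \<in> Units E"
  using Ind_M_inv k(2) G f unfolding M_inv_def by blast+
 ultimately show "Ind C A B ?g = Ind C A B f"
  using E.Units_l_cancel[of "Ind C K A k" "Ind C A B ?g" "Ind C A B f"] E.Units_closed E.m_comm by auto
qed

end

theorem proposition15p9:
  fixes C :: "('o, 'm) smcat" (structure)
  assumes "symmetric_monoidal_category C"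
    and "has_equalizers C" and "has_coequalizers C"
    and "bistable C"
    and "abelian_category (Hopf_bc C)"
  shows
    "(\<forall>A \<in> Ob (Hopf_bc C).
        fredholm C A A (Id C (und A)) \<and>
        Ind C A A (Id C (und A)) = Id C \<I> \<and>
        Ind C A A (Id C (und A)) \<in> M_inv C)
     \<and>
     (\<forall>A B D \<xi> \<xi>'.
        fredholm C A B \<xi> \<and> fredholm C B D \<xi>' \<longrightarrow>
        fredholm C A D (\<xi>' \<cdot> \<xi>) \<and>
        Ind C A D (\<xi>' \<cdot> \<xi>) = Ind C B D \<xi>' \<cdot> Ind C A B \<xi> \<and>
        Ind C A D (\<xi>' \<cdot> \<xi>) \<in> M_inv C)
     \<and>
     (\<forall>A B \<xi> \<epsilon>.
        fredholm C A B \<xi> \<and> finite_hom C A B \<epsilon> \<longrightarrow>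
        fredholm C A B (convolution C A B \<xi> \<epsilon>) \<and>
        Ind C A B (convolution C A B \<xi> \<epsilon>) = Ind C A B \<xi> \<and>
        Ind C A B (convolution C A B \<xi> \<epsilon>) \<in> M_inv C)"
proof -
  interpret hopf_index C using assms by (intro hopf_index.intro smc.intro hopf_index_axioms.intro)
  show ?thesis
    by (intro conjI ballI allI impI; (elim conjE)?; (rule Ind_M_inv)?;
        (rule fredholm_id fredholm_comp fredholm_finite_perturbation; assumption))
qed

end
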